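(* Let $C$ be a strict $\omega$-category, and let $\mathcal N(C)$ be its Street nerve. Let $t\mathcal N(C)$ be the set of simplices of $\mathcal N(C)$ of positive dimension corresponding to morphisms $|\Delta[n]|\to C$ ($n\ge1$) that send the unique non-trivial (i.e. non-unit) $n$-cell of $|\Delta[n]|$ to a weakly invertible cell of $C$. Then the stratified simplicial set $(\mathcal N(C),t\mathcal N(C))$ is a saturated complicial set.
   Context: **$\omega$-categories.** A (strict) $\omega$-category $C$ has sets $C_n$ of $n$-cells ($n\ge0$), source and target maps $d_k^-,d_k^+:C_n\to C_k$ ($k<n$) satisfying the globular identities, compositions $d*_k c$ of $n$-cells defined for $k<n$ whenever $d_k^+c=d_k^-d$, and units $1^m_c\in C_m$ for $c\in C_n$, $m>n$ (with $1_c:=1_c^{n+1}$), satisfying the usual strict associativity, interchange and unit laws. For an $n$-cell $c$, $c:a\to b$ means $d_{n-1}^-c=a$, $d_{n-1}^+c=b$. **Weakly invertible cells.** An invertibility set is a set $E\subset\coprod_{n>0}C_n$ such that for every $n\ge 0$ and every $(n+1)$-cell $b\in E$ there exist $\tilde b,c,c'\in E$ with $\tilde b\in C_{n+1}$, $c,c'\in C_{n+2}$ and $c:1_{d_n^-b}\to\tilde b*_n b$, $c':1_{d_n^+b}\to b*_n\tilde b$. A cell of positive dimension is weakly invertible if it belongs to some invertibility set. **Orientals and Street nerve.** For $n\ge0$ let $C_\bullet(\Delta[n])$ be the normalized chain complex: $C_k(\Delta[n])$ is the free abelian group on the nondegenerate $k$-simplices of $\Delta[n]$, with $\partial_{k}:C_{k+1}\to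 C_{k}$, $\partial v=\sum_i(-1)^i d_iv$ (degenerate faces counted as $0$), augmentation $e$ sending each vertex to $1$, and $C_k^*(\Delta[n])\subset C_k(\Delta[n])$ the submonoid generated by the nondegenerate simplices. The $n$-th oriental $|\Delta[n]|$ is the $\omega$-category whose $p$-cells are the families $(x_k^\alpha)_{0\le k\le p,\ \alpha\in\{-,+\}}$ with $x_k^\alpha\in C_k^*(\Delta[n])$, $x_p^-=x_p^+$, $\partial_{k-1}(x_k^\alpha)=x_{k-1}^+-x_{k-1}^-$ for $0<k\le p$, and $e(x_0^\pm)=1$. The cell $d_k^\alpha x$ ($k<p$) keeps the entries of index $<k$ and has both entries of index $k$ equal to $x_k^\alpha$; $1^m_x$ is obtained by adding zero entries; and for $d_k^-x=d_k^+y=z$, $x*_ky=x-z+y$ (entrywise, where $z$ is extended by $0$). These form a cosimplicial $\omega$-category, and $\mathcal N(C)_n:=\mathrm{Hom}_{\omega\text{-}\mathrm{cat}}(|\Delta[n]|,C)$. The unique non-unit $n$-cell of $|\Delta[n]|$ is the one whose entries of index $n$ equal the nondegenerate $n$-simplex of $\Delta[n]$. **Stratified and complicial sets.** A stratification of a simplicial set $X$ is a subset $tX\subset\coprod_{n>0}X_n$ (the marked simplices) containing all degenerate simplices; morphisms of stratified sets are simplicial maps preserving marked simplices. For $n\ge1$, $0\le k\le n$: $\Delta^k[n]$ is $\Delta[n]$ in which (besides the degenerate simplices) the marked simplices are those of positive dimension whose vertices contain $\{k-1,k,k+1\}\cap[n]$; $\Lambda^k[n]^\circ$ is $\Lambda^k[n]$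 (union of all codimension-one faces except the one opposite to $k$) with the stratification in which a simplex is marked iff it is marked in $\Delta^k[n]$; $\Delta^k[n]'$ is obtained from $\Delta^k[n]$ by also marking the $(k-1)$-th and $(k+1)$-th faces (those that exist); $\Delta^k[n]''$ is obtained from $\Delta^k[n]$ by also marking all codimension-one faces. A stratified set $X$ is a complicial set if $X\to1$ has the right lifting property with respect to all $\Lambda^k[n]^\circ\to\Delta^k[n]$ and all $\Delta^k[n]'\to\Delta^k[n]''$. $\Delta[3]^{eq}$ is $\Delta[3]$ with marked simplices: the edges $[02]$, $[13]$ and all simplices of dimension $\ge2$ (and degenerate ones). $\Delta[3]^\#$ is $\Delta[3]$ with all simplices of positive dimension marked. The join $U\star V$ of stratified sets is the simplicial join, in which a simplex is marked iff at least one of its two components (in $U$, in $V$) is marked. A plain $\Delta[n]$ carries the minimal stratification (only degenerate simplices marked), and $\Delta[-1]=\emptyset$. A complicial set is saturated if it has the right lifting property with respect to $\Delta[3]^{eq}\star\Delta[n]\to\Delta[3]^\#\star\Delta[n]$ and $\Delta[n]\star\Delta[3]^{eq}\to\Delta[n]\star\Delta[3]^\#$ for all $n\ge-1$. *)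

theory Defs
  imports "HOL-Library.Poly_Mapping" "HOL-Library.FuncSet"
begin

section \<open>Strict omega-categories\<close>

datatype sign = Minus | Plus

text \<open>
  The sets \<open>cell C n\<close> of \<open>n\<close>-cells need not be disjoint for different \<open>n\<close>, so every operation
  carries the dimension of its argument:
  \<open>bd C \<alpha> n k c\<close> is \<open>d\<^sub>k\<^sup>\<alpha> c\<close> for an \<open>n\<close>-cell \<open>c\<close> (with \<open>k < n\<close>),
  \<open>cmp C n k d c\<close> is the composite \<open>d *\<^sub>k c\<close> of \<open>n\<close>-cells (with \<open>k < n\<close>), and
  \<open>idn C n m c\<close> is the unit \<open>m\<close>-cell on the \<open>n\<close>-cell \<open>c\<close> (with \<open>n < m\<close>).
  Outside these ranges the values are irrelevant.
  Subsets of the coproduct of the sets of cells (or of simplices, below) are families of sets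
  indexed by the dimension.
\<close>

record 'a omega_cat =
  cell :: "nat \<Rightarrow> 'a set"
  bd :: "sign \<Rightarrow> nat \<Rightarrow> nat \<Rightarrow> 'a \<Rightarrow> 'a"
  cmp :: "nat \<Rightarrow> nat \<Rightarrow> 'a \<Rightarrow> 'a \<Rightarrow> 'a"
  idn :: "nat \<Rightarrow> nat \<Rightarrow> 'a \<Rightarrow> 'a"

definition composable :: "('a, 'r) omega_cat_scheme \<Rightarrow> nat \<Rightarrow> nat \<Rightarrow> 'a \<Rightarrow> 'a \<Rightarrow> bool" where
  "composable C n k d c \<longleftrightarrow>
     k < n \<and> d \<in> cell C n \<and> c \<in> cell C n \<and> bd C Plus n k c = bd C Minus n k d"

locale strict_omega_category =
  fixes C :: "('a, 'r) omega_cat_scheme"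
  assumes bd_cell: "\<lbrakk>k < n; x \<in> cell C n\<rbrakk> \<Longrightarrow> bd C \<alpha> n k x \<in> cell C k"
    and idn_cell: "\<lbrakk>n < m; x \<in> cell C n\<rbrakk> \<Longrightarrow> idn C n m x \<in> cell C m"
    and cmp_cell: "composable C n k x y \<Longrightarrow> cmp C n k x y \<in> cell C n"
    and globular: "\<lbrakk>j < k; k < n; x \<in> cell C n\<rbrakk> \<Longrightarrow> bd C \<alpha> k j (bd C \<beta> n k x) = bd C \<alpha> n j x"
    and bd_cmp_below: "\<lbrakk>composable C n k x y; j < k\<rbrakk> \<Longrightarrow> bd C \<alpha> n j (cmp C n k x y) = bd C \<alpha> n j x"
    and source_cmp: "composable C n k x y \<Longrightarrow> bd C Minus n k (cmp C n k x y) = bd C Minus n k y"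
    and target_cmp: "composable C n k x y \<Longrightarrow> bd C Plus n k (cmp C n k x y) = bd C Plus n k x"
    and bd_cmp_above: "\<lbrakk>composable C n k x y; k < j; j < n\<rbrakk> \<Longrightarrow>
          bd C \<alpha> n j (cmp C n k x y) = cmp C j k (bd C \<alpha> n j x) (bd C \<alpha> n j y)"
    and bd_idn_below: "\<lbrakk>k < n; n < m; x \<in> cell C n\<rbrakk> \<Longrightarrow> bd C \<alpha> m k (idn C n m x) = bd C \<alpha> n k x"
    and bd_idn_same: "\<lbrakk>n < m; x \<in> cell C n\<rbrakk> \<Longrightarrow> bd C \<alpha> m n (idn C n m x) = x"
    and bd_idn_above: "\<lbrakk>n < k; k < m; x \<in> cell C n\<rbrakk> \<Longrightarrow> bd C \<alpha> m k (idn C n m x) = idn C n k x"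
    and idn_idn: "\<lbrakk>n < k; k < m; x \<in> cell C n\<rbrakk> \<Longrightarrow> idn C k m (idn C n k x) = idn C n m x"
    and idn_cmp: "\<lbrakk>composable C n k x y; n < m\<rbrakk> \<Longrightarrow>
          idn C n m (cmp C n k x y) = cmp C m k (idn C n m x) (idn C n m y)"
    and right_unit: "\<lbrakk>k < n; x \<in> cell C n\<rbrakk> \<Longrightarrow> cmp C n k x (idn C k n (bd C Minus n k x)) = x"
    and left_unit: "\<lbrakk>k < n; x \<in> cell C n\<rbrakk> \<Longrightarrow> cmp C n k (idn C k n (bd C Plus n k x)) x = x"
    and assoc: "\<lbrakk>composable C n k x y; composable C n k y z\<rbrakk> \<Longrightarrow>
          cmp C n k (cmp C n k x y) z = cmp C n k x (cmp C n k y z)"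
    and interchange: "\<lbrakk>j < k; composable C n k x y; composable C n k z w; composable C n j x z\<rbrakk> \<Longrightarrow>
          cmp C n j (cmp C n k x y) (cmp C n k z w) = cmp C n k (cmp C n j x z) (cmp C n j y w)"

definition omega_functor ::
  "('a, 'r) omega_cat_scheme \<Rightarrow> ('b, 's) omega_cat_scheme \<Rightarrow> (nat \<Rightarrow> 'a \<Rightarrow> 'b) \<Rightarrow> bool" where
  "omega_functor D C f \<longleftrightarrow>
     (\<forall>n. f n \<in> cell D n \<rightarrow> cell C n) \<and>
     (\<forall>\<alpha> n k. k < n \<longrightarrow> (\<forall>x \<in> cell D n. f k (bd D \<alpha> n k x) = bd C \<alpha> n k (f n x))) \<and>
     (\<forall>n k x y. composable D n k x y \<longrightarrow> f n (cmp D n k x y) = cmp C n k (f n x) (f n y)) \<and>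
     (\<forall>n m. n < m \<longrightarrow> (\<forall>x \<in> cell D n. f m (idn D n m x) = idn C n m (f n x)))"

definition is_unit :: "('a, 'r) omega_cat_scheme \<Rightarrow> nat \<Rightarrow> 'a \<Rightarrow> bool" where
  "is_unit C n x \<longleftrightarrow> (\<exists>m y. m < n \<and> y \<in> cell C m \<and> x = idn C m n y)"

text \<open>\<open>arrow C n c a b\<close> means \<open>c : a \<rightarrow> b\<close> for the \<open>(n + 1)\<close>-cell \<open>c\<close>.\<close>

definition arrow :: "('a, 'r) omega_cat_scheme \<Rightarrow> nat \<Rightarrow> 'a \<Rightarrow> 'a \<Rightarrow> 'a \<Rightarrow> bool" where
  "arrow C n c a b \<longleftrightarrow>
     c \<in> cell C (n + 1) \<and> bd C Minus (n + 1) n c = a \<and> bd C Plus (n + 1) n c = b"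

definition invertibility_set :: "('a, 'r) omega_cat_scheme \<Rightarrow> (nat \<Rightarrow> 'a set) \<Rightarrow> bool" where
  "invertibility_set C E \<longleftrightarrow>
     E 0 = {} \<and> (\<forall>n. E n \<subseteq> cell C n) \<and>
     (\<forall>n. \<forall>b \<in> E (n + 1). \<exists>b' \<in> E (n + 1). \<exists>c \<in> E (n + 2). \<exists>c' \<in> E (n + 2).
        composable C (n + 1) n b' b \<and> composable C (n + 1) n b b' \<and>
        arrow C (n + 1) c (idn C n (n + 1) (bd C Minus (n + 1) n b)) (cmp C (n + 1) n b' b) \<and>
        arrow C (n + 1) c' (idn C n (n + 1) (bd C Plus (n + 1) n b)) (cmp C (n + 1) n b b'))"

definition weakly_invertible :: "('a, 'r) omega_cat_scheme \<Rightarrow> nat \<Rightarrow> 'a \<Rightarrow> bool" where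
  "weakly_invertible C n x \<longleftrightarrow> n > 0 \<and> (\<exists>E. invertibility_set C E \<and> x \<in> E n)"

section \<open>Simplicial sets\<close>

text \<open>
  A monotone map \<open>[m] \<rightarrow> [n]\<close> is encoded as the list of its \<open>m + 1\<close> values; the same lists are the
  \<open>m\<close>-simplices of \<open>\<Delta>[n]\<close>.
\<close>

definition Delta_hom :: "nat \<Rightarrow> nat \<Rightarrow> nat list set" where
  "Delta_hom m n = {\<theta>. length \<theta> = m + 1 \<and> sorted \<theta> \<and> set \<theta> \<subseteq> {..n}}"

definition Delta_id :: "nat \<Rightarrow> nat list" where
  "Delta_id n = [0..<n + 1]"

definition Delta_comp :: "nat list \<Rightarrow> nat list \<Rightarrow> nat list" where
  "Delta_comp \<theta> \<phi> = map (\<lambda>i. \<theta> ! i) \<phi>"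

text \<open>The \<open>i\<close>-th coface \<open>[n - 1] \<rightarrow> [n]\<close> and the \<open>i\<close>-th codegeneracy \<open>[n + 1] \<rightarrow> [n]\<close>.\<close>

definition coface :: "nat \<Rightarrow> nat \<Rightarrow> nat list" where
  "coface n i = [0..<i] @ [i + 1..<n + 1]"

definition codegeneracy :: "nat \<Rightarrow> nat \<Rightarrow> nat list" where
  "codegeneracy n i = [0..<i + 1] @ [i..<n + 1]"

text \<open>
  For \<open>\<theta> : [m] \<rightarrow> [n]\<close>, \<open>act X n \<theta>\<close> is the operator \<open>X\<^sub>n \<rightarrow> X\<^sub>m\<close>; here \<open>m\<close> is determined by \<open>\<theta>\<close>.
\<close>

record 'a sset =
  splx :: "nat \<Rightarrow> 'a set"
  act :: "nat \<Rightarrow> nat list \<Rightarrow> 'a \<Rightarrow> 'a"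

definition simplicial_set :: "('a, 'r) sset_scheme \<Rightarrow> bool" where
  "simplicial_set X \<longleftrightarrow>
     (\<forall>m n. \<forall>\<theta> \<in> Delta_hom m n. act X n \<theta> \<in> splx X n \<rightarrow> splx X m) \<and>
     (\<forall>n. \<forall>x \<in> splx X n. act X n (Delta_id n) x = x) \<and>
     (\<forall>l m n. \<forall>\<theta> \<in> Delta_hom m n. \<forall>\<phi> \<in> Delta_hom l m. \<forall>x \<in> splx X n.
        act X m \<phi> (act X n \<theta> x) = act X n (Delta_comp \<theta> \<phi>) x)"

definition degenerate :: "('a, 'r) sset_scheme \<Rightarrow> nat \<Rightarrow> 'a set" where
  "degenerate X n = {x. \<exists>m i y. n = m + 1 \<and> i \<le> m \<and> y \<in> splx X m \<and> x = act X m (codegeneracy m i) y}"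

definition nondegenerate :: "('a, 'r) sset_scheme \<Rightarrow> nat \<Rightarrow> 'a set" where
  "nondegenerate X n = splx X n - degenerate X n"

text \<open>\<open>\<Delta>[n]\<close> for \<open>n \<ge> -1\<close>, where \<open>\<Delta>[-1]\<close> is empty.\<close>

definition Delta :: "int \<Rightarrow> nat list sset" where
  "Delta n = \<lparr> splx = (\<lambda>m. {s. length s = m + 1 \<and> sorted s \<and> (\<forall>i \<in> set s. int i \<le> n)}),
              act = (\<lambda>_ \<theta> s. Delta_comp s \<theta>) \<rparr>"

section \<open>Normalized chains and orientals\<close>

inductive_set pos_chains :: "('a, 'r) sset_scheme \<Rightarrow> nat \<Rightarrow> ('a \<Rightarrow>\<^sub>0 int) set"
  for X :: "('a, 'r) sset_scheme" and k :: nat where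
  zero: "0 \<in> pos_chains X k"
| generator: "v \<in> nondegenerate X k \<Longrightarrow> frag_of v \<in> pos_chains X k"
| add: "\<lbrakk>x \<in> pos_chains X k; y \<in> pos_chains X k\<rbrakk> \<Longrightarrow> x + y \<in> pos_chains X k"

text \<open>The class of a \<open>k\<close>-simplex in the normalized chains: degenerate simplices are \<open>0\<close>.\<close>

definition chain_of :: "('a, 'r) sset_scheme \<Rightarrow> nat \<Rightarrow> 'a \<Rightarrow> ('a \<Rightarrow>\<^sub>0 int)" where
  "chain_of X k v = (if v \<in> degenerate X k then 0 else frag_of v)"

text \<open>\<open>boundary X k\<close> is \<open>\<partial>\<^sub>k\<close>, from \<open>(k + 1)\<close>-chains to \<open>k\<close>-chains.\<close>

definition boundary :: "('a, 'r) sset_scheme \<Rightarrow> nat \<Rightarrow> ('a \<Rightarrow>\<^sub>0 int) \<Rightarrow> ('a \<Rightarrow>\<^sub>0 int)" where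
  "boundary X k = frag_extend (\<lambda>v. \<Sum>i\<le>k + 1.
     frag_cmul ((-1) ^ i) (chain_of X k (act X (k + 1) (coface (k + 1) i) v)))"

definition augmentation :: "('a \<Rightarrow>\<^sub>0 int) \<Rightarrow> int" where
  "augmentation x = (\<Sum>v \<in> Poly_Mapping.keys x. Poly_Mapping.lookup x v)"

text \<open>
  A family \<open>(x\<^sub>k\<^sup>\<alpha>)\<close> with \<open>k \<le> p\<close> is encoded as a function that is \<open>0\<close> for \<open>k > p\<close>. With this encoding
  adding zero entries is the identity on functions.
\<close>

type_synonym table = "nat \<Rightarrow> sign \<Rightarrow> (nat list \<Rightarrow>\<^sub>0 int)"

definition oriental_cell :: "nat \<Rightarrow> nat \<Rightarrow> table set" where
  "oriental_cell n p = {x.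
     (\<forall>k\<le>p. \<forall>\<alpha>. x k \<alpha> \<in> pos_chains (Delta (int n)) k) \<and>
     (\<forall>k>p. \<forall>\<alpha>. x k \<alpha> = 0) \<and>
     x p Minus = x p Plus \<and>
     (\<forall>k<p. \<forall>\<alpha>. boundary (Delta (int n)) k (x (k + 1) \<alpha>) = x k Plus - x k Minus) \<and>
     (\<forall>\<alpha>. augmentation (x 0 \<alpha>) = 1)}"

definition table_bd :: "sign \<Rightarrow> nat \<Rightarrow> table \<Rightarrow> table" where
  "table_bd \<alpha> k x = (\<lambda>j \<beta>. if j < k then x j \<beta> else if j = k then x k \<alpha> else 0)"

definition oriental :: "nat \<Rightarrow> table omega_cat" where
  "oriental n = \<lparr> cell = oriental_cell n,
     bd = (\<lambda>\<alpha> _ k x. table_bd \<alpha> k x),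
     cmp = (\<lambda>_ k x y j \<beta>. x j \<beta> - table_bd Minus k x j \<beta> + y j \<beta>),
     idn = (\<lambda>_ _ x. x) \<rparr>"

text \<open>The \<open>\<omega>\<close>-functor \<open>|\<Delta>[m]| \<rightarrow> |\<Delta>[n]|\<close> induced by \<open>\<theta> : [m] \<rightarrow> [n]\<close>.\<close>

definition oriental_map :: "nat \<Rightarrow> nat list \<Rightarrow> table \<Rightarrow> table" where
  "oriental_map n \<theta> x =
     (\<lambda>k \<alpha>. frag_extend (\<lambda>v. chain_of (Delta (int n)) k (Delta_comp \<theta> v)) (x k \<alpha>))"

text \<open>
  The unique non-unit \<open>n\<close>-cell of \<open>|\<Delta>[n]|\<close>; its entries of index \<open>n\<close> are the nondegenerate
  \<open>n\<close>-simplex \<open>[0, \<dots>, n]\<close>.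
\<close>

definition top_cell :: "nat \<Rightarrow> table" where
  "top_cell n = (THE x. x \<in> cell (oriental n) n \<and> \<not> is_unit (oriental n) n x)"

section \<open>Stratified and complicial sets\<close>

record 'a strat = "'a sset" +
  marked :: "nat \<Rightarrow> 'a set"

definition with_marking :: "('a, 'r) sset_scheme \<Rightarrow> (nat \<Rightarrow> 'a set) \<Rightarrow> 'a strat" where
  "with_marking X M = \<lparr> splx = splx X, act = act X, marked = M \<rparr>"

definition stratified_set :: "('a, 'r) strat_scheme \<Rightarrow> bool" where
  "stratified_set X \<longleftrightarrow> simplicial_set X \<and> marked X 0 = {} \<and>
     (\<forall>n. marked X n \<subseteq> splx X n) \<and> (\<forall>n. degenerate X n \<subseteq> marked X n)"

definition strat_map ::
  "('a, 'r) strat_scheme \<Rightarrow> ('b, 's) strat_scheme \<Rightarrow> (nat \<Rightarrow> 'a \<Rightarrow> 'b) \<Rightarrow> bool" where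
  "strat_map X Y f \<longleftrightarrow>
     (\<forall>n. f n \<in> splx X n \<rightarrow> splx Y n) \<and>
     (\<forall>m n. \<forall>\<theta> \<in> Delta_hom m n. \<forall>x \<in> splx X n. f m (act X n \<theta> x) = act Y n \<theta> (f n x)) \<and>
     (\<forall>n. f n ` marked X n \<subseteq> marked Y n)"

text \<open>\<open>p : X \<rightarrow> Y\<close> has the right lifting property with respect to \<open>i : A \<rightarrow> B\<close>.\<close>

definition has_rlp ::
  "('x, 'p) strat_scheme \<Rightarrow> ('y, 'q) strat_scheme \<Rightarrow> (nat \<Rightarrow> 'x \<Rightarrow> 'y) \<Rightarrow>
   ('a, 'r) strat_scheme \<Rightarrow> ('b, 's) strat_scheme \<Rightarrow> (nat \<Rightarrow> 'a \<Rightarrow> 'b) \<Rightarrow> bool" where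
  "has_rlp X Y p A B i \<longleftrightarrow>
     (\<forall>u v. strat_map A X u \<and> strat_map B Y v \<and> (\<forall>n. \<forall>a \<in> splx A n. p n (u n a) = v n (i n a)) \<longrightarrow>
       (\<exists>h. strat_map B X h \<and> (\<forall>n. \<forall>a \<in> splx A n. h n (i n a) = u n a) \<and>
            (\<forall>n. \<forall>b \<in> splx B n. p n (h n b) = v n b)))"

definition terminal_strat :: "unit strat" where
  "terminal_strat = \<lparr> splx = (\<lambda>_. UNIV), act = (\<lambda>_ _ _. ()), marked = (\<lambda>n. {_. n > 0}) \<rparr>"

text \<open>
  Right lifting property of \<open>X \<rightarrow> 1\<close> with respect to \<open>A \<rightarrow> B\<close>, where the underlying simplicial set of
  \<open>A\<close> is a simplicial subset of that of \<open>B\<close> and the map is the inclusion.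
\<close>

definition lifts_against ::
  "('x, 'p) strat_scheme \<Rightarrow> ('a, 'r) strat_scheme \<Rightarrow> ('a, 's) strat_scheme \<Rightarrow> bool" where
  "lifts_against X A B \<longleftrightarrow> has_rlp X terminal_strat (\<lambda>_ _. ()) A B (\<lambda>_ a. a)"

definition Delta_min :: "int \<Rightarrow> nat list strat" where
  "Delta_min n = with_marking (Delta n) (degenerate (Delta n))"

definition Delta_adm :: "nat \<Rightarrow> nat \<Rightarrow> nat list strat" where
  "Delta_adm k n = with_marking (Delta (int n)) (\<lambda>m. degenerate (Delta (int n)) m \<union>
     {s \<in> splx (Delta (int n)) m. m > 0 \<and> {int k - 1, int k, int k + 1} \<inter> {0..int n} \<subseteq> int ` set s})"

definition horn :: "nat \<Rightarrow> nat \<Rightarrow> nat list sset" where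
  "horn k n = \<lparr> splx = (\<lambda>m. {s \<in> splx (Delta (int n)) m. \<exists>i\<le>n. i \<noteq> k \<and> i \<notin> set s}),
               act = act (Delta (int n)) \<rparr>"

definition horn_adm :: "nat \<Rightarrow> nat \<Rightarrow> nat list strat" where
  "horn_adm k n = with_marking (horn k n) (\<lambda>m. splx (horn k n) m \<inter> marked (Delta_adm k n) m)"

text \<open>
  Marking, in addition, the \<open>i\<close>-th faces for \<open>i\<close> in a set \<open>I\<close>. As an \<open>(n - 1)\<close>-simplex of \<open>\<Delta>[n]\<close>, the
  \<open>i\<close>-th face is the coface map itself. For \<open>n = 1\<close> the faces are vertices, which are never marked.
\<close>

definition mark_faces :: "nat \<Rightarrow> int set \<Rightarrow> nat list strat \<Rightarrow> nat list strat" where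
  "mark_faces n I X = with_marking X (\<lambda>m. marked X m \<union>
     {coface n i | i. i \<le> n \<and> int i \<in> I \<and> m > 0 \<and> n = m + 1})"

definition Delta_adm' :: "nat \<Rightarrow> nat \<Rightarrow> nat list strat" where
  "Delta_adm' k n = mark_faces n {int k - 1, int k + 1} (Delta_adm k n)"

definition Delta_adm'' :: "nat \<Rightarrow> nat \<Rightarrow> nat list strat" where
  "Delta_adm'' k n = mark_faces n UNIV (Delta_adm k n)"

definition complicial_set :: "('a, 'r) strat_scheme \<Rightarrow> bool" where
  "complicial_set X \<longleftrightarrow> stratified_set X \<and>
     (\<forall>n k. 1 \<le> n \<and> k \<le> n \<longrightarrow> lifts_against X (horn_adm k n) (Delta_adm k n)) \<and>
     (\<forall>n k. 1 \<le> n \<and> k \<le> n \<longrightarrow> lifts_against X (Delta_adm' k n) (Delta_adm'' k n))"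

definition Delta3_eq :: "nat list strat" where
  "Delta3_eq = with_marking (Delta 3) (\<lambda>m. degenerate (Delta 3) m \<union>
     {s \<in> splx (Delta 3) m. s = [0, 2] \<or> s = [1, 3] \<or> m \<ge> 2})"

definition Delta3_sharp :: "nat list strat" where
  "Delta3_sharp = with_marking (Delta 3) (\<lambda>m. {s \<in> splx (Delta 3) m. m > 0})"

text \<open>
  Simplices of a join whose component in \<open>U\<close>, resp. in \<open>V\<close>, has dimension \<open>-1\<close> are of the form
  \<open>JoinR v\<close>, resp. \<open>JoinL u\<close>. In \<open>Join i u v\<close>, \<open>i\<close> is the dimension of \<open>u\<close>, and the component \<open>v\<close>
  of an \<open>n\<close>-simplex has dimension \<open>n - i - 1\<close>.
\<close>

datatype ('a, 'b) join_simplex = JoinL 'a | JoinR 'b | Join nat 'a 'b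

fun join_act :: "('a, 'r) sset_scheme \<Rightarrow> ('b, 's) sset_scheme \<Rightarrow>
    nat \<Rightarrow> nat list \<Rightarrow> ('a, 'b) join_simplex \<Rightarrow> ('a, 'b) join_simplex" where
  "join_act U V n \<theta> (JoinL u) = JoinL (act U n \<theta> u)"
| "join_act U V n \<theta> (JoinR v) = JoinR (act V n \<theta> v)"
| "join_act U V n \<theta> (Join i u v) =
     (let \<theta>\<^sub>U = filter (\<lambda>t. t \<le> i) \<theta>;
          \<theta>\<^sub>V = map (\<lambda>t. t - (i + 1)) (filter (\<lambda>t. i < t) \<theta>);
          u' = act U i \<theta>\<^sub>U u;
          v' = act V (n - i - 1) \<theta>\<^sub>V v
      in if \<theta>\<^sub>V = [] then JoinL u'
         else if \<theta>\<^sub>U = [] then JoinR v'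
         else Join (length \<theta>\<^sub>U - 1) u' v')"

definition join :: "('a, 'r) strat_scheme \<Rightarrow> ('b, 's) strat_scheme \<Rightarrow> ('a, 'b) join_simplex strat" where
  "join U V = \<lparr>
     splx = (\<lambda>n. JoinL ` splx U n \<union> JoinR ` splx V n \<union>
               {Join i u v | i j u v. i + j + 1 = n \<and> u \<in> splx U i \<and> v \<in> splx V j}),
     act = join_act U V,
     marked = (\<lambda>n. JoinL ` marked U n \<union> JoinR ` marked V n \<union>
               {Join i u v | i j u v. i + j + 1 = n \<and> u \<in> splx U i \<and> v \<in> splx V j \<and>
                                      (u \<in> marked U i \<or> v \<in> marked V j)}) \<rparr>"

definition saturated_complicial_set :: "('a, 'r) strat_scheme \<Rightarrow> bool" where
  "saturated_complicial_set X \<longleftrightarrow> complicial_set X \<and>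
     (\<forall>n\<ge>-1. lifts_against X (join Delta3_eq (Delta_min n)) (join Delta3_sharp (Delta_min n))) \<and>
     (\<forall>n\<ge>-1. lifts_against X (join (Delta_min n) Delta3_eq) (join (Delta_min n) Delta3_sharp))"

section \<open>The Street nerve\<close>

text \<open>
  The \<open>\<omega>\<close>-functors are required to be extensional, so that equality of simplices is equality of
  \<open>\<omega>\<close>-functors on the cells of the oriental.
\<close>

definition street_nerve :: "('a, 'r) omega_cat_scheme \<Rightarrow> (nat \<Rightarrow> table \<Rightarrow> 'a) sset" where
  "street_nerve C = \<lparr>
     splx = (\<lambda>n. {f. omega_functor (oriental n) C f \<and> (\<forall>p. f p \<in> extensional (cell (oriental n) p))}),
     act = (\<lambda>n \<theta> f p. restrict (\<lambda>x. f p (oriental_map n \<theta> x)) (cell (oriental (length \<theta> - 1)) p)) \<rparr>"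

definition nerve_marking :: "('a, 'r) omega_cat_scheme \<Rightarrow> nat \<Rightarrow> (nat \<Rightarrow> table \<Rightarrow> 'a) set" where
  "nerve_marking C n =
     {f \<in> splx (street_nerve C) n. n > 0 \<and> weakly_invertible C n (f n (top_cell n))}"

end

theory Submission
  imports Defs "HOL-Library.Multiset"
begin

text \<open>
  All cells are put into one set on which the \<open>D \<alpha> k\<close> are idempotents, so that a cell is identified
  with its units. An oriental is loop-free: each of its cells is a composite of whiskered atoms, one
  atom for each simplex of highest dimension, and a functor may be prescribed atom by atom.

  In the face of \<open>\<Delta>[n]\<close> opposite to \<open>k\<close>, as it occurs in the boundary of the top cell, all
  whiskers are built from simplices containing \<open>{k-1, k, k+1} \<inter> [n]\<close>: after collapsing \<open>k\<close> with one
  of its neighbours the face becomes the top cell, which has no whiskers. The whiskers are therefore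
  weakly invertible. Whiskering with a weakly invertible cell can be undone up to weakly invertible
  cells, also when its dimension is lower. So the missing face of a horn is obtained by solving an
  equation, and the last face of a thin simplex is weakly invertible because it can be isolated in the
  boundary. For saturation, the same division shows that the triangles \<open>[0, 1, 2]\<close> and \<open>[1, 2, 3]\<close>,
  joined with the remaining vertices, provide the two one-sided inverses of the edge \<open>[1, 2]\<close>.
\<close>

section \<open>Single-sorted omega-categories\<close>

text \<open>Division rests on one interchange. Let \<open>w\<close> be weakly invertible of
  dimension k + 1 with inverse \<open>w'\<close>, and let \<open>e\<close> run from a unit to
  \<open>cm k w w'\<close>. Sliding a cell \<open>z\<close> past \<open>e\<close> turns composition
  of \<open>z\<close> with \<open>cm k w w'\<close> along k into composition with whiskerings of
  \<open>e\<close> along k + 1. Sides are exchanged and k grows, so the recursion stops where the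
  weak inverse has the dimension of \<open>z\<close> and acts directly. Prescribing functors
  presupposes no freeness of orientals. Values are generated by all composites of the given pieces,
  and two values of a cell agree because every composite has a normal form whose highest blocks are
  sorted along \<open>lt\<close>. Adjacent blocks in the wrong order do not meet, so they lie beside
  each other one dimension lower and can be exchanged there. The order compares first vertices and
  then tails in reverse, because coning with a vertex interchanges sources and targets. Weak
  invertibility is a greatest fixed point. Closure properties are therefore coinductions, unless an
  inverse up to \<open>eqv\<close> is at hand, which already suffices.\<close>

fun opp :: "sign \<Rightarrow> sign" where "opp Minus = Plus" | "opp Plus = Minus"

lemma opp_opp [simp]: "opp (opp \<alpha>) = \<alpha>" by (cases \<alpha>) auto

locale scat =
  fixes A :: "'c set" and D :: "sign \<Rightarrow> nat \<Rightarrow> 'c \<Rightarrow> 'c" and cm :: "nat \<Rightarrow> 'c \<Rightarrow> 'c \<Rightarrow> 'c"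
  assumes D_in: "x \<in> A \<Longrightarrow> D \<alpha> k x \<in> A"
    and D_below: "\<lbrakk>x \<in> A; k < j\<rbrakk> \<Longrightarrow> D \<alpha> k (D \<beta> j x) = D \<alpha> k x"
    and D_above: "\<lbrakk>x \<in> A; j \<le> k\<rbrakk> \<Longrightarrow> D \<alpha> k (D \<beta> j x) = D \<beta> j x"
    and cm_in: "\<lbrakk>x \<in> A; y \<in> A; D Plus k y = D Minus k x\<rbrakk> \<Longrightarrow> cm k x y \<in> A"
    and D_cm_below: "\<lbrakk>x \<in> A; y \<in> A; D Plus k y = D Minus k x; j < k\<rbrakk> \<Longrightarrow> D \<alpha> j (cm k x y) = D \<alpha> j x"
    and src_cm: "\<lbrakk>x \<in> A; y \<in> A; D Plus k y = D Minus k x\<rbrakk> \<Longrightarrow> D Minus k (cm k x y) = D Minus k y"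
    and tgt_cm: "\<lbrakk>x \<in> A; y \<in> A; D Plus k y = D Minus k x\<rbrakk> \<Longrightarrow> D Plus k (cm k x y) = D Plus k x"
    and D_cm_above: "\<lbrakk>x \<in> A; y \<in> A; D Plus k y = D Minus k x; k < j\<rbrakk> \<Longrightarrow>
          D \<alpha> j (cm k x y) = cm k (D \<alpha> j x) (D \<alpha> j y)"
    and unitR: "x \<in> A \<Longrightarrow> cm k x (D Minus k x) = x"
    and unitL: "x \<in> A \<Longrightarrow> cm k (D Plus k x) x = x"
    and cm_assoc: "\<lbrakk>x \<in> A; y \<in> A; z \<in> A; D Plus k y = D Minus k x; D Plus k z = D Minus k y\<rbrakk> \<Longrightarrow>
          cm k (cm k x y) z = cm k x (cm k y z)"
    and cm_interchange: "\<lbrakk>j < k; x \<in> A; y \<in> A; z \<in> A; w \<in> A; D Plus k y = D Minus k x;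
          D Plus k w = D Minus k z; D Plus j z = D Minus j x\<rbrakk> \<Longrightarrow>
          cm j (cm k x y) (cm k z w) = cm k (cm j x z) (cm j y w)"
begin

lemmas D_simps = D_in D_below D_above
lemmas cm_simps = cm_in D_cm_below src_cm tgt_cm D_cm_above

definition cells :: "nat \<Rightarrow> 'c set" where
  "cells n = {x \<in> A. D Minus n x = x}"

lemma cells_in: "x \<in> cells n \<Longrightarrow> x \<in> A"
  by (simp add: cells_def)

lemma cells_D: "\<lbrakk>x \<in> cells n; n \<le> m\<rbrakk> \<Longrightarrow> D \<alpha> m x = x"
  using D_above[of x n m \<alpha> Minus] by (simp add: cells_def)

lemma cells_mono: "\<lbrakk>x \<in> cells n; n \<le> m\<rbrakk> \<Longrightarrow> x \<in> cells m"
  using cells_D[of x n m Minus] by (simp add: cells_def)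

lemma D_cells: "x \<in> A \<Longrightarrow> k \<le> n \<Longrightarrow> D \<alpha> k x \<in> cells n"
  by (simp add: cells_def D_simps)

text \<open>Cells of dimension at most \<open>k\<close> are their own \<open>k\<close>-boundaries,
  so composability along \<open>k\<close> already means equality.\<close>

lemma cm_trivial:
  assumes "x \<in> cells n" "y \<in> cells n" "n \<le> k" "D Plus k y = D Minus k x"
  shows "y = x" "cm k x y = x"
proof -
  show 1: "y = x" using assms cells_D[of x n k] cells_D[of y n k] by simp
  show "cm k x y = x" using unitR[of x k] assms cells_D[of x n k] 1 cells_in by metis
qed

lemma cm_cells:
  assumes "x \<in> cells n" "y \<in> cells n" "D Plus k y = D Minus k x"
  shows "cm k x y \<in> cells n"
proof (cases "k < n")
  case True
  then show ?thesis
    using assms by (simp add: cells_def cm_simps)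
next
  case False
  then show ?thesis using cm_trivial[of x n y k] assms by simp
qed

lemma D_cm_parallel:
  "\<lbrakk>x \<in> A; y \<in> A; D Plus k y = D Minus k x; j < k\<rbrakk> \<Longrightarrow> D \<alpha> j y = D \<alpha> j x"
  by (metis D_below)

lemma D_composable:
  assumes "x \<in> A" "y \<in> A" "D Plus k y = D Minus k x" "k < j"
  shows "D Plus k (D \<alpha> j y) = D Minus k (D \<alpha> j x)"
  using assms by (simp add: D_below)

text \<open>Reversing the direction of every dimension at once gives the opposite structure. A
  statement about one side is proved once and interpreted here to obtain the statement about the
  other side.\<close>

lemma dual_scat: "scat A (\<lambda>\<alpha>. D (opp \<alpha>)) (\<lambda>k x y. cm k y x)"
proof
  fix x y k j \<alpha> assume "x \<in> A" "y \<in> A" "D (opp Plus) k y = D (opp Minus) k x" "j < k"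
  then show "D (opp \<alpha>) j (cm k y x) = D (opp \<alpha>) j x"
    by (simp add: cm_simps) (metis D_below)
next
  fix j k x y z w
  assume jk: "j < k" and A: "x \<in> A" "y \<in> A" "z \<in> A" "w \<in> A" and "D (opp Plus) k y = D (opp Minus) k x"
          "D (opp Plus) k w = D (opp Minus) k z" "D (opp Plus) j z = D (opp Minus) j x"
  then have e: "D Plus k x = D Minus k y" "D Plus k z = D Minus k w" "D Plus j x = D Minus j z" by simp_all
  \<comment> \<open>The interchange law of the opposite structure is applied to the other diagonal
    pair. Its composability along \<open>j\<close> follows because the \<open>j\<close>-boundary of
    a cell is that of its \<open>k\<close>-boundaries.\<close>
  have "D Plus j y = D Minus j w"
    using e A D_below[OF A(2) jk, of Plus Minus] D_below[OF A(1) jk, of Plus Plus]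
      D_below[OF A(4) jk, of Minus Minus] D_below[OF A(3) jk, of Minus Plus] by metis
  then show "cm j (cm k w z) (cm k y x) = cm k (cm j w y) (cm j z x)"
    using cm_interchange[OF jk A(4,3,2,1)] e by blast
qed (simp_all add: D_simps cm_simps unitL unitR cm_assoc)

lemma cells_dual: "scat.cells A (\<lambda>\<alpha>. D (opp \<alpha>)) n = cells n"
proof -
  interpret d: scat A "\<lambda>\<alpha>. D (opp \<alpha>)" "\<lambda>k x y. cm k y x" by (rule dual_scat)
  have "D (opp Minus) n x = x \<longleftrightarrow> D Minus n x = x" if "x \<in> A" for x
    using that D_above[of x n n Minus Plus] D_above[of x n n Plus Minus] by force
  then show ?thesis unfolding d.cells_def cells_def by blast
qed

subsection \<open>Weakly invertible cells\<close>

text \<open>One unfolding of the definition of an invertibility set, with a predicate in place of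
  membership so that it also serves coinduction up to \<open>WI\<close>. The unit on
  \<open>D Minus n b\<close> is \<open>D Minus n b\<close> itself.\<close>

definition inv_data :: "(nat \<Rightarrow> 'c \<Rightarrow> bool) \<Rightarrow> nat \<Rightarrow> 'c \<Rightarrow> bool" where
  "inv_data R n b \<longleftrightarrow> (\<exists>b' c c'. R (Suc n) b' \<and> R (Suc (Suc n)) c \<and> R (Suc (Suc n)) c' \<and>
     D Plus n b = D Minus n b' \<and> D Plus n b' = D Minus n b \<and>
     D Minus (Suc n) c = D Minus n b \<and> D Plus (Suc n) c = cm n b' b \<and>
     D Minus (Suc n) c' = D Plus n b \<and> D Plus (Suc n) c' = cm n b b')"

lemma inv_data_mono: "inv_data R n b \<Longrightarrow> (\<And>n x. R n x \<Longrightarrow> S n x) \<Longrightarrow> inv_data S n b"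
  unfolding inv_data_def by blast

definition inv_set :: "(nat \<Rightarrow> 'c \<Rightarrow> bool) \<Rightarrow> bool" where
  "inv_set R \<longleftrightarrow> (\<forall>n b. R n b \<longrightarrow> b \<in> cells n \<and> (\<exists>m. n = Suc m \<and> inv_data R m b))"

definition WI :: "nat \<Rightarrow> 'c \<Rightarrow> bool" where
  "WI n x \<longleftrightarrow> (\<exists>R. inv_set R \<and> R n x)"

lemma inv_set_WI: "inv_set WI"
  unfolding inv_set_def
proof (intro allI impI)
  fix n b assume "WI n b"
  then obtain R where R: "inv_set R" "R n b" by (auto simp: WI_def)
  have "\<And>n x. R n x \<Longrightarrow> WI n x" using R(1) by (auto simp: WI_def)
  then show "b \<in> cells n \<and> (\<exists>m. n = Suc m \<and> inv_data WI m b)"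
    using R inv_data_mono[of R _ b WI] unfolding inv_set_def by blast
qed

lemma WI_cells: "WI n b \<Longrightarrow> b \<in> cells n"
  and WI_in: "WI n b \<Longrightarrow> b \<in> A"
  and WI_pos: "WI n b \<Longrightarrow> 0 < n"
  and WI_data: "WI (Suc n) b \<Longrightarrow> inv_data WI n b"
  using inv_set_WI cells_in unfolding inv_set_def by blast+

text \<open>Coinduction up to \<open>WI\<close>: the union of \<open>R\<close> with
  \<open>WI\<close> is an invertibility set, so inverses and comparison cells that are already known
  to be weakly invertible may be used freely.\<close>

lemma WI_coinduct:
  assumes "R n x"
    and "\<And>n b. R n b \<Longrightarrow> b \<in> cells n \<and> (\<exists>m. n = Suc m \<and> inv_data (\<lambda>n x. R n x \<or> WI n x) m b)"
  shows "WI n x"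
proof -
  have "inv_set (\<lambda>n x. R n x \<or> WI n x)"
    unfolding inv_set_def
  proof (intro allI impI, erule disjE)
    fix n b assume "R n b"
    then show "b \<in> cells n \<and> (\<exists>m. n = Suc m \<and> inv_data (\<lambda>n x. R n x \<or> WI n x) m b)"
      by (rule assms(2))
  next
    fix n b assume "WI n b"
    then show "b \<in> cells n \<and> (\<exists>m. n = Suc m \<and> inv_data (\<lambda>n x. R n x \<or> WI n x) m b)"
      using inv_set_WI inv_data_mono[of WI _ b "\<lambda>n x. R n x \<or> WI n x"] unfolding inv_set_def by blast
  qed
  then show ?thesis using assms(1) unfolding WI_def by blast
qed

lemma WI_unit: assumes "x \<in> cells n" "n < m" shows "WI m x"
proof (rule WI_coinduct[where R = "\<lambda>m x. \<exists>n. m = Suc n \<and> x \<in> cells n"])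
  show "\<exists>n. m = Suc n \<and> x \<in> cells n"
    using assms cells_mono[of x n "m - 1"] by (intro exI[of _ "m - 1"]) auto
next
  fix n b assume "\<exists>n'. n = Suc n' \<and> b \<in> cells n'"
  then obtain k where k: "n = Suc k" "b \<in> cells k" by blast
  then have "D \<alpha> k b = b" "D \<alpha> (Suc k) b = b" for \<alpha> using cells_D[of b k] by simp_all
  moreover have "cm k b b = b" using unitR[of b k] k calculation cells_in by force
  ultimately show "b \<in> cells n \<and> (\<exists>m. n = Suc m \<and> inv_data (\<lambda>n x. (\<exists>n'. n = Suc n' \<and> x \<in> cells n') \<or> WI n x) m b)"
    unfolding inv_data_def using k cells_mono[of b k "Suc k"]
    by (intro conjI exI[of _ k] exI[of _ b]) auto
qed

lemma WI_dual_aux: assumes "WI n x" shows "scat.WI A (\<lambda>\<alpha>. D (opp \<alpha>)) (\<lambda>k x y. cm k y x) n x"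
proof -
  interpret d: scat A "\<lambda>\<alpha>. D (opp \<alpha>)" "\<lambda>k x y. cm k y x" by (rule dual_scat)
  show ?thesis
  proof (rule d.WI_coinduct[where R = WI], fact)
    fix n b assume b: "WI n b"
    then obtain m where m: "n = Suc m" using WI_pos gr0_implies_Suc by blast
    obtain b' c c' where *: "WI (Suc m) b'" "WI (Suc (Suc m)) c" "WI (Suc (Suc m)) c'"
      "D Plus m b = D Minus m b'" "D Plus m b' = D Minus m b"
      "D Minus (Suc m) c = D Minus m b" "D Plus (Suc m) c = cm m b' b"
      "D Minus (Suc m) c' = D Plus m b" "D Plus (Suc m) c' = cm m b b'"
      using WI_data[of m b] b m unfolding inv_data_def by blast
    \<comment> \<open>In the opposite structure the comparison cells run from the composite to the
      unit. The weak inverses of \<open>c\<close> and \<open>c'\<close> have this direction.\<close>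
    obtain e where e: "WI (Suc (Suc m)) e" "D Plus (Suc m) c = D Minus (Suc m) e"
      "D Plus (Suc m) e = D Minus (Suc m) c"
      using WI_data[OF *(2)] unfolding inv_data_def by blast
    obtain e' where e': "WI (Suc (Suc m)) e'" "D Plus (Suc m) c' = D Minus (Suc m) e'"
      "D Plus (Suc m) e' = D Minus (Suc m) c'"
      using WI_data[OF *(3)] unfolding inv_data_def by blast
    have "d.inv_data (\<lambda>n x. WI n x \<or> d.WI n x) m b"
      unfolding d.inv_data_def using * e e'
      by (intro exI[of _ b'] exI[of _ e] exI[of _ e']) auto
    then show "b \<in> d.cells n \<and> (\<exists>m. n = Suc m \<and> d.inv_data (\<lambda>n x. WI n x \<or> d.WI n x) m b)"
      using m WI_cells[OF b] by (simp add: cells_dual)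
  qed
qed

lemma WI_dual: "scat.WI A (\<lambda>\<alpha>. D (opp \<alpha>)) (\<lambda>k x y. cm k y x) n x = WI n x"
  using WI_dual_aux[of n x] scat.WI_dual_aux[OF dual_scat, of n x] by auto

section \<open>Closure of weakly invertible cells under whiskering and composition\<close>

lemma WI_whiskL:
  assumes "WI m b" "u \<in> cells n" "n < m" "k < n" "D Plus k b = D Minus k u"
  shows "WI m (cm k u b)"
proof (rule WI_coinduct[where R = "\<lambda>m z. \<exists>b. z = cm k u b \<and> WI m b \<and> n < m \<and> D Plus k b = D Minus k u"])
  show "\<exists>b'. cm k u b = cm k u b' \<and> WI m b' \<and> n < m \<and> D Plus k b' = D Minus k u" using assms by blast
next
  fix m z assume "\<exists>b. z = cm k u b \<and> WI m b \<and> n < m \<and> D Plus k b = D Minus k u"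
  then obtain b where b: "z = cm k u b" "WI m b" "n < m" "D Plus k b = D Minus k u" by blast
  obtain p where p: "m = Suc p" using b(3) by (cases m) auto
  obtain b' c c' where *: "WI (Suc p) b'" "WI (Suc (Suc p)) c" "WI (Suc (Suc p)) c'"
      "D Plus p b = D Minus p b'" "D Plus p b' = D Minus p b"
      "D Minus (Suc p) c = D Minus p b" "D Plus (Suc p) c = cm p b' b"
      "D Minus (Suc p) c' = D Plus p b" "D Plus (Suc p) c' = cm p b b'"
    using WI_data[of p b] b p unfolding inv_data_def by blast
  note A = b(2)[THEN WI_in] *(1-3)[THEN WI_in] assms(2)[THEN cells_in]
  have u: "D \<alpha> j u = u" if "n \<le> j" for \<alpha> j using cells_D[OF assms(2)] that .
  have kp: "k < p" using assms(4) b(3) p by simp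
  have b'k: "D Plus k b' = D Minus k u"
    using b(4) *(5) A kp D_below[of b k p Plus Minus] D_below[of b' k p Plus Plus] by metis
  have ck: "D Plus k c = D Minus k u"
    using b(4) *(6) A kp D_below[of c k "Suc p" Plus Minus] D_below[of b k p Plus Minus] by simp
  have ck': "D Plus k c' = D Minus k u"
    using b(4) *(8) A kp D_below[of c' k "Suc p" Plus Minus] D_below[of b k p Plus Plus] by simp
  \<comment> \<open>As \<open>u\<close> has dimension at most \<open>p\<close>, it is a unit for
    composition along \<open>p\<close>, and interchange merges the two copies of \<open>u\<close>.
    Whiskering the inverse of \<open>b\<close> thus gives an inverse of the whiskered cell.\<close>
  have 1: "cm p (cm k u b') (cm k u b) = cm k u (cm p b' b)"
    using cm_interchange[of k p u u b' b] A *(4,5) kp u[of p] assms(3,4) b p b'k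
      unitR[of u p] by (simp add: )
  have 2: "cm p (cm k u b) (cm k u b') = cm k u (cm p b b')"
    using cm_interchange[of k p u u b b'] A *(4,5) kp u[of p] assms(3,4) b p b'k
      unitR[of u p] by (simp add: )
  have "inv_data (\<lambda>m z. \<exists>b. z = cm k u b \<and> WI m b \<and> n < m \<and> D Plus k b = D Minus k u) p z"
    unfolding inv_data_def
    apply (rule exI[of _ "cm k u b'"], rule exI[of _ "cm k u c"], rule exI[of _ "cm k u c'"])
    using A * b p b'k ck ck' kp u by (auto simp: cm_simps 1 2)
  moreover have "z \<in> cells m"
    unfolding b(1) using b assms(2) WI_cells cells_mono[of u n m] by (intro cm_cells) auto
  ultimately show "z \<in> cells m \<and> (\<exists>p. m = Suc p \<and> inv_data (\<lambda>m z. (\<exists>b. z = cm k u b \<and> WI m b \<and> n < m \<and> D Plus k b = D Minus k u) \<or> WI m z) p z)"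
    using p inv_data_mono by (smt (verit, best))
qed

lemma WI_whiskR:
  assumes "WI m b" "u \<in> cells n" "n < m" "k < n" "D Minus k b = D Plus k u"
  shows "WI m (cm k b u)"
  using scat.WI_whiskL[OF dual_scat, of m b u n k] assms by (simp add: WI_dual cells_dual)

text \<open>The inverse is \<open>cm n y' x'\<close>. Its comparison cell first opens the unit to
  \<open>cm n y' y\<close> by \<open>d\<close> and then inserts \<open>c\<close> in the middle. That
  cell is itself a composite in the top direction, one dimension higher, which is why the
  coinduction relation ranges over all dimensions.\<close>

lemma WI_top:
  assumes "WI (Suc n) x" "WI (Suc n) y" "D Plus n y = D Minus n x"
  shows "WI (Suc n) (cm n x y)"
proof (rule WI_coinduct[where R = "\<lambda>m z. \<exists>n x y. m = Suc n \<and> z = cm n x y \<and> WI m x \<and> WI m y \<and> D Plus n y = D Minus n x"])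
  show "\<exists>n' x' y'. Suc n = Suc n' \<and> cm n x y = cm n' x' y' \<and> WI (Suc n) x' \<and> WI (Suc n) y' \<and> D Plus n' y' = D Minus n' x'"
    using assms by blast
next
  fix m z assume "\<exists>n x y. m = Suc n \<and> z = cm n x y \<and> WI m x \<and> WI m y \<and> D Plus n y = D Minus n x"
  then obtain n x y where h: "m = Suc n" "z = cm n x y" "WI (Suc n) x" "WI (Suc n) y" "D Plus n y = D Minus n x"
    by blast
  obtain x' c c' where x': "WI (Suc n) x'" "WI (Suc (Suc n)) c" "WI (Suc (Suc n)) c'"
      "D Plus n x = D Minus n x'" "D Plus n x' = D Minus n x"
      "D Minus (Suc n) c = D Minus n x" "D Plus (Suc n) c = cm n x' x"
      "D Minus (Suc n) c' = D Plus n x" "D Plus (Suc n) c' = cm n x x'"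
    using WI_data[OF h(3)] unfolding inv_data_def by blast
  obtain y' d d' where y': "WI (Suc n) y'" "WI (Suc (Suc n)) d" "WI (Suc (Suc n)) d'"
      "D Plus n y = D Minus n y'" "D Plus n y' = D Minus n y"
      "D Minus (Suc n) d = D Minus n y" "D Plus (Suc n) d = cm n y' y"
      "D Minus (Suc n) d' = D Plus n y" "D Plus (Suc n) d' = cm n y y'"
    using WI_data[OF h(4)] unfolding inv_data_def by blast
  note A = h(3,4)[THEN WI_in] x'(1-3)[THEN WI_in] y'(1-3)[THEN WI_in]
  note C = h(3,4)[THEN WI_cells] x'(1)[THEN WI_cells] y'(1)[THEN WI_cells]
  have S: "D \<alpha> (Suc n) x = x" "D \<alpha> (Suc n) y = y" "D \<alpha> (Suc n) x' = x'" "D \<alpha> (Suc n) y' = y'" for \<alpha>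
    using C cells_D by blast+
  have cb: "D \<alpha> n c = D Minus n x" "D \<alpha> n d = D Minus n y" "D \<alpha> n c' = D Plus n x" "D \<alpha> n d' = D Plus n y" for \<alpha>
    using A x' y' D_below[of c n "Suc n" \<alpha> Minus] D_below[of d n "Suc n" \<alpha> Minus]
      D_below[of c' n "Suc n" \<alpha> Minus] D_below[of d' n "Suc n" \<alpha> Minus]
    by (simp_all add: D_above)
  have e: "WI (Suc (Suc n)) (cm n y' (cm n c y))"
    apply (rule WI_whiskL[where n = "Suc n"], rule WI_whiskR[where n = "Suc n"])
    using C A cb h y' x' by (auto simp: cm_simps)
  have e': "WI (Suc (Suc n)) (cm n x (cm n d' x'))"
    apply (rule WI_whiskL[where n = "Suc n"], rule WI_whiskR[where n = "Suc n"])
    using C A cb h y' x' by (auto simp: cm_simps)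
  have 1: "cm n (cm n y' x') (cm n x y) = cm n y' (cm n (cm n x' x) y)"
    using A h x' y' by (simp add: cm_assoc cm_simps)
  have 2: "cm n (cm n x y) (cm n y' x') = cm n x (cm n (cm n y y') x')"
    using A h x' y' by (simp add: cm_assoc cm_simps)
  have 3: "cm n (D Minus n x) y = y" "cm n (D Plus n y) x' = x'"
    using A h x' unitL[of y n] unitL[of x' n] by simp_all
  have e1: "D Minus (Suc n) (cm n y' (cm n c y)) = D Plus (Suc n) d"
    using A h x' y' cb S 3 by (simp add: cm_simps)
  have e2: "D Minus (Suc n) (cm n x (cm n d' x')) = D Plus (Suc n) c'"
    using A h x' y' cb S 3 by (simp add: cm_simps)
  have e3: "D Plus (Suc n) (cm n y' (cm n c y)) = cm n (cm n y' x') (cm n x y)"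
    using A h x' y' cb S 3 by (simp add: cm_simps 1)
  have e4: "D Plus (Suc n) (cm n x (cm n d' x')) = cm n (cm n x y) (cm n y' x')"
    using A h x' y' cb S 3 by (simp add: cm_simps 2)
  have eA: "cm n y' (cm n c y) \<in> A" "cm n x (cm n d' x') \<in> A" using e e' WI_in by blast+
  have "inv_data (\<lambda>m z. \<exists>n x y. m = Suc n \<and> z = cm n x y \<and> WI m x \<and> WI m y \<and> D Plus n y = D Minus n x) n z"
    unfolding inv_data_def
    apply (rule exI[of _ "cm n y' x'"], rule exI[of _ "cm (Suc n) (cm n y' (cm n c y)) d"],
         rule exI[of _ "cm (Suc n) (cm n x (cm n d' x')) c'"], intro conjI)
    subgoal using x' y' h by metis
    subgoal using e e1 y' by metis
    subgoal using e' e2 x' by metis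
    using A h x' y' eA e1 e2 e3 e4 by (simp_all add: cm_simps)
  moreover have "z \<in> cells m"
    unfolding h using C h by (intro cm_cells)
  ultimately show "z \<in> cells m \<and> (\<exists>p. m = Suc p \<and> inv_data (\<lambda>m z. (\<exists>n x y. m = Suc n \<and> z = cm n x y \<and> WI m x \<and> WI m y \<and> D Plus n y = D Minus n x) \<or> WI m z) p z)"
    using h(1) inv_data_mono by (smt (verit, best))
qed

lemma WI_cm:
  assumes "WI m x" "WI m y" "k < m" "D Plus k y = D Minus k x"
  shows "WI m (cm k x y)"
proof (cases "Suc k = m")
  case True
  then show ?thesis using WI_top assms by blast
next
  case False
  then obtain p where p: "m = Suc p" "k < p" using assms(3) by (cases m) auto
  note A = assms(1,2)[THEN WI_in]
  \<comment> \<open>Interchange writes a composite along a low dimension as a composite along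
    \<open>p\<close> of two whiskered cells, where \<open>WI_top\<close> applies.\<close>
  have eq: "cm k x y = cm p (cm k x (D Plus p y)) (cm k (D Minus p x) y)"
    using cm_interchange[of k p x "D Minus p x" "D Plus p y" y] A assms p
    by (simp add: unitR unitL D_simps)
  have "WI m (cm k x (D Plus p y))"
    using A assms p by (intro WI_whiskR[where n = p]) (auto simp: D_simps D_cells)
  moreover have "WI m (cm k (D Minus p x) y)"
    using A assms p by (intro WI_whiskL[where n = p]) (auto simp: D_simps D_cells)
  ultimately show ?thesis
    unfolding eq p using A assms p by (intro WI_top) (auto simp: cm_simps D_simps)
qed

end

context scat begin

subsection \<open>Cells up to weakly invertible cells\<close>

definition eqv :: "nat \<Rightarrow> 'c \<Rightarrow> 'c \<Rightarrow> bool" where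
  "eqv n x y \<longleftrightarrow> (\<exists>e. WI (Suc n) e \<and> D Minus n e = x \<and> D Plus n e = y)"

lemma eqv_cells: "eqv n x y \<Longrightarrow> x \<in> cells n" "eqv n x y \<Longrightarrow> y \<in> cells n"
  unfolding eqv_def using WI_in D_cells by blast+

lemma eqv_refl: "x \<in> cells n \<Longrightarrow> eqv n x x"
  unfolding eqv_def using WI_unit[of x n "Suc n"] cells_D[of x n n] by blast

lemma eqv_sym: "eqv n x y \<Longrightarrow> eqv n y x"
  unfolding eqv_def using WI_data inv_data_def by metis

lemma eqv_trans: assumes "eqv n x y" "eqv n y z" shows "eqv n x z"
proof -
  obtain e where e: "WI (Suc n) e" "D Minus n e = x" "D Plus n e = y" using assms(1) eqv_def by auto
  obtain f where f: "WI (Suc n) f" "D Minus n f = y" "D Plus n f = z" using assms(2) eqv_def by auto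
  have "WI (Suc n) (cm n f e)" using WI_top e f by simp
  then show ?thesis unfolding eqv_def
    using e f WI_in by (intro exI[of _ "cm n f e"]) (simp add: cm_simps)
qed

lemma eqv_bd: "eqv n x y \<Longrightarrow> k < n \<Longrightarrow> D \<alpha> k x = D \<alpha> k y"
  unfolding eqv_def using WI_in D_below by metis

lemma eqv_whiskL:
  assumes "eqv n x y" "u \<in> cells n" "k < n" "D Plus k x = D Minus k u"
  shows "eqv n (cm k u x) (cm k u y)"
proof -
  obtain e where e: "WI (Suc n) e" "D Minus n e = x" "D Plus n e = y" using assms(1) eqv_def by auto
  have k: "D Plus k e = D Minus k u" using assms e D_below[of e k n Plus Minus] WI_in by metis
  then have "WI (Suc n) (cm k u e)" using WI_whiskL[of "Suc n" e u n k] e assms by simp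
  then show ?thesis unfolding eqv_def
    using e assms k WI_in[OF e(1)] cells_in[OF assms(2)] cells_D[OF assms(2)]
    by (intro exI[of _ "cm k u e"]) (simp add: cm_simps)
qed

lemma eqv_dual: "scat.eqv A (\<lambda>\<alpha>. D (opp \<alpha>)) (\<lambda>k x y. cm k y x) n x y \<longleftrightarrow> eqv n x y"
proof -
  interpret d: scat A "\<lambda>\<alpha>. D (opp \<alpha>)" "\<lambda>k x y. cm k y x" by (rule dual_scat)
  have "d.eqv n x y = eqv n y x" unfolding d.eqv_def eqv_def by (auto simp: WI_dual)
  then show ?thesis using eqv_sym by blast
qed

lemma eqv_whiskR:
  assumes "eqv n x y" "u \<in> cells n" "k < n" "D Minus k x = D Plus k u"
  shows "eqv n (cm k x u) (cm k y u)"
  using scat.eqv_whiskL[OF dual_scat, where n = n and x = x and y = y and u = u and k = k] assms by (simp add: eqv_dual cells_dual)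

lemma eqv_cong:
  assumes "eqv n x x'" "eqv n y y'" "k < n" "D Plus k y = D Minus k x"
  shows "eqv n (cm k x y) (cm k x' y')"
proof -
  have "eqv n (cm k x y) (cm k x y')"
    using assms eqv_cells eqv_whiskL by blast
  moreover have "eqv n (cm k x y') (cm k x' y')"
    using assms eqv_cells eqv_whiskR[of n x x' y' k] eqv_bd[OF assms(2,3), of Plus] by metis
  ultimately show ?thesis by (rule eqv_trans)
qed

lemma WI_inverse:
  assumes "WI (Suc n) w"
  obtains w' where "WI (Suc n) w'" "D Plus n w = D Minus n w'" "D Plus n w' = D Minus n w"
    "eqv (Suc n) (D Minus n w) (cm n w' w)" "eqv (Suc n) (D Plus n w) (cm n w w')"
  using WI_data[OF assms] unfolding inv_data_def eqv_def by metis

text \<open>The hypotheses are symmetric in \<open>b\<close> and \<open>b'\<close>, so all such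
  pairs form a coinduction relation: weak invertibility of \<open>b'\<close> comes out together with
  that of \<open>b\<close>.\<close>

lemma WI_I:
  assumes "b \<in> cells (Suc n)" "b' \<in> cells (Suc n)" "D Plus n b = D Minus n b'" "D Plus n b' = D Minus n b"
    "eqv (Suc n) (D Minus n b) (cm n b' b)" "eqv (Suc n) (D Plus n b) (cm n b b')"
  shows "WI (Suc n) b"
proof -
  define R where "R m b \<longleftrightarrow> (\<exists>n b'. m = Suc n \<and> b \<in> cells (Suc n) \<and> b' \<in> cells (Suc n) \<and>
     D Plus n b = D Minus n b' \<and> D Plus n b' = D Minus n b \<and>
     eqv (Suc n) (D Minus n b) (cm n b' b) \<and> eqv (Suc n) (D Plus n b) (cm n b b'))" for m b
  show ?thesis
  proof (rule WI_coinduct[where R = R])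
    show "R (Suc n) b" unfolding R_def using assms by blast
  next
    fix m b assume "R m b"
    then obtain n b' where h: "m = Suc n" "b \<in> cells (Suc n)" "b' \<in> cells (Suc n)"
      "D Plus n b = D Minus n b'" "D Plus n b' = D Minus n b"
      "eqv (Suc n) (D Minus n b) (cm n b' b)" "eqv (Suc n) (D Plus n b) (cm n b b')"
      unfolding R_def by blast
    obtain c where c: "WI (Suc (Suc n)) c" "D Minus (Suc n) c = D Minus n b" "D Plus (Suc n) c = cm n b' b"
      using h(6) unfolding eqv_def by blast
    obtain c' where c': "WI (Suc (Suc n)) c'" "D Minus (Suc n) c' = D Plus n b" "D Plus (Suc n) c' = cm n b b'"
      using h(7) unfolding eqv_def by blast
    have "R (Suc n) b'"
      unfolding R_def using h by (intro exI[of _ n] exI[of _ b]) auto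
    then have "inv_data (\<lambda>n x. R n x \<or> WI n x) n b"
      unfolding inv_data_def using h c c' by (intro exI[of _ b'] exI[of _ c] exI[of _ c']) auto
    then show "b \<in> cells m \<and> (\<exists>n. m = Suc n \<and> inv_data (\<lambda>n x. R n x \<or> WI n x) n b)"
      using h by blast
  qed
qed

text \<open>An inverse of \<open>y\<close> is also one of \<open>x\<close>: the two are parallel,
  and replacing \<open>y\<close> by \<open>x\<close> changes both composites only by an
  equivalence.\<close>

lemma WI_eqv: assumes "eqv n x y" "WI n y" shows "WI n x"
proof -
  obtain m where m: "n = Suc m" using assms WI_pos gr0_implies_Suc by blast
  obtain y' where y': "WI (Suc m) y'" "D Plus m y = D Minus m y'" "D Plus m y' = D Minus m y"
    "eqv (Suc m) (D Minus m y) (cm m y' y)" "eqv (Suc m) (D Plus m y) (cm m y y')"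
    using WI_inverse assms m by metis
  have xy: "D \<alpha> m x = D \<alpha> m y" for \<alpha> using eqv_bd assms(1) m by simp
  have yx: "eqv (Suc m) y x" using assms m eqv_sym by blast
  have "eqv (Suc m) (cm m y' y) (cm m y' x)"
    using eqv_whiskL[OF yx] y' WI_cells by simp
  moreover have "eqv (Suc m) (cm m y y') (cm m x y')"
    using eqv_whiskR[OF yx] y' WI_cells by simp
  ultimately show ?thesis unfolding m
    using y' xy assms m eqv_cells(1) WI_cells
    by (intro WI_I[of x m y']) (auto intro: eqv_trans)
qed

section \<open>One-sided weak inverses\<close>

definition RI :: "nat \<Rightarrow> 'c \<Rightarrow> bool" where
  "RI n x \<longleftrightarrow> x \<in> cells (Suc n) \<and> (\<exists>r \<in> cells (Suc n). D Plus n r = D Minus n x \<and>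
     D Minus n r = D Plus n x \<and> eqv (Suc n) (D Plus n x) (cm n x r))"

definition LI :: "nat \<Rightarrow> 'c \<Rightarrow> bool" where
  "LI n x \<longleftrightarrow> x \<in> cells (Suc n) \<and> (\<exists>r \<in> cells (Suc n). D Plus n r = D Minus n x \<and>
     D Minus n r = D Plus n x \<and> eqv (Suc n) (D Minus n x) (cm n r x))"

lemma RI_dual: "scat.RI A (\<lambda>\<alpha>. D (opp \<alpha>)) (\<lambda>k x y. cm k y x) n x = LI n x"
  and LI_dual: "scat.LI A (\<lambda>\<alpha>. D (opp \<alpha>)) (\<lambda>k x y. cm k y x) n x = RI n x"
proof -
  interpret d: scat A "\<lambda>\<alpha>. D (opp \<alpha>)" "\<lambda>k x y. cm k y x" by (rule dual_scat)
  show "d.RI n x = LI n x" "d.LI n x = RI n x"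
    unfolding d.RI_def d.LI_def RI_def LI_def by (auto simp: eqv_dual cells_dual)
qed

text \<open>As in a monoid: with right inverse \<open>r\<close> and left inverse \<open>l\<close>,
  the chain r x ~ (l x)(r x) = l (x r) x ~ l x ~ 1 makes \<open>r\<close> two-sided.\<close>

lemma RI_LI_WI: assumes "RI n x" "LI n x" shows "WI (Suc n) x"
proof -
  obtain r where r: "x \<in> cells (Suc n)" "r \<in> cells (Suc n)" "D Plus n r = D Minus n x"
     "D Minus n r = D Plus n x" "eqv (Suc n) (D Plus n x) (cm n x r)"
    using assms(1) unfolding RI_def by blast
  obtain l where l: "l \<in> cells (Suc n)" "D Plus n l = D Minus n x"
     "D Minus n l = D Plus n x" "eqv (Suc n) (D Minus n x) (cm n l x)"
    using assms(2) unfolding LI_def by blast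
  note A = r(1,2)[THEN cells_in] l(1)[THEN cells_in]
  have rx: "cm n r x \<in> cells (Suc n)" using r by (intro cm_cells) auto
  have "eqv (Suc n) (cm n (D Minus n x) (cm n r x)) (cm n (cm n l x) (cm n r x))"
    using l r A by (intro eqv_cong eqv_refl rx) (auto simp: cm_simps D_simps)
  then have 1: "eqv (Suc n) (cm n r x) (cm n (cm n l x) (cm n r x))"
    using unitL[of "cm n r x" n] A r by (simp add: cm_simps)
  have "cm n (cm n l x) (cm n r x) = cm n (cm n l (cm n x r)) x"
    using A r l by (simp add: cm_assoc cm_simps)
  moreover have "eqv (Suc n) (cm n (cm n l (D Plus n x)) x) (cm n (cm n l (cm n x r)) x)"
    using l r A by (intro eqv_cong eqv_refl) (auto simp: cm_simps D_simps)
  moreover have "cm n l (D Plus n x) = l" using unitR[of l n] A l by simp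
  ultimately have "eqv (Suc n) (cm n l x) (cm n (cm n l x) (cm n r x))" by simp
  then have "eqv (Suc n) (D Minus n x) (cm n r x)"
    using 1 l(4) eqv_sym eqv_trans by blast
  then show ?thesis using r by (intro WI_I[of x n r]) auto
qed

lemma WI_cm_RI:
  assumes "WI (Suc n) (cm n x y)" "x \<in> cells (Suc n)" "y \<in> cells (Suc n)" "D Plus n y = D Minus n x"
  shows "RI n x"
proof -
  obtain w' where w: "WI (Suc n) w'" "D Plus n (cm n x y) = D Minus n w'" "D Plus n w' = D Minus n (cm n x y)"
    "eqv (Suc n) (D Plus n (cm n x y)) (cm n (cm n x y) w')"
    using WI_inverse[OF assms(1)] by metis
  note A = assms(2,3)[THEN cells_in] w(1)[THEN WI_in]
  show ?thesis unfolding RI_def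
    using w assms A WI_cells[OF w(1)]
    by (intro conjI bexI[of _ "cm n y w'"]) (simp_all add: cm_simps cm_assoc cm_cells)
qed

lemma WI_cm_LI:
  assumes "WI (Suc n) (cm n x y)" "x \<in> cells (Suc n)" "y \<in> cells (Suc n)" "D Plus n y = D Minus n x"
  shows "LI n y"
  using scat.WI_cm_RI[OF dual_scat, where n = n and x = y and y = x] assms by (simp add: WI_dual cells_dual RI_dual)

subsection \<open>Division by weakly invertible cells\<close>

text \<open>Faithfulness, up to \<open>eqv\<close>, of whiskering with a weakly invertible cell.
  Parallelism is assumed in advance, since strict equality of boundaries cannot be recovered from
  the whiskered cells.\<close>

definition InjR :: "nat \<Rightarrow> nat \<Rightarrow> bool" where
  "InjR k p \<longleftrightarrow> (\<forall>w z z'. WI (Suc k) w \<and> z \<in> cells (Suc p) \<and> z' \<in> cells (Suc p) \<and>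
     (\<forall>\<alpha>. D \<alpha> p z = D \<alpha> p z') \<and> D Plus k w = D Minus k z \<and> eqv (Suc p) (cm k z w) (cm k z' w) \<longrightarrow>
     eqv (Suc p) z z')"

definition InjL :: "nat \<Rightarrow> nat \<Rightarrow> bool" where
  "InjL k p \<longleftrightarrow> (\<forall>w z z'. WI (Suc k) w \<and> z \<in> cells (Suc p) \<and> z' \<in> cells (Suc p) \<and>
     (\<forall>\<alpha>. D \<alpha> p z = D \<alpha> p z') \<and> D Plus k z = D Minus k w \<and> eqv (Suc p) (cm k w z) (cm k w z') \<longrightarrow>
     eqv (Suc p) z z')"

lemma all_opp: "(\<forall>\<alpha>. P (opp \<alpha>)) \<longleftrightarrow> (\<forall>\<alpha>. P \<alpha>)"
  by (metis opp_opp)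

lemma Inj_dual: "scat.InjR A (\<lambda>\<alpha>. D (opp \<alpha>)) (\<lambda>k x y. cm k y x) k p = InjL k p"
   "scat.InjL A (\<lambda>\<alpha>. D (opp \<alpha>)) (\<lambda>k x y. cm k y x) k p = InjR k p"
proof -
  interpret d: scat A "\<lambda>\<alpha>. D (opp \<alpha>)" "\<lambda>k x y. cm k y x" by (rule dual_scat)
  have e: "D Plus k w = D Minus k z \<longleftrightarrow> D Minus k z = D Plus k w" for k w z by auto
  have o: "(\<forall>\<alpha>. D (opp \<alpha>) p z = D (opp \<alpha>) p z') \<longleftrightarrow> (\<forall>\<alpha>. D \<alpha> p z = D \<alpha> p z')" for z z'
    by (rule all_opp)
  show "d.InjR k p = InjL k p"
    unfolding d.InjR_def InjL_def eqv_dual cells_dual WI_dual o opp.simps by (metis)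
  show "d.InjL k p = InjR k p"
    unfolding d.InjL_def InjR_def eqv_dual cells_dual WI_dual o opp.simps by (metis)
qed

text \<open>The component at \<open>z\<close> of the strict transformation from the identity to whiskering with the
  target of \<open>e\<close>.\<close>

lemma naturality:
  assumes "z \<in> A" "e \<in> A" "D Plus k e = D Minus k z" "D Minus (Suc k) e = D Minus k z"
  shows "cm (Suc k) (cm k (D Plus (Suc k) z) e) z = cm (Suc k) (cm k z (D Plus (Suc k) e)) (cm k (D Minus (Suc k) z) e)"
proof -
  have "cm k (cm (Suc k) (D Plus (Suc k) z) z) (cm (Suc k) e (D Minus (Suc k) e))
     = cm (Suc k) (cm k (D Plus (Suc k) z) e) (cm k z (D Minus (Suc k) e))"
    using assms by (intro cm_interchange) (auto simp: D_simps)
  moreover have "cm k (cm (Suc k) z (D Minus (Suc k) z)) (cm (Suc k) (D Plus (Suc k) e) e)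
     = cm (Suc k) (cm k z (D Plus (Suc k) e)) (cm k (D Minus (Suc k) z) e)"
    using assms by (intro cm_interchange) (auto simp: D_simps)
  ultimately show ?thesis using assms unitL[of z "Suc k"] unitR[of z "Suc k"] unitR[of e "Suc k"] unitL[of e "Suc k"] unitR[of z k] by metis
qed

lemma D_le_eq:
  assumes "z \<in> A" "z' \<in> A" "\<And>\<alpha>. D \<alpha> p z = D \<alpha> p z'" "j \<le> p"
  shows "D \<alpha> j z = D \<alpha> j z'"
proof (cases "j = p")
  case False
  then have "j < p" using assms(4) by simp
  then have "D \<alpha> j z = D \<alpha> j (D \<alpha> p z)" "D \<alpha> j z' = D \<alpha> j (D \<alpha> p z')" using assms(1,2) D_below by simp_all
  then show ?thesis using assms(3) by simp
qed (use assms in simp)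

lemma WI_unit_cell:
  assumes "WI (Suc k) w"
  obtains w' e where "WI (Suc k) w'" "D Plus k w = D Minus k w'" "D Plus k w' = D Minus k w"
    "WI (Suc (Suc k)) e" "D Minus (Suc k) e = D Plus k w" "D Plus (Suc k) e = cm k w w'"
    "\<And>\<alpha>. D \<alpha> k e = D Plus k w"
proof -
  obtain w' where w': "WI (Suc k) w'" "D Plus k w = D Minus k w'" "D Plus k w' = D Minus k w"
      "eqv (Suc k) (D Plus k w) (cm k w w')"
    using WI_inverse assms by metis
  obtain e where e: "WI (Suc (Suc k)) e" "D Minus (Suc k) e = D Plus k w" "D Plus (Suc k) e = cm k w w'"
    using w'(4) unfolding eqv_def by blast
  have "D \<alpha> k e = D Plus k w" for \<alpha>
    using D_below[of e k "Suc k" \<alpha> Minus] e WI_in[OF e(1)] WI_in[OF assms] D_above[of w k k] by simp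
  then show ?thesis using that w' e by blast
qed

text \<open>Whiskering the hypothesis with \<open>w'\<close> replaces \<open>w\<close> by
  \<open>cm k w w'\<close>. By \<open>naturality\<close> both sides become composites along k + 1
  with the same \<open>q\<close> and \<open>r\<close>, because \<open>z\<close> and
  \<open>z'\<close> share their boundaries up to dimension \<open>p\<close>. Cancelling
  \<open>q\<close> on the left, one dimension higher, finishes.\<close>

lemma inj_step: assumes "InjL (Suc k) p" "k < p" shows "InjR k p"
  unfolding InjR_def
proof (intro allI impI, elim conjE)
  fix w z z' assume h: "WI (Suc k) w" "z \<in> cells (Suc p)" "z' \<in> cells (Suc p)"
     "\<forall>\<alpha>. D \<alpha> p z = D \<alpha> p z'" "D Plus k w = D Minus k z" "eqv (Suc p) (cm k z w) (cm k z' w)"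
  obtain w' e where w': "WI (Suc k) w'" "D Plus k w = D Minus k w'" "D Plus k w' = D Minus k w"
    and e: "WI (Suc (Suc k)) e" "D Minus (Suc k) e = D Plus k w" "D Plus (Suc k) e = cm k w w'"
    "\<And>\<alpha>. D \<alpha> k e = D Plus k w"
    using WI_unit_cell[OF h(1)] by metis
  note A = h(1)[THEN WI_in] h(2,3)[THEN cells_in] w'(1)[THEN WI_in] e(1)[THEN WI_in]
  have zz: "D \<alpha> j z = D \<alpha> j z'" if "j \<le> p" for \<alpha> j
    using D_le_eq[of z z' p j \<alpha>] h(4) A that by simp
  have k: "D Minus k z' = D Plus k w" using zz[of k Minus] h assms(2) by simp
  define q where "q = cm k (D Plus (Suc k) z) e"
  define r where "r = cm k (D Minus (Suc k) z) e"
  have qr: "WI (Suc (Suc k)) q" "WI (Suc (Suc k)) r"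
    unfolding q_def r_def using A e h by (auto intro!: WI_whiskL[where n = "Suc k"] simp: D_cells D_simps)
  have n1: "cm (Suc k) q z = cm (Suc k) (cm k z (cm k w w')) r"
    unfolding q_def r_def using naturality[of z e k] A e h by simp
  have n2: "cm (Suc k) q z' = cm (Suc k) (cm k z' (cm k w w')) r"
    unfolding q_def r_def using naturality[of z' e k] A e h k zz[of "Suc k"] assms(2) by simp
  have Dr: "D Plus (Suc k) r = D Minus (Suc k) (cm k z (cm k w w'))"
    unfolding r_def using A e h w' by (simp add: cm_simps D_simps cells_D[OF WI_cells[OF h(1)]] cells_D[OF WI_cells[OF w'(1)]])
  have "eqv (Suc p) (cm k (cm k z w) w') (cm k (cm k z' w) w')"
    using h(6) WI_cells[OF w'(1)] assms(2) A h(5) w'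
    by - (rule eqv_whiskR, auto simp: cm_simps intro: cells_mono)
  then have "eqv (Suc p) (cm k z (cm k w w')) (cm k z' (cm k w w'))"
    using A h w' k by (simp add: cm_assoc)
  then have "eqv (Suc p) (cm (Suc k) q z) (cm (Suc k) q z')"
    unfolding n1 n2 using Dr WI_cells[OF qr(2)] assms(2)
    by - (rule eqv_whiskR, auto intro: cells_mono)
  moreover have "D Plus (Suc k) z = D Minus (Suc k) q"
    unfolding q_def using A e h by (simp add: cm_simps D_simps) (metis A(2) D_above D_below D_in lessI order.refl unitR)
  ultimately show "eqv (Suc p) z z'"
    using assms(1) qr h unfolding InjL_def by blast
qed

lemma inj_base: "InjR p p"
  unfolding InjR_def
proof (intro allI impI, elim conjE)
  fix w z z' assume h: "WI (Suc p) w" "z \<in> cells (Suc p)" "z' \<in> cells (Suc p)"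
     "\<forall>\<alpha>. D \<alpha> p z = D \<alpha> p z'" "D Plus p w = D Minus p z" "eqv (Suc p) (cm p z w) (cm p z' w)"
  obtain w' where w': "WI (Suc p) w'" "D Plus p w = D Minus p w'" "D Plus p w' = D Minus p w"
      "eqv (Suc p) (D Plus p w) (cm p w w')"
    using WI_inverse h(1) by metis
  note A = h(1)[THEN WI_in] h(2,3)[THEN cells_in] w'(1)[THEN WI_in]
  have k: "D Minus p z' = D Plus p w" using h by metis
  have *: "eqv (Suc p) x (cm p (cm p x w) w')" if x: "x \<in> cells (Suc p)" "D Plus p w = D Minus p x" for x
  proof -
    have "eqv (Suc p) (cm p x (D Plus p w)) (cm p x (cm p w w'))"
      using x A w' cells_in[OF x(1)] by - (rule eqv_whiskL, auto simp: D_simps)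
    then show ?thesis using x A w' cells_in[OF x(1)] unitR[of x p] by (simp add: cm_assoc)
  qed
  have "eqv (Suc p) (cm p (cm p z w) w') (cm p (cm p z' w) w')"
    using h(6) WI_cells[OF w'(1)] A h(5) w' by - (rule eqv_whiskR, auto simp: cm_simps)
  then show "eqv (Suc p) z z'"
    using *[of z] *[of z'] h k eqv_trans eqv_sym by metis
qed

text \<open>Downward induction on the distance from \<open>k\<close> to \<open>p\<close>. Left and
  right alternate in \<open>inj_step\<close>, so both are carried along.\<close>

lemma inj: "k \<le> p \<Longrightarrow> InjR k p \<and> InjL k p"
proof (induction "p - k" arbitrary: k)
  case 0
  then have "k = p" by simp
  then show ?case using inj_base scat.inj_base[OF dual_scat] by (simp add: Inj_dual)
next
  case (Suc d)
  then have "InjR (Suc k) p \<and> InjL (Suc k) p" "k < p" by simp_all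
  then show ?case using inj_step scat.inj_step[OF dual_scat] by (simp add: Inj_dual)
qed

lemma injR:
  assumes "eqv (Suc p) (cm k z w) (cm k z' w)" "WI (Suc k) w" "k \<le> p" "z \<in> cells (Suc p)" "z' \<in> cells (Suc p)"
     "\<And>\<alpha>. D \<alpha> p z = D \<alpha> p z'" "D Plus k w = D Minus k z"
  shows "eqv (Suc p) z z'"
  using inj[OF assms(3)] assms unfolding InjR_def by blast

text \<open>Fullness, up to \<open>eqv\<close>, of whiskering with a weakly invertible cell; the
  companion of \<open>InjR\<close>.\<close>

definition ExR :: "nat \<Rightarrow> nat \<Rightarrow> bool" where
  "ExR k p \<longleftrightarrow> (\<forall>w a b y. WI (Suc k) w \<and> a \<in> cells p \<and> b \<in> cells p \<and> (\<forall>\<alpha>. \<forall>j<p. D \<alpha> j a = D \<alpha> j b) \<and>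
     D Plus k w = D Minus k a \<and> y \<in> cells (Suc p) \<and> D Minus p y = cm k a w \<and> D Plus p y = cm k b w \<longrightarrow>
     (\<exists>z \<in> cells (Suc p). D Minus p z = a \<and> D Plus p z = b \<and> eqv (Suc p) (cm k z w) y))"

definition ExL :: "nat \<Rightarrow> nat \<Rightarrow> bool" where
  "ExL k p \<longleftrightarrow> (\<forall>w a b y. WI (Suc k) w \<and> a \<in> cells p \<and> b \<in> cells p \<and> (\<forall>\<alpha>. \<forall>j<p. D \<alpha> j a = D \<alpha> j b) \<and>
     D Plus k a = D Minus k w \<and> y \<in> cells (Suc p) \<and> D Minus p y = cm k w a \<and> D Plus p y = cm k w b \<longrightarrow>
     (\<exists>z \<in> cells (Suc p). D Minus p z = a \<and> D Plus p z = b \<and> eqv (Suc p) (cm k w z) y))"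

text \<open>Dualising exchanges \<open>a\<close> and \<open>b\<close>, so the composability
  condition moves from one to the other. By \<open>k < p\<close> the two have the same
  \<open>k\<close>-boundaries.\<close>

lemma Ex_dual: assumes "k < p"
  shows "scat.ExR A (\<lambda>\<alpha>. D (opp \<alpha>)) (\<lambda>k x y. cm k y x) k p = ExL k p"
   "scat.ExL A (\<lambda>\<alpha>. D (opp \<alpha>)) (\<lambda>k x y. cm k y x) k p = ExR k p"
proof -
  interpret d: scat A "\<lambda>\<alpha>. D (opp \<alpha>)" "\<lambda>k x y. cm k y x" by (rule dual_scat)
  have e: "D Plus k w = D Minus k z \<longleftrightarrow> D Minus k z = D Plus k w" for k w z by auto
  have o: "(\<forall>\<alpha>. \<forall>j<p. D (opp \<alpha>) j z = D (opp \<alpha>) j z') \<longleftrightarrow> (\<forall>\<alpha>. \<forall>j<p. D \<alpha> j z = D \<alpha> j z')" for z z'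
    by (rule all_opp)
  show "d.ExR k p = ExL k p"
    unfolding d.ExR_def ExL_def eqv_dual cells_dual WI_dual o opp.simps
    apply (rule iffI; intro allI impI; elim conjE)
    subgoal premises h for w a b y
      using h(1)[rule_format, of w b a y] h(2-) assms by metis
    subgoal premises h for w a b y
      using h(1)[rule_format, of w b a y] h(2-) assms by metis
    done
  show "d.ExL k p = ExR k p"
    unfolding d.ExL_def ExR_def eqv_dual cells_dual WI_dual o opp.simps
    apply (rule iffI; intro allI impI; elim conjE)
    subgoal premises h for w a b y
      using h(1)[rule_format, of w b a y] h(2-) assms by metis
    subgoal premises h for w a b y
      using h(1)[rule_format, of w b a y] h(2-) assms by metis
    done
qed

text \<open>The case where \<open>w\<close> has the dimension of \<open>y\<close>: the solution is
  \<open>cm k w' y\<close>. Only the end of \<open>z\<close> that meets \<open>w\<close> is dictated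
  by \<open>w\<close>; the other is inherited from \<open>y\<close>.\<close>

lemma ExL0:
  assumes "WI (Suc k) w" "y \<in> cells (Suc k)" "D Plus k y = D Plus k w"
  shows "\<exists>z \<in> cells (Suc k). D Plus k z = D Minus k w \<and> D Minus k z = D Minus k y \<and> eqv (Suc k) (cm k w z) y"
proof -
  obtain w' where w': "WI (Suc k) w'" "D Plus k w = D Minus k w'" "D Plus k w' = D Minus k w"
      "eqv (Suc k) (D Plus k w) (cm k w w')"
    using WI_inverse assms(1) by metis
  note A = assms(1)[THEN WI_in] cells_in[OF assms(2)] w'(1)[THEN WI_in]
  have "eqv (Suc k) (cm k (D Plus k w) y) (cm k (cm k w w') y)"
    using assms A w' by - (rule eqv_whiskR, auto simp: D_simps)
  then have "eqv (Suc k) (cm k w (cm k w' y)) y"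
    using assms A w' unitL[of y k] by (simp add: cm_assoc eqv_sym)
  then show ?thesis using A w' assms WI_cells[OF w'(1)]
    by (intro bexI[of _ "cm k w' y"]) (auto simp: cm_simps cm_cells)
qed

lemma ExR0:
  assumes "WI (Suc k) w" "y \<in> cells (Suc k)" "D Minus k y = D Minus k w"
  shows "\<exists>z \<in> cells (Suc k). D Minus k z = D Plus k w \<and> D Plus k z = D Plus k y \<and> eqv (Suc k) (cm k z w) y"
  using scat.ExL0[OF dual_scat, of k w y] assms by (simp add: cells_dual WI_dual eqv_dual)

text \<open>The cell \<open>Y\<close> is \<open>y\<close> transported along \<open>e\<close>. If
  \<open>cm (Suc k) q z\<close> is equivalent to \<open>Y\<close>, then by \<open>naturality\<close>
  cancelling \<open>r\<close> and afterwards \<open>w'\<close> shows that \<open>cm k z w\<close> is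
  equivalent to \<open>y\<close>. So existence uses cancellation along k + 1 and along k. When k + 1
  = p, the equation for \<open>z\<close> is the elementary one of \<open>ExL0\<close>.\<close>

lemma ex_step: assumes "Suc k < p \<Longrightarrow> ExL (Suc k) p" "k < p" shows "ExR k p"
  unfolding ExR_def
proof (intro allI impI, elim conjE)
  fix w a b y assume h: "WI (Suc k) w" "a \<in> cells p" "b \<in> cells p" "\<forall>\<alpha>. \<forall>j<p. D \<alpha> j a = D \<alpha> j b"
     "D Plus k w = D Minus k a" "y \<in> cells (Suc p)" "D Minus p y = cm k a w" "D Plus p y = cm k b w"
  obtain w' e where w': "WI (Suc k) w'" "D Plus k w = D Minus k w'" "D Plus k w' = D Minus k w"
    and e: "WI (Suc (Suc k)) e" "D Minus (Suc k) e = D Plus k w" "D Plus (Suc k) e = cm k w w'"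
    "\<And>\<alpha>. D \<alpha> k e = D Plus k w"
    using WI_unit_cell[OF h(1)] by metis
  note A = h(1)[THEN WI_in] h(2,3,6)[THEN cells_in] w'(1)[THEN WI_in] e(1)[THEN WI_in]
  have bk: "D Minus k b = D Plus k w" using h assms(2) by simp
  have W: "D \<alpha> j w = w" "D \<alpha> j w' = w'" if "Suc k \<le> j" for \<alpha> j
    using that h(1) w'(1) WI_cells cells_D by blast+
  define q where "q = cm k (D Plus (Suc k) b) e"
  define r where "r = cm k (D Minus (Suc k) a) e"
  define Y where "Y = cm (Suc k) (cm k y w') r"
  have qr: "WI (Suc (Suc k)) q" "WI (Suc (Suc k)) r"
    unfolding q_def r_def using A e h bk by (auto intro!: WI_whiskL[where n = "Suc k"] simp: D_cells D_simps)
  note QA = qr[THEN WI_in] qr[THEN WI_cells]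
  have ky: "D Minus k y = D Minus k w"
    using D_below[of y k p Minus Minus] A h assms(2) by (simp add: cm_simps)
  have y1: "D Minus (Suc k) y = cm k (D Minus (Suc k) a) w"
  proof (cases "Suc k = p")
    case True then show ?thesis using h cells_D[of a p "Suc k"] by simp
  next
    case False
    then show ?thesis using D_below[of y "Suc k" p Minus Minus] A h assms(2) W by (simp add: cm_simps)
  qed
  have y2: "D Plus (Suc k) y = cm k (D Plus (Suc k) b) w"
  proof (cases "Suc k = p")
    case True then show ?thesis using h cells_D[of b p "Suc k"] by simp
  next
    case False
    then have "D Plus (Suc k) y = D Plus (Suc k) (cm k b w)"
      using D_below[of y "Suc k" p Plus Plus] A h(8) assms(2) by simp
    then show ?thesis using A W bk by (simp add: cm_simps)
  qed
  have rD: "D Plus (Suc k) r = D Minus (Suc k) (cm k y w')" "D Minus (Suc k) r = D Minus (Suc k) a"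
    unfolding r_def using A e h w' ky y1 W unitR[of "D Minus (Suc k) a" k]
    by (simp_all add: cm_simps D_simps cm_assoc)
  have qD: "D Plus (Suc k) q = D Plus (Suc k) (cm k y w')" "D Minus (Suc k) q = D Plus (Suc k) b"
    unfolding q_def using A e h w' ky y2 W bk unitR[of "D Plus (Suc k) b" k]
    by (simp_all add: cm_simps D_simps cm_assoc)
  have yw: "cm k y w' \<in> cells (Suc p)"
    using h(6) w' ky WI_cells[OF w'(1)] assms(2) by - (rule cm_cells, auto intro: cells_mono)
  have Yc: "Y \<in> cells (Suc p)"
    unfolding Y_def using yw QA rD assms(2) by - (rule cm_cells, auto intro: cells_mono)
  have ywA: "cm k y w' \<in> A" using yw cells_in by blast
  have "\<exists>z \<in> cells (Suc p). D Minus p z = a \<and> D Plus p z = b \<and> eqv (Suc p) (cm (Suc k) q z) Y"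
  proof (cases "Suc k = p")
    case True
    have "D Plus (Suc k) Y = D Plus (Suc k) q" unfolding Y_def using ywA QA rD qD by (simp add: cm_simps)
    then obtain z where z: "z \<in> cells (Suc p)" "D Plus p z = D Minus p q" "D Minus p z = D Minus p Y" "eqv (Suc p) (cm p q z) Y"
      using ExL0[OF qr(1)] Yc True by auto
    have "D Minus p Y = a" unfolding Y_def using True ywA QA rD cells_D[OF h(2), of p] by (simp add: cm_simps)
    moreover have "D Minus p q = b" using qD True cells_D[OF h(3), of p] by simp
    ultimately show ?thesis using z True by auto
  next
    case False
    then have kp: "Suc k < p" using assms(2) by simp
    have ab: "D \<alpha> (Suc k) a = D \<alpha> (Suc k) b" for \<alpha> using h(4) kp by simp
    have rp: "D \<alpha> p r = r" for \<alpha> using QA cells_D[of r "Suc (Suc k)" p] kp by simp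
    have "D Minus p Y = cm (Suc k) (cm k a (cm k w w')) r"
      unfolding Y_def using kp ywA A QA rD rp h ky w' W by (simp add: cm_simps cm_assoc)
    also have "\<dots> = cm (Suc k) q a"
      unfolding q_def r_def using naturality[of a e k] A e h ab by simp
    finally have Y1: "D Minus p Y = cm (Suc k) q a" .
    have "D Plus p Y = cm (Suc k) (cm k b (cm k w w')) r"
      unfolding Y_def using kp ywA A QA rD rp h ky w' W bk by (simp add: cm_simps cm_assoc)
    also have "\<dots> = cm (Suc k) q b"
      unfolding q_def r_def using naturality[of b e k] A e h ab bk by simp
    finally have Y2: "D Plus p Y = cm (Suc k) q b" .
    show ?thesis
      using assms(1)[OF kp] qr(1) h(2,3,4) Yc Y1 Y2 qD(2) ab unfolding ExL_def by metis
  qed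
  then obtain z where z: "z \<in> cells (Suc p)" "D Minus p z = a" "D Plus p z = b" "eqv (Suc p) (cm (Suc k) q z) Y"
    by blast
  note zA = cells_in[OF z(1)]
  have zk: "D Minus k z = D Plus k w" using D_below[OF zA assms(2), of Minus Minus] z h by simp
  have z1: "D Minus (Suc k) z = D Minus (Suc k) a"
    using D_below[OF zA, of "Suc k" p Minus Minus] z cells_D[OF h(2), of p] assms(2) by (cases "Suc k = p") auto
  have z2: "D Plus (Suc k) z = D Plus (Suc k) b"
    using D_below[OF zA, of "Suc k" p Plus Plus] z cells_D[OF h(3), of p] assms(2) by (cases "Suc k = p") auto
  have "cm (Suc k) q z = cm (Suc k) (cm k z (cm k w w')) r"
    unfolding q_def r_def using naturality[of z e k] zA A e zk z1 z2 by simp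
  then have E: "eqv (Suc p) (cm (Suc k) (cm k z (cm k w w')) r) (cm (Suc k) (cm k y w') r)"
    using z Y_def by simp
  have zw: "cm k z w \<in> cells (Suc p)"
    using z(1) zk WI_cells[OF h(1)] assms(2) by - (rule cm_cells, auto intro: cells_mono)
  have zww: "cm k z (cm k w w') \<in> cells (Suc p)"
    using z(1) zk cells_mono[OF cm_cells[OF WI_cells[OF h(1)] WI_cells[OF w'(1)] w'(3)], of "Suc p"] w' assms(2) A
    by - (rule cm_cells, auto simp: cm_simps)
  have par: "D \<alpha> p (cm k z (cm k w w')) = D \<alpha> p (cm k y w')" for \<alpha>
  proof -
    have "D \<alpha> p (cm k z (cm k w w')) = cm k (D \<alpha> p z) (cm k w w')"
      using A zA zk w' W assms(2) by (simp add: cm_simps)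
    moreover have "D \<alpha> p (cm k y w') = cm k (D \<alpha> p y) w'"
      using A w' W assms(2) ky by (simp add: cm_simps)
    moreover have "cm k (cm k a w) w' = cm k a (cm k w w')" "cm k (cm k b w) w' = cm k b (cm k w w')"
      using A w' h(5) bk by (simp_all add: cm_assoc)
    ultimately show ?thesis using z(2,3) h(7,8) by (cases \<alpha>) simp_all
  qed
  have "eqv (Suc p) (cm k z (cm k w w')) (cm k y w')"
    using E qr(2) assms(2) zww yw par rD(1)
      D_le_eq[OF cells_in[OF zww] ywA par, of "Suc k" Minus] by (intro injR[OF E]) auto
  then have "eqv (Suc p) (cm k (cm k z w) w') (cm k y w')"
    using A zA zk w' by (simp add: cm_assoc)
  then have "eqv (Suc p) (cm k z w) y"
  proof (rule injR)
    show "D \<alpha> p (cm k z w) = D \<alpha> p y" for \<alpha>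
      using A zA zk z h W assms(2) by (cases \<alpha>) (simp_all add: cm_simps)
  qed (use w' zw h assms(2) A zA zk in \<open>auto simp: cm_simps\<close>)
  then show "\<exists>z \<in> cells (Suc p). D Minus p z = a \<and> D Plus p z = b \<and> eqv (Suc p) (cm k z w) y"
    using z by blast
qed

lemma ex: "k < p \<Longrightarrow> ExR k p \<and> ExL k p"
proof (induction "p - k" arbitrary: k rule: less_induct)
  case less
  then have *: "ExR (Suc k) p \<and> ExL (Suc k) p" if "Suc k < p" using that by simp
  have "ExR k p" using ex_step * less.prems by blast
  moreover have "ExL k p"
    using scat.ex_step[OF dual_scat, of k p] * less.prems by (simp add: Ex_dual)
  ultimately show ?case by blast
qed

lemma exR:
  assumes "WI (Suc k) w" "k < p" "a \<in> cells p" "b \<in> cells p" "\<And>\<alpha> j. j < p \<Longrightarrow> D \<alpha> j a = D \<alpha> j b"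
     "D Plus k w = D Minus k a" "y \<in> cells (Suc p)" "D Minus p y = cm k a w" "D Plus p y = cm k b w"
  obtains z where "z \<in> cells (Suc p)" "D Minus p z = a" "D Plus p z = b" "eqv (Suc p) (cm k z w) y"
proof -
  have "ExR k p" using ex assms(2) by blast
  then show ?thesis using assms that unfolding ExR_def by blast
qed

lemma exL:
  assumes "WI (Suc k) w" "k < p" "a \<in> cells p" "b \<in> cells p" "\<And>\<alpha> j. j < p \<Longrightarrow> D \<alpha> j a = D \<alpha> j b"
     "D Plus k a = D Minus k w" "y \<in> cells (Suc p)" "D Minus p y = cm k w a" "D Plus p y = cm k w b"
  obtains z where "z \<in> cells (Suc p)" "D Minus p z = a" "D Plus p z = b" "eqv (Suc p) (cm k w z) y"
proof -
  have "ExL k p" using ex assms(2) by blast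
  then show ?thesis using assms that unfolding ExL_def by blast
qed

section \<open>Reflection of invertibility through whiskering\<close>

lemma lift_inverse:
  assumes x: "x \<in> cells (Suc p)" "k < p" "WI (Suc k) w" "D Plus k w = D Minus k x"
    and r: "r \<in> cells (Suc p)" "D Plus p r = D Minus p (cm k x w)" "D Minus p r = D Plus p (cm k x w)"
  obtains s where "s \<in> cells (Suc p)" "D Plus p s = D Minus p x" "D Minus p s = D Plus p x"
    "eqv (Suc p) (cm k s w) r" "D Plus k w = D Minus k s"
    "cm p (cm k x w) (cm k s w) = cm k (cm p x s) w" "cm p (cm k s w) (cm k x w) = cm k (cm p s x) w"
proof -
  note A = cells_in[OF x(1)] WI_in[OF x(3)] cells_in[OF r(1)]
  have W: "D \<alpha> j w = w" if "Suc k \<le> j" for \<alpha> j using that x(3) WI_cells cells_D by blast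
  have k: "D Minus k (D \<alpha> p x) = D Plus k w" for \<alpha> using A x by (simp add: D_below)
  obtain s where s: "s \<in> cells (Suc p)" "D Minus p s = D Plus p x" "D Plus p s = D Minus p x"
    "eqv (Suc p) (cm k s w) r"
  proof (rule exR[OF x(3,2), of "D Plus p x" "D Minus p x" r])
    show "D Minus p r = cm k (D Plus p x) w" "D Plus p r = cm k (D Minus p x) w"
      using r A x W by (simp_all add: cm_simps)
  qed (use A x r k in \<open>auto simp: D_simps D_cells\<close>)
  note sA = cells_in[OF s(1)]
  have sk: "D Plus k w = D Minus k s" using D_below[OF sA x(2), of Minus Minus] s k by simp
  \<comment> \<open>The cell \<open>w\<close> is a unit for composition along \<open>p\<close>, so
    interchange makes whiskering with \<open>w\<close> commute with composition along
    \<open>p\<close>.\<close>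
  have ww: "cm p w w = w" using unitR[of w p] A W[of p Minus] x(2) by simp
  have "cm k (cm p x s) (cm p w w) = cm p (cm k x w) (cm k s w)"
    using A sA s x W sk by (intro cm_interchange) auto
  moreover have "cm k (cm p s x) (cm p w w) = cm p (cm k s w) (cm k x w)"
    using A sA s x W sk by (intro cm_interchange) auto
  ultimately show ?thesis using that s sk ww by metis
qed

text \<open>For \<open>k = p\<close> composition with \<open>w'\<close> recovers \<open>z\<close> up
  to \<open>eqv\<close>. For \<open>k < p\<close> the cells whose whiskering with \<open>w\<close>
  is weakly invertible form a coinduction relation: the inverse and the comparison cells of the
  whiskered cell are divided by \<open>w\<close>, and the quotients stay in the relation.\<close>

lemma WI_reflR:
  assumes "WI (Suc p) (cm k z w)" "z \<in> cells (Suc p)" "WI (Suc k) w" "k \<le> p" "D Plus k w = D Minus k z"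
  shows "WI (Suc p) z"
proof (cases "k = p")
  case True
  obtain w' where w': "WI (Suc p) w'" "D Plus p w = D Minus p w'" "D Plus p w' = D Minus p w"
      "eqv (Suc p) (D Plus p w) (cm p w w')"
    using WI_inverse assms(3) True by metis
  note A = cells_in[OF assms(2)] WI_in[OF assms(3)] WI_in[OF w'(1)]
  have "eqv (Suc p) (cm p z (D Plus p w)) (cm p z (cm p w w'))"
    using assms A w' True by - (rule eqv_whiskL, auto simp: D_simps)
  then have "eqv (Suc p) z (cm p (cm p z w) w')"
    using assms A w' True unitR[of z p] by (simp add: cm_assoc)
  moreover have "WI (Suc p) (cm p (cm p z w) w')"
    using assms A w' True by - (rule WI_top, auto simp: cm_simps)
  ultimately show ?thesis using WI_eqv by blast
next
  case False
  then have kp: "k < p" using assms(4) by simp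
  define R where "R n z \<longleftrightarrow> (\<exists>p. n = Suc p \<and> k < p \<and> z \<in> cells n \<and> D Plus k w = D Minus k z \<and> WI n (cm k z w))" for n z
  have W: "D \<alpha> j w = w" if "Suc k \<le> j" for \<alpha> j using that assms(3) WI_cells cells_D by blast
  note wA = WI_in[OF assms(3)]
  \<comment> \<open>The quotient \<open>c\<close> returns the given comparison cell only up to
    \<open>eqv\<close> after whiskering. By \<open>WI_eqv\<close> this is enough for membership in
    \<open>R\<close>.\<close>
  have lift: "\<exists>c. R (Suc (Suc p)) c \<and> D Minus (Suc p) c = a \<and> D Plus (Suc p) c = b"
    if H: "k < p" "a \<in> cells (Suc p)" "b \<in> cells (Suc p)" "\<And>\<alpha>. D \<alpha> p a = D \<alpha> p b" "D Plus k w = D Minus k a"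
      "eqv (Suc p) (cm k a w) (cm k b w)" for p a b
  proof -
    obtain E where E: "WI (Suc (Suc p)) E" "D Minus (Suc p) E = cm k a w" "D Plus (Suc p) E = cm k b w"
      using H(6) unfolding eqv_def by blast
    obtain c where c: "c \<in> cells (Suc (Suc p))" "D Minus (Suc p) c = a" "D Plus (Suc p) c = b" "eqv (Suc (Suc p)) (cm k c w) E"
    proof (rule exR[OF assms(3), of "Suc p" a b E])
      show "D \<alpha> j a = D \<alpha> j b" if "j < Suc p" for \<alpha> j
        using D_le_eq[of a b p j \<alpha>] H(4) that cells_in[OF H(2)] cells_in[OF H(3)] by simp
    qed (use H E WI_cells in auto)
    have "D Minus k c = D Plus k w" using D_below[of c k "Suc p" Minus Minus] cells_in[OF c(1)] c H by simp
    moreover have "WI (Suc (Suc p)) (cm k c w)" using WI_eqv[OF c(4) E(1)] .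
    ultimately show ?thesis unfolding R_def using c H(1) by (intro exI[of _ c]) auto
  qed
  show ?thesis
  proof (rule WI_coinduct[where R = R])
    show "R (Suc p) z" unfolding R_def using assms kp by blast
  next
    fix n z assume "R n z"
    then obtain p where h: "n = Suc p" "k < p" "z \<in> cells (Suc p)" "D Plus k w = D Minus k z" "WI (Suc p) (cm k z w)"
      unfolding R_def by blast
    note zA = cells_in[OF h(3)]
    obtain y where y: "WI (Suc p) y" "D Plus p (cm k z w) = D Minus p y" "D Plus p y = D Minus p (cm k z w)"
      "eqv (Suc p) (D Minus p (cm k z w)) (cm p y (cm k z w))" "eqv (Suc p) (D Plus p (cm k z w)) (cm p (cm k z w) y)"
      using WI_inverse[OF h(5)] by metis
    obtain s where s: "s \<in> cells (Suc p)" "D Plus p s = D Minus p z" "D Minus p s = D Plus p z"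
      "eqv (Suc p) (cm k s w) y" "D Plus k w = D Minus k s"
      "cm p (cm k z w) (cm k s w) = cm k (cm p z s) w" "cm p (cm k s w) (cm k z w) = cm k (cm p s z) w"
      using lift_inverse[OF h(3,2) assms(3) h(4) WI_cells[OF y(1)]] y by metis
    note sA = cells_in[OF s(1)]
    have "R (Suc p) s" unfolding R_def using h s WI_eqv[OF s(4) y(1)] by blast
    have ys: "eqv (Suc p) y (cm k s w)" using s(4) by (rule eqv_sym)
    have "eqv (Suc p) (cm p y (cm k z w)) (cm p (cm k s w) (cm k z w))"
      using ys y h WI_cells by (intro eqv_whiskR) auto
    then have "eqv (Suc p) (D Minus p (cm k z w)) (cm k (cm p s z) w)"
      using y(4) s(7) eqv_trans by metis
    moreover have "D Minus p (cm k z w) = cm k (D Minus p z) w"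
      using h zA wA W by (simp add: cm_simps)
    moreover have "D \<alpha> p (D Minus p z) = D \<alpha> p (cm p s z)" for \<alpha>
      using zA sA s by (cases \<alpha>) (simp_all add: cm_simps D_simps)
    moreover have "D Plus k w = D Minus k (D Minus p z)" using zA h by (simp add: D_below)
    ultimately obtain c where c: "R (Suc (Suc p)) c" "D Minus (Suc p) c = D Minus p z" "D Plus (Suc p) c = cm p s z"
      using lift[OF h(2), of "D Minus p z" "cm p s z"] h(3) zA s cm_cells D_cells[OF zA, of p "Suc p"] by auto
    have "eqv (Suc p) (cm p (cm k z w) y) (cm p (cm k z w) (cm k s w))"
      using ys y h WI_cells by (intro eqv_whiskL) auto
    then have "eqv (Suc p) (D Plus p (cm k z w)) (cm k (cm p z s) w)"
      using y(5) s(6) eqv_trans by metis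
    moreover have "D Plus p (cm k z w) = cm k (D Plus p z) w"
      using h zA wA W by (simp add: cm_simps)
    moreover have "D \<alpha> p (D Plus p z) = D \<alpha> p (cm p z s)" for \<alpha>
      using zA sA s by (cases \<alpha>) (simp_all add: cm_simps D_simps)
    moreover have "D Plus k w = D Minus k (D Plus p z)" using zA h by (simp add: D_below)
    ultimately obtain c' where c': "R (Suc (Suc p)) c'" "D Minus (Suc p) c' = D Plus p z" "D Plus (Suc p) c' = cm p z s"
      using lift[OF h(2), of "D Plus p z" "cm p z s"] h(3) zA s cm_cells D_cells[OF zA, of p "Suc p"] by auto
    have "inv_data (\<lambda>n x. R n x \<or> WI n x) p z"
      unfolding inv_data_def using \<open>R (Suc p) s\<close> s c c'
      by (intro exI[of _ s] exI[of _ c] exI[of _ c']) auto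
    then show "z \<in> cells n \<and> (\<exists>p. n = Suc p \<and> inv_data (\<lambda>n x. R n x \<or> WI n x) p z)"
      using h by blast
  qed
qed

lemma WI_reflL:
  assumes "WI (Suc p) (cm k w z)" "z \<in> cells (Suc p)" "WI (Suc k) w" "k \<le> p" "D Plus k z = D Minus k w"
  shows "WI (Suc p) z"
  using scat.WI_reflR[OF dual_scat, where p = p and k = k and z = z and w = w] assms by (simp add: cells_dual WI_dual)

text \<open>A right inverse of the whiskered cell is divided by \<open>w\<close>, and
  \<open>injR\<close> cancels \<open>w\<close> from the comparison. The condition
  \<open>k < p\<close> fits the whiskers of a single face, whose dimension is lower than that of the
  face.\<close>

lemma RI_reflR:
  assumes "RI p (cm k x w)" "x \<in> cells (Suc p)" "WI (Suc k) w" "k < p" "D Plus k w = D Minus k x"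
  shows "RI p x"
proof -
  obtain r where r: "r \<in> cells (Suc p)" "D Plus p r = D Minus p (cm k x w)" "D Minus p r = D Plus p (cm k x w)"
      "eqv (Suc p) (D Plus p (cm k x w)) (cm p (cm k x w) r)" "cm k x w \<in> cells (Suc p)"
    using assms(1) unfolding RI_def by blast
  obtain s where s: "s \<in> cells (Suc p)" "D Plus p s = D Minus p x" "D Minus p s = D Plus p x"
      "eqv (Suc p) (cm k s w) r" "D Plus k w = D Minus k s"
      "cm p (cm k x w) (cm k s w) = cm k (cm p x s) w"
    using lift_inverse[OF assms(2,4,3,5) r(1,2,3)] by metis
  note A = cells_in[OF assms(2)] cells_in[OF s(1)] WI_in[OF assms(3)]
  have W: "D \<alpha> p w = w" for \<alpha> using assms(3,4) WI_cells cells_D[of w "Suc k" p] by simp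
  have rs: "eqv (Suc p) r (cm k s w)" using s(4) by (rule eqv_sym)
  have "eqv (Suc p) (cm p (cm k x w) r) (cm p (cm k x w) (cm k s w))"
    using rs r by (intro eqv_whiskL) auto
  then have "eqv (Suc p) (D Plus p (cm k x w)) (cm k (cm p x s) w)" using r(4) s(6) eqv_trans by metis
  moreover have "D Plus p (cm k x w) = cm k (D Plus p x) w"
    using A assms W by (simp add: cm_simps)
  ultimately have "eqv (Suc p) (cm k (D Plus p x) w) (cm k (cm p x s) w)" by simp
  then have "eqv (Suc p) (D Plus p x) (cm p x s)"
  proof (rule injR)
    show "D \<alpha> p (D Plus p x) = D \<alpha> p (cm p x s)" for \<alpha>
      using A s by (cases \<alpha>) (simp_all add: cm_simps D_simps)
  qed (use A s assms in \<open>auto simp: D_simps D_cells cm_cells\<close>)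
  then show ?thesis unfolding RI_def using s assms by blast
qed

lemma LI_reflR:
  assumes "LI p (cm k x w)" "x \<in> cells (Suc p)" "WI (Suc k) w" "k < p" "D Plus k w = D Minus k x"
  shows "LI p x"
proof -
  obtain r where r: "r \<in> cells (Suc p)" "D Plus p r = D Minus p (cm k x w)" "D Minus p r = D Plus p (cm k x w)"
      "eqv (Suc p) (D Minus p (cm k x w)) (cm p r (cm k x w))" "cm k x w \<in> cells (Suc p)"
    using assms(1) unfolding LI_def by blast
  obtain s where s: "s \<in> cells (Suc p)" "D Plus p s = D Minus p x" "D Minus p s = D Plus p x"
      "eqv (Suc p) (cm k s w) r" "D Plus k w = D Minus k s"
      "cm p (cm k s w) (cm k x w) = cm k (cm p s x) w"
    using lift_inverse[OF assms(2,4,3,5) r(1,2,3)] by metis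
  note A = cells_in[OF assms(2)] cells_in[OF s(1)] WI_in[OF assms(3)]
  have W: "D \<alpha> p w = w" for \<alpha> using assms(3,4) WI_cells cells_D[of w "Suc k" p] by simp
  have rs: "eqv (Suc p) r (cm k s w)" using s(4) by (rule eqv_sym)
  have "eqv (Suc p) (cm p r (cm k x w)) (cm p (cm k s w) (cm k x w))"
    using rs r by (intro eqv_whiskR) auto
  then have "eqv (Suc p) (D Minus p (cm k x w)) (cm k (cm p s x) w)" using r(4) s(6) eqv_trans by metis
  moreover have "D Minus p (cm k x w) = cm k (D Minus p x) w"
    using A assms W by (simp add: cm_simps)
  ultimately have "eqv (Suc p) (cm k (D Minus p x) w) (cm k (cm p s x) w)" by simp
  then have "eqv (Suc p) (D Minus p x) (cm p s x)"
  proof (rule injR)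
    show "D \<alpha> p (D Minus p x) = D \<alpha> p (cm p s x)" for \<alpha>
      using A s by (cases \<alpha>) (simp_all add: cm_simps D_simps)
  qed (use A s assms in \<open>auto simp: D_simps D_cells cm_cells\<close>)
  then show ?thesis unfolding LI_def using s assms by blast
qed

lemma RI_reflL:
  assumes "RI p (cm k w x)" "x \<in> cells (Suc p)" "WI (Suc k) w" "k < p" "D Plus k x = D Minus k w"
  shows "RI p x"
  using scat.LI_reflR[OF dual_scat, where p = p and k = k and x = x and w = w] assms by (simp add: cells_dual WI_dual LI_dual)

lemma LI_reflL:
  assumes "LI p (cm k w x)" "x \<in> cells (Suc p)" "WI (Suc k) w" "k < p" "D Plus k x = D Minus k w"
  shows "LI p x"
  using scat.RI_reflR[OF dual_scat, where p = p and k = k and x = x and w = w] assms by (simp add: cells_dual WI_dual RI_dual)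

end

subsection \<open>The single-sorted omega-category of a strict omega-category\<close>

text \<open>A cell is replaced by the table of its boundaries and its units, so that it is identified with
  its units.\<close>

definition hatT :: "('a, 'r) omega_cat_scheme \<Rightarrow> nat \<Rightarrow> 'a \<Rightarrow> nat \<Rightarrow> sign \<Rightarrow> 'a" where
  "hatT C n x = (\<lambda>k \<alpha>. if k < n then bd C \<alpha> n k x else if k = n then x else idn C n k x)"

definition hatA :: "('a, 'r) omega_cat_scheme \<Rightarrow> (nat \<Rightarrow> sign \<Rightarrow> 'a) set" where
  "hatA C = {hatT C n x | n x. x \<in> cell C n}"

definition hatD :: "('a, 'r) omega_cat_scheme \<Rightarrow> sign \<Rightarrow> nat \<Rightarrow> (nat \<Rightarrow> sign \<Rightarrow> 'a) \<Rightarrow> nat \<Rightarrow> sign \<Rightarrow> 'a" where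
  "hatD C \<alpha> k X = (\<lambda>j \<beta>. if j < k then X j \<beta> else if j = k then X k \<alpha> else idn C k j (X k \<alpha>))"

definition hatC :: "('a, 'r) omega_cat_scheme \<Rightarrow> nat \<Rightarrow> (nat \<Rightarrow> sign \<Rightarrow> 'a) \<Rightarrow> (nat \<Rightarrow> sign \<Rightarrow> 'a) \<Rightarrow> nat \<Rightarrow> sign \<Rightarrow> 'a" where
  "hatC C k X Y = (\<lambda>j \<beta>. if j < k then X j \<beta>
     else if j = k then (case \<beta> of Minus \<Rightarrow> Y k Minus | Plus \<Rightarrow> X k Plus)
     else cmp C j k (X j \<beta>) (Y j \<beta>))"

context strict_omega_category
begin

lemma hatT_at [simp]: "hatT C n x n \<alpha> = x"
  by (simp add: hatT_def)

lemma hatT_inj: "hatT C n x = hatT C n y \<Longrightarrow> x = y"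
  by (metis hatT_at)

lemma hatT_idn: assumes "x \<in> cell C n" "n < m" shows "hatT C m (idn C n m x) = hatT C n x"
  using assms bd_idn_below bd_idn_same bd_idn_above idn_idn
  by (intro ext) (auto simp: hatT_def dest: not_less_iff_gr_or_eq[THEN iffD1])

lemma hatD_hatT: assumes "x \<in> cell C n" "k < n" shows "hatD C \<alpha> k (hatT C n x) = hatT C k (bd C \<alpha> n k x)"
  using assms by (intro ext) (auto simp: hatT_def hatD_def globular)

lemma hatD_hatT_above: assumes "x \<in> cell C n" "n \<le> k" shows "hatD C \<alpha> k (hatT C n x) = hatT C n x"
proof (intro ext)
  fix j \<beta>
  consider "j < k" | "j = k" | "j > k" "k = n" | "j > k" "n < k" using assms(2) by linarith
  then show "hatD C \<alpha> k (hatT C n x) j \<beta> = hatT C n x j \<beta>"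
    by cases (use assms idn_idn in \<open>auto simp: hatT_def hatD_def\<close>)
qed

lemma hatC_hatT: assumes "composable C n k x y" shows "hatC C k (hatT C n x) (hatT C n y) = hatT C n (cmp C n k x y)"
proof (intro ext)
  fix j \<beta>
  have k: "k < n" using assms by (simp add: composable_def)
  consider "j < k" | "j = k" | "k < j" "j < n" | "j = n" | "n < j" by linarith
  then show "hatC C k (hatT C n x) (hatT C n y) j \<beta> = hatT C n (cmp C n k x y) j \<beta>"
  proof cases
    case 2
    then show ?thesis using k assms source_cmp target_cmp by (cases \<beta>) (auto simp: hatT_def hatC_def)
  qed (use k assms in \<open>auto simp: hatT_def hatC_def bd_cmp_below bd_cmp_above idn_cmp\<close>)
qed

text \<open>Passing to units does not change the table, so a table is represented by a cell in every
  large dimension. Finitely many tables thus have representatives in a common dimension, where the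
  many-sorted laws apply.\<close>

lemma hatA_ev: assumes "X \<in> hatA C" shows "\<exists>N. \<forall>n\<ge>N. \<exists>x \<in> cell C n. X = hatT C n x"
proof -
  obtain N x where x: "X = hatT C N x" "x \<in> cell C N" using assms by (auto simp: hatA_def)
  show ?thesis
  proof (intro exI[of _ N] allI impI)
    fix n assume "N \<le> n"
    then show "\<exists>x \<in> cell C n. X = hatT C n x"
      using x hatT_idn[of x N n] idn_cell[of N n x] by (cases "N = n") (blast, metis le_neq_implies_less)
  qed
qed

lemma hatA_ev_fin:
  assumes "finite S" "S \<subseteq> hatA C"
  shows "\<exists>n>k. \<forall>X\<in>S. \<exists>x \<in> cell C n. X = hatT C n x"
proof -
  have "\<exists>N. \<forall>n\<ge>N. \<forall>X\<in>S. \<exists>x \<in> cell C n. X = hatT C n x"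
    using assms
  proof (induction S)
    case (insert X S)
    then obtain N where N: "\<forall>n\<ge>N. \<forall>X\<in>S. \<exists>x \<in> cell C n. X = hatT C n x" by blast
    obtain M where M: "\<forall>n\<ge>M. \<exists>x \<in> cell C n. X = hatT C n x" using hatA_ev insert by blast
    show ?case by (rule exI[of _ "max N M"]) (use N M in auto)
  qed auto
  then obtain N where "\<forall>n\<ge>N. \<forall>X\<in>S. \<exists>x \<in> cell C n. X = hatT C n x" by blast
  then show ?thesis by (intro exI[of _ "max N (Suc k)"]) auto
qed

lemma hatA_rep:
  assumes "X \<in> hatA C"
  obtains n x where "k < n" "x \<in> cell C n" "X = hatT C n x"
  using hatA_ev_fin[of "{X}" k] assms by auto

lemma hatT_in: "x \<in> cell C n \<Longrightarrow> hatT C n x \<in> hatA C"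
  by (auto simp: hatA_def)

lemma hat_composable:
  assumes "x \<in> cell C n" "y \<in> cell C n" "k < n"
  shows "hatD C Plus k (hatT C n y) = hatD C Minus k (hatT C n x) \<longleftrightarrow> composable C n k x y"
  using assms hatD_hatT hatT_inj by (auto simp: composable_def)

lemma scat_hat: "scat (hatA C) (hatD C) (hatC C)"
proof
  fix X \<alpha> and k :: nat assume "X \<in> hatA C"
  then show "hatD C \<alpha> k X \<in> hatA C"
    by (rule hatA_rep[of X k]) (simp add: hatD_hatT bd_cell hatT_in)
next
  fix X \<alpha> \<beta> and k j :: nat assume "X \<in> hatA C" "k < j"
  then show "hatD C \<alpha> k (hatD C \<beta> j X) = hatD C \<alpha> k X"
    by - (rule hatA_rep[of X j], auto simp: hatD_hatT bd_cell globular)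
next
  fix X \<alpha> \<beta> and k j :: nat assume "X \<in> hatA C" "j \<le> k"
  then show "hatD C \<alpha> k (hatD C \<beta> j X) = hatD C \<beta> j X"
    by - (rule hatA_rep[of X j], auto simp: hatD_hatT hatD_hatT_above bd_cell)
next
  fix X Y and k :: nat assume h: "X \<in> hatA C" "Y \<in> hatA C" "hatD C Plus k Y = hatD C Minus k X"
  then obtain n x y where r: "k < n" "x \<in> cell C n" "y \<in> cell C n" "X = hatT C n x" "Y = hatT C n y"
    using hatA_ev_fin[of "{X, Y}" k] by auto
  then have c: "composable C n k x y" using h hat_composable by simp
  have e: "hatC C k X Y = hatT C n (cmp C n k x y)" using r c hatC_hatT by simp
  show "hatC C k X Y \<in> hatA C" using e hatT_in cmp_cell c by simp
  show "hatD C Minus k (hatC C k X Y) = hatD C Minus k Y" "hatD C Plus k (hatC C k X Y) = hatD C Plus k X"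
    using e r c cmp_cell by (simp_all add: hatD_hatT source_cmp target_cmp)
  show "hatD C \<alpha> j (hatC C k X Y) = hatD C \<alpha> j X" if "j < k" for \<alpha> j
    using e r c cmp_cell that by (simp add: hatD_hatT bd_cmp_below)
next
  fix X Y \<alpha> and k j :: nat assume h: "X \<in> hatA C" "Y \<in> hatA C" "hatD C Plus k Y = hatD C Minus k X" "k < j"
  then obtain n x y where r: "j < n" "x \<in> cell C n" "y \<in> cell C n" "X = hatT C n x" "Y = hatT C n y"
    using hatA_ev_fin[of "{X, Y}" j] by auto
  then have c: "composable C n k x y" using h hat_composable by simp
  then have c': "composable C j k (bd C \<alpha> n j x) (bd C \<alpha> n j y)"
    using h r by (simp add: composable_def bd_cell globular)
  show "hatD C \<alpha> j (hatC C k X Y) = hatC C k (hatD C \<alpha> j X) (hatD C \<alpha> j Y)"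
    using r c c' h cmp_cell by (simp add: hatC_hatT hatD_hatT bd_cmp_above)
next
  fix X and k :: nat assume h: "X \<in> hatA C"
  then obtain n x where r: "k < n" "x \<in> cell C n" "X = hatT C n x"
    by (rule hatA_rep[of X k])
  have u: "hatT C n (idn C k n (bd C \<alpha> n k x)) = hatD C \<alpha> k X" for \<alpha>
    using r by (simp add: hatD_hatT hatT_idn bd_cell)
  have "composable C n k x (idn C k n (bd C Minus n k x))" "composable C n k (idn C k n (bd C Plus n k x)) x"
    using r by (auto simp: composable_def idn_cell bd_cell bd_idn_same)
  then show "hatC C k X (hatD C Minus k X) = X" "hatC C k (hatD C Plus k X) X = X"
    unfolding u[symmetric] using r by (simp_all add: hatC_hatT left_unit right_unit)
next
  fix X Y Z and k :: nat assume h: "X \<in> hatA C" "Y \<in> hatA C" "Z \<in> hatA C"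
    "hatD C Plus k Y = hatD C Minus k X" "hatD C Plus k Z = hatD C Minus k Y"
  then obtain n x y z where r: "k < n" "x \<in> cell C n" "y \<in> cell C n" "z \<in> cell C n"
      "X = hatT C n x" "Y = hatT C n y" "Z = hatT C n z"
    using hatA_ev_fin[of "{X, Y, Z}" k] by auto
  then have c: "composable C n k x y" "composable C n k y z" using h hat_composable by simp_all
  then have "composable C n k (cmp C n k x y) z" "composable C n k x (cmp C n k y z)"
    using cmp_cell source_cmp target_cmp by (auto simp: composable_def)
  then show "hatC C k (hatC C k X Y) Z = hatC C k X (hatC C k Y Z)"
    using r c by (simp add: hatC_hatT assoc)
next
  fix X Y Z W and j k :: nat
  assume h: "j < k" "X \<in> hatA C" "Y \<in> hatA C" "Z \<in> hatA C" "W \<in> hatA C" "hatD C Plus k Y = hatD C Minus k X"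
          "hatD C Plus k W = hatD C Minus k Z" "hatD C Plus j Z = hatD C Minus j X"
  then obtain n x y z w where r: "k < n" "x \<in> cell C n" "y \<in> cell C n" "z \<in> cell C n" "w \<in> cell C n"
      "X = hatT C n x" "Y = hatT C n y" "Z = hatT C n z" "W = hatT C n w"
    using hatA_ev_fin[of "{X, Y, Z, W}" k] by auto
  have jn: "j < n" using h(1) r(1) by simp
  have c: "composable C n k x y" "composable C n k z w" "composable C n j x z"
    using h r jn hat_composable by simp_all
  have xy: "bd C \<alpha> n j y = bd C \<alpha> n j x" "bd C \<alpha> n j w = bd C \<alpha> n j z" for \<alpha>
    using c h(1) r globular[of j k n] unfolding composable_def by metis+
  have c2: "composable C n j y w" using c r jn xy by (simp add: composable_def)
  have c3: "composable C n j (cmp C n k x y) (cmp C n k z w)"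
    using c cmp_cell bd_cmp_below h(1) jn by (simp add: composable_def)
  have "bd C Plus n k (cmp C n j y w) = bd C Minus n k (cmp C n j x z)"
    using bd_cmp_above[OF c2 h(1) r(1)] bd_cmp_above[OF c(3) h(1) r(1)] c by (simp add: composable_def)
  then have c4: "composable C n k (cmp C n j x z) (cmp C n j y w)"
    using c c2 cmp_cell r by (simp add: composable_def)
  show "hatC C j (hatC C k X Y) (hatC C k Z W) = hatC C k (hatC C j X Z) (hatC C j Y W)"
    using r c c2 c3 c4 interchange[OF h(1) c] by (simp add: hatC_hatT)
qed

sublocale hat: scat "hatA C" "hatD C" "hatC C"
  by (rule scat_hat)

lemma hat_cells: "hat.cells n = hatT C n ` cell C n"
proof (intro equalityI subsetI)
  fix X assume X: "X \<in> hat.cells n"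
  then obtain m x where m: "n < m" "x \<in> cell C m" "X = hatT C m x"
    using hatA_rep[OF hat.cells_in[OF X], of n] by metis
  then have "X = hatT C n (bd C Minus m n x)" using hat.cells_D[OF X, of n Minus] hatD_hatT by simp
  then show "X \<in> hatT C n ` cell C n" using m bd_cell by blast
qed (auto simp: hat.cells_def hatT_in hatD_hatT_above)

text \<open>A boundary and the unit on it have the same table, and \<open>hatT\<close> is injective
  in each dimension. The two forms of the invertibility condition therefore match term by
  term.\<close>

lemma hat_inv_data:
  assumes b: "b \<in> cell C (n + 1)" and E: "\<And>m x. x \<in> E m \<Longrightarrow> x \<in> cell C m"
  shows "hat.inv_data (\<lambda>m X. \<exists>x \<in> E m. X = hatT C m x) n (hatT C (n + 1) b) \<longleftrightarrow>
     (\<exists>b' \<in> E (n + 1). \<exists>c \<in> E (n + 2). \<exists>c' \<in> E (n + 2).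
        composable C (n + 1) n b' b \<and> composable C (n + 1) n b b' \<and>
        arrow C (n + 1) c (idn C n (n + 1) (bd C Minus (n + 1) n b)) (cmp C (n + 1) n b' b) \<and>
        arrow C (n + 1) c' (idn C n (n + 1) (bd C Plus (n + 1) n b)) (cmp C (n + 1) n b b'))"
    (is "?l \<longleftrightarrow> ?r")
proof -
  have *: "hatD C Plus n (hatT C (Suc n) b) = hatD C Minus n (hatT C (Suc n) b') \<and>
     hatD C Plus n (hatT C (Suc n) b') = hatD C Minus n (hatT C (Suc n) b) \<and>
     hatD C Minus (Suc n) (hatT C (Suc (Suc n)) c) = hatD C Minus n (hatT C (Suc n) b) \<and>
     hatD C Plus (Suc n) (hatT C (Suc (Suc n)) c) = hatC C n (hatT C (Suc n) b') (hatT C (Suc n) b) \<and>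
     hatD C Minus (Suc n) (hatT C (Suc (Suc n)) c') = hatD C Plus n (hatT C (Suc n) b) \<and>
     hatD C Plus (Suc n) (hatT C (Suc (Suc n)) c') = hatC C n (hatT C (Suc n) b) (hatT C (Suc n) b')
   \<longleftrightarrow> composable C (n + 1) n b' b \<and> composable C (n + 1) n b b' \<and>
        arrow C (n + 1) c (idn C n (n + 1) (bd C Minus (n + 1) n b)) (cmp C (n + 1) n b' b) \<and>
        arrow C (n + 1) c' (idn C n (n + 1) (bd C Plus (n + 1) n b)) (cmp C (n + 1) n b b')"
    if h: "b' \<in> E (Suc n)" "c \<in> E (Suc (Suc n))" "c' \<in> E (Suc (Suc n))" for b' c c'
  proof -
    note e = h[THEN E]
    have 1: "hatD C Plus n (hatT C (Suc n) b) = hatD C Minus n (hatT C (Suc n) b') \<longleftrightarrow> composable C (Suc n) n b' b"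
      "hatD C Plus n (hatT C (Suc n) b') = hatD C Minus n (hatT C (Suc n) b) \<longleftrightarrow> composable C (Suc n) n b b'"
      using e b hat_composable[of b' "Suc n" b n] hat_composable[of b "Suc n" b' n] by simp_all
    have u: "hatD C \<alpha> n (hatT C (Suc n) b) = hatT C (Suc n) (idn C n (Suc n) (bd C \<alpha> (Suc n) n b))" for \<alpha>
      using b by (simp add: hatD_hatT hatT_idn bd_cell)
    have v: "hatD C \<alpha> (Suc n) (hatT C (Suc (Suc n)) c) = hatT C (Suc n) (bd C \<alpha> (Suc (Suc n)) (Suc n) c)"
      if "c \<in> cell C (Suc (Suc n))" for \<alpha> c
      using that by (simp add: hatD_hatT)
    have w: "hatT C (Suc n) x = hatT C (Suc n) y \<longleftrightarrow> x = y" for x y using hatT_inj by blast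
    show ?thesis
      unfolding 1 using e by (auto simp: u v hatC_hatT arrow_def w)
  qed
  show ?thesis
  proof
    assume ?l
    then obtain b' c c' where h: "b' \<in> E (Suc n)" "c \<in> E (Suc (Suc n))" "c' \<in> E (Suc (Suc n))" and
      h': "hatD C Plus n (hatT C (Suc n) b) = hatD C Minus n (hatT C (Suc n) b') \<and>
     hatD C Plus n (hatT C (Suc n) b') = hatD C Minus n (hatT C (Suc n) b) \<and>
     hatD C Minus (Suc n) (hatT C (Suc (Suc n)) c) = hatD C Minus n (hatT C (Suc n) b) \<and>
     hatD C Plus (Suc n) (hatT C (Suc (Suc n)) c) = hatC C n (hatT C (Suc n) b') (hatT C (Suc n) b) \<and>
     hatD C Minus (Suc n) (hatT C (Suc (Suc n)) c') = hatD C Plus n (hatT C (Suc n) b) \<and>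
     hatD C Plus (Suc n) (hatT C (Suc (Suc n)) c') = hatC C n (hatT C (Suc n) b) (hatT C (Suc n) b')"
      unfolding hat.inv_data_def by auto
    show ?r using h' unfolding *[OF h] using h by force
  next
    assume ?r
    then obtain b' c c' where h: "b' \<in> E (Suc n)" "c \<in> E (Suc (Suc n))" "c' \<in> E (Suc (Suc n))" and
      h': "composable C (n + 1) n b' b \<and> composable C (n + 1) n b b' \<and>
        arrow C (n + 1) c (idn C n (n + 1) (bd C Minus (n + 1) n b)) (cmp C (n + 1) n b' b) \<and>
        arrow C (n + 1) c' (idn C n (n + 1) (bd C Plus (n + 1) n b)) (cmp C (n + 1) n b b')"
      by auto
    show ?l using h' unfolding *[OF h, symmetric] hat.inv_data_def using h
      by (intro exI[of _ "hatT C (Suc n) b'"] exI[of _ "hatT C (Suc (Suc n)) c"] exI[of _ "hatT C (Suc (Suc n)) c'"]) auto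
  qed
qed

lemma WI_hat:
  assumes "x \<in> cell C n"
  shows "hat.WI n (hatT C n x) \<longleftrightarrow> weakly_invertible C n x"
proof
  assume h: "hat.WI n (hatT C n x)"
  define E where "E n = {x \<in> cell C n. hat.WI n (hatT C n x)}" for n
  have Ec: "x \<in> cell C m" if "x \<in> E m" for m x using that by (simp add: E_def)
  have e: "(\<lambda>m X. \<exists>x \<in> E m. X = hatT C m x) = hat.WI"
    using hat.WI_cells by (fastforce simp: E_def hat_cells)
  have "invertibility_set C E"
    unfolding invertibility_set_def
  proof (intro conjI allI ballI)
    show "E 0 = {}" using hat.WI_pos by (auto simp: E_def)
    show "E n \<subseteq> cell C n" for n by (auto simp: E_def)
    fix n b assume "b \<in> E (n + 1)"
    then show "\<exists>b' \<in> E (n + 1). \<exists>c \<in> E (n + 2). \<exists>c' \<in> E (n + 2).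
        composable C (n + 1) n b' b \<and> composable C (n + 1) n b b' \<and>
        arrow C (n + 1) c (idn C n (n + 1) (bd C Minus (n + 1) n b)) (cmp C (n + 1) n b' b) \<and>
        arrow C (n + 1) c' (idn C n (n + 1) (bd C Plus (n + 1) n b)) (cmp C (n + 1) n b b')"
      using hat_inv_data[of b n E, OF Ec Ec] hat.WI_data[of n "hatT C (n + 1) b"] unfolding e by (simp add: E_def)
  qed
  then show "weakly_invertible C n x"
    unfolding weakly_invertible_def using h assms hat.WI_pos by (auto simp: E_def)
next
  assume "weakly_invertible C n x"
  then obtain E where E: "invertibility_set C E" "x \<in> E n" "n > 0" unfolding weakly_invertible_def by blast
  have Ec: "x \<in> cell C m" if "x \<in> E m" for m x using that E by (auto simp: invertibility_set_def)
  define R where "R = (\<lambda>m X. \<exists>x \<in> E m. X = hatT C m x)"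
  have "hat.inv_set R"
    unfolding hat.inv_set_def
  proof (intro allI impI)
    fix n X assume "R n X"
    then obtain b where b: "b \<in> E n" "X = hatT C n b" by (auto simp: R_def)
    have "n \<noteq> 0" using b E(1) unfolding invertibility_set_def by (metis empty_iff)
    then obtain m where m: "n = m + 1" by (cases n) auto
    have "hat.inv_data R m X"
      unfolding R_def b(2) m using E(1) b m Ec
      by (subst hat_inv_data) (simp_all add: invertibility_set_def)
    then show "X \<in> hat.cells n \<and> (\<exists>m. n = Suc m \<and> hat.inv_data R m X)"
      using b Ec m by (auto simp: hat_cells)
  qed
  then show "hat.WI n (hatT C n x)" unfolding hat.WI_def R_def using E(2) by blast
qed

end

section \<open>Chains and cells of orientals\<close>

abbreviation "coef \<equiv> Poly_Mapping.lookup"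
abbreviation "supp \<equiv> Poly_Mapping.keys"

type_synonym chain = "nat list \<Rightarrow>\<^sub>0 int"

definition cone :: "nat \<Rightarrow> chain \<Rightarrow> chain" where
  "cone a c = frag_extend (\<lambda>v. frag_of (a # v)) c"

lemma cone_simps [simp]: "cone a 0 = 0" "cone a (frag_of v) = frag_of (a # v)"
  "cone a (c + d) = cone a c + cone a d" "cone a (c - d) = cone a c - cone a d" "cone a (- c) = - cone a c"
  by (simp_all add: cone_def frag_extend_add frag_extend_diff frag_extend_minus)

lemma frag_induct [case_names zero one diff]:
  assumes "P 0" "\<And>v. P (frag_of v)" "\<And>c d. P c \<Longrightarrow> P d \<Longrightarrow> P (c - d)"
  shows "P (c :: 'b \<Rightarrow>\<^sub>0 int)"
  by (rule frag_induction[of c UNIV]) (use assms in auto)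

lemma coef_cone: "coef (cone a c) v = (case v of [] \<Rightarrow> 0 | b # w \<Rightarrow> if b = a then coef c w else 0)"
  by (induction c rule: frag_induct) (auto split: list.splits simp: lookup_minus)

lemma coef_cone_simps [simp]: "coef (cone a c) [] = 0" "coef (cone a c) (b # w) = (if b = a then coef c w else 0)"
  by (simp_all add: coef_cone)

lemma supp_cone: "supp (cone a c) = (#) a ` supp c"
  by (auto simp: in_keys_iff coef_cone split: list.splits if_splits)

text \<open>The simplices are augmented by the empty one, so that the augmentation is a boundary as well.\<close>

fun dl :: "nat list \<Rightarrow> chain" where
  "dl [] = 0"
| "dl (a # w) = frag_of w - cone a (dl w)"

definition bnd :: "chain \<Rightarrow> chain" where
  "bnd = frag_extend dl"

lemma bnd_simps [simp]: "bnd 0 = 0" "bnd (frag_of v) = dl v"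
  "bnd (c + d) = bnd c + bnd d" "bnd (c - d) = bnd c - bnd d" "bnd (- c) = - bnd c"
  by (simp_all add: bnd_def frag_extend_add frag_extend_diff frag_extend_minus)

lemma bnd_cone: "bnd (cone a c) = c - cone a (bnd c)"
  by (induction c rule: frag_induct) auto

definition pos :: "chain \<Rightarrow> bool" where
  "pos c \<longleftrightarrow> (\<forall>v. 0 \<le> coef c v)"

lemma posD: "pos c \<Longrightarrow> 0 \<le> coef c v"
  by (simp add: pos_def)

lemma pos_simps [simp]: "pos 0" "pos (frag_of v)"
  by (auto simp: pos_def)

lemma pos_add: "pos c \<Longrightarrow> pos d \<Longrightarrow> pos (c + d)"
  by (simp add: pos_def lookup_add)

lemma pos_cone: "pos c \<Longrightarrow> pos (cone a c)"
  by (auto simp: pos_def coef_cone split: list.splits)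

lemma pos_sum_list: "(\<And>x. x \<in> set xs \<Longrightarrow> pos (f x)) \<Longrightarrow> pos (\<Sum>x\<leftarrow>xs. f x)"
  by (induction xs) (auto intro: pos_add)

lemma supp_add_pos: assumes "pos c" "pos d" shows "supp (c + d) = supp c \<union> supp d"
  using posD[OF assms(1)] posD[OF assms(2)]
  by (auto simp: in_keys_iff lookup_add) (smt (verit))+

lemma supp_add_sub: "v \<in> supp (c + d) \<Longrightarrow> v \<in> supp c \<or> v \<in> supp d"
  by (auto simp: in_keys_iff lookup_add)

lemma pos_add_zero: assumes "pos c" "pos d" "c + d = 0" shows "c = 0" "d = 0"
  using supp_add_pos[OF assms(1,2)] assms(3) by auto

lemma supp_sum_list: "v \<in> supp (\<Sum>x\<leftarrow>xs. f x) \<Longrightarrow> \<exists>x \<in> set xs. v \<in> supp (f x)"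
  by (induction xs) (auto dest: supp_add_sub)

subsection \<open>Atoms\<close>

text \<open>Steiner's atom generated by a simplex. The recursion is \<open>bnd_cone\<close>
  separated into positive and negative parts: the boundary of the tail enters with a minus sign, so
  the cone on a target of the tail belongs to the source and conversely. In dimension 0 the source
  is the first vertex and the target the last one.\<close>

fun atom :: "nat list \<Rightarrow> table" where
  "atom [] k \<alpha> = 0"
| "atom (a # w) 0 \<alpha> = (if \<alpha> = Minus \<or> w = [] then frag_of [a] else atom w 0 Plus)"
| "atom (a # w) (Suc k) Minus = cone a (atom w k Plus)"
| "atom (a # w) (Suc k) Plus = atom w (Suc k) Plus + cone a (atom w k Minus)"

abbreviation strict :: "nat list \<Rightarrow> bool" where
  "strict v \<equiv> sorted_wrt (<) v"

lemma atom_zero: "length v \<le> k \<Longrightarrow> atom v k \<alpha> = 0"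
  by (induction v k \<alpha> rule: atom.induct) auto

lemma atom_top: "length v = Suc k \<Longrightarrow> atom v k \<alpha> = frag_of v"
proof (induction v k \<alpha> rule: atom.induct)
  case (4 a w k)
  then show ?case using atom_zero[of w "Suc k" Plus] by auto
qed auto

lemma atom_0: "v \<noteq> [] \<Longrightarrow> atom v 0 Minus = frag_of [hd v]" "v \<noteq> [] \<Longrightarrow> atom v 0 Plus = frag_of [last v]"
  by (cases v; simp) (induction v; simp)

lemma atom_bnd0: "v \<noteq> [] \<Longrightarrow> bnd (atom v 0 \<alpha>) = frag_of []"
  by (cases \<alpha>) (auto simp: atom_0)

lemma atom_bnd: "v \<noteq> [] \<Longrightarrow> bnd (atom v (Suc k) \<alpha>) = atom v k Plus - atom v k Minus"
proof (induction v arbitrary: k \<alpha>)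
  case (Cons a w)
  show ?case
  proof (cases "w = []")
    case True
    then show ?thesis by (cases \<alpha>; cases k) (auto simp: bnd_cone atom_zero)
  next
    case False
    then show ?thesis using Cons.IH by (cases \<alpha>; cases k) (auto simp: bnd_cone atom_bnd0 atom_0)
  qed
qed auto

lemma atom_pos: "pos (atom v k \<alpha>)"
  by (induction v k \<alpha> rule: atom.induct) (auto intro: pos_add pos_cone)

lemma atom_supp: "u \<in> supp (atom v k \<alpha>) \<Longrightarrow> length u = Suc k \<and> set u \<subseteq> set v \<and> (strict v \<longrightarrow> strict u)"
proof (induction v k \<alpha> arbitrary: u rule: atom.induct)
  case (2 a w \<alpha>)
  then show ?case by (auto split: if_splits)
next
  case (3 a w k)
  then show ?case by (auto simp: supp_cone; blast)
next
  case (4 a w k)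
  show ?case using 4(3)[simplified, THEN supp_add_sub] 4(1,2)
    by (auto simp: supp_cone; blast)
qed auto

text \<open>The order on simplices witnessing that the orientals are loop-free.\<close>

function lt :: "nat list \<Rightarrow> nat list \<Rightarrow> bool" where
  "lt v [] \<longleftrightarrow> v \<noteq> []"
| "lt [] (b # w) \<longleftrightarrow> False"
| "lt (a # v) (b # w) \<longleftrightarrow> a < b \<or> a = b \<and> lt w v"
  by pat_completeness auto
termination by (relation "measure (\<lambda>(v, w). length v + length w)") auto

lemma lt_irrefl [simp]: "\<not> lt v v"
  by (induction v) auto

lemma lt_total: "v = w \<or> lt v w \<or> lt w v"
  by (induction v w rule: lt.induct) auto

lemma lt_trans: "lt u v \<Longrightarrow> lt v w \<Longrightarrow> lt u w"
proof (induction "length u + length v + length w" arbitrary: u v w rule: less_induct)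
  case less
  show ?case
  proof (cases u)
    case Nil
    then show ?thesis using less.prems by (cases v) auto
  next
    case (Cons a u')
    note u = this
    show ?thesis
    proof (cases v)
      case Nil
      then show ?thesis using less.prems u by (cases w) auto
    next
      case (Cons b v')
      show ?thesis
      proof (cases w)
        case Nil
        then show ?thesis using u by simp
      next
        case w: (Cons c w')
        show ?thesis using less.prems less.hyps[of w' v' u'] u Cons w by auto
      qed
    qed
  qed
qed

lemma lt_asym: "lt v w \<Longrightarrow> \<not> lt w v"
  using lt_trans lt_irrefl by blast

abbreviation le :: "nat list \<Rightarrow> nat list \<Rightarrow> bool" where
  "le v w \<equiv> v = w \<or> lt v w"

text \<open>A simplex in a target of the tail starts with a vertex larger than \<open>a\<close>. The
  others share the first vertex with \<open>v\<close>, and there the exchange of signs in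
  \<open>atom\<close> is matched by the exchange of tails in \<open>lt\<close>.\<close>

lemma atom_lt:
  assumes "strict v" "Suc k < length v"
  shows "u \<in> supp (atom v k Minus) \<Longrightarrow> lt u v" "u \<in> supp (atom v k Plus) \<Longrightarrow> lt v u"
proof -
  have "(u \<in> supp (atom v k Minus) \<longrightarrow> lt u v) \<and> (u \<in> supp (atom v k Plus) \<longrightarrow> lt v u)"
    using assms
  proof (induction v arbitrary: k u)
    case (Cons a w)
    have hd: "lt (a # w) u" if "u \<in> supp (atom w k Plus)" for k
    proof -
      have "length u = Suc k" "set u \<subseteq> set w" using atom_supp[OF that] by auto
      then obtain b u' where "u = b # u'" "b \<in> set w" by (cases u) auto
      then show ?thesis using Cons.prems(1) by auto
    qed
    show ?case
    proof (cases k)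
      case 0
      then show ?thesis using hd[of 0] Cons.prems by auto
    next
      case (Suc l)
      then show ?thesis using hd[of k] Cons.prems Cons.IH[of l]
        by (auto simp: supp_cone dest!: supp_add_sub)
    qed
  qed auto
  then show "u \<in> supp (atom v k Minus) \<Longrightarrow> lt u v" "u \<in> supp (atom v k Plus) \<Longrightarrow> lt v u" by auto
qed

subsection \<open>Cells\<close>

definition complex :: "nat list set \<Rightarrow> bool" where
  "complex P \<longleftrightarrow> (\<forall>v\<in>P. v \<noteq> [] \<and> strict v \<and> (\<forall>w. w \<noteq> [] \<and> strict w \<and> set w \<subseteq> set v \<longrightarrow> w \<in> P))"

text \<open>Cells of all dimensions together. The value \<open>frag_of []\<close> of
  \<open>bnd\<close> in index 0 says that the augmentation is 1. That the two entries of top index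
  agree is the boundary equation with a zero entry above; see \<open>Cell_stable\<close>.\<close>

definition Cell :: "nat list set \<Rightarrow> table set" where
  "Cell P = {x. (\<forall>k \<alpha>. pos (x k \<alpha>)) \<and> (\<forall>k \<alpha>. \<forall>v \<in> supp (x k \<alpha>). v \<in> P \<and> length v = Suc k) \<and>
     (\<forall>k \<alpha>. bnd (x (Suc k) \<alpha>) = x k Plus - x k Minus) \<and> (\<forall>\<alpha>. bnd (x 0 \<alpha>) = frag_of []) \<and>
     (\<exists>p. \<forall>k>p. \<forall>\<alpha>. x k \<alpha> = 0)}"

definition tcm :: "nat \<Rightarrow> table \<Rightarrow> table \<Rightarrow> table" where
  "tcm k x y = (\<lambda>j \<beta>. x j \<beta> - table_bd Minus k x j \<beta> + y j \<beta>)"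

lemma CellD:
  assumes "x \<in> Cell P"
  shows "pos (x k \<alpha>)" "v \<in> supp (x k \<alpha>) \<Longrightarrow> v \<in> P" "v \<in> supp (x k \<alpha>) \<Longrightarrow> length v = Suc k"
    "bnd (x (Suc k) \<alpha>) = x k Plus - x k Minus" "bnd (x 0 \<alpha>) = frag_of []" "\<exists>p. \<forall>k>p. \<forall>\<alpha>. x k \<alpha> = 0"
  using assms unfolding Cell_def by blast+

lemma Cell_mono: "P \<subseteq> Q \<Longrightarrow> Cell P \<subseteq> Cell Q"
  unfolding Cell_def by blast

lemma atom_Cell:
  assumes "complex P" "b \<in> P"
  shows "atom b \<in> Cell P"
proof -
  have b: "b \<noteq> []" "strict b" using assms unfolding complex_def by auto
  have "v \<in> P" if "v \<in> supp (atom b k \<alpha>)" for v k \<alpha>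
    using atom_supp[OF that] assms b unfolding complex_def by (metis Zero_not_Suc list.size(3))
  then show ?thesis unfolding Cell_def
    using atom_pos atom_supp atom_bnd atom_bnd0 b atom_zero[of b]
    by (auto intro!: exI[of _ "length b"])
qed

lemma table_eq:
  assumes "table_bd Plus k y = table_bd Minus k x"
  shows "j < k \<Longrightarrow> y j \<beta> = x j \<beta>" "y k Plus = x k Minus"
  using fun_cong[OF fun_cong[OF assms, of j], of \<beta>] fun_cong[OF fun_cong[OF assms, of k], of Plus]
  by (auto simp: table_bd_def)

lemma tcm_simps:
  assumes "table_bd Plus k y = table_bd Minus k x"
  shows "j < k \<Longrightarrow> tcm k x y j \<beta> = x j \<beta>" "tcm k x y k Minus = y k Minus" "tcm k x y k Plus = x k Plus"
    "k < j \<Longrightarrow> tcm k x y j \<beta> = x j \<beta> + y j \<beta>"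
  using table_eq[OF assms] by (auto simp: tcm_def table_bd_def)

lemma tcm_at:
  assumes "table_bd Plus k y = table_bd Minus k x"
  shows "tcm k x y j \<beta> = (if j < k then x j \<beta> else if j = k then (case \<beta> of Minus \<Rightarrow> y k Minus | Plus \<Rightarrow> x k Plus)
    else x j \<beta> + y j \<beta>)"
  using tcm_simps[OF assms] by (auto split: sign.splits)

lemma Cell_stable:
  assumes "x \<in> Cell P" shows "(\<forall>k>p. \<forall>\<alpha>. x k \<alpha> = 0) \<longleftrightarrow> table_bd \<beta> p x = x"
proof
  assume h: "\<forall>k>p. \<forall>\<alpha>. x k \<alpha> = 0"
  then have "x p Plus = x p Minus" using CellD(4)[OF assms, of p Minus] by simp
  then have "x p \<alpha> = x p \<gamma>" for \<alpha> \<gamma> by (cases \<alpha>; cases \<gamma>) auto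
  then show "table_bd \<beta> p x = x" using h unfolding table_bd_def fun_eq_iff by (metis linorder_neqE_nat)
next
  assume "table_bd \<beta> p x = x"
  then show "\<forall>k>p. \<forall>\<alpha>. x k \<alpha> = 0" unfolding table_bd_def fun_eq_iff by (metis less_not_sym less_irrefl)
qed

lemma scat_Cell: "scat (Cell P) table_bd tcm"
proof
  fix x \<alpha> and k :: nat assume x: "x \<in> Cell P"
  show "table_bd \<alpha> k x \<in> Cell P"
    unfolding Cell_def
  proof (intro CollectI conjI allI ballI)
    show "bnd (table_bd \<alpha> k x (Suc j) \<beta>) = table_bd \<alpha> k x j Plus - table_bd \<alpha> k x j Minus" for j \<beta>
      using CellD(4)[OF x] by (cases "Suc j = k") (auto simp: table_bd_def)
    show "\<exists>p. \<forall>j>p. \<forall>\<beta>. table_bd \<alpha> k x j \<beta> = 0"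
      by (intro exI[of _ k]) (auto simp: table_bd_def)
  qed (use CellD[OF x] in \<open>auto simp: table_bd_def split: if_splits\<close>)
next
  fix x y and k :: nat assume h: "x \<in> Cell P" "y \<in> Cell P" "table_bd Plus k y = table_bd Minus k x"
  note e = tcm_at[OF h(3)] table_eq[OF h(3)]
  show "tcm k x y \<in> Cell P"
    unfolding Cell_def
  proof (intro CollectI conjI allI ballI)
    show "pos (tcm k x y j \<beta>)" for j \<beta>
      unfolding e using CellD(1)[OF h(1)] CellD(1)[OF h(2)] by (auto intro: pos_add split: sign.splits)
    show "v \<in> P" "length v = Suc j" if "v \<in> supp (tcm k x y j \<beta>)" for j \<beta> v
      using that CellD(2,3)[OF h(1)] CellD(2,3)[OF h(2)] unfolding e(1) by (auto split: sign.splits if_splits dest!: supp_add_sub)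
    show "bnd (tcm k x y (Suc j) \<beta>) = tcm k x y j Plus - tcm k x y j Minus" for j \<beta>
    proof -
      consider "Suc j < k" | "Suc j = k" | "j = k" | "k < j" by linarith
      then show ?thesis
        using CellD(4)[OF h(1), of j] CellD(4)[OF h(2), of j] e(2,3)
        by cases (auto simp: e(1) split: sign.splits)
    qed
    show "bnd (tcm k x y 0 \<beta>) = frag_of []" for \<beta>
      using CellD(5)[OF h(1)] CellD(5)[OF h(2)] unfolding e(1) by (cases k) (auto split: sign.splits)
    obtain p q where "\<forall>k>p. \<forall>\<alpha>. x k \<alpha> = 0" "\<forall>k>q. \<forall>\<alpha>. y k \<alpha> = 0" using CellD(6) h by metis
    then show "\<exists>p. \<forall>j>p. \<forall>\<beta>. tcm k x y j \<beta> = 0"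
      by (intro exI[of _ "max k (max p q)"]) (auto simp: e(1))
  qed
  show "table_bd Minus k (tcm k x y) = table_bd Minus k y" "table_bd Plus k (tcm k x y) = table_bd Plus k x"
    using e by (auto simp: table_bd_def fun_eq_iff)
  show "table_bd \<alpha> j (tcm k x y) = table_bd \<alpha> j x" if "j < k" for j \<alpha>
    using that by (auto simp: table_bd_def fun_eq_iff e(1))
next
  fix x y \<alpha> and k j :: nat assume h: "x \<in> Cell P" "y \<in> Cell P" "table_bd Plus k y = table_bd Minus k x" "k < j"
  have "table_bd Plus k (table_bd \<alpha> j y) = table_bd Minus k (table_bd \<alpha> j x)"
    using table_eq[OF h(3)] h(4) by (auto simp: table_bd_def fun_eq_iff)
  then show "table_bd \<alpha> j (tcm k x y) = tcm k (table_bd \<alpha> j x) (table_bd \<alpha> j y)"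
    using h(4) unfolding fun_eq_iff by (auto simp: tcm_at[OF h(3)] tcm_at table_bd_def split: sign.splits)
next
  fix x and k :: nat assume x: "x \<in> Cell P"
  have "table_bd Plus k (table_bd Minus k x) = table_bd Minus k x" "table_bd Plus k x = table_bd Minus k (table_bd Plus k x)"
    by (auto simp: table_bd_def fun_eq_iff)
  then show "tcm k x (table_bd Minus k x) = x" "tcm k (table_bd Plus k x) x = x"
    unfolding fun_eq_iff by (auto simp: tcm_at table_bd_def split: sign.splits)
next
  fix x y z and k :: nat assume h: "x \<in> Cell P" "y \<in> Cell P" "z \<in> Cell P"
    "table_bd Plus k y = table_bd Minus k x" "table_bd Plus k z = table_bd Minus k y"
  note e = tcm_at[OF h(4)] table_eq[OF h(4)] tcm_at[OF h(5)] table_eq[OF h(5)]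
  have c: "table_bd Plus k z = table_bd Minus k (tcm k x y)" "table_bd Plus k (tcm k y z) = table_bd Minus k x"
    using e by (auto simp: table_bd_def fun_eq_iff)
  show "tcm k (tcm k x y) z = tcm k x (tcm k y z)"
    by (intro ext) (auto simp: tcm_at[OF c(1)] tcm_at[OF c(2)] e split: sign.splits)
next
  fix x y z w and j k :: nat
  assume h: "j < k" "x \<in> Cell P" "y \<in> Cell P" "z \<in> Cell P" "w \<in> Cell P" "table_bd Plus k y = table_bd Minus k x"
          "table_bd Plus k w = table_bd Minus k z" "table_bd Plus j z = table_bd Minus j x"
  note e = tcm_at[OF h(6)] table_eq[OF h(6)] tcm_at[OF h(7)] table_eq[OF h(7)] tcm_at[OF h(8)] table_eq[OF h(8)]
  have 1: "table_bd Plus j w = table_bd Minus j y"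
    using e h(1) by (auto simp: table_bd_def fun_eq_iff)
  note e1 = tcm_at[OF 1] table_eq[OF 1]
  have 2: "table_bd Plus j (tcm k z w) = table_bd Minus j (tcm k x y)"
     "table_bd Plus k (tcm j y w) = table_bd Minus k (tcm j x z)"
    using e e1 h(1) by (auto simp: table_bd_def fun_eq_iff split: sign.splits)
  show "tcm j (tcm k x y) (tcm k z w) = tcm k (tcm j x z) (tcm j y w)"
    using h(1) unfolding fun_eq_iff by (auto simp: tcm_at[OF 2(1)] tcm_at[OF 2(2)] e e1 split: sign.splits)
qed (auto simp: table_bd_def fun_eq_iff)

lemma Cell_cells: "x \<in> scat.cells (Cell P) table_bd p \<longleftrightarrow> x \<in> Cell P \<and> (\<forall>k>p. \<forall>\<alpha>. x k \<alpha> = 0)"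
  using Cell_stable[of x P p Minus] scat.cells_def[OF scat_Cell[of P]] by blast

subsection \<open>Blocks\<close>

definition bsum :: "nat list list \<Rightarrow> table" where
  "bsum bs k \<alpha> = (\<Sum>b\<leftarrow>bs. atom b k \<alpha>)"

lemma bsum_simps [simp]: "bsum [] k \<alpha> = 0" "bsum (b # bs) k \<alpha> = atom b k \<alpha> + bsum bs k \<alpha>"
  "bsum (bs @ cs) k \<alpha> = bsum bs k \<alpha> + bsum cs k \<alpha>"
  by (simp_all add: bsum_def)

lemma bsum_mset: "mset bs = mset cs \<Longrightarrow> bsum bs = bsum cs"
  by (intro ext) (metis bsum_def mset_map sum_mset_sum_list)

lemma bsum_pos: "pos (bsum bs k \<alpha>)"
  by (induction bs) (auto intro: pos_add atom_pos)

lemma bsum_supp: "v \<in> supp (bsum bs k \<alpha>) \<Longrightarrow> \<exists>b\<in>set bs. v \<in> supp (atom b k \<alpha>)"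
  unfolding bsum_def by (rule supp_sum_list)

lemma bsum_bnd: "(\<And>b. b \<in> set bs \<Longrightarrow> b \<noteq> []) \<Longrightarrow> bnd (bsum bs (Suc k) \<alpha>) = bsum bs k Plus - bsum bs k Minus"
  by (induction bs) (auto simp: atom_bnd)

lemma bsum_bnd_same: "(\<And>b. b \<in> set bs \<Longrightarrow> b \<noteq> []) \<Longrightarrow> bnd (bsum bs k \<alpha>) = bnd (bsum bs k \<beta>)"
proof (cases k)
  case 0
  then show "(\<And>b. b \<in> set bs \<Longrightarrow> b \<noteq> []) \<Longrightarrow> bnd (bsum bs k \<alpha>) = bnd (bsum bs k \<beta>)"
    by (induction bs) (auto simp: atom_bnd0)
qed (simp add: bsum_bnd)

lemma bsum_fin: "\<exists>p. \<forall>k>p. \<forall>\<alpha>. bsum bs k \<alpha> = 0"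
proof (induction bs)
  case (Cons b bs)
  then obtain p where "\<forall>k>p. \<forall>\<alpha>. bsum bs k \<alpha> = 0" by blast
  then show ?case by (intro exI[of _ "max p (length b)"]) (auto simp: atom_zero)
qed auto

text \<open>Describes the cell from level \<open>m\<close> upwards and forgets the lower entries.
  Lowering \<open>m\<close> reveals the whiskers one dimension at a time, and at level 0 a single
  block remains. Repetitions are possible a priori, hence a list.\<close>

definition blk :: "nat list set \<Rightarrow> nat \<Rightarrow> nat list list \<Rightarrow> table \<Rightarrow> bool" where
  "blk P m bs x \<longleftrightarrow> (\<forall>k\<ge>m. \<forall>\<alpha>. x k \<alpha> = bsum bs k \<alpha>) \<and> (\<forall>b\<in>set bs. b \<in> P \<and> m < length b)"

lemma blk_mset: "blk P m bs x \<Longrightarrow> mset bs = mset cs \<Longrightarrow> blk P m cs x"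
  unfolding blk_def using bsum_mset mset_eq_setD by metis

lemma blk_mono: "blk P m bs x \<Longrightarrow> P \<subseteq> Q \<Longrightarrow> blk Q m bs x"
  unfolding blk_def by blast

text \<open>Only positivity of the middle boundary \<open>M\<close> is at stake. A negative
  coefficient at \<open>v\<close> puts \<open>v\<close> into the source of some \<open>b1\<close> in
  \<open>bs1\<close>. As the target of \<open>x\<close> is positive, \<open>v\<close> then lies in
  the target of some \<open>b2\<close> in \<open>bs2\<close>. By \<open>atom_lt\<close> this gives
  \<open>lt b2 v\<close> and \<open>lt v b1\<close>, against \<open>le b1 b2\<close>.\<close>

lemma split:
  assumes x: "x \<in> Cell P" and P: "complex P" and b: "blk P (Suc j) (bs1 @ bs2) x"
    and le: "\<And>b1 b2. b1 \<in> set bs1 \<Longrightarrow> b2 \<in> set bs2 \<Longrightarrow> le b1 b2"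
  obtains y z where "y \<in> Cell P" "z \<in> Cell P" "blk P (Suc j) bs1 z" "blk P (Suc j) bs2 y"
    "table_bd Plus j z = table_bd Minus j y" "table_bd Minus j z = table_bd Minus j x"
    "table_bd Plus j y = table_bd Plus j x" "x = tcm j y z"
    "z j Minus = x j Minus" "\<And>k \<alpha>. k < j \<Longrightarrow> z k \<alpha> = x k \<alpha>"
proof -
  have bb: "\<And>b. b \<in> set bs1 \<union> set bs2 \<Longrightarrow> b \<in> P \<and> Suc j < length b"
    using b unfolding blk_def by simp
  then have bP: "\<And>b. b \<in> set bs1 \<union> set bs2 \<Longrightarrow> b \<in> P" by blast
  have ne: "\<And>b. b \<in> set bs1 \<union> set bs2 \<Longrightarrow> b \<noteq> []" using bb by (metis list.size(3) not_less_zero)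
  have xj: "x j Plus = x j Minus + (bsum bs1 j Plus - bsum bs1 j Minus) + (bsum bs2 j Plus - bsum bs2 j Minus)"
  proof -
    have "bnd (x (Suc j) Minus) = bnd (bsum (bs1 @ bs2) (Suc j) Minus)" using b unfolding blk_def by simp
    then have "x j Plus - x j Minus = (bsum bs1 j Plus - bsum bs1 j Minus) + (bsum bs2 j Plus - bsum bs2 j Minus)"
      using CellD(4)[OF x] ne by (simp add: bsum_bnd)
    then show ?thesis by (simp add: algebra_simps)
  qed
  \<comment> \<open>The boundary reached after the blocks of \<open>bs1\<close>: their sources have
    been replaced by their targets.\<close>
  define M where "M = x j Minus + bsum bs1 j Plus - bsum bs1 j Minus"
  have xM: "x j Plus = M + bsum bs2 j Plus - bsum bs2 j Minus" unfolding xj M_def by (simp add: algebra_simps)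
  have posM: "pos M"
    unfolding pos_def
  proof (intro allI, rule ccontr)
    fix v assume "\<not> 0 \<le> coef M v"
    then have neg: "coef M v < 0" by simp
    have c1: "coef M v = coef (x j Minus) v + coef (bsum bs1 j Plus) v - coef (bsum bs1 j Minus) v"
      unfolding M_def by (simp add: lookup_add lookup_minus)
    have "coef (bsum bs1 j Minus) v \<noteq> 0"
      using c1 neg posD[OF CellD(1)[OF x, of j Minus], of v] posD[OF bsum_pos[of bs1 j Plus], of v] by linarith
    then obtain b1 where b1: "b1 \<in> set bs1" "v \<in> supp (atom b1 j Minus)"
      using bsum_supp by (metis in_keys_iff)
    have l1: "lt v b1" using atom_lt(1)[OF _ _ b1(2)] b b1 P unfolding blk_def complex_def by auto
    have "v \<notin> supp (bsum bs2 j Plus)"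
    proof
      assume "v \<in> supp (bsum bs2 j Plus)"
      then obtain b2 where b2: "b2 \<in> set bs2" "v \<in> supp (atom b2 j Plus)" using bsum_supp by blast
      have "lt b2 v" using atom_lt(2)[OF _ _ b2(2)] b b2 P unfolding blk_def complex_def by auto
      then show False using l1 le[OF b1(1) b2(1)] lt_trans lt_asym by blast
    qed
    then have "coef (bsum bs2 j Plus) v = 0" by (simp add: in_keys_iff)
    then have "coef (x j Plus) v \<le> coef M v"
      unfolding xM using posD[OF bsum_pos[of bs2 j Minus], of v] by (simp add: lookup_add lookup_minus)
    then show False using neg posD[OF CellD(1)[OF x, of j Plus], of v] by linarith
  qed
  have suppb: "v \<in> P \<and> length v = Suc k" if "v \<in> supp (bsum bs k \<alpha>)" "set bs \<subseteq> set bs1 \<union> set bs2" for v bs k \<alpha>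
  proof -
    obtain b where b: "b \<in> set bs" "v \<in> supp (atom b k \<alpha>)" using bsum_supp \<open>v \<in> supp (bsum bs k \<alpha>)\<close> by blast
    have "b \<in> P" using b that bP by blast
    then show ?thesis using atom_supp[OF b(2)] P unfolding complex_def by (metis Zero_not_Suc list.size(3))
  qed
  have suppM: "v \<in> P \<and> length v = Suc j" if "v \<in> supp M" for v
  proof -
    have "coef (x j Minus) v \<noteq> 0 \<or> coef (bsum bs1 j Plus) v \<noteq> 0 \<or> coef (bsum bs1 j Minus) v \<noteq> 0"
      using that unfolding M_def in_keys_iff lookup_add lookup_minus by auto
    then show ?thesis using suppb[of v bs1 j] CellD(2,3)[OF x] unfolding in_keys_iff by fast
  qed
  have bM: "bnd M = bnd (x j Minus)"
    unfolding M_def using bsum_bnd_same[of bs1 j Plus Minus] ne by simp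
  have bx: "bnd (x j Plus) = bnd (x j Minus)" unfolding xM
    using bM bsum_bnd_same[of bs2 j Plus Minus] ne by simp
  define z where "z = (\<lambda>k \<alpha>. if k < j then x k \<alpha> else if k = j then (if \<alpha> = Minus then x j Minus else M) else bsum bs1 k \<alpha>)"
  define y where "y = (\<lambda>k \<alpha>. if k < j then x k \<alpha> else if k = j then (if \<alpha> = Minus then M else x j Plus) else bsum bs2 k \<alpha>)"
  have zC: "z \<in> Cell P"
    unfolding Cell_def
  proof (intro CollectI conjI allI ballI)
    show "pos (z k \<alpha>)" for k \<alpha> unfolding z_def using CellD(1)[OF x] posM bsum_pos by auto
    show "v \<in> P" "length v = Suc k" if "v \<in> supp (z k \<alpha>)" for v k \<alpha>
      using that CellD(2,3)[OF x] suppM suppb[of v bs1 k \<alpha>] unfolding z_def by (auto split: if_splits)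
    show "bnd (z (Suc k) \<alpha>) = z k Plus - z k Minus" for k \<alpha>
    proof -
      consider "Suc k < j" | "Suc k = j" | "k = j" | "j < k" by linarith
      then show ?thesis
      proof cases
        case 3 then show ?thesis unfolding z_def using ne by (simp add: bsum_bnd M_def algebra_simps)
      qed (use CellD(4)[OF x] bM ne in \<open>auto simp: z_def bsum_bnd\<close>)
    qed
    show "bnd (z 0 \<alpha>) = frag_of []" for \<alpha> using CellD(5)[OF x] bM unfolding z_def by auto
    show "\<exists>p. \<forall>k>p. \<forall>\<alpha>. z k \<alpha> = 0"
    proof -
      obtain p where "\<forall>k>p. \<forall>\<alpha>. bsum bs1 k \<alpha> = 0" using bsum_fin by blast
      then show ?thesis by (intro exI[of _ "max p j"]) (auto simp: z_def)
    qed
  qed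
  have yC: "y \<in> Cell P"
    unfolding Cell_def
  proof (intro CollectI conjI allI ballI)
    show "pos (y k \<alpha>)" for k \<alpha> unfolding y_def using CellD(1)[OF x] posM bsum_pos by auto
    show "v \<in> P" "length v = Suc k" if "v \<in> supp (y k \<alpha>)" for v k \<alpha>
      using that CellD(2,3)[OF x] suppM suppb[of v bs2 k \<alpha>] unfolding y_def by (auto split: if_splits)
    show "bnd (y (Suc k) \<alpha>) = y k Plus - y k Minus" for k \<alpha>
    proof -
      consider "Suc k < j" | "Suc k = j" | "k = j" | "j < k" by linarith
      then show ?thesis
      proof cases
        case 3 then show ?thesis unfolding y_def using ne xM by (simp add: bsum_bnd algebra_simps)
      qed (use CellD(4)[OF x] bM bx ne in \<open>auto simp: y_def bsum_bnd\<close>)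
    qed
    show "bnd (y 0 \<alpha>) = frag_of []" for \<alpha> using CellD(5)[OF x] bM bx unfolding y_def by auto
    show "\<exists>p. \<forall>k>p. \<forall>\<alpha>. y k \<alpha> = 0"
    proof -
      obtain p where "\<forall>k>p. \<forall>\<alpha>. bsum bs2 k \<alpha> = 0" using bsum_fin by blast
      then show ?thesis by (intro exI[of _ "max p j"]) (auto simp: y_def)
    qed
  qed
  have c: "table_bd Plus j z = table_bd Minus j y" unfolding y_def z_def table_bd_def by (intro ext) auto
  have "x k \<alpha> = tcm j y z k \<alpha>" for k \<alpha>
  proof -
    have "x k \<alpha> = bsum bs1 k \<alpha> + bsum bs2 k \<alpha>" if "j < k" using b that unfolding blk_def by simp
    then show ?thesis unfolding tcm_at[OF c] by (auto simp: y_def z_def add.commute split: sign.splits)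
  qed
  then have "x = tcm j y z" by blast
  moreover have "blk P (Suc j) bs1 z" "blk P (Suc j) bs2 y"
    using b unfolding y_def z_def blk_def by auto
  moreover have "table_bd Minus j z = table_bd Minus j x" "table_bd Plus j y = table_bd Plus j x"
     "z j Minus = x j Minus" "\<And>k \<alpha>. k < j \<Longrightarrow> z k \<alpha> = x k \<alpha>"
    unfolding y_def z_def table_bd_def by (auto simp: fun_eq_iff)
  ultimately show ?thesis using that yC zC c by blast
qed

lemma chain_list: assumes "pos c" shows "\<exists>rs. c = (\<Sum>r\<leftarrow>rs. frag_of r) \<and> set rs \<subseteq> supp c"
proof -
  have rep: "coef (sum_list (replicate n (frag_of v))) w = (if v = w then int n else 0)" for n and v w :: "nat list"
    by (induction n) (auto simp: lookup_add)
  have "\<forall>c. pos c \<and> supp c \<subseteq> S \<longrightarrow> (\<exists>rs. c = (\<Sum>r\<leftarrow>rs. frag_of r) \<and> set rs \<subseteq> supp c)" if "finite S" for S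
    using that
  proof (induction S)
    case empty
    then show ?case by (auto intro!: exI[of _ "[]"])
  next
    case (insert v S)
    show ?case
    proof (intro allI impI)
      fix c assume c: "pos c \<and> supp c \<subseteq> insert v S"
      define d where "d = c - (\<Sum>r\<leftarrow>replicate (nat (coef c v)) v. frag_of r)"
      have d: "coef d w = (if w = v then 0 else coef c w)" for w
        unfolding d_def using c posD[of c v] by (auto simp: lookup_minus rep)
      have "pos d" using c by (auto simp: pos_def d)
      moreover have "supp d \<subseteq> S" using c insert by (auto simp: in_keys_iff d split: if_splits)
      ultimately obtain rs where rs: "d = (\<Sum>r\<leftarrow>rs. frag_of r)" "set rs \<subseteq> supp d" using insert by blast
      have sd: "supp d \<subseteq> supp c" by (auto simp: in_keys_iff d split: if_splits)
      have "c = (\<Sum>r\<leftarrow>rs @ replicate (nat (coef c v)) v. frag_of r)"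
        using rs(1) unfolding d_def by (simp add: algebra_simps)
      moreover have "set (rs @ replicate (nat (coef c v)) v) \<subseteq> supp c"
        using rs sd by (auto simp: in_keys_iff)
      ultimately show "\<exists>rs. c = (\<Sum>r\<leftarrow>rs. frag_of r) \<and> set rs \<subseteq> supp c" by blast
    qed
  qed
  from this[OF finite_keys[of c]] show ?thesis using assms by blast
qed

lemma bsum_generators: "(\<And>r. r \<in> set rs \<Longrightarrow> length r = Suc m) \<Longrightarrow> bsum rs m \<alpha> = (\<Sum>r\<leftarrow>rs. frag_of r)"
  "(\<And>r. r \<in> set rs \<Longrightarrow> length r = Suc m) \<Longrightarrow> m < k \<Longrightarrow> bsum rs k \<alpha> = 0"
  by (induction rs) (auto simp: atom_top atom_zero)

text \<open>What is left of the source at level \<open>m\<close> after removing the sources of the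
  blocks is a sum of generators of dimension \<open>m\<close>. Such a generator is its own source
  and target at this level, so it counts as a new block.\<close>

lemma down:
  assumes x: "x \<in> Cell P" and P: "complex P" and b: "blk P (Suc m) bs x"
    and ge: "\<And>v. coef (bsum bs m Minus) v \<le> coef (x m Minus) v"
  obtains rs where "blk P m (bs @ rs) x" "\<forall>r\<in>set rs. length r = Suc m"
    "x m Minus = bsum bs m Minus + (\<Sum>r\<leftarrow>rs. frag_of r)"
proof -
  have ne: "\<And>b. b \<in> set bs \<Longrightarrow> b \<noteq> []" and bP: "\<And>b. b \<in> set bs \<Longrightarrow> b \<in> P"
    using b unfolding blk_def by auto
  define c where "c = x m Minus - bsum bs m Minus"
  have "pos c" unfolding pos_def c_def using ge by (simp add: lookup_minus)
  then obtain rs where rs: "c = (\<Sum>r\<leftarrow>rs. frag_of r)" "set rs \<subseteq> supp c" using chain_list by blast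
  have sc: "supp c \<subseteq> supp (x m Minus)"
  proof
    fix v assume v: "v \<in> supp c"
    then have "coef c v > 0" using posD[OF \<open>pos c\<close>, of v] by (simp add: in_keys_iff)
    then show "v \<in> supp (x m Minus)"
      using posD[OF bsum_pos, of bs m Minus v] unfolding c_def by (auto simp: lookup_minus in_keys_iff)
  qed
  have len: "length r = Suc m \<and> r \<in> P" if "r \<in> set rs" for r
    using rs(2) sc that CellD(2,3)[OF x] by blast
  have xm: "x m Minus = bsum bs m Minus + (\<Sum>r\<leftarrow>rs. frag_of r)" using rs(1) unfolding c_def by (simp add: algebra_simps)
  have "bnd (x (Suc m) Minus) = bnd (bsum bs (Suc m) Minus)" using b unfolding blk_def by simp
  then have "x m Plus - x m Minus = bsum bs m Plus - bsum bs m Minus"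
    using CellD(4)[OF x] ne by (simp add: bsum_bnd)
  then have xp: "x m Plus = bsum bs m Plus + (\<Sum>r\<leftarrow>rs. frag_of r)" using xm by (simp add: algebra_simps)
  have "x k \<alpha> = bsum (bs @ rs) k \<alpha>" if "m \<le> k" for k \<alpha>
  proof (cases "m = k")
    case True
    then show ?thesis using xm xp len bsum_generators(1)[of rs m] by (cases \<alpha>) auto
  next
    case False
    then show ?thesis using b len that bsum_generators(2)[of rs m k] unfolding blk_def by auto
  qed
  moreover have "b \<in> P \<and> m < length b" if "b \<in> set (bs @ rs)" for b
    using that len b unfolding blk_def by auto
  ultimately have "blk P m (bs @ rs) x" unfolding blk_def by blast
  then show ?thesis using that len xm by blast
qed

text \<open>Source and target of an atom are disjoint by \<open>atom_lt\<close>, and their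
  difference is the difference of the boundaries of \<open>x\<close>. Since all coefficients are
  nonnegative, each boundary of \<open>x\<close> must contain its part of the atom.\<close>

lemma single_ge:
  assumes x: "x \<in> Cell P" and P: "complex P" and b: "blk P (Suc m) bs x" and l: "length bs \<le> 1"
  shows "coef (bsum bs m \<alpha>) v \<le> coef (x m \<alpha>) v"
proof (cases bs)
  case Nil
  then show ?thesis using posD[OF CellD(1)[OF x]] by simp
next
  case (Cons b cs)
  then have bs: "bs = [b]" using l by (cases cs) auto
  then have bb: "b \<noteq> []" "strict b" "Suc m < length b" "b \<in> P" using b P unfolding blk_def complex_def by auto
  have "bnd (x (Suc m) Minus) = bnd (atom b (Suc m) Minus)" using b bs unfolding blk_def by simp
  then have e: "x m Plus - x m Minus = atom b m Plus - atom b m Minus"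
    using CellD(4)[OF x] bb by (simp add: atom_bnd)
  then have e: "coef (x m Plus) v - coef (x m Minus) v = coef (atom b m Plus) v - coef (atom b m Minus) v"
    by (metis lookup_minus)
  have "coef (atom b m Plus) v = 0 \<or> coef (atom b m Minus) v = 0"
    using atom_lt[OF bb(2,3), of v] lt_asym by (meson in_keys_iff)
  then show ?thesis
    using e posD[OF CellD(1)[OF x, of m Plus], of v] posD[OF CellD(1)[OF x, of m Minus], of v]
      posD[OF atom_pos[of b m Plus], of v] posD[OF atom_pos[of b m Minus], of v] bs by (cases \<alpha>) auto
qed

lemma single_down:
  assumes "x \<in> Cell P" "complex P" "blk P (Suc m) bs x" "length bs \<le> 1"
  obtains rs where "blk P m (bs @ rs) x" "\<forall>r\<in>set rs. length r = Suc m"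
    "x m Minus = bsum bs m Minus + (\<Sum>r\<leftarrow>rs. frag_of r)"
  using down[OF assms(1-3)] single_ge[OF assms] by blast

lemma blk_bd:
  assumes x: "x \<in> Cell P" and b: "blk P (Suc j) bs x"
  shows "x j Plus = x j Minus + (bsum bs j Plus - bsum bs j Minus)"
proof -
  have ne: "\<And>b. b \<in> set bs \<Longrightarrow> b \<noteq> []" using b unfolding blk_def by auto
  have "bnd (x (Suc j) Minus) = bnd (bsum bs (Suc j) Minus)" using b unfolding blk_def by simp
  then have "x j Plus - x j Minus = bsum bs j Plus - bsum bs j Minus"
    using CellD(4)[OF x] ne by (simp add: bsum_bnd)
  then show ?thesis by (simp add: algebra_simps)
qed

text \<open>The blocks fix the difference between target and source at level \<open>j\<close>, so
  either boundary determines the other.\<close>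

lemma blk_det:
  assumes x: "x \<in> Cell P" "x' \<in> Cell P" and b: "blk P (Suc j) bs x" "blk P (Suc j) bs x'"
    and e: "table_bd \<beta> j x = table_bd \<beta> j x'"
  shows "x = x'"
proof (intro ext)
  fix k \<alpha>
  have j: "x j \<beta> = x' j \<beta>" using e unfolding table_bd_def fun_eq_iff by (metis less_irrefl)
  have j': "x j \<gamma> = x' j \<gamma>" for \<gamma>
    using blk_bd[OF x(1) b(1)] blk_bd[OF x(2) b(2)] j by (cases \<beta>; cases \<gamma>) auto
  consider "k < j" | "k = j" | "j < k" by linarith
  then show "x k \<alpha> = x' k \<alpha>"
  proof cases
    case 1 then show ?thesis using e unfolding table_bd_def fun_eq_iff by metis
  next
    case 2 then show ?thesis using j' by simp
  next
    case 3 then show ?thesis using b unfolding blk_def by simp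
  qed
qed

text \<open>Each atom contributes one vertex to the source, and the augmentation of a cell is
  1.\<close>

lemma blk_length0:
  assumes "x \<in> Cell P" "blk P 0 bs x" shows "length bs = 1"
proof -
  have ne: "\<And>b. b \<in> set bs \<Longrightarrow> b \<noteq> []" using assms(2) unfolding blk_def by auto
  have "bnd (bsum bs 0 Minus) = frag_of []" using assms CellD(5) unfolding blk_def by fastforce
  moreover have "coef (bnd (bsum bs 0 Minus)) [] = int (length bs)"
    using ne by (induction bs) (auto simp: atom_bnd0 lookup_add)
  ultimately show ?thesis by simp
qed

lemma blk0_atom: assumes "x \<in> Cell P" "blk P 0 bs x" shows "\<exists>b. bs = [b] \<and> b \<in> P \<and> x = atom b"
proof -
  obtain b where "bs = [b]" using blk_length0[OF assms] by (cases bs) auto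
  then show ?thesis using assms(2) unfolding blk_def by (auto simp: fun_eq_iff)
qed

lemma blk_ex: assumes "x \<in> Cell P" shows "\<exists>m. blk P (Suc m) [] x"
proof -
  obtain p where "\<forall>k>p. \<forall>\<alpha>. x k \<alpha> = 0" using CellD(6)[OF assms] by blast
  then show ?thesis unfolding blk_def by (intro exI[of _ p]) auto
qed

lemma sort_ex: "\<exists>cs. mset cs = mset bs \<and> sorted_wrt le cs"
proof (induction bs)
  case (Cons b bs)
  have ins: "\<exists>ds. mset ds = add_mset b (mset cs) \<and> sorted_wrt le ds" if "sorted_wrt le cs" for cs
    using that
  proof (induction cs)
    case (Cons c cs)
    show ?case
    proof (cases "le b c")
      case True
      then show ?thesis using Cons.prems lt_trans by (intro exI[of _ "b # c # cs"]) auto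
    next
      case False
      then have bc: "lt c b" using lt_total by blast
      obtain ds where ds: "mset ds = add_mset b (mset cs)" "sorted_wrt le ds" using Cons by auto
      have "set ds = insert b (set cs)" using mset_eq_setD[of ds "b # cs"] ds by simp
      then show ?thesis using ds bc Cons.prems by (intro exI[of _ "c # ds"]) auto
    qed
  qed (auto intro: exI[of _ "[b]"])
  obtain cs where cs: "mset cs = mset bs" "sorted_wrt le cs" using Cons by blast
  obtain ds where "mset ds = add_mset b (mset bs)" "sorted_wrt le ds" using ins[OF cs(2)] cs(1) by auto
  then show ?case by (intro exI[of _ ds]) simp
qed auto

text \<open>At a high level there are no blocks. A cell with at most one block is taken one level
  down, where new generators appear; these are sorted, and \<open>split\<close> cuts the cell into
  factors with one block each. At level 0 one block means an atom.\<close>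

lemma Cell_induct [consumes 2, case_names atom comp]:
  assumes x: "x \<in> Cell P" and P: "complex P"
    and at: "\<And>b. b \<in> P \<Longrightarrow> Q (atom b)"
    and co: "\<And>k x y. \<lbrakk>x \<in> Cell P; y \<in> Cell P; table_bd Plus k y = table_bd Minus k x; Q x; Q y\<rbrakk> \<Longrightarrow> Q (tcm k x y)"
  shows "Q x"
proof -
  have "Q x" if "x \<in> Cell P" "blk P m bs x" "length bs \<le> 1" for m bs x
    using that
  proof (induction m arbitrary: bs x)
    case 0
    then show ?case using blk0_atom at by blast
  next
    case (Suc m)
    obtain rs where rs: "blk P m (bs @ rs) x" using single_down[OF Suc.prems(1) P Suc.prems(2,3)] by blast
    show ?case
    proof (cases m)
      case 0
      then show ?thesis using blk0_atom at rs Suc.prems by blast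
    next
      case (Suc j)
      obtain cs where cs: "mset cs = mset (bs @ rs)" "sorted_wrt le cs" using sort_ex by blast
      have "Q x" if "x \<in> Cell P" "blk P (Suc j) cs x" "sorted_wrt le cs" for x cs
        using that
      proof (induction cs arbitrary: x rule: rev_induct)
        case Nil
        then show ?case using Suc.IH[of x "[]"] Suc by simp
      next
        case (snoc b cs)
        obtain y z where yz: "y \<in> Cell P" "z \<in> Cell P" "blk P (Suc j) cs z" "blk P (Suc j) [b] y"
          "table_bd Plus j z = table_bd Minus j y" "x = tcm j y z"
        proof -
          have "le b1 b2" if "b1 \<in> set cs" "b2 \<in> set [b]" for b1 b2
            using snoc.prems(3) that by (auto simp: sorted_wrt_append)
          then show thesis using split[OF snoc.prems(1) P snoc.prems(2)] that by metis
        qed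
        have "Q y" using Suc.IH[of y "[b]"] yz Suc by simp
        moreover have "Q z" using snoc.IH[of z] snoc.prems(3) yz by (simp add: sorted_wrt_append)
        ultimately show ?case using co yz by blast
      qed
      then show ?thesis using blk_mset[OF rs cs(1)[symmetric]] cs Suc.prems Suc by blast
    qed
  qed
  then show ?thesis using blk_ex[OF x] x by force
qed

section \<open>Gluing functors on orientals\<close>

context scat begin

text \<open>The two ways of sliding cells past each other. They place whiskered factors in
  succession in \<open>Dec_ex\<close> and reverse two blocks in \<open>swap\<close>.\<close>

lemma exchange:
  assumes "x \<in> A" "y \<in> A" "D Plus i y = D Minus i x" "i < j"
  shows "cm j (cm i (D Plus j x) y) (cm i x (D Minus j y)) = cm i x y"
    "cm j (cm i x (D Plus j y)) (cm i (D Minus j x) y) = cm i x y"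
proof -
  have "cm i (cm j (D Plus j x) x) (cm j y (D Minus j y)) = cm j (cm i (D Plus j x) y) (cm i x (D Minus j y))"
    using assms by (intro cm_interchange) (auto simp: D_simps)
  then show "cm j (cm i (D Plus j x) y) (cm i x (D Minus j y)) = cm i x y"
    using assms by (simp add: unitL unitR)
  have "cm i (cm j x (D Minus j x)) (cm j (D Plus j y) y) = cm j (cm i x (D Plus j y)) (cm i (D Minus j x) y)"
    using assms by (intro cm_interchange) (auto simp: D_simps)
  then show "cm j (cm i x (D Plus j y)) (cm i (D Minus j x) y) = cm i x y"
    using assms by (simp add: unitL unitR)
qed

lemma cm_whiskR:
  assumes "x \<in> A" "y \<in> A" "D Plus j y = D Minus j x" "u \<in> cells j" "k < j" "D Plus k u = D Minus k x"
  shows "cm k (cm j x y) u = cm j (cm k x u) (cm k y u)"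
proof -
  have u: "D \<alpha> j u = u" for \<alpha> using cells_D[OF assms(4)] by simp
  have "cm k (cm j x y) (cm j u u) = cm j (cm k x u) (cm k y u)"
    using assms u cells_in[OF assms(4)] by (intro cm_interchange) auto
  then show ?thesis using unitR[of u j] u cells_in[OF assms(4)] by simp
qed

lemma cm_whiskL:
  assumes "x \<in> A" "y \<in> A" "D Plus j y = D Minus j x" "u \<in> cells j" "k < j" "D Minus k u = D Plus k x"
  shows "cm k u (cm j x y) = cm j (cm k u x) (cm k u y)"
proof -
  have u: "D \<alpha> j u = u" for \<alpha> using cells_D[OF assms(4)] by simp
  have "cm k (cm j u u) (cm j x y) = cm j (cm k u x) (cm k u y)"
    using assms u cells_in[OF assms(4)] by (intro cm_interchange) auto
  then show ?thesis using unitR[of u j] u cells_in[OF assms(4)] by simp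
qed

definition tfun :: "nat list set \<Rightarrow> (table \<Rightarrow> 'c) \<Rightarrow> bool" where
  "tfun P F \<longleftrightarrow> (\<forall>x\<in>Cell P. F x \<in> A) \<and> (\<forall>x\<in>Cell P. \<forall>\<alpha> k. F (table_bd \<alpha> k x) = D \<alpha> k (F x)) \<and>
     (\<forall>k. \<forall>x\<in>Cell P. \<forall>y\<in>Cell P. table_bd Plus k y = table_bd Minus k x \<longrightarrow> F (tcm k x y) = cm k (F x) (F y))"

lemma tfunD:
  assumes "tfun P F" "x \<in> Cell P"
  shows "F x \<in> A" "F (table_bd \<alpha> k x) = D \<alpha> k (F x)"
    "y \<in> Cell P \<Longrightarrow> table_bd Plus k y = table_bd Minus k x \<Longrightarrow> F (tcm k x y) = cm k (F x) (F y)"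
  using assms unfolding tfun_def by blast+

lemma tfun_comp:
  "\<lbrakk>tfun P F; x \<in> Cell P; y \<in> Cell P; table_bd Plus k y = table_bd Minus k x\<rbrakk> \<Longrightarrow> D Plus k (F y) = D Minus k (F x)"
  using tfunD(2) by metis

lemma tfun_cells: "tfun P F \<Longrightarrow> x \<in> Cell P \<Longrightarrow> \<forall>k>p. \<forall>\<alpha>. x k \<alpha> = 0 \<Longrightarrow> F x \<in> cells p"
  using Cell_stable[of x P p Minus] tfunD(1)[of P F x] tfunD(2)[of P F x Minus p] unfolding cells_def by force

lemma tfun_mono: "tfun Q F \<Longrightarrow> P \<subseteq> Q \<Longrightarrow> tfun P F"
  unfolding tfun_def using Cell_mono[of P Q] by blast

end

lemma supp_atom_top: "v \<noteq> [] \<Longrightarrow> v \<in> supp (atom v (length v - 1) \<alpha>)"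
  by (cases v) (simp_all add: atom_top)

lemma atom_Cell_D: assumes "atom b \<in> Cell P" "b \<noteq> []" shows "b \<in> P"
  using CellD(2)[OF assms(1) supp_atom_top[OF assms(2)]] .

lemma pos_le_two:
  assumes "pos c" "\<And>v \<alpha>. coef c v \<le> coef (atom b i \<alpha>) v" "strict b" "Suc i < length b"
  shows "c = 0"
proof (rule poly_mapping_eqI)
  fix v
  have "coef (atom b i Plus) v = 0 \<or> coef (atom b i Minus) v = 0"
    using atom_lt[OF assms(3,4), of v] lt_asym by (meson in_keys_iff)
  then show "coef c v = coef 0 v"
    using assms(2)[of v Plus] assms(2)[of v Minus] posD[OF assms(1), of v] by auto
qed

text \<open>Downward induction: once entry k + 1 vanishes, the two entries of index \<open>k\<close>
  coincide and lie below both the source and the target of \<open>b\<close>, which are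
  disjoint.\<close>

lemma zero_above:
  assumes x: "x \<in> Cell P" and b: "strict b" "length b = Suc q" and q: "\<And>k \<alpha>. q \<le> k \<Longrightarrow> x k \<alpha> = 0"
    and le: "\<And>k v \<alpha>. m < k \<Longrightarrow> coef (x k \<alpha>) v \<le> coef (atom b k \<alpha>) v"
  shows "m < k \<Longrightarrow> x k \<alpha> = 0"
proof (induction "q - k" arbitrary: k \<alpha>)
  case 0
  then show ?case using q by simp
next
  case (Suc d)
  then have z: "x (Suc k) Minus = 0" by simp
  then have e: "x k Plus = x k Minus" using CellD(4)[OF x, of k Minus] by simp
  have e2: "x k \<beta> = x k \<gamma>" for \<beta> \<gamma> using e by (cases \<beta>; cases \<gamma>) auto
  show ?case
  proof (rule pos_le_two[of _ b k])
    show "coef (x k \<alpha>) v \<le> coef (atom b k \<beta>) v" for v \<beta>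
      using le[of k \<beta> v] Suc.prems e2[of \<alpha> \<beta>] by simp
  qed (use Suc b CellD(1)[OF x] in auto)
qed

text \<open>The top simplex of the block has coefficient 1 in the composite, so it occurs in one
  factor only. The other factor has a zero entry in that dimension and lies below the atom at all
  levels above \<open>m\<close>; \<open>zero_above\<close> then empties it.\<close>

lemma bsplit:
  assumes x: "x \<in> Cell P" "y \<in> Cell P" "table_bd Plus k y = table_bd Minus k x" "complex P" "k \<le> m"
    and b: "blk P (Suc m) bs (tcm k x y)" "length bs \<le> 1"
  shows "blk P (Suc m) [] x \<and> blk P (Suc m) bs y \<or> blk P (Suc m) bs x \<and> blk P (Suc m) [] y"
proof -
  have e: "x i \<alpha> + y i \<alpha> = bsum bs i \<alpha>" if "m < i" for i \<alpha>
    using b(1) that tcm_simps(4)[OF x(3), of i \<alpha>] x(5) unfolding blk_def by (metis Suc_leI le_less_trans)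
  note px = CellD(1)[OF x(1)] CellD(1)[OF x(2)]
  show ?thesis
  proof (cases bs)
    case Nil
    then have "x i \<alpha> = 0 \<and> y i \<alpha> = 0" if "m < i" for i \<alpha> using pos_add_zero[OF px[of i \<alpha>]] e[OF that, of \<alpha>] by auto
    then show ?thesis using Nil unfolding blk_def by auto
  next
    case (Cons b cs)
    then have bs: "bs = [b]" using b(2) by (cases cs) auto
    have bb: "strict b" "b \<in> P" "Suc m < length b" using b(1) bs x(4) unfolding blk_def complex_def by auto
    define q where "q = length b - 1"
    have q: "length b = Suc q" "m < q" using bb unfolding q_def by auto
    have hi: "x i \<alpha> = 0 \<and> y i \<alpha> = 0" if "q < i" for i \<alpha>
      using pos_add_zero[OF px] e[of i \<alpha>] that q bs by (simp add: atom_zero)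
    have qs: "x q Plus = x q Minus" "y q Plus = y q Minus"
      using CellD(4)[OF x(1), of q Minus] CellD(4)[OF x(2), of q Minus] hi[of "Suc q"] by simp_all
    have sum: "coef (x q Minus) v + coef (y q Minus) v = coef (frag_of b) v" for v
      using e[OF q(2), of Minus] bs q by (simp add: atom_top flip: lookup_add)
    have s2: "x q \<alpha> = x q Minus" "y q \<alpha> = y q Minus" for \<alpha> using qs by (cases \<alpha>; simp)+
    have lt1: "coef (x i \<alpha>) v \<le> coef (atom b i \<alpha>) v" "coef (y i \<alpha>) v \<le> coef (atom b i \<alpha>) v" if "m < i" for i \<alpha> v
    proof -
      have "coef (x i \<alpha>) v + coef (y i \<alpha>) v = coef (atom b i \<alpha>) v"
        using e[OF that, of \<alpha>] bs by (simp flip: lookup_add)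
      then show "coef (x i \<alpha>) v \<le> coef (atom b i \<alpha>) v" "coef (y i \<alpha>) v \<le> coef (atom b i \<alpha>) v"
        using posD[OF px(1), of i \<alpha> v] posD[OF px(2), of i \<alpha> v] by linarith+
    qed
    have "coef (x q Minus) b + coef (y q Minus) b = 1" using sum[of b] by simp
    then have "coef (x q Minus) b = 0 \<or> coef (y q Minus) b = 0"
      using posD[OF px(1), of q Minus b] posD[OF px(2), of q Minus b] by linarith
    moreover have "coef (x q Minus) v = 0" "coef (y q Minus) v = 0" if "v \<noteq> b" for v
      using sum[of v] that posD[OF px(1), of q Minus v] posD[OF px(2), of q Minus v] by auto
    ultimately have "x q Minus = 0 \<or> y q Minus = 0"
      by (metis poly_mapping_eqI lookup_zero)
    then show ?thesis
    proof
      assume "x q Minus = 0"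
      then have "x i \<alpha> = 0" if "q \<le> i" for i \<alpha> using that hi s2 by (cases "q = i") auto
      then have z: "x i \<alpha> = 0" if "m < i" for i \<alpha>
        using zero_above[OF x(1) bb(1) q(1) _ lt1(1)] that by blast
      then have "y i \<alpha> = bsum bs i \<alpha>" if "m < i" for i \<alpha> using e[OF that] that by simp
      then show ?thesis using z b(1) unfolding blk_def by auto
    next
      assume "y q Minus = 0"
      then have "y i \<alpha> = 0" if "q \<le> i" for i \<alpha> using that hi s2 by (cases "q = i") auto
      then have z: "y i \<alpha> = 0" if "m < i" for i \<alpha>
        using zero_above[OF x(2) bb(1) q(1) _ lt1(2)] that by blast
      then have "x i \<alpha> = bsum bs i \<alpha>" if "m < i" for i \<alpha> using e[OF that] that by simp
      then show ?thesis using z b(1) unfolding blk_def by auto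
    qed
  qed
qed

lemma blk_filter:
  assumes "blk P m bs x" "m \<le> n"
  shows "blk P n (filter (\<lambda>b. n < length b) bs) x"
proof -
  have "bsum bs k \<alpha> = bsum (filter (\<lambda>b. n < length b) bs) k \<alpha>" if "n \<le> k" for k \<alpha>
    using that by (induction bs) (auto simp: atom_zero)
  then show ?thesis using assms unfolding blk_def by auto
qed

lemma blk_Nil_cells: "x \<in> Cell P \<Longrightarrow> blk P (Suc j) [] x \<Longrightarrow> x \<in> scat.cells (Cell P) table_bd j"
  unfolding Cell_cells blk_def by auto

text \<open>By \<open>bsplit\<close> one of the factors has no block above level \<open>k\<close>.
  It then has dimension at most \<open>k\<close> and acts as a unit.\<close>

lemma trivial_comp:
  assumes x: "x \<in> Cell P" "y \<in> Cell P" "table_bd Plus k y = table_bd Minus k x" "complex P" "m \<le> Suc k"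
    and b: "blk P m bs (tcm k x y)" "length bs \<le> 1"
  shows "(x \<in> scat.cells (Cell P) table_bd k \<and> tcm k x y = y) \<or> (y \<in> scat.cells (Cell P) table_bd k \<and> tcm k x y = x)"
proof -
  interpret t: scat "Cell P" table_bd tcm by (rule scat_Cell)
  have "length (filter (\<lambda>b. Suc k < length b) bs) \<le> 1" using b(2) length_filter_le le_trans by blast
  then have "blk P (Suc k) [] x \<or> blk P (Suc k) [] y"
    using bsplit[OF x(1-4) le_refl blk_filter[OF b(1) x(5)]] by blast
  then show ?thesis
  proof
    assume "blk P (Suc k) [] x"
    then have "x \<in> t.cells k" using blk_Nil_cells x by blast
    moreover then have "tcm k x y = y" using t.cells_D[of x k k] x t.unitL[of y k] by simp
    ultimately show ?thesis by blast
  next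
    assume "blk P (Suc k) [] y"
    then have "y \<in> t.cells k" using blk_Nil_cells x by blast
    moreover then have "tcm k x y = x" using t.cells_D[of y k k] x t.unitR[of x k] by simp
    ultimately show ?thesis by blast
  qed
qed

lemma frag_mset: fixes rs :: "nat list list" shows "(\<Sum>r\<leftarrow>rs. frag_of r) = (\<Sum>r\<leftarrow>ss. frag_of r) \<Longrightarrow> mset rs = mset ss"
proof (rule multiset_eqI)
  fix v
  have c: "coef (\<Sum>r\<leftarrow>rs. frag_of r) v = int (count (mset rs) v)" for rs :: "nat list list"
    by (induction rs) (auto simp: lookup_add)
  show "(\<Sum>r\<leftarrow>rs. frag_of r) = (\<Sum>r\<leftarrow>ss. frag_of r) \<Longrightarrow> count (mset rs) v = count (mset ss) v"
    using c[of rs] c[of ss] by simp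
qed

lemma sorted_unique: "sorted_wrt le xs \<Longrightarrow> sorted_wrt le ys \<Longrightarrow> mset xs = mset ys \<Longrightarrow> xs = ys"
proof (induction xs arbitrary: ys)
  case (Cons x xs)
  then obtain y ys' where ys: "ys = y # ys'" by (cases ys) auto
  have "y \<in> set (x # xs)" "x \<in> set (y # ys')" using mset_eq_setD[OF Cons.prems(3)] ys by auto
  then have "le x y" "le y x" using Cons.prems ys by auto
  then have "x = y" using lt_asym by blast
  then show ?case using Cons ys by auto
qed auto

section \<open>Functors on a union of complexes, determined by compatible functors on the
  members\<close>

locale gluing = scat A D cm for A :: "'c set" and D cm +
  fixes I :: "'i set" and P :: "'i \<Rightarrow> nat list set" and G :: "'i \<Rightarrow> table \<Rightarrow> 'c"
  assumes cplx: "i \<in> I \<Longrightarrow> complex (P i)" and fG: "i \<in> I \<Longrightarrow> tfun (P i) (G i)"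
    and agree: "\<lbrakk>i \<in> I; j \<in> I; b \<in> P i; b \<in> P j\<rbrakk> \<Longrightarrow> G i (atom b) = G j (atom b)"
begin

definition U where "U = (\<Union>i\<in>I. P i)"

lemma complex_U: "complex U"
  using cplx unfolding U_def complex_def by blast

lemma P_U: "i \<in> I \<Longrightarrow> P i \<subseteq> U"
  unfolding U_def by blast

sublocale t: scat "Cell U" table_bd tcm
  by (rule scat_Cell)

text \<open>All values obtained by evaluating composites of cells of the members. The result
  \<open>glue\<close> amounts to this relation being single-valued and total on
  \<open>Cell U\<close>.\<close>

inductive R :: "table \<Rightarrow> 'c \<Rightarrow> bool" where
  base: "i \<in> I \<Longrightarrow> x \<in> Cell (P i) \<Longrightarrow> R x (G i x)"
| comp: "\<lbrakk>R x y; R x' y'; table_bd Plus k x' = table_bd Minus k x; D Plus k y' = D Minus k y\<rbrakk> \<Longrightarrow>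
    R (tcm k x x') (cm k y y')"

lemma R_in: "R x y \<Longrightarrow> x \<in> Cell U \<and> y \<in> A"
proof (induction rule: R.induct)
  case (base i x)
  then show ?case using Cell_mono[OF P_U] tfunD(1)[OF fG] by blast
qed (auto intro: t.cm_in cm_in)

lemma R_D: "R x y \<Longrightarrow> R (table_bd \<alpha> k x) (D \<alpha> k y)"
proof (induction rule: R.induct)
  case (base i x)
  have "table_bd \<alpha> k x \<in> Cell (P i)" using scat.D_in[OF scat_Cell] base by blast
  then have "R (table_bd \<alpha> k x) (G i (table_bd \<alpha> k x))" using R.base base by blast
  then show ?case using tfunD(2)[OF fG] base by simp
next
  case (comp x y x' y' j)
  note a = comp(1,2)[THEN R_in] comp(3,4)
  consider "k < j" | "k = j" "\<alpha> = Minus" | "k = j" "\<alpha> = Plus" | "j < k" using linorder_less_linear[of k j] by (cases \<alpha>; blast)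
  then show ?case
  proof cases
    case 4
    then show ?thesis using comp R.comp[OF comp(5,6), of j] a
      by (simp add: t.cm_simps cm_simps t.D_composable D_composable)
  qed (use a comp in \<open>simp_all add: t.cm_simps cm_simps\<close>)
qed

lemma R_cells: "R x y \<Longrightarrow> x \<in> t.cells p \<Longrightarrow> y \<in> cells p"
proof (induction arbitrary: p rule: R.induct)
  case (base i x)
  then show ?case using tfun_cells[OF fG] Cell_cells by blast
next
  case (comp x y x' y' k)
  note a = comp(1,2)[THEN R_in] comp(3,4)
  have z: "\<forall>i>max k p. \<forall>\<alpha>. x i \<alpha> = 0 \<and> x' i \<alpha> = 0"
  proof (intro allI impI)
    fix i \<alpha> assume i: "max k p < i"
    then have "x i \<alpha> + x' i \<alpha> = 0" using comp(7) tcm_simps(4)[OF comp(3), of i \<alpha>] unfolding Cell_cells by simp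
    moreover have "pos (x i \<alpha>)" "pos (x' i \<alpha>)" using CellD(1) a by blast+
    ultimately show "x i \<alpha> = 0 \<and> x' i \<alpha> = 0" using pos_add_zero[of "x i \<alpha>" "x' i \<alpha>"] by blast
  qed
  show ?case
  proof (cases "k < p")
    case True
    then have "x \<in> t.cells p" "x' \<in> t.cells p" using z a unfolding Cell_cells by auto
    then show ?thesis using comp cm_cells by blast
  next
    case False
    then have "x \<in> t.cells k" "x' \<in> t.cells k" using z a unfolding Cell_cells by auto
    then have "x' = x" "tcm k x x' = x" using t.cm_trivial comp(3) by blast+
    then show ?thesis using comp cm_cells by metis
  qed
qed

text \<open>The restriction to at most one block makes an induction on the level possible. Every
  cell is covered, because it has no blocks at a sufficiently high level.\<close>

definition Uniq where "Uniq m \<longleftrightarrow> (\<forall>x y y' bs. blk U m bs x \<and> length bs \<le> 1 \<and> R x y \<and> R x y' \<longrightarrow> y = y')"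
definition Tot where "Tot m \<longleftrightarrow> (\<forall>x bs. x \<in> Cell U \<and> blk U m bs x \<and> length bs \<le> 1 \<longrightarrow> (\<exists>y. R x y))"

text \<open>A factorisation along \<open>j\<close> into factors with one block each, together with a
  value of the composite. The list runs from the source side to the target side. The initial factor
  without block has dimension at most \<open>j\<close> and only carries the source.\<close>

inductive Dec :: "nat \<Rightarrow> nat list list \<Rightarrow> table \<Rightarrow> 'c \<Rightarrow> bool" for j where
  nil: "R x y \<Longrightarrow> blk U (Suc j) [] x \<Longrightarrow> Dec j [] x y"
| snoc: "\<lbrakk>Dec j bs x y; R x' y'; blk U (Suc j) [b] x'; table_bd Plus j x = table_bd Minus j x';
    D Plus j y = D Minus j y'\<rbrakk> \<Longrightarrow> Dec j (bs @ [b]) (tcm j x' x) (cm j y' y)"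

lemma Dec_R: "Dec j bs x y \<Longrightarrow> R x y"
  by (induction rule: Dec.induct) (auto intro: R.comp)

lemma blk_tcm:
  assumes "blk U (Suc j) bs x" "blk U (Suc j) bs' x'" "table_bd Plus k x = table_bd Minus k x'" "k \<le> j"
  shows "blk U (Suc j) (bs @ bs') (tcm k x' x)"
  using assms tcm_simps(4)[OF assms(3)] unfolding blk_def by (auto simp: add.commute)

lemma Dec_blk: "Dec j bs x y \<Longrightarrow> blk U (Suc j) bs x"
  by (induction rule: Dec.induct) (auto intro: blk_tcm)

lemma Nil_cells: "R x y \<Longrightarrow> blk U (Suc j) [] x \<Longrightarrow> x \<in> t.cells j \<and> y \<in> cells j"
  using R_cells R_in blk_Nil_cells by blast

lemma blk_D: "j \<le> i \<Longrightarrow> blk U (Suc i) [] (table_bd \<alpha> j x)"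
  unfolding blk_def table_bd_def by auto

lemma Dec_append:
  "\<lbrakk>Dec j bs' x' y'; Dec j bs x y; table_bd Plus j x = table_bd Minus j x'; D Plus j y = D Minus j y'\<rbrakk> \<Longrightarrow>
    Dec j (bs @ bs') (tcm j x' x) (cm j y' y)"
proof (induction rule: Dec.induct)
  case (nil x' y')
  have c: "x' \<in> t.cells j" "y' \<in> cells j" using Nil_cells nil by blast+
  have "x' = table_bd Plus j x" "y' = D Plus j y"
    using nil t.cells_D[OF c(1), of j Minus] cells_D[OF c(2), of j Minus] by simp_all
  then have "tcm j x' x = x" "cm j y' y = y" using R_in[OF Dec_R[OF nil(3)]] t.unitL[of x j] unitL[of y j] by metis+
  then show ?case using nil(3) by simp
next
  case (snoc cs x0 y0 x1 y1 b)
  note a = Dec_R[OF snoc(1), THEN R_in] snoc(2)[THEN R_in] Dec_R[OF snoc(7), THEN R_in]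
  have c: "table_bd Plus j x = table_bd Minus j x0" "D Plus j y = D Minus j y0"
    using snoc(4,5,8,9) a by (simp_all add: t.cm_simps cm_simps)
  have "Dec j (bs @ cs) (tcm j x0 x) (cm j y0 y)" using snoc c by blast
  then have "Dec j ((bs @ cs) @ [b]) (tcm j x1 (tcm j x0 x)) (cm j y1 (cm j y0 y))"
    using snoc c a by (intro Dec.snoc) (auto simp: t.cm_simps cm_simps)
  then show ?case using a c snoc by (simp add: t.cm_assoc cm_assoc)
qed

text \<open>A whisker of dimension at most \<open>j\<close> has no block at level j + 1, and it
  distributes over composition along \<open>j\<close>. So it can be attached to every factor without
  changing the list.\<close>

lemma Dec_whiskR:
  "\<lbrakk>Dec j bs x y; R u v; u \<in> t.cells j; k < j; table_bd Plus k u = table_bd Minus k x; D Plus k v = D Minus k y\<rbrakk> \<Longrightarrow>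
    Dec j bs (tcm k x u) (cm k y v)"
proof (induction rule: Dec.induct)
  case (nil x y)
  then show ?case
    using blk_tcm[of j "[]" u "[]" x k] by (intro Dec.nil R.comp) (auto simp: Cell_cells blk_def)
next
  case (snoc cs x0 y0 x1 y1 b)
  note a = Dec_R[OF snoc(1), THEN R_in] snoc(2)[THEN R_in] R_in[OF snoc(7)]
  have v: "v \<in> cells j" using R_cells snoc by blast
  have c: "table_bd Plus k u = table_bd Minus k x1" "D Plus k v = D Minus k y1"
    using snoc a by (simp_all add: t.cm_simps cm_simps)
  have c0: "table_bd Plus k u = table_bd Minus k x0" "D Plus k v = D Minus k y0"
    using c t.D_cm_parallel[of x1 x0 j k Minus] D_cm_parallel[of y1 y0 j k Minus] a snoc by simp_all
  have uv: "table_bd \<alpha> j u = u" "D \<alpha> j v = v" for \<alpha> using t.cells_D cells_D snoc(8) v by blast+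
  have b: "blk U (Suc j) [b] (tcm k x1 u)"
    using blk_tcm[of j "[]" u "[b]" x1 k] snoc c by (auto simp: Cell_cells blk_def)
  have "Dec j (cs @ [b]) (tcm j (tcm k x1 u) (tcm k x0 u)) (cm j (cm k y1 v) (cm k y0 v))"
    using snoc c c0 a uv b by (intro Dec.snoc) (auto simp: t.cm_simps cm_simps intro: R.comp)
  then show ?case
    using a v snoc c by (simp add: t.cm_whiskR cm_whiskR)
qed

lemma Dec_whiskL:
  "\<lbrakk>Dec j bs x y; R u v; u \<in> t.cells j; k < j; table_bd Minus k u = table_bd Plus k x; D Minus k v = D Plus k y\<rbrakk> \<Longrightarrow>
    Dec j bs (tcm k u x) (cm k v y)"
proof (induction rule: Dec.induct)
  case (nil x y)
  then show ?case
    using blk_tcm[of j "[]" x "[]" u k] by (intro Dec.nil R.comp) (auto simp: Cell_cells blk_def)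
next
  case (snoc cs x0 y0 x1 y1 b)
  note a = Dec_R[OF snoc(1), THEN R_in] snoc(2)[THEN R_in] R_in[OF snoc(7)]
  have v: "v \<in> cells j" using R_cells snoc by blast
  have c: "table_bd Minus k u = table_bd Plus k x1" "D Minus k v = D Plus k y1"
    using snoc a by (simp_all add: t.cm_simps cm_simps)
  have c0: "table_bd Minus k u = table_bd Plus k x0" "D Minus k v = D Plus k y0"
    using c t.D_cm_parallel[of x1 x0 j k Plus] D_cm_parallel[of y1 y0 j k Plus] a snoc by simp_all
  have uv: "table_bd \<alpha> j u = u" "D \<alpha> j v = v" for \<alpha> using t.cells_D cells_D snoc(8) v by blast+
  have b: "blk U (Suc j) [b] (tcm k u x1)"
    using blk_tcm[of j "[b]" x1 "[]" u k] snoc c by (auto simp: Cell_cells blk_def)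
  have "Dec j (cs @ [b]) (tcm j (tcm k u x1) (tcm k u x0)) (cm j (cm k v y1) (cm k v y0))"
    using snoc c c0 a uv b by (intro Dec.snoc) (auto simp: t.cm_simps cm_simps intro: R.comp)
  then show ?case
    using a v snoc c by (simp add: t.cm_whiskL cm_whiskL)
qed

lemma Dec_ex_base:
  assumes "i \<in> I"
  shows "x \<in> Cell (P i) \<Longrightarrow> blk (P i) (Suc j) cs x \<Longrightarrow> sorted_wrt le cs \<Longrightarrow> Dec j cs x (G i x)"
proof (induction cs arbitrary: x rule: rev_induct)
  case Nil
  then show ?case using assms P_U by (intro Dec.nil R.base) (auto intro: blk_mono)
next
  case (snoc b cs)
  have le: "le b1 b2" if "b1 \<in> set cs" "b2 \<in> set [b]" for b1 b2
    using snoc.prems(3) that by (auto simp: sorted_wrt_append)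
  obtain y z where yz: "y \<in> Cell (P i)" "z \<in> Cell (P i)" "blk (P i) (Suc j) cs z" "blk (P i) (Suc j) [b] y"
          "table_bd Plus j z = table_bd Minus j y" "x = tcm j y z"
    using split[OF snoc.prems(1) cplx[OF assms] snoc.prems(2) le] by metis
  have "Dec j (cs @ [b]) (tcm j y z) (cm j (G i y) (G i z))"
    using snoc yz assms P_U by (intro Dec.snoc snoc.IH R.base tfun_comp[OF fG]) (auto simp: sorted_wrt_append intro: blk_mono)
  then show ?case using tfunD(3)[OF fG[OF assms]] yz by simp
qed

text \<open>Every evaluated composite can be rewritten as a factorisation along \<open>j\<close>.
  Composites along a dimension above \<open>j\<close> are trivial, as there is at most one block;
  along \<open>j\<close> the lists are concatenated; below \<open>j\<close> both factors are
  whiskered and put in succession by \<open>exchange\<close>.\<close>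

lemma Dec_ex:
  "\<lbrakk>R x y; blk U (Suc (Suc j)) bs x; length bs \<le> 1\<rbrakk> \<Longrightarrow>
     \<exists>rs cs. (\<forall>r\<in>set rs. length r = Suc (Suc j)) \<and> mset cs = mset (bs @ rs) \<and> Dec j cs x y"
proof (induction arbitrary: bs rule: R.induct)
  case (base i x)
  have "b \<in> P i" if "b \<in> set bs" for b
  proof -
    have bs: "bs = [b]" using that base by (cases bs; cases "tl bs") auto
    have l: "Suc (Suc j) < length b" using base(3) that unfolding blk_def by blast
    then have "x (length b - 1) Minus = bsum bs (length b - 1) Minus" using base(3) unfolding blk_def by simp
    moreover have "b \<in> supp (atom b (length b - 1) Minus)" using l by (intro supp_atom_top) auto
    ultimately have "b \<in> supp (x (length b - 1) Minus)" using bs by simp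
    then show ?thesis by (rule CellD(2)[OF base(2)])
  qed
  then have b: "blk (P i) (Suc (Suc j)) bs x" using base(3) unfolding blk_def by blast
  obtain rs where rs: "blk (P i) (Suc j) (bs @ rs) x" "\<forall>r\<in>set rs. length r = Suc (Suc j)"
    by (rule single_down[OF base(2) cplx[OF base(1)] b base(4)]) (rule that)
  obtain cs where cs: "mset cs = mset (bs @ rs)" "sorted_wrt le cs" using sort_ex by blast
  have "Dec j cs x (G i x)"
    using Dec_ex_base[OF base(1,2) blk_mset[OF rs(1) cs(1)[symmetric]] cs(2)] .
  then show ?case using rs cs by blast
next
  case (comp x y x' y' k)
  note a = comp(1,2)[THEN R_in] comp(3,4)
  show ?case
  proof (cases "Suc j \<le> k")
    case True
    then consider "x \<in> t.cells k" "tcm k x x' = x'" | "x' \<in> t.cells k" "tcm k x x' = x"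
      using trivial_comp[OF _ _ comp(3) complex_U _ comp(7,8)] a by auto
    then show ?thesis
    proof cases
      case 1
      then have "y \<in> cells k" using R_cells comp by blast
      then have "cm k y y' = y'" using unitL[of y' k] cells_D[of y k k Minus] a by simp
      then show ?thesis using comp 1 by simp
    next
      case 2
      then have "y' \<in> cells k" using R_cells comp by blast
      then have "cm k y y' = y" using unitR[of y k] cells_D[of y' k k Plus] a by simp
      then show ?thesis using comp 2 by simp
    qed
  next
    case False
    then have "k \<le> Suc j" by simp
    then obtain bs1 bs2 where bs: "blk U (Suc (Suc j)) bs1 x" "blk U (Suc (Suc j)) bs2 x'"
       "length bs1 \<le> 1" "length bs2 \<le> 1" "mset bs = mset (bs1 @ bs2)"
      using bsplit[OF _ _ comp(3) complex_U _ comp(7,8)] a comp(8)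
    proof -
      assume t: "\<And>bs1 bs2. \<lbrakk>blk U (Suc (Suc j)) bs1 x; blk U (Suc (Suc j)) bs2 x'; length bs1 \<le> 1; length bs2 \<le> 1;
         mset bs = mset (bs1 @ bs2)\<rbrakk> \<Longrightarrow> thesis"
      from bsplit[OF _ _ comp(3) complex_U \<open>k \<le> Suc j\<close> comp(7,8)] a
      show thesis using t[of "[]" bs] t[of bs "[]"] comp(8) by auto
    qed
    obtain rs1 cs1 where 1: "\<forall>r\<in>set rs1. length r = Suc (Suc j)" "mset cs1 = mset (bs1 @ rs1)" "Dec j cs1 x y"
      using comp(5) bs by blast
    obtain rs2 cs2 where 2: "\<forall>r\<in>set rs2. length r = Suc (Suc j)" "mset cs2 = mset (bs2 @ rs2)" "Dec j cs2 x' y'"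
      using comp(6) bs by blast
    have m: "mset (cs2 @ cs1) = mset (bs @ (rs1 @ rs2))" using 1 2 bs by simp
    have "Dec j (cs2 @ cs1) (tcm k x x') (cm k y y')"
    proof (cases "k = j")
      case True
      then show ?thesis using Dec_append 1 2 comp(3,4) by blast
    next
      case kj: False
      then have k: "k < j" using False by simp
      have "Dec j cs1 (tcm k x (table_bd Plus j x')) (cm k y (D Plus j y'))"
        using 1 comp k a by (intro Dec_whiskR R_D) (auto simp: t.D_simps D_simps t.D_cells)
      moreover have "Dec j cs2 (tcm k (table_bd Minus j x) x') (cm k (D Minus j y) y')"
        using 2 comp k a by (intro Dec_whiskL R_D) (auto simp: t.D_simps D_simps t.D_cells)
      ultimately have "Dec j (cs2 @ cs1) (tcm j (tcm k x (table_bd Plus j x')) (tcm k (table_bd Minus j x) x'))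
         (cm j (cm k y (D Plus j y')) (cm k (D Minus j y) y'))"
        using a k by (intro Dec_append) (auto simp: t.D_simps D_simps t.cm_simps cm_simps)
      then show ?thesis using t.exchange(2)[of x x' k j] exchange(2)[of y y' k j] a k by simp
    qed
    then show ?thesis using m 1 2 by (intro exI[of _ "rs1 @ rs2"] exI[of _ "cs2 @ cs1"]) auto
  qed
qed

text \<open>Here \<open>c\<close> is performed before \<open>b\<close> although
  \<open>lt b c\<close>, so no simplex lies both in the target of \<open>c\<close> and in the source
  of \<open>b\<close>. Hence both sources are present in the source of the composite, which can be
  taken down to level \<open>j\<close> and cut along j - 1 into a part with \<open>b\<close> and a
  part with \<open>c\<close>. Cells placed beside each other can be performed in either
  order.\<close>

lemma swap:
  assumes UT: "Uniq (Suc j)" "Tot (Suc j)"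
    and r: "R xc yc" "R xb yb" "blk U (Suc j) [c] xc" "blk U (Suc j) [b] xb" "lt b c"
    and co: "table_bd Plus j xc = table_bd Minus j xb" "D Plus j yc = D Minus j yb"
  shows "\<exists>xb' yb' xc' yc'. R xb' yb' \<and> R xc' yc' \<and> blk U (Suc j) [b] xb' \<and> blk U (Suc j) [c] xc' \<and>
    table_bd Plus j xb' = table_bd Minus j xc' \<and> D Plus j yb' = D Minus j yc' \<and>
    tcm j xb xc = tcm j xc' xb' \<and> cm j yb yc = cm j yc' yb'"
proof -
  note a = r(1,2)[THEN R_in]
  have sb: "strict b" "strict c" "Suc j < length b" "Suc j < length c" "b \<in> U" "c \<in> U"
    using r complex_U unfolding blk_def complex_def by auto
  define x where "x = tcm j xb xc"
  have xC: "x \<in> Cell U" unfolding x_def using a co by (simp add: t.cm_in)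
  have bl: "blk U (Suc j) [b, c] x"
    using blk_mset[OF blk_tcm[OF r(3,4) co(1)], of "[b, c]"] unfolding x_def by simp
  have xm: "x j Minus = xc j Minus" unfolding x_def by (rule tcm_simps(2)[OF co(1)])
  have ge: "coef (bsum [b, c] j Minus) v \<le> coef (x j Minus) v" for v
  proof -
    have 1: "coef (atom c j Minus) v \<le> coef (xc j Minus) v"
      using single_ge[OF _ complex_U r(3), of Minus v] a by simp
    have 2: "coef (atom b j Minus) v \<le> coef (xb j Minus) v"
      using single_ge[OF _ complex_U r(4), of Minus v] a by simp
    have 3: "xb j Minus = xc j Minus + (atom c j Plus - atom c j Minus)"
      using blk_bd[OF _ r(3)] a table_eq(2)[OF co(1)] by simp
    have "coef (atom b j Minus) v = 0 \<or> coef (atom c j Plus) v = 0"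
    proof (rule ccontr)
      assume "\<not> ?thesis"
      then have "v \<in> supp (atom b j Minus)" "v \<in> supp (atom c j Plus)" by (simp_all add: in_keys_iff)
      then have "lt v b" "lt c v" using atom_lt(1)[OF sb(1,3)] atom_lt(2)[OF sb(2,4)] by blast+
      then show False using r(5) lt_trans lt_asym by blast
    qed
    then show ?thesis
    proof
      assume "coef (atom b j Minus) v = 0"
      then show ?thesis using 1 unfolding xm by (simp add: lookup_add)
    next
      assume "coef (atom c j Plus) v = 0"
      moreover have "coef (xb j Minus) v = coef (xc j Minus) v + (coef (atom c j Plus) v - coef (atom c j Minus) v)"
        unfolding 3 by (simp add: lookup_add lookup_minus)
      ultimately show ?thesis using 2 unfolding xm by (simp add: lookup_add)
    qed
  qed
  obtain rs where rs: "blk U j ([b, c] @ rs) x" "\<forall>r\<in>set rs. length r = Suc j"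
    by (rule down[OF xC complex_U bl ge]) (rule that)
  \<comment> \<open>A cell has one block at level 0, so two blocks in the wrong order cannot be
    composed along vertices.\<close>
  have "j \<noteq> 0"
  proof
    assume "j = 0"
    then have "length ([b, c] @ rs) = 1" using blk_length0[OF xC] rs(1) by blast
    then show False by simp
  qed
  then obtain i where j: "j = Suc i" using not0_implies_Suc by blast
  define cs1 where "cs1 = filter (\<lambda>v. le v b) ([b, c] @ rs)"
  define cs2 where "cs2 = filter (\<lambda>v. \<not> le v b) ([b, c] @ rs)"
  have cs: "cs1 = b # filter (\<lambda>v. le v b) rs" "cs2 = c # filter (\<lambda>v. \<not> le v b) rs"
    unfolding cs1_def cs2_def using r(5) lt_asym lt_irrefl by auto
  have b12: "blk U (Suc i) (cs1 @ cs2) x"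
    by (rule blk_mset[OF rs(1)[unfolded j]]) (simp add: cs1_def cs2_def)
  have le12: "le b1 b2" if "b1 \<in> set cs1" "b2 \<in> set cs2" for b1 b2
  proof -
    have "le b1 b" using that(1) unfolding cs1_def set_filter by blast
    moreover have "lt b b2" using that(2) lt_total[of b b2] unfolding cs2_def set_filter by blast
    ultimately show ?thesis using lt_trans by blast
  qed
  obtain Y Z where YZ: "Y \<in> Cell U" "Z \<in> Cell U" "blk U (Suc i) cs1 Z" "blk U (Suc i) cs2 Y"
    "table_bd Plus i Z = table_bd Minus i Y" "x = tcm i Y Z"
    using split[OF xC complex_U b12 le12] by metis
  have ij: "i < j" using j by simp
  have f: "filter (\<lambda>b. Suc j < length b) (filter p rs) = []" for p
    using rs(2) by (auto simp: filter_empty_conv)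
  have bY: "blk U (Suc j) [c] Y" and bZ: "blk U (Suc j) [b] Z"
    using blk_filter[OF YZ(4), of "Suc j"] blk_filter[OF YZ(3), of "Suc j"] sb(3,4) ij unfolding cs by (simp_all add: f del: filter_filter)
  obtain yY yZ where RY: "R Y yY" and RZ: "R Z yZ" using UT(2) YZ bY bZ unfolding Tot_def by fastforce
  note aY = R_in[OF RY] R_in[OF RZ]
  have co2: "D Plus i yZ = D Minus i yY"
    using R_D[OF RZ, of Plus i] R_D[OF RY, of Minus i] YZ(5) UT(1) blk_D[of i j] ij unfolding Uniq_def by fastforce
  have k: "table_bd Plus i (table_bd \<beta> j Z) = table_bd Minus i (table_bd \<gamma> j Y)" "table_bd Plus i Z = table_bd Minus i (table_bd \<gamma> j Y)"
      "table_bd Plus i (table_bd \<beta> j Z) = table_bd Minus i Y"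
      "D Plus i (D \<beta> j yZ) = D Minus i (D \<gamma> j yY)" "D Plus i yZ = D Minus i (D \<gamma> j yY)"
      "D Plus i (D \<beta> j yZ) = D Minus i yY" for \<beta> \<gamma>
    using YZ co2 aY ij by (simp_all add: t.D_below D_below)
  have RR: "R (tcm i Y (table_bd \<beta> j Z)) (cm i yY (D \<beta> j yZ))" "R (tcm i (table_bd \<beta> j Y) Z) (cm i (D \<beta> j yY) yZ)" for \<beta>
    using RY RZ R_D k by (auto intro!: R.comp)
  have BB: "blk U (Suc j) [c] (tcm i Y (table_bd \<beta> j Z))" "blk U (Suc j) [b] (tcm i (table_bd \<beta> j Y) Z)" for \<beta>
    using blk_tcm[OF blk_D[of j j] bY k(3)] blk_tcm[OF bZ blk_D[of j j] k(2)] ij by auto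
  \<comment> \<open>One block and one boundary determine a cell by \<open>blk_det\<close>. This
    identifies the given factors with those produced by the cut, and \<open>Uniq\<close> carries the
    identification over to the values.\<close>
  have "xc = tcm i Y (table_bd Minus j Z)"
  proof (rule blk_det[OF _ _ r(3) BB(1)])
    show "table_bd Minus j xc = table_bd Minus j (tcm i Y (table_bd Minus j Z))"
      using t.src_cm[of xb xc j] t.D_cm_above[OF YZ(1,2,5) ij, of Minus]
        t.D_cm_above[OF YZ(1) t.D_in[OF YZ(2)] k(3) ij, of Minus Minus] a co YZ(2,6) x_def by (simp add: t.D_above)
  qed (use a RR[THEN R_in] in auto)
  moreover have "xb = tcm i (table_bd Plus j Y) Z"
  proof (rule blk_det[OF _ _ r(4) BB(2)])
    show "table_bd Plus j xb = table_bd Plus j (tcm i (table_bd Plus j Y) Z)"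
      using t.tgt_cm[of xb xc j] t.D_cm_above[OF YZ(1,2,5) ij, of Plus]
        t.D_cm_above[OF t.D_in[OF YZ(1)] YZ(2) k(2) ij, of Plus Plus] a co YZ(1,6) x_def by (simp add: t.D_above)
  qed (use a RR[THEN R_in] in auto)
  ultimately have y: "yc = cm i yY (D Minus j yZ)" "yb = cm i (D Plus j yY) yZ"
    using UT(1) r RR unfolding Uniq_def by (metis One_nat_def le_refl length_Cons list.size(3))+
  have "tcm j xb xc = tcm j (tcm i Y (table_bd Plus j Z)) (tcm i (table_bd Minus j Y) Z)"
    using t.exchange(2)[OF YZ(1,2,5) ij] YZ(6) x_def by simp
  moreover have "cm j yb yc = cm j (cm i yY (D Plus j yZ)) (cm i (D Minus j yY) yZ)"
    unfolding y using exchange[of yY yZ i j] aY co2 ij by simp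
  moreover have "table_bd Plus j (tcm i (table_bd Minus j Y) Z) = table_bd Minus j (tcm i Y (table_bd Plus j Z))"
    using t.D_cm_above[OF t.D_in[OF YZ(1)] YZ(2) k(2) ij] t.D_cm_above[OF YZ(1) t.D_in[OF YZ(2)] k(3) ij] YZ(1,2)
    by (simp add: t.D_above)
  moreover have "D Plus j (cm i (D Minus j yY) yZ) = D Minus j (cm i yY (D Plus j yZ))"
    using D_cm_above[OF _ _ k(5) ij] D_cm_above[OF _ _ k(6) ij] aY by (simp add: D_above D_in)
  ultimately show ?thesis
    using RR(1)[of Plus] RR(2)[of Minus] BB(1)[of Plus] BB(2)[of Minus] by metis
qed

text \<open>The insertion step of insertion sort on factorisations, with \<open>swap\<close> as the
  elementary transposition.\<close>

lemma Dec_insert: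
  assumes UT: "Uniq (Suc j)" "Tot (Suc j)"
  shows "\<lbrakk>Dec j bs x y; sorted_wrt le bs; R x' y'; blk U (Suc j) [b] x'; table_bd Plus j x = table_bd Minus j x';
    D Plus j y = D Minus j y'\<rbrakk> \<Longrightarrow> \<exists>cs. mset cs = add_mset b (mset bs) \<and> sorted_wrt le cs \<and> Dec j cs (tcm j x' x) (cm j y' y)"
proof (induction arbitrary: x' y' rule: Dec.induct)
  case (nil x y)
  then show ?case using Dec.snoc[OF Dec.nil[OF nil(1,2)] nil(4-7)] by (intro exI[of _ "[b]"]) auto
next
  case (snoc cs x0 y0 xc yc c)
  note a = Dec_R[OF snoc(1), THEN R_in] snoc(2)[THEN R_in] R_in[OF snoc(8)]
  show ?case
  proof (cases "le c b")
    case True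
    have "Dec j ((cs @ [c]) @ [b]) (tcm j x' (tcm j xc x0)) (cm j y' (cm j yc y0))"
      using snoc by (intro Dec.snoc) auto
    moreover have "sorted_wrt le ((cs @ [c]) @ [b])"
      using snoc.prems(1) True lt_trans by (auto simp: sorted_wrt_append)
    ultimately show ?thesis by (intro exI[of _ "(cs @ [c]) @ [b]"]) auto
  next
    case False
    then have lt: "lt b c" using lt_total by blast
    have co: "table_bd Plus j xc = table_bd Minus j x'" "D Plus j yc = D Minus j y'"
      using snoc a by (simp_all add: t.cm_simps cm_simps)
    obtain xb' yb' xc' yc' where s: "R xb' yb'" "R xc' yc'" "blk U (Suc j) [b] xb'" "blk U (Suc j) [c] xc'"
      "table_bd Plus j xb' = table_bd Minus j xc'" "D Plus j yb' = D Minus j yc'"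
      "tcm j x' xc = tcm j xc' xb'" "cm j y' yc = cm j yc' yb'"
      using swap[OF UT snoc(2) snoc(8) snoc(3) snoc(9) lt co] by blast
    note a' = s(1,2)[THEN R_in]
    have src: "table_bd Minus j xb' = table_bd Minus j xc" "D Minus j yb' = D Minus j yc"
      using s(5-8) a a' co by (metis t.src_cm, metis src_cm)
    obtain cs0 where cs0: "mset cs0 = add_mset b (mset cs)" "sorted_wrt le cs0" "Dec j cs0 (tcm j xb' x0) (cm j yb' y0)"
      using snoc.IH[of xb' yb'] snoc(4,5) snoc.prems(1) s src by (auto simp: sorted_wrt_append)
    have "Dec j (cs0 @ [c]) (tcm j xc' (tcm j xb' x0)) (cm j yc' (cm j yb' y0))"
      using cs0 s src a a' snoc(4,5) by (intro Dec.snoc) (auto simp: t.cm_simps cm_simps)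
    moreover have "tcm j xc' (tcm j xb' x0) = tcm j x' (tcm j xc x0)" "cm j yc' (cm j yb' y0) = cm j y' (cm j yc y0)"
      using t.cm_assoc[of xc' xb' x0 j] cm_assoc[of yc' yb' y0 j] t.cm_assoc[of x' xc x0 j] cm_assoc[of y' yc y0 j]
        a a' s src co snoc(4,5) by simp_all
    moreover have "sorted_wrt le (cs0 @ [c])"
      using cs0 snoc.prems(1) lt mset_eq_setD[of cs0 "b # cs"] by (auto simp: sorted_wrt_append)
    ultimately show ?thesis using cs0 by (intro exI[of _ "cs0 @ [c]"]) auto
  qed
qed

lemma Dec_sort:
  assumes UT: "Uniq (Suc j)" "Tot (Suc j)"
  shows "Dec j bs x y \<Longrightarrow> \<exists>cs. mset cs = mset bs \<and> sorted_wrt le cs \<and> Dec j cs x y"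
proof (induction rule: Dec.induct)
  case (nil x y)
  then show ?case using Dec.nil by (intro exI[of _ "[]"]) auto
next
  case (snoc bs x y x' y' b)
  then obtain cs where cs: "mset cs = mset bs" "sorted_wrt le cs" "Dec j cs x y" by blast
  then show ?case using Dec_insert[OF UT cs(3,2) snoc(2-5)] by auto
qed

text \<open>The last factor shares its target with the composite and the remaining part shares its
  source, so the block list fixes both by \<open>blk_det\<close>. Their values agree by
  \<open>Uniq\<close>.\<close>

lemma Dec_unique:
  assumes UT: "Uniq (Suc j)"
  shows "Dec j bs x y \<Longrightarrow> Dec j bs x y' \<Longrightarrow> y = y'"
proof (induction arbitrary: y' rule: Dec.induct)
  case (nil x y)
  then show ?case using UT Dec_R unfolding Uniq_def by (metis le0 list.size(3))
next
  case (snoc bs x0 y0 x1 y1 b)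
  from snoc.prems obtain x0' y0' x1' y1' where s: "tcm j x1 x0 = tcm j x1' x0'" "y' = cm j y1' y0'" "Dec j bs x0' y0'"
    "R x1' y1'" "blk U (Suc j) [b] x1'" "table_bd Plus j x0' = table_bd Minus j x1'" "D Plus j y0' = D Minus j y1'"
    by cases auto
  note a = Dec_R[OF snoc(1), THEN R_in] snoc(2)[THEN R_in] Dec_R[OF s(3), THEN R_in] R_in[OF s(4)]
  have "x1 = x1'"
    using a s snoc(4) by (intro blk_det[OF _ _ snoc(3) s(5), of Plus]) (auto, metis t.tgt_cm)
  moreover have "x0 = x0'"
    using a s snoc(4) by (intro blk_det[OF _ _ Dec_blk[OF snoc(1)] Dec_blk[OF s(3)], of Minus]) (auto, metis t.src_cm)
  ultimately have "y0 = y0'" "y1 = y1'" using snoc s UT unfolding Uniq_def by (blast, fastforce)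
  then show ?case using s by simp
qed

text \<open>Atoms are indecomposable: in a composite equal to an atom one factor is a unit. Hence
  the value was already given by a member of the family.\<close>

lemma R_atom: "R x y \<Longrightarrow> x = atom b \<Longrightarrow> b \<noteq> [] \<Longrightarrow> \<exists>i\<in>I. b \<in> P i \<and> y = G i (atom b)"
proof (induction rule: R.induct)
  case (base i x)
  then show ?case using atom_Cell_D by blast
next
  case (comp x y x' y' k)
  note a = comp(1,2)[THEN R_in] comp(3,4)
  have "b \<in> U" using t.cm_in[of x x' k] a comp(7,8) atom_Cell_D by simp
  then have "blk U 0 [b] (tcm k x x')" using comp(7,8) unfolding blk_def by auto
  then consider "x \<in> t.cells k" "tcm k x x' = x'" | "x' \<in> t.cells k" "tcm k x x' = x"
    using trivial_comp[OF _ _ comp(3) complex_U] a by force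
  then show ?case
  proof cases
    case 1
    then have "y \<in> cells k" using R_cells comp by blast
    then have "cm k y y' = y'" using unitL[of y' k] cells_D[of y k k Minus] a by simp
    then show ?thesis using comp 1 by simp
  next
    case 2
    then have "y' \<in> cells k" using R_cells comp by blast
    then have "cm k y y' = y" using unitR[of y k] cells_D[of y' k k Plus] a by simp
    then show ?thesis using comp 2 by simp
  qed
qed

text \<open>At level 1 a cell with at most one block is an atom. In the step, two values of a cell
  give two factorisations whose generators can be read off from the cell. They agree as multisets,
  hence as sorted lists, and the values agree by the level below. For totality the cell is split and
  its factors are evaluated one by one.\<close>

lemma Uniq_Tot: "Uniq (Suc j) \<and> Tot (Suc j)"
proof (induction j)
  case 0
  have at: "\<exists>b\<in>U. x = atom b" if "x \<in> Cell U" "blk U (Suc 0) bs x" "length bs \<le> 1" for x bs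
    using single_down[OF that(1) complex_U that(2,3)] blk0_atom[OF that(1)] by metis
  have ne: "b \<noteq> []" if "b \<in> U" for b using complex_U that unfolding complex_def by auto
  have "Uniq (Suc 0)"
    unfolding Uniq_def
  proof (intro allI impI, elim conjE)
    fix x y y' bs assume h: "blk U (Suc 0) bs x" "length bs \<le> 1" "R x y" "R x y'"
    then obtain b where "b \<in> U" "x = atom b" using at R_in by blast
    then show "y = y'" using R_atom[OF h(3)] R_atom[OF h(4)] ne agree by metis
  qed
  moreover have "Tot (Suc 0)"
    unfolding Tot_def
  proof (intro allI impI, elim conjE)
    fix x bs assume h: "x \<in> Cell U" "blk U (Suc 0) bs x" "length bs \<le> 1"
    then obtain b where b: "b \<in> U" "x = atom b" using at by blast
    then obtain i where "i \<in> I" "b \<in> P i" unfolding U_def by blast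
    then show "\<exists>y. R x y" using R.base[of i "atom b"] atom_Cell[OF cplx] b by blast
  qed
  ultimately show ?case by blast
next
  case (Suc j)
  then have UT: "Uniq (Suc j)" "Tot (Suc j)" by blast+
  have "Uniq (Suc (Suc j))"
    unfolding Uniq_def
  proof (intro allI impI, elim conjE)
    fix x y y' bs assume h: "blk U (Suc (Suc j)) bs x" "length bs \<le> 1" "R x y" "R x y'"
    obtain rs cs where 1: "\<forall>r\<in>set rs. length r = Suc (Suc j)" "mset cs = mset (bs @ rs)" "Dec j cs x y"
      using Dec_ex[OF h(3,1,2)] by blast
    obtain rs' cs' where 2: "\<forall>r\<in>set rs'. length r = Suc (Suc j)" "mset cs' = mset (bs @ rs')" "Dec j cs' x y'"
      using Dec_ex[OF h(4,1,2)] by blast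
    have "x (Suc j) Minus = bsum (bs @ rs) (Suc j) Minus" "x (Suc j) Minus = bsum (bs @ rs') (Suc j) Minus"
      using blk_mset[OF Dec_blk[OF 1(3)] 1(2)] blk_mset[OF Dec_blk[OF 2(3)] 2(2)] unfolding blk_def by blast+
    then have "(\<Sum>r\<leftarrow>rs. frag_of r) = (\<Sum>r\<leftarrow>rs'. frag_of r)"
      using bsum_generators(1)[OF 1(1)[rule_format]] bsum_generators(1)[OF 2(1)[rule_format]] by simp
    then have m: "mset cs = mset cs'" unfolding 1(2) 2(2) using frag_mset[of rs rs'] by simp
    obtain ds where ds: "mset ds = mset cs" "sorted_wrt le ds" "Dec j ds x y" using Dec_sort[OF UT 1(3)] by blast
    obtain ds' where ds': "mset ds' = mset cs'" "sorted_wrt le ds'" "Dec j ds' x y'" using Dec_sort[OF UT 2(3)] by blast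
    have "ds = ds'" by (rule sorted_unique[OF ds(2) ds'(2)]) (simp add: ds(1) ds'(1) m)
    then show "y = y'" using Dec_unique[OF UT(1)] ds ds' by blast
  qed
  moreover have "Tot (Suc (Suc j))"
    unfolding Tot_def
  proof (intro allI impI, elim conjE)
    fix x bs assume h: "x \<in> Cell U" "blk U (Suc (Suc j)) bs x" "length bs \<le> 1"
    obtain rs where rs: "blk U (Suc j) (bs @ rs) x" using single_down[OF h(1) complex_U h(2,3)] by blast
    obtain cs where cs: "mset cs = mset (bs @ rs)" "sorted_wrt le cs" using sort_ex by blast
    have "\<exists>y. R x y" if "x \<in> Cell U" "blk U (Suc j) cs x" "sorted_wrt le cs" for x cs
      using that
    proof (induction cs arbitrary: x rule: rev_induct)
      case Nil
      then show ?case using UT(2) unfolding Tot_def by (metis le0 list.size(3))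
    next
      case (snoc b cs)
      have le: "le b1 b2" if "b1 \<in> set cs" "b2 \<in> set [b]" for b1 b2
        using snoc.prems(3) that by (auto simp: sorted_wrt_append)
      obtain y z where yz: "y \<in> Cell U" "z \<in> Cell U" "blk U (Suc j) cs z" "blk U (Suc j) [b] y"
              "table_bd Plus j z = table_bd Minus j y" "x = tcm j y z"
        using split[OF snoc.prems(1) complex_U snoc.prems(2) le] by metis
      obtain v w where vw: "R y v" "R z w"
        using snoc.IH[OF yz(2,3)] snoc.prems(3) UT(2) yz unfolding Tot_def by (fastforce simp: sorted_wrt_append)
      have "D Plus j w = D Minus j v"
        using R_D[OF vw(2), of Plus j] R_D[OF vw(1), of Minus j] yz(5) UT(1) blk_D[of j j] unfolding Uniq_def by fastforce
      then show ?case using R.comp vw yz by blast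
    qed
    then show "\<exists>y. R x y" using blk_mset[OF rs cs(1)[symmetric]] cs h by blast
  qed
  ultimately show ?case by blast
qed

theorem glue: "\<exists>F. tfun U F \<and> (\<forall>i\<in>I. \<forall>x\<in>Cell (P i). F x = G i x)"
proof -
  have u: "y = y'" if "R x y" "R x y'" for x y y'
    using that blk_ex R_in Uniq_Tot unfolding Uniq_def by (metis le0 list.size(3))
  have ex: "\<exists>y. R x y" if "x \<in> Cell U" for x
    using that blk_ex Uniq_Tot unfolding Tot_def by (metis le0 list.size(3))
  define F where "F x = (THE y. R x y)" for x
  have F: "F x = y" if "R x y" for x y unfolding F_def using that u by blast
  have RF: "R x (F x)" if "x \<in> Cell U" for x using ex[OF that] F by blast
  have "tfun U F"
    unfolding tfun_def
  proof (intro conjI ballI allI impI)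
    show FD: "F (table_bd \<alpha> k x) = D \<alpha> k (F x)" if "x \<in> Cell U" for x \<alpha> k using R_D[OF RF[OF that]] F by blast
    show "F (tcm k x y) = cm k (F x) (F y)" if "x \<in> Cell U" "y \<in> Cell U" "table_bd Plus k y = table_bd Minus k x" for k x y
      using R.comp[OF RF[OF that(1)] RF[OF that(2)] that(3)] FD that F by metis
  qed (use RF R_in in blast)
  then show ?thesis using F R.base by blast
qed

end

section \<open>Maps of orientals\<close>

definition Dv :: "nat set \<Rightarrow> nat list set" where
  "Dv V = {v. v \<noteq> [] \<and> strict v \<and> set v \<subseteq> V}"

lemma complex_Dv: "complex (Dv V)"
  unfolding complex_def Dv_def by auto

lemma strict_iff: "strict v \<longleftrightarrow> sorted v \<and> distinct v"
  by (rule strict_sorted_iff)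

lemma sorted_map_mono: "sorted v \<Longrightarrow> (\<And>a b. a \<in> set v \<Longrightarrow> b \<in> set v \<Longrightarrow> a \<le> b \<Longrightarrow> f a \<le> f b) \<Longrightarrow> sorted (map f v)"
  for f :: "nat \<Rightarrow> nat"
  by (induction v) auto

lemma strict_map: "strict v \<Longrightarrow> (\<And>a b. a \<in> set v \<Longrightarrow> b \<in> set v \<Longrightarrow> a < b \<Longrightarrow> f a < f b) \<Longrightarrow> strict (map f v)"
  by (induction v) auto

text \<open>The class of a simplex in normalized chains: on sorted lists, failure of strictness
  means degeneracy.\<close>

definition push :: "nat list \<Rightarrow> chain" where
  "push w = (if strict w then frag_of w else 0)"

definition pcone :: "nat \<Rightarrow> chain \<Rightarrow> chain" where
  "pcone b c = frag_extend (\<lambda>u. push (b # u)) c"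

definition pshc :: "(nat \<Rightarrow> nat) \<Rightarrow> chain \<Rightarrow> chain" where
  "pshc f c = frag_extend (\<lambda>v. push (map f v)) c"

definition pm :: "(nat \<Rightarrow> nat) \<Rightarrow> table \<Rightarrow> table" where
  "pm f x k \<alpha> = pshc f (x k \<alpha>)"

lemma pcone_simps [simp]: "pcone a 0 = 0" "pcone a (frag_of v) = push (a # v)"
  "pcone a (c + d) = pcone a c + pcone a d" "pcone a (c - d) = pcone a c - pcone a d"
  by (simp_all add: pcone_def frag_extend_add frag_extend_diff)

lemma pshc_simps [simp]: "pshc f 0 = 0" "pshc f (frag_of v) = push (map f v)"
  "pshc f (c + d) = pshc f c + pshc f d" "pshc f (c - d) = pshc f c - pshc f d"
  by (simp_all add: pshc_def frag_extend_add frag_extend_diff)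

lemma pshc_cone: "pshc f (cone a c) = pcone (f a) (pshc f c)"
  by (induction c rule: frag_induct) (auto simp: push_def)

lemma dl_supp: "u \<in> supp (dl v) \<Longrightarrow> set u \<subseteq> set v \<and> (strict v \<longrightarrow> strict u) \<and> Suc (length u) = length v"
proof (induction v arbitrary: u)
  case (Cons a w)
  have "u \<in> supp (frag_of w) \<or> u \<in> supp (cone a (dl w))"
    using Cons.prems unfolding in_keys_iff by (auto simp: lookup_minus)
  then show ?case using Cons.IH by (auto simp: supp_cone; blast)
qed auto

lemma pcone_cone: "pcone b (cone b c) = 0"
  by (induction c rule: frag_induct) (auto simp: push_def)

text \<open>If \<open>b\<close> repeats the first vertex of \<open>u\<close>, the left side
  vanishes. On the right \<open>push u\<close> cancels against the cone on the tail of
  \<open>u\<close>, and the remaining cones repeat \<open>b\<close> and vanish by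
  \<open>pcone_cone\<close>.\<close>

lemma bnd_push_Cons:
  assumes "sorted (b # u)"
  shows "bnd (push (b # u)) = push u - pcone b (bnd (push u))"
proof (cases "strict u")
  case False
  then show ?thesis by (simp add: push_def)
next
  case True
  show ?thesis
  proof (cases u)
    case Nil
    then show ?thesis by (simp add: push_def)
  next
    case (Cons c w)
    have s: "strict (c # w)" using True Cons by simp
    show ?thesis
    proof (cases "b < c")
      case lt: True
      have "pcone b (dl u) = cone b (dl u)"
        unfolding pcone_def cone_def
      proof (rule frag_extend_eq)
        fix v assume "v \<in> supp (dl u)"
        then have "strict v" "set v \<subseteq> set u" using dl_supp[of v u] True by auto
        moreover have "b < x" if "x \<in> set u" for x using that lt s Cons by auto
        ultimately have "strict (b # v)" by auto
        then show "push (b # v) = frag_of (b # v)" by (simp add: push_def)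
      qed
      moreover have "strict (b # u)" using lt s Cons by auto
      ultimately show ?thesis using True by (simp add: push_def)
    next
      case False
      then have bc: "b = c" using assms Cons by auto
      have "\<not> strict (b # u)" using bc Cons by auto
      then show ?thesis using True bc Cons s by (simp add: push_def pcone_cone)
    qed
  qed
qed

lemma bnd_pshc_simplex:
  assumes "\<And>a b. a \<in> V \<Longrightarrow> b \<in> V \<Longrightarrow> a \<le> b \<Longrightarrow> f a \<le> f b"
  shows "strict v \<Longrightarrow> set v \<subseteq> V \<Longrightarrow> bnd (push (map f v)) = pshc f (dl v)"
proof (induction v)
  case (Cons a w)
  have "sorted (map f (a # w))"
    using Cons.prems assms unfolding strict_iff by (intro sorted_map_mono) blast+
  then have "bnd (push (map f (a # w))) = push (map f w) - pcone (f a) (bnd (push (map f w)))"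
    using bnd_push_Cons by simp
  then show ?case using Cons by (simp add: pshc_cone)
qed (simp add: push_def)

lemma frag_ext_induct:
  assumes "supp c \<subseteq> S" "P 0" "\<And>v. v \<in> S \<Longrightarrow> P (frag_of v)" "\<And>c d. P c \<Longrightarrow> P d \<Longrightarrow> P (c - d)"
  shows "P (c :: 'b \<Rightarrow>\<^sub>0 int)"
  by (rule frag_induction[of c S]) (use assms in auto)

lemma bnd_pshc:
  assumes "\<And>a b. a \<in> V \<Longrightarrow> b \<in> V \<Longrightarrow> a \<le> b \<Longrightarrow> f a \<le> f b" and "supp c \<subseteq> {v. strict v \<and> set v \<subseteq> V}"
  shows "bnd (pshc f c) = pshc f (bnd c)"
  using assms(2) by (rule frag_ext_induct) (auto simp: bnd_pshc_simplex[OF assms(1)])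

lemma pshc_pos: "pos c \<Longrightarrow> pos (pshc f c)"
proof -
  assume "pos c"
  then obtain rs where "c = (\<Sum>r\<leftarrow>rs. frag_of r)" using chain_list by blast
  moreover have "pshc f (\<Sum>r\<leftarrow>rs. frag_of r) = (\<Sum>r\<leftarrow>rs. push (map f r))" by (induction rs) auto
  ultimately show ?thesis by (auto intro!: pos_sum_list simp: push_def)
qed

lemma pshc_supp: "u \<in> supp (pshc f c) \<Longrightarrow> \<exists>v\<in>supp c. u = map f v \<and> strict u"
proof -
  assume "u \<in> supp (pshc f c)"
  then obtain v where "v \<in> supp c" "u \<in> supp (push (map f v))"
    unfolding pshc_def using keys_frag_extend[of "\<lambda>v. push (map f v)" c] by (meson UN_E subsetD)
  then show ?thesis unfolding push_def by (auto split: if_splits)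
qed

lemma pm_Cell:
  assumes f: "\<And>a b. a \<in> V \<Longrightarrow> b \<in> V \<Longrightarrow> a \<le> b \<Longrightarrow> f a \<le> f b" "f ` V \<subseteq> W" and x: "x \<in> Cell (Dv V)"
  shows "pm f x \<in> Cell (Dv W)"
proof -
  have s: "supp (x k \<alpha>) \<subseteq> {v. strict v \<and> set v \<subseteq> V}" for k \<alpha>
    using CellD(2)[OF x] unfolding Dv_def by blast
  show ?thesis
    unfolding Cell_def
  proof (intro CollectI conjI allI ballI)
    show "pos (pm f x k \<alpha>)" for k \<alpha> unfolding pm_def using CellD(1)[OF x] pshc_pos by blast
    show "v \<in> Dv W" "length v = Suc k" if v: "v \<in> supp (pm f x k \<alpha>)" for v k \<alpha>
    proof -
      obtain u where "u \<in> supp (x k \<alpha>)" "v = map f u" "strict v"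
        using pshc_supp v unfolding pm_def by blast
      then show "v \<in> Dv W" "length v = Suc k"
        using CellD(2,3)[OF x] f(2) unfolding Dv_def by (auto, fastforce)
    qed
    show "bnd (pm f x (Suc k) \<alpha>) = pm f x k Plus - pm f x k Minus" for k \<alpha>
      unfolding pm_def using bnd_pshc[OF f(1) s] CellD(4)[OF x] by simp
    show "bnd (pm f x 0 \<alpha>) = frag_of []" for \<alpha>
      unfolding pm_def using bnd_pshc[OF f(1) s] CellD(5)[OF x] by (simp add: push_def)
    obtain p where "\<forall>k>p. \<forall>\<alpha>. x k \<alpha> = 0" using CellD(6)[OF x] by blast
    then show "\<exists>p. \<forall>k>p. \<forall>\<alpha>. pm f x k \<alpha> = 0" by (intro exI[of _ p]) (auto simp: pm_def)
  qed
qed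

lemma pm_bd: "pm f (table_bd \<alpha> k x) = table_bd \<alpha> k (pm f x)"
  by (auto simp: pm_def table_bd_def fun_eq_iff)

lemma pm_tcm: "pm f (tcm k x y) = tcm k (pm f x) (pm f y)"
  by (auto simp: pm_def tcm_def table_bd_def fun_eq_iff)

text \<open>A simplex that becomes degenerate under \<open>g\<close> has a repeated vertex, and the
  repetition survives the application of \<open>f\<close>.\<close>

lemma pshc_comp:
  assumes "\<And>a b. a \<in> V \<Longrightarrow> b \<in> V \<Longrightarrow> a \<le> b \<Longrightarrow> g a \<le> g b" "supp c \<subseteq> {v. strict v \<and> set v \<subseteq> V}"
  shows "pshc f (pshc g c) = pshc (f \<circ> g) c"
  using assms(2)
proof (rule frag_ext_induct)
  fix v assume "v \<in> {v. strict v \<and> set v \<subseteq> V}"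
  then have "sorted (map g v)"
    using assms(1) unfolding strict_iff by (intro sorted_map_mono) blast+
  then have "strict (map f (map g v)) \<Longrightarrow> strict (map g v)"
    unfolding strict_iff by (meson distinct_map)
  then show "pshc f (pshc g (frag_of v)) = pshc (f \<circ> g) (frag_of v)"
    by (auto simp: push_def)
qed auto

lemma pm_comp:
  assumes "\<And>a b. a \<in> V \<Longrightarrow> b \<in> V \<Longrightarrow> a \<le> b \<Longrightarrow> g a \<le> g b" "x \<in> Cell (Dv V)"
  shows "pm f (pm g x) = pm (f \<circ> g) x"
proof (intro ext)
  fix k \<alpha>
  have "supp (x k \<alpha>) \<subseteq> {v. strict v \<and> set v \<subseteq> V}"
    using CellD(2)[OF assms(2)] unfolding Dv_def by blast
  from pshc_comp[of V g, OF assms(1) this] show "pm f (pm g x) k \<alpha> = pm (f \<circ> g) x k \<alpha>"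
    unfolding pm_def by blast
qed

lemma pm_cong:
  assumes "x \<in> Cell (Dv V)" "\<And>a. a \<in> V \<Longrightarrow> f a = g a"
  shows "pm f x = pm g x"
proof (intro ext)
  fix k \<alpha>
  show "pm f x k \<alpha> = pm g x k \<alpha>"
    unfolding pm_def pshc_def
  proof (rule frag_extend_eq)
    fix v assume "v \<in> supp (x k \<alpha>)"
    then have "set v \<subseteq> V" using CellD(2)[OF assms(1)] unfolding Dv_def by blast
    then have "map f v = map g v" using assms(2) by (intro map_cong) auto
    then show "push (map f v) = push (map g v)" by (rule arg_cong)
  qed
qed

lemma pm_id:
  assumes "x \<in> Cell (Dv V)" "\<And>a. a \<in> V \<Longrightarrow> f a = a"
  shows "pm f x = x"
proof -
  have "pm f x = pm (\<lambda>a. a) x" by (rule pm_cong[OF assms])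
  also have "\<dots> = x"
  proof (intro ext)
    fix k \<alpha>
    have "pshc (\<lambda>a. a) (x k \<alpha>) = frag_extend frag_of (x k \<alpha>)"
      unfolding pshc_def by (rule frag_extend_eq) (use CellD(2)[OF assms(1)] in \<open>auto simp: push_def Dv_def\<close>)
    then show "pm (\<lambda>a. a) x k \<alpha> = x k \<alpha>" unfolding pm_def using frag_expansion by metis
  qed
  finally show ?thesis .
qed

lemma pm_atom:
  assumes "strict v" "\<And>a b. a \<in> set v \<Longrightarrow> b \<in> set v \<Longrightarrow> a < b \<Longrightarrow> f a < f b"
  shows "pm f (atom v) = atom (map f v)"
proof (intro ext)
  fix k \<alpha>
  have fc: "frag_extend (\<lambda>u. frag_of (map f u)) (cone a c) = cone (f a) (frag_extend (\<lambda>u. frag_of (map f u)) c)" for a c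
    by (induction c rule: frag_induct) (auto simp: frag_extend_diff)
  have e: "frag_extend (\<lambda>u. frag_of (map f u)) (atom v k \<alpha>) = atom (map f v) k \<alpha>" for v k \<alpha>
    by (induction v k \<alpha> rule: atom.induct) (auto simp: fc frag_extend_add)
  have "pshc f (atom v k \<alpha>) = frag_extend (\<lambda>u. frag_of (map f u)) (atom v k \<alpha>)"
    unfolding pshc_def
  proof (rule frag_extend_eq)
    fix u assume "u \<in> supp (atom v k \<alpha>)"
    then have "set u \<subseteq> set v" "strict u" using atom_supp assms(1) by blast+
    then have "strict (map f u)" using assms(2) by (intro strict_map) blast+
    then show "push (map f u) = frag_of (map f u)" by (simp add: push_def)
  qed
  then show "pm f (atom v) k \<alpha> = atom (map f v) k \<alpha>" unfolding pm_def using e by simp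
qed

context scat begin

lemma tfun_pm:
  assumes "tfun (Dv W) F" "\<And>a b. a \<in> V \<Longrightarrow> b \<in> V \<Longrightarrow> a \<le> b \<Longrightarrow> f a \<le> f b" "f ` V \<subseteq> W"
  shows "tfun (Dv V) (\<lambda>x. F (pm f x))"
  unfolding tfun_def
proof (intro conjI ballI allI impI)
  fix x assume x: "x \<in> Cell (Dv V)"
  then have px: "pm f x \<in> Cell (Dv W)" using pm_Cell assms by blast
  show "F (pm f x) \<in> A" using tfunD(1)[OF assms(1) px] .
  show "F (pm f (table_bd \<alpha> k x)) = D \<alpha> k (F (pm f x))" for \<alpha> k
    using tfunD(2)[OF assms(1) px] by (simp add: pm_bd)
  fix k y assume y: "y \<in> Cell (Dv V)" "table_bd Plus k y = table_bd Minus k x"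
  then have py: "pm f y \<in> Cell (Dv W)" using pm_Cell assms by blast
  have "table_bd Plus k (pm f y) = table_bd Minus k (pm f x)" using y by (simp flip: pm_bd)
  then show "F (pm f (tcm k x y)) = cm k (F (pm f x)) (F (pm f y))"
    using tfunD(3)[OF assms(1) px py] by (simp add: pm_tcm)
qed

end

subsection \<open>The orientals\<close>

abbreviation Dl :: "nat \<Rightarrow> nat list set" where
  "Dl n \<equiv> Dv {..n}"

lemma splx_Delta: "s \<in> splx (Delta (int n)) m \<longleftrightarrow> length s = Suc m \<and> sorted s \<and> set s \<subseteq> {..n}"
  by (auto simp: Delta_def)

lemma degenerate_Delta:
  assumes "s \<in> splx (Delta N) k"
  shows "s \<in> degenerate (Delta N) k \<longleftrightarrow> \<not> strict s"
proof
  assume "s \<in> degenerate (Delta N) k"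
  then obtain m i y where h: "k = m + 1" "i \<le> m" "y \<in> splx (Delta N) m" "s = map ((!) y) (codegeneracy m i)"
    unfolding degenerate_def by (auto simp: Delta_def Delta_comp_def)
  have "s ! i = y ! i" "s ! Suc i = y ! i" "Suc i < length s"
    using h by (auto simp: codegeneracy_def nth_append)
  then show "\<not> strict s" unfolding sorted_wrt_iff_nth_less by (metis lessI less_irrefl)
next
  assume ns: "\<not> strict s"
  have s: "length s = Suc k" "sorted s" "\<forall>a\<in>set s. int a \<le> N" using assms by (auto simp: Delta_def)
  have "\<exists>i. Suc i < length s \<and> s ! i = s ! Suc i"
  proof (rule ccontr)
    assume h: "\<not> ?thesis"
    have "s ! i < s ! Suc i" if "Suc i < length s" for i
      using h that s(2) sorted_nth_mono[of s i "Suc i"] by force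
    then have "strict s" by (simp add: sorted_wrt_iff_nth_Suc_transp)
    then show False using ns by simp
  qed
  then obtain i where i: "Suc i < length s" "s ! i = s ! Suc i" by blast
  then obtain m where m: "k = Suc m" "i \<le> m" using s by (cases k) auto
  define y where "y = map ((!) s) ([0..<Suc i] @ [Suc (Suc i)..<length s])"
  have yn: "y ! t = (if t \<le> i then s ! t else s ! Suc t)" if "t \<le> m" for t
    using that m s unfolding y_def by (auto simp: nth_append simp del: upt_Suc)
  have yl: "length y = Suc m" unfolding y_def using m s by auto
  have "sorted ([0..<Suc i] @ [Suc (Suc i)..<length s])" by (auto simp: sorted_append simp del: upt_Suc)
  then have "sorted y"
    unfolding y_def by (rule sorted_map_mono) (use s(2) i in \<open>auto intro!: sorted_nth_mono\<close>)
  moreover have "set y \<subseteq> set s" unfolding y_def using i by auto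
  ultimately have "y \<in> splx (Delta N) m" using s yl by (auto simp: Delta_def)
  moreover have "s = map ((!) y) (codegeneracy m i)"
  proof (rule nth_equalityI)
    show "length s = length (map ((!) y) (codegeneracy m i))" using s m by (simp add: codegeneracy_def)
    fix t assume t: "t < length s"
    then show "s ! t = map ((!) y) (codegeneracy m i) ! t"
      using yn s m i by (cases "t = Suc i") (auto simp: codegeneracy_def nth_append simp del: upt_Suc)
  qed
  ultimately show "s \<in> degenerate (Delta N) k"
    unfolding degenerate_def using m by (auto simp: Delta_def Delta_comp_def)
qed

lemma chain_of_push: "s \<in> splx (Delta N) k \<Longrightarrow> chain_of (Delta N) k s = push s"
  by (simp add: chain_of_def push_def degenerate_Delta)

lemma nondegenerate_Delta: "v \<in> nondegenerate (Delta (int n)) k \<longleftrightarrow> v \<in> Dl n \<and> length v = Suc k"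
  unfolding nondegenerate_def using degenerate_Delta[of v "int n" k] splx_Delta[of v n k]
  by (auto simp: Dv_def strict_iff)

lemma pos_chains_iff: "c \<in> pos_chains (Delta (int n)) k \<longleftrightarrow> pos c \<and> (\<forall>v\<in>supp c. v \<in> Dl n \<and> length v = Suc k)"
proof
  assume "c \<in> pos_chains (Delta (int n)) k"
  then show "pos c \<and> (\<forall>v\<in>supp c. v \<in> Dl n \<and> length v = Suc k)"
    by induction (auto simp: nondegenerate_Delta pos_add dest!: supp_add_sub)
next
  assume h: "pos c \<and> (\<forall>v\<in>supp c. v \<in> Dl n \<and> length v = Suc k)"
  then obtain rs where rs: "c = (\<Sum>r\<leftarrow>rs. frag_of r)" "set rs \<subseteq> supp c" using chain_list by blast
  have "\<forall>r\<in>set rs. r \<in> nondegenerate (Delta (int n)) k" using rs(2) h nondegenerate_Delta by blast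
  then have "(\<Sum>r\<leftarrow>rs. frag_of r) \<in> pos_chains (Delta (int n)) k"
    by (induction rs) (auto intro: pos_chains.intros)
  then show "c \<in> pos_chains (Delta (int n)) k" using rs by simp
qed

lemma frag_cmul_cone: "cone a (frag_cmul c d) = frag_cmul c (cone a d)"
  unfolding cone_def by (rule frag_extend_cmul)

lemma cone_sum: "cone a (\<Sum>i\<in>S. f i) = (\<Sum>i\<in>S. cone a (f i))"
  by (induction S rule: infinite_finite_induct) auto

lemma dl_sum: "dl v = (\<Sum>i<length v. frag_cmul ((-1) ^ i) (frag_of (take i v @ drop (Suc i) v)))"
proof (induction v)
  case (Cons a w)
  have "cone a (dl w) = (\<Sum>i<length w. frag_cmul ((-1) ^ i) (frag_of (a # take i w @ drop (Suc i) w)))"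
    unfolding Cons.IH cone_sum by (simp add: frag_cmul_cone)
  then show ?case by (simp add: sum.lessThan_Suc_shift flip: sum_negf del: sum.lessThan_Suc)
qed auto

lemma coface_eq: "length v = Suc k \<Longrightarrow> i \<le> k \<Longrightarrow> map ((!) v) (coface k i) = take i v @ drop (Suc i) v"
  unfolding coface_def by (intro nth_equalityI) (auto simp: nth_append simp del: upt_Suc)

lemma strict_delete: "strict v \<Longrightarrow> strict (take i v @ drop (Suc i) v)"
proof (induction v arbitrary: i)
  case (Cons a w)
  then show ?case
    by (cases i) (auto dest: in_set_takeD in_set_dropD)
qed auto

lemma boundary_bnd:
  assumes "\<And>v. v \<in> supp c \<Longrightarrow> v \<in> Dl n \<and> length v = Suc (Suc k)"
  shows "boundary (Delta (int n)) k c = bnd c"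
  unfolding boundary_def bnd_def
proof (rule frag_extend_eq)
  fix v assume "v \<in> supp c"
  then have v: "strict v" "set v \<subseteq> {..n}" "length v = Suc (Suc k)" using assms unfolding Dv_def by auto
  have "chain_of (Delta (int n)) k (act (Delta (int n)) (k + 1) (coface (k + 1) i) v) = frag_of (take i v @ drop (Suc i) v)"
    if "i \<le> k + 1" for i
  proof -
    have e: "act (Delta (int n)) (k + 1) (coface (k + 1) i) v = take i v @ drop (Suc i) v"
      using coface_eq[of v "k + 1" i] v that by (simp add: Delta_def Delta_comp_def)
    have "take i v @ drop (Suc i) v \<in> splx (Delta (int n)) k"
      using v that strict_delete[OF v(1), of i] unfolding splx_Delta strict_iff by (auto dest: in_set_takeD in_set_dropD)
    then show ?thesis unfolding e using chain_of_push strict_delete[OF v(1), of i] by (simp add: push_def)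
  qed
  then have "(\<Sum>i\<le>k + 1. frag_cmul ((-1) ^ i) (chain_of (Delta (int n)) k (act (Delta (int n)) (k + 1) (coface (k + 1) i) v)))
     = (\<Sum>i\<le>k + 1. frag_cmul ((-1) ^ i) (frag_of (take i v @ drop (Suc i) v)))"
    by (intro sum.cong) auto
  also have "\<dots> = dl v" unfolding dl_sum v(3) by (simp add: lessThan_Suc_atMost)
  finally show "(\<Sum>i\<le>k + 1. frag_cmul ((-1) ^ i) (chain_of (Delta (int n)) k (act (Delta (int n)) (k + 1) (coface (k + 1) i) v))) = dl v" .
qed

lemma augmentation_bnd:
  assumes "\<And>v. v \<in> supp c \<Longrightarrow> length v = Suc 0"
  shows "augmentation c = 1 \<longleftrightarrow> bnd c = frag_of []"
proof -
  have d: "dl v = frag_of []" if "v \<in> supp c" for v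
    using assms[OF that] by (cases v) auto
  have "bnd c = frag_extend (\<lambda>_. frag_of []) c"
    unfolding bnd_def by (rule frag_extend_eq) (rule d)
  also have "\<dots> = (\<Sum>v\<in>supp c. frag_cmul (coef c v) (frag_of []))" unfolding frag_extend_def by simp
  also have "\<dots> = frag_cmul (\<Sum>v\<in>supp c. coef c v) (frag_of [])"
  proof -
    have "(\<Sum>v\<in>S. frag_cmul (coef c v) (frag_of [])) = frag_cmul (\<Sum>v\<in>S. coef c v) (frag_of [])" for S
      by (induction S rule: infinite_finite_induct) (simp_all add: frag_cmul_distrib)
    then show ?thesis .
  qed
  finally have e: "bnd c = frag_cmul (augmentation c) (frag_of [])" unfolding augmentation_def .
  show ?thesis
  proof
    assume "bnd c = frag_of []"
    from arg_cong[OF trans[OF e[symmetric] this], of "\<lambda>c. coef c []"] show "augmentation c = 1" by simp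
  qed (use e in simp)
qed

text \<open>On increasing lists \<open>bnd\<close> is the normalized boundary, extended by the
  augmentation. The agreement of the two entries of index \<open>p\<close> is the boundary equation
  with zero in index p + 1.\<close>

lemma oriental_cell_iff: "x \<in> oriental_cell n p \<longleftrightarrow> x \<in> Cell (Dl n) \<and> (\<forall>k>p. \<forall>\<alpha>. x k \<alpha> = 0)"
proof
  assume h: "x \<in> oriental_cell n p"
  have z: "\<forall>k>p. \<forall>\<alpha>. x k \<alpha> = 0" using h unfolding oriental_cell_def by blast
  have 1: "pos (x k \<alpha>) \<and> (\<forall>v\<in>supp (x k \<alpha>). v \<in> Dl n \<and> length v = Suc k)" for k \<alpha>
    using h z unfolding oriental_cell_def pos_chains_iff by (cases "k \<le> p") auto
  have "bnd (x (Suc k) \<alpha>) = x k Plus - x k Minus" for k \<alpha>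
  proof -
    consider "k < p" | "k = p" | "p < k" by linarith
    then show ?thesis
    proof cases
      case 1
      then show ?thesis using h boundary_bnd[of "x (Suc k) \<alpha>" n k] \<open>\<And>k \<alpha>. pos (x k \<alpha>) \<and> _ k \<alpha>\<close>
        unfolding oriental_cell_def by auto
    next
      case 2
      then show ?thesis using h z unfolding oriental_cell_def by auto
    next
      case 3 then show ?thesis using z by auto
    qed
  qed
  moreover have "bnd (x 0 \<alpha>) = frag_of []" for \<alpha>
    using h augmentation_bnd[of "x 0 \<alpha>"] 1 unfolding oriental_cell_def by auto
  ultimately show "x \<in> Cell (Dl n) \<and> (\<forall>k>p. \<forall>\<alpha>. x k \<alpha> = 0)" using 1 z unfolding Cell_def by blast
next
  assume h: "x \<in> Cell (Dl n) \<and> (\<forall>k>p. \<forall>\<alpha>. x k \<alpha> = 0)"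
  note C = CellD[OF conjunct1[OF h]]
  have "boundary (Delta (int n)) k (x (k + 1) \<alpha>) = x k Plus - x k Minus" for k \<alpha>
    using boundary_bnd[of "x (k + 1) \<alpha>" n k] C(2-4) by simp
  moreover have "augmentation (x 0 \<alpha>) = 1" for \<alpha>
    using augmentation_bnd[of "x 0 \<alpha>"] C(3,5) by simp
  moreover have "x p Minus = x p Plus"
    using C(4)[of p Minus] h by simp
  ultimately show "x \<in> oriental_cell n p"
    unfolding oriental_cell_def pos_chains_iff using h C(1-3) by blast
qed

lemma oriental_sel [simp]: "cell (oriental n) = oriental_cell n" "bd (oriental n) \<alpha> p k x = table_bd \<alpha> k x"
  "cmp (oriental n) p k x y = tcm k x y" "idn (oriental n) p q x = x"
  by (simp_all add: oriental_def tcm_def)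

lemma oriental_map_pm:
  assumes "\<theta> \<in> Delta_hom m n" "x \<in> Cell (Dl m)"
  shows "oriental_map n \<theta> x = pm ((!) \<theta>) x"
proof (intro ext)
  fix k \<alpha>
  show "oriental_map n \<theta> x k \<alpha> = pm ((!) \<theta>) x k \<alpha>"
    unfolding oriental_map_def pm_def pshc_def
  proof (rule frag_extend_eq)
    fix v assume "v \<in> supp (x k \<alpha>)"
    then have v: "v \<in> Dl m" "length v = Suc k" using CellD(2,3)[OF assms(2)] by blast+
    have "sorted (map ((!) \<theta>) v)"
      using v(1) assms(1) unfolding Dv_def Delta_hom_def strict_iff
      by (intro sorted_map_mono) (auto intro!: sorted_nth_mono)
    moreover have "set (map ((!) \<theta>) v) \<subseteq> {..n}"
    proof
      fix a assume "a \<in> set (map ((!) \<theta>) v)"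
      then obtain b where b: "b \<in> set v" "a = \<theta> ! b" by auto
      then have "b < length \<theta>" using v(1) assms(1) unfolding Dv_def Delta_hom_def by auto
      then show "a \<in> {..n}" using b assms(1) nth_mem unfolding Delta_hom_def by blast
    qed
    ultimately show "chain_of (Delta (int n)) k (Delta_comp \<theta> v) = push (map ((!) \<theta>) v)"
      using v chain_of_push[of "map ((!) \<theta>) v" "int n" k] by (simp add: Delta_comp_def splx_Delta)
  qed
qed

lemma Delta_hom_mono:
  assumes "\<theta> \<in> Delta_hom m n"
  shows "a \<in> {..m} \<Longrightarrow> b \<in> {..m} \<Longrightarrow> a \<le> b \<Longrightarrow> \<theta> ! a \<le> \<theta> ! b" "(!) \<theta> ` {..m} \<subseteq> {..n}"
proof -
  show "a \<in> {..m} \<Longrightarrow> b \<in> {..m} \<Longrightarrow> a \<le> b \<Longrightarrow> \<theta> ! a \<le> \<theta> ! b"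
    using assms unfolding Delta_hom_def by (auto intro: sorted_nth_mono)
  have "\<theta> ! a \<in> {..n}" if "a \<le> m" for a
  proof -
    have "\<theta> ! a \<in> set \<theta>" using assms that unfolding Delta_hom_def by simp
    then show ?thesis using assms unfolding Delta_hom_def by blast
  qed
  then show "(!) \<theta> ` {..m} \<subseteq> {..n}" by auto
qed

lemma oriental_map_Cell:
  assumes "\<theta> \<in> Delta_hom m n" "x \<in> Cell (Dl m)"
  shows "oriental_map n \<theta> x \<in> Cell (Dl n)"
  unfolding oriental_map_pm[OF assms] using pm_Cell[OF Delta_hom_mono[OF assms(1)] assms(2)] by blast

section \<open>The Street nerve in terms of single-sorted functors\<close>

definition dimt :: "table \<Rightarrow> nat" where
  "dimt x = (LEAST p. \<forall>k>p. \<forall>\<alpha>. x k \<alpha> = 0)"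

lemma dimt: assumes "x \<in> Cell P" shows "\<forall>k>dimt x. \<forall>\<alpha>. x k \<alpha> = 0"
  "(\<forall>k>p. \<forall>\<alpha>. x k \<alpha> = 0) \<Longrightarrow> dimt x \<le> p"
proof -
  obtain p where "\<forall>k>p. \<forall>\<alpha>. x k \<alpha> = 0" using CellD(6)[OF assms] by blast
  then show "\<forall>k>dimt x. \<forall>\<alpha>. x k \<alpha> = 0" unfolding dimt_def by (rule LeastI)
qed (auto simp: dimt_def intro: Least_le)

context strict_omega_category
begin

abbreviation "NC \<equiv> street_nerve C"

text \<open>The least dimension merely fixes a choice: functors preserve units and tables do not
  distinguish a cell from its units, so any dimension of \<open>x\<close> gives the same result by
  \<open>Fh_at\<close>.\<close>

definition Fh :: "(nat \<Rightarrow> table \<Rightarrow> 'a) \<Rightarrow> table \<Rightarrow> nat \<Rightarrow> sign \<Rightarrow> 'a" where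
  "Fh f x = hatT C (dimt x) (f (dimt x) x)"

text \<open>Inverse to \<open>Fh\<close>: a cell is read off from its table at its own dimension,
  where both signs give the cell itself.\<close>

definition mk :: "nat \<Rightarrow> (table \<Rightarrow> nat \<Rightarrow> sign \<Rightarrow> 'a) \<Rightarrow> nat \<Rightarrow> table \<Rightarrow> 'a" where
  "mk n F p = restrict (\<lambda>x. F x p Minus) (oriental_cell n p)"

lemma nerve_functor:
  assumes "f \<in> splx NC n"
  shows "x \<in> oriental_cell n p \<Longrightarrow> f p x \<in> cell C p"
    "k < p \<Longrightarrow> x \<in> oriental_cell n p \<Longrightarrow> f k (table_bd \<alpha> k x) = bd C \<alpha> p k (f p x)"
    "composable (oriental n) p k x y \<Longrightarrow> f p (tcm k x y) = cmp C p k (f p x) (f p y)"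
    "p < q \<Longrightarrow> x \<in> oriental_cell n p \<Longrightarrow> f q x = idn C p q (f p x)"
    "f p \<in> extensional (oriental_cell n p)"
  using assms unfolding street_nerve_def omega_functor_def by auto

lemma Fh_at:
  assumes "f \<in> splx NC n" "x \<in> oriental_cell n p"
  shows "Fh f x = hatT C p (f p x)"
proof -
  have x: "x \<in> Cell (Dl n)" using assms(2) oriental_cell_iff by blast
  have d: "x \<in> oriental_cell n (dimt x)" "dimt x \<le> p"
    using dimt[OF x] assms(2) x oriental_cell_iff by blast+
  show ?thesis
  proof (cases "dimt x = p")
    case False
    then have "f p x = idn C (dimt x) p (f (dimt x) x)" using nerve_functor(4)[OF assms(1)] d by simp
    then show ?thesis unfolding Fh_def using hatT_idn nerve_functor(1)[OF assms(1) d(1)] False d by simp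
  qed (simp add: Fh_def)
qed

lemma Cell_oriental: assumes "x \<in> Cell (Dl n)" "y \<in> Cell (Dl n)"
  obtains p where "k < p" "x \<in> oriental_cell n p" "y \<in> oriental_cell n p"
proof -
  have "x \<in> oriental_cell n (max (Suc k) (max (dimt x) (dimt y)))" "y \<in> oriental_cell n (max (Suc k) (max (dimt x) (dimt y)))"
    using dimt(1)[OF assms(1)] dimt(1)[OF assms(2)] assms unfolding oriental_cell_iff by auto
  then show ?thesis using that[of "max (Suc k) (max (dimt x) (dimt y))"] by simp
qed

lemma nerve_tfun:
  assumes f: "f \<in> splx NC n"
  shows "hat.tfun (Dl n) (Fh f)"
  unfolding hat.tfun_def
proof (intro conjI ballI allI impI)
  fix x assume x: "x \<in> Cell (Dl n)"
  obtain p where p: "x \<in> oriental_cell n p" using Cell_oriental x by blast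
  show "Fh f x \<in> hatA C" using Fh_at[OF f p] nerve_functor(1)[OF f p] hatT_in by simp
next
  fix x \<alpha> k assume x: "x \<in> Cell (Dl n)"
  obtain p where p: "k < p" "x \<in> oriental_cell n p" using Cell_oriental x by blast
  have t: "table_bd \<alpha> k x \<in> oriental_cell n k"
    using scat.D_in[OF scat_Cell x] unfolding oriental_cell_iff by (auto simp: table_bd_def)
  show "Fh f (table_bd \<alpha> k x) = hatD C \<alpha> k (Fh f x)"
    using Fh_at[OF f p(2)] Fh_at[OF f t] nerve_functor(1,2)[OF f] p hatD_hatT by simp
next
  fix k x y assume h: "x \<in> Cell (Dl n)" "y \<in> Cell (Dl n)" "table_bd Plus k y = table_bd Minus k x"
  obtain p where p: "k < p" "x \<in> oriental_cell n p" "y \<in> oriental_cell n p" using Cell_oriental h by blast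
  have co: "composable (oriental n) p k x y" using p h unfolding composable_def by simp
  have t: "tcm k x y \<in> oriental_cell n p"
    using scat.cm_in[OF scat_Cell h] p tcm_simps(4)[OF h(3)] unfolding oriental_cell_iff by auto
  have "composable C p k (f p x) (f p y)"
    using p nerve_functor(1,2)[OF f] h(3) unfolding composable_def by metis
  then show "Fh f (tcm k x y) = hatC C k (Fh f x) (Fh f y)"
    using Fh_at[OF f p(2)] Fh_at[OF f p(3)] Fh_at[OF f t] nerve_functor(3)[OF f co] hatC_hatT by simp
qed

lemma mk_at:
  assumes "hat.tfun (Dl n) F" "x \<in> oriental_cell n p"
  shows "mk n F p x \<in> cell C p" "F x = hatT C p (mk n F p x)"
proof -
  have "F x \<in> hat.cells p" using hat.tfun_cells[OF assms(1)] assms(2) oriental_cell_iff by blast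
  then obtain c where "c \<in> cell C p" "F x = hatT C p c" using hat_cells by blast
  then show "mk n F p x \<in> cell C p" "F x = hatT C p (mk n F p x)" unfolding mk_def using assms(2) by simp_all
qed

lemma mk_splx:
  assumes F: "hat.tfun (Dl n) F"
  shows "mk n F \<in> splx NC n"
proof -
  have "omega_functor (oriental n) C (mk n F)"
    unfolding omega_functor_def
  proof (intro conjI allI impI ballI)
    show "mk n F p \<in> cell (oriental n) p \<rightarrow> cell C p" for p using mk_at[OF F] by auto
    fix \<alpha> p k x assume h: "k < p" "x \<in> cell (oriental n) p"
    then have x: "x \<in> oriental_cell n p" "x \<in> Cell (Dl n)" using oriental_cell_iff by auto
    have t: "table_bd \<alpha> k x \<in> oriental_cell n k"
      using scat.D_in[OF scat_Cell x(2)] unfolding oriental_cell_iff by (auto simp: table_bd_def)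
    have "hatT C k (mk n F k (table_bd \<alpha> k x)) = hatD C \<alpha> k (hatT C p (mk n F p x))"
      using mk_at(2)[OF F t] mk_at(2)[OF F x(1)] hat.tfunD(2)[OF F x(2), of \<alpha> k] by simp
    also have "\<dots> = hatT C k (bd C \<alpha> p k (mk n F p x))" using mk_at(1)[OF F x(1)] h by (simp add: hatD_hatT)
    finally show "mk n F k (bd (oriental n) \<alpha> p k x) = bd C \<alpha> p k (mk n F p x)" using hatT_inj by simp
  next
    fix p k x y assume co: "composable (oriental n) p k x y"
    then have h: "k < p" "x \<in> oriental_cell n p" "y \<in> oriental_cell n p" "table_bd Plus k y = table_bd Minus k x"
      "x \<in> Cell (Dl n)" "y \<in> Cell (Dl n)"
      unfolding composable_def using oriental_cell_iff by auto
    have t: "tcm k x y \<in> oriental_cell n p"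
      using scat.cm_in[OF scat_Cell h(5,6,4)] h tcm_simps(4)[OF h(4)] unfolding oriental_cell_iff by auto
    have "hatD C Plus k (hatT C p (mk n F p y)) = hatD C Minus k (hatT C p (mk n F p x))"
      using hat.tfun_comp[OF F h(5,6,4)] mk_at(2)[OF F h(2)] mk_at(2)[OF F h(3)] by simp
    then have c: "composable C p k (mk n F p x) (mk n F p y)"
      using hat_composable mk_at(1)[OF F] h by blast
    have "hatT C p (mk n F p (tcm k x y)) = hatC C k (hatT C p (mk n F p x)) (hatT C p (mk n F p y))"
      using mk_at(2)[OF F t] mk_at(2)[OF F h(2)] mk_at(2)[OF F h(3)] hat.tfunD(3)[OF F h(5,6,4)] by simp
    then show "mk n F p (cmp (oriental n) p k x y) = cmp C p k (mk n F p x) (mk n F p y)"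
      using hatC_hatT[OF c] hatT_inj by simp
  next
    fix p q x assume h: "p < q" "x \<in> cell (oriental n) p"
    then have x: "x \<in> oriental_cell n p" "x \<in> oriental_cell n q" unfolding oriental_sel oriental_cell_iff by auto
    have "hatT C q (mk n F q x) = hatT C q (idn C p q (mk n F p x))"
      using mk_at[OF F x(1)] mk_at(2)[OF F x(2)] hatT_idn h by simp
    then show "mk n F q (idn (oriental n) p q x) = idn C p q (mk n F p x)" using hatT_inj by simp
  qed
  then show ?thesis unfolding street_nerve_def mk_def by auto
qed

lemma Fh_mk:
  assumes F: "hat.tfun (Dl n) F" and x: "x \<in> Cell (Dl n)"
  shows "Fh (mk n F) x = F x"
proof -
  obtain p where p: "x \<in> oriental_cell n p" using Cell_oriental x by blast
  show ?thesis using Fh_at[OF mk_splx[OF F] p] mk_at(2)[OF F p] by simp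
qed

lemma nerve_eqI:
  assumes "f \<in> splx NC n" "g \<in> splx NC n" "\<And>x. x \<in> Cell (Dl n) \<Longrightarrow> Fh f x = Fh g x"
  shows "f = g"
proof
  fix p
  show "f p = g p"
  proof (rule extensionalityI[of _ "oriental_cell n p"])
    fix x assume x: "x \<in> oriental_cell n p"
    then have "Fh f x = Fh g x" using assms(3) oriental_cell_iff by blast
    then show "f p x = g p x" using Fh_at[OF assms(1) x] Fh_at[OF assms(2) x] hatT_inj by simp
  qed (use nerve_functor(5) assms in blast)+
qed

lemma nerve_act:
  assumes f: "f \<in> splx NC n" and t: "\<theta> \<in> Delta_hom m n"
  shows "act NC n \<theta> f \<in> splx NC m" "x \<in> Cell (Dl m) \<Longrightarrow> Fh (act NC n \<theta> f) x = Fh f (pm ((!) \<theta>) x)"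
proof -
  define F where "F x = Fh f (pm ((!) \<theta>) x)" for x
  have F: "hat.tfun (Dl m) F"
    unfolding F_def using hat.tfun_pm[OF nerve_tfun[OF f] Delta_hom_mono[OF t]] by blast
  have lt: "length \<theta> - 1 = m" using t by (simp add: Delta_hom_def)
  have "act NC n \<theta> f = mk m F"
  proof (intro ext)
    fix p x
    show "act NC n \<theta> f p x = mk m F p x"
    proof (cases "x \<in> oriental_cell m p")
      case True
      then have x: "x \<in> Cell (Dl m)" "\<forall>k>p. \<forall>\<alpha>. x k \<alpha> = 0" using oriental_cell_iff by auto
      have e: "oriental_map n \<theta> x = pm ((!) \<theta>) x" using oriental_map_pm[OF t x(1)] .
      have "pm ((!) \<theta>) x \<in> oriental_cell n p"
        using oriental_map_Cell[OF t x(1)] x(2) unfolding e oriental_cell_iff by (simp add: pm_def)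
      then have "F x = hatT C p (f p (pm ((!) \<theta>) x))" unfolding F_def using Fh_at[OF f] by blast
      then show ?thesis using True by (simp add: street_nerve_def lt[simplified] mk_def e)
    next
      case False
      then show ?thesis by (simp add: street_nerve_def lt[simplified] mk_def)
    qed
  qed
  then show "act NC n \<theta> f \<in> splx NC m" "x \<in> Cell (Dl m) \<Longrightarrow> Fh (act NC n \<theta> f) x = Fh f (pm ((!) \<theta>) x)"
    using mk_splx[OF F] Fh_mk[OF F] F_def by simp_all
qed

lemma Delta_comp_hom: "\<theta> \<in> Delta_hom m n \<Longrightarrow> \<phi> \<in> Delta_hom l m \<Longrightarrow> Delta_comp \<theta> \<phi> \<in> Delta_hom l n"
proof -
  assume h: "\<theta> \<in> Delta_hom m n" "\<phi> \<in> Delta_hom l m"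
  have "sorted (map ((!) \<theta>) \<phi>)"
    using h unfolding Delta_hom_def by (intro sorted_map_mono) (auto intro!: sorted_nth_mono)
  then show "Delta_comp \<theta> \<phi> \<in> Delta_hom l n"
    using h Delta_hom_mono(2)[OF h(1)] unfolding Delta_hom_def Delta_comp_def by auto
qed

lemma Delta_id_hom: "Delta_id n \<in> Delta_hom n n"
  by (auto simp: Delta_hom_def Delta_id_def sorted_append)

lemma simplicial_nerve: "simplicial_set NC"
  unfolding simplicial_set_def
proof (intro conjI allI ballI)
  show "act NC n \<theta> \<in> splx NC n \<rightarrow> splx NC m" if "\<theta> \<in> Delta_hom m n" for m n \<theta>
    using nerve_act(1) that by blast
next
  fix n f assume f: "f \<in> splx NC n"
  show "act NC n (Delta_id n) f = f"
  proof (rule nerve_eqI[of _ n])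
    fix x assume x: "x \<in> Cell (Dl n)"
    have "pm ((!) (Delta_id n)) x = x" by (rule pm_id[OF x]) (auto simp: Delta_id_def simp del: upt_Suc)
    then show "Fh (act NC n (Delta_id n) f) x = Fh f x" using nerve_act(2)[OF f Delta_id_hom x] by simp
  qed (use nerve_act(1)[OF f Delta_id_hom] f in auto)
next
  fix l m n \<theta> \<phi> f assume h: "\<theta> \<in> Delta_hom m n" "\<phi> \<in> Delta_hom l m" "f \<in> splx NC n"
  note c = Delta_comp_hom[OF h(1,2)]
  show "act NC m \<phi> (act NC n \<theta> f) = act NC n (Delta_comp \<theta> \<phi>) f"
  proof (rule nerve_eqI[of _ l])
    fix x assume x: "x \<in> Cell (Dl l)"
    have "pm ((!) \<theta>) (pm ((!) \<phi>) x) = pm ((!) \<theta> \<circ> (!) \<phi>) x"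
      by (rule pm_comp[OF Delta_hom_mono(1)[OF h(2)] x])
    also have "\<dots> = pm ((!) (Delta_comp \<theta> \<phi>)) x"
      using h(2) by (intro pm_cong[OF x]) (auto simp: Delta_comp_def Delta_hom_def)
    finally have e: "pm ((!) \<theta>) (pm ((!) \<phi>) x) = pm ((!) (Delta_comp \<theta> \<phi>)) x" .
    have "pm ((!) \<phi>) x \<in> Cell (Dl m)" using pm_Cell[OF Delta_hom_mono[OF h(2)] x] by blast
    then show "Fh (act NC m \<phi> (act NC n \<theta> f)) x = Fh (act NC n (Delta_comp \<theta> \<phi>) f) x"
      using nerve_act(2)[OF nerve_act(1)[OF h(3,1)] h(2) x] nerve_act(2)[OF h(3,1)] nerve_act(2)[OF h(3) c x] e by simp
  qed (use nerve_act(1) h c in blast)+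
qed

end

section \<open>Cells containing a top-dimensional simplex\<close>

lemma single_down_ex:
  assumes "x \<in> Cell P" "complex P" "blk P (Suc m) bs x" "length bs \<le> 1"
  shows "\<exists>rs. blk P m (bs @ rs) x \<and> (\<forall>r\<in>set rs. length r = Suc m) \<and>
    x m Minus = bsum bs m Minus + (\<Sum>r\<leftarrow>rs. frag_of r)"
  by (rule single_down[OF assms]) blast

lemma hd_minus: "u \<in> supp (atom b j Minus) \<Longrightarrow> hd u = hd b"
  by (cases b; cases j) (auto simp: supp_cone)

lemma tl_plus: "length r = Suc (Suc j) \<Longrightarrow> tl r \<in> supp (atom r j Plus)"
proof (cases r; cases j)
  fix a w i assume h: "length r = Suc (Suc j)" "r = a # w" "j = Suc i"
  then have "atom r j Plus = frag_of w + cone a (atom w i Minus)" by (simp add: atom_top)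
  then have "coef (atom r j Plus) w \<ge> 1"
    using posD[OF pos_cone[OF atom_pos[of w i Minus]], of a w] by (simp add: lookup_add)
  then show "tl r \<in> supp (atom r j Plus)" using h by (simp add: in_keys_iff)
qed (auto simp: atom_top)

text \<open>All simplices in a source of \<open>b\<close> start with the first vertex of
  \<open>b\<close>, whereas the target of \<open>r\<close> contains \<open>tl r\<close>, which
  starts with a later vertex.\<close>

lemma no_before:
  assumes "strict b" "strict r" "length r = Suc (Suc j)" "set r \<subseteq> set b"
    "supp (atom r j Plus) \<subseteq> supp (atom b j Minus)"
  shows False
proof -
  have "hd (tl r) = hd b" using tl_plus[OF assms(3)] assms(5) hd_minus by blast
  moreover obtain x y w where r: "r = x # y # w" using assms(3) by (cases r; cases "tl r") auto
  moreover obtain c b' where b: "b = c # b'" using assms(4) r by (cases b) auto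
  ultimately show False using assms(1,2,4) by auto
qed

text \<open>Targets have no uniform first vertex, so \<open>b\<close> is taken apart. If
  \<open>r\<close> avoids the first vertex \<open>a\<close>, everything takes place in the tail; if
  \<open>r\<close> starts with \<open>a\<close>, removing \<open>a\<close> exchanges signs and leads
  to \<open>no_before\<close>. In dimension 0 the target is the last vertex, from which no edge
  starts.\<close>

lemma no_after:
  "\<lbrakk>strict b; strict r; length r = Suc (Suc j); set r \<subseteq> set b; supp (atom r j Minus) \<subseteq> supp (atom b j Plus)\<rbrakk> \<Longrightarrow> False"
proof (induction b arbitrary: r j)
  case (Cons a w)
  obtain x y r' where r: "r = x # y # r'" using Cons.prems(3) by (cases r; cases "tl r") auto
  show ?case
  proof (cases j)
    case 0
    then have "[x] = [last (a # w)]" using Cons.prems(5) r by (auto simp: atom_0 split: if_splits)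
    moreover have "z \<le> last (a # w)" if "z \<in> set (a # w)" for z
      using that Cons.prems(1) by (induction w arbitrary: a z) (auto, force+)
    moreover have "y \<in> set (a # w)" "x < y" using Cons.prems(2,4) r by auto
    ultimately show False by fastforce
  next
    case (Suc i)
    show ?thesis
    proof (cases "x = a")
      case False
      have xw: "set r \<subseteq> set w"
      proof
        fix z assume "z \<in> set r"
        moreover have "a < x" using Cons.prems(1,4) r False by auto
        ultimately have "a < z" "z \<in> set (a # w)" using Cons.prems(2,4) r by auto
        then show "z \<in> set w" by auto
      qed
      have "supp (atom r j Minus) \<subseteq> supp (atom w j Plus)"
      proof
        fix u assume u: "u \<in> supp (atom r j Minus)"
        then have "hd u = x" using hd_minus r by fastforce
        moreover have "u \<in> supp (atom w j Plus) \<or> u \<in> supp (cone a (atom w i Minus))"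
          using u Cons.prems(5) Suc by (auto dest!: supp_add_sub)
        ultimately show "u \<in> supp (atom w j Plus)" using False by (auto simp: supp_cone)
      qed
      then show False using Cons.IH[OF _ Cons.prems(2,3) xw] Cons.prems(1) by simp
    next
      case True
      have "supp (atom (y # r') i Plus) \<subseteq> supp (atom w i Minus)"
      proof
        fix u assume "u \<in> supp (atom (y # r') i Plus)"
        then have "a # u \<in> supp (atom r j Minus)" using r True Suc by (simp add: supp_cone)
        then have "a # u \<in> supp (atom w j Plus) \<or> a # u \<in> supp (cone a (atom w i Minus))"
          using Cons.prems(5) Suc by (auto dest!: supp_add_sub)
        moreover have "a # u \<notin> supp (atom w j Plus)" using atom_supp[of "a # u" w j Plus] Cons.prems(1) by auto
        ultimately show "u \<in> supp (atom w i Minus)" by (auto simp: supp_cone)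
      qed
      moreover have "set (y # r') \<subseteq> set w" using Cons.prems(1,2,4) r True by auto
      ultimately show False
        using no_before[of w "y # r'" i] Cons.prems(1-3) r Suc by auto
    qed
  qed
qed auto

lemma supp_le: "pos c \<Longrightarrow> (\<And>v. coef c v \<le> coef d v) \<Longrightarrow> supp c \<subseteq> supp d"
proof
  fix v assume h: "pos c" "\<And>v. coef c v \<le> coef d v" "v \<in> supp c"
  have "coef c v \<noteq> 0" using h(3) by (simp add: in_keys_iff)
  then have "0 < coef d v" using h(2)[of v] posD[OF h(1), of v] by linarith
  then show "v \<in> supp d" by (simp add: in_keys_iff)
qed

text \<open>The whisker next to the block would have its target inside the source of
  \<open>atom b\<close>, or its source inside the target. Both are excluded by
  \<open>no_before\<close> and \<open>no_after\<close>, so no block is added on the way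
  down.\<close>

lemma top_unique:
  assumes b: "strict b" "b \<noteq> []"
  shows "x \<in> Cell (Dv (set b)) \<Longrightarrow> blk (Dv (set b)) m [b] x \<Longrightarrow> x = atom b"
proof (induction m arbitrary: x)
  case 0
  then show ?case using blk0_atom by force
next
  case (Suc m)
  define P where "P = Dv (set b)"
  have P: "complex P" unfolding P_def by (rule complex_Dv)
  have x: "x \<in> Cell P" "blk P (Suc m) [b] x" using Suc.prems P_def by auto
  have lb: "Suc m < length b" using x(2) unfolding blk_def by auto
  obtain rs where rs: "blk P m ([b] @ rs) x" "\<forall>r\<in>set rs. length r = Suc m"
    using single_down_ex[OF x(1) P x(2)] by auto
  show ?case
  proof (cases m)
    case 0
    then have "length ([b] @ rs) = 1" using blk_length0 x rs by blast
    then show ?thesis using Suc.IH Suc.prems rs 0 P_def by auto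
  next
    case (Suc j)
    have IH: "y = atom b" if "y \<in> Cell P" "blk P (Suc j) [b] y" for y using Suc.IH that Suc P_def by blast
    have rP: "strict r \<and> set r \<subseteq> set b \<and> length r = Suc (Suc j)" if "r \<in> set rs" for r
      using rs that Suc unfolding blk_def P_def Dv_def by auto
    obtain cs where cs: "mset cs = mset ([b] @ rs)" "sorted_wrt le cs" using sort_ex by blast
    have bcs: "blk P (Suc j) cs x" using blk_mset[OF rs(1) cs(1)[symmetric]] Suc by simp
    have "b \<in> set cs" using mset_eq_setD[OF cs(1)] by simp
    then obtain cs1 cs2 where c12: "cs = cs1 @ b # cs2" by (meson split_list)
    have s12: "set cs1 \<union> set cs2 \<subseteq> set rs" using cs(1) unfolding c12
      by (metis add_mset_add_single append_Cons append_Nil mset.simps(2) mset_append set_mset_mset set_mset_union subset_refl union_mset_add_mset_right add_mset_remove_trivial add_mset_add_mset_same_iff)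
    have "cs1 = []"
    proof (rule ccontr)
      assume "cs1 \<noteq> []"
      \<comment> \<open>The block \<open>r\<close> immediately before \<open>b\<close> is brought
        into contact with it by successive splits; by the induction hypothesis the part with block
        \<open>b\<close> is \<open>atom b\<close>.\<close>
      then obtain ds r where d: "cs1 = ds @ [r]" by (metis rev_exhaust)
      have r: "strict r" "set r \<subseteq> set b" "length r = Suc (Suc j)" using rP s12 d by auto
      have b1: "blk P (Suc j) ((ds @ [r] @ [b]) @ cs2) x" using bcs c12 d by simp
      obtain z where z: "z \<in> Cell P" "blk P (Suc j) (ds @ [r] @ [b]) z"
        by (rule split[OF x(1) P b1]) (use cs(2) c12 d in \<open>auto simp: sorted_wrt_append\<close>)
      have b2: "blk P (Suc j) ((ds @ [r]) @ [b]) z" using z(2) by simp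
      obtain y z' where y: "y \<in> Cell P" "z' \<in> Cell P" "blk P (Suc j) (ds @ [r]) z'" "blk P (Suc j) [b] y"
        "table_bd Plus j z' = table_bd Minus j y"
        by (rule split[OF z(1) P b2]) (use cs(2) c12 d in \<open>auto simp: sorted_wrt_append\<close>)
      obtain yr where yr: "yr \<in> Cell P" "blk P (Suc j) [r] yr" "table_bd Plus j yr = table_bd Plus j z'"
        by (rule split[OF y(2) P y(3)]) (use cs(2) c12 d in \<open>auto simp: sorted_wrt_append\<close>)
      have "table_bd Plus j yr = table_bd Minus j (atom b)" using yr(3) y(5) IH[OF y(1,4)] by simp
      then have e: "yr j Plus = atom b j Minus" by (rule table_eq(2))
      have "supp (atom r j Plus) \<subseteq> supp (atom b j Minus)"
        using single_ge[OF yr(1) P yr(2), of Plus] e by (intro supp_le atom_pos) simp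
      then show False using no_before[OF b(1) r(1,3,2)] by blast
    qed
    moreover have "cs2 = []"
    proof (rule ccontr)
      assume "cs2 \<noteq> []"
      then obtain ds r where d: "cs2 = r # ds" by (cases cs2) auto
      have r: "strict r" "set r \<subseteq> set b" "length r = Suc (Suc j)" using rP s12 d by auto
      have b1: "blk P (Suc j) (cs1 @ ([b] @ r # ds)) x" using bcs c12 d by simp
      obtain y where y: "y \<in> Cell P" "blk P (Suc j) ([b] @ r # ds) y"
        by (rule split[OF x(1) P b1]) (use cs(2) c12 d in \<open>auto simp: sorted_wrt_append\<close>)
      obtain y' z where z: "y' \<in> Cell P" "z \<in> Cell P" "blk P (Suc j) [b] z" "blk P (Suc j) (r # ds) y'"
        "table_bd Plus j z = table_bd Minus j y'"
        by (rule split[OF y(1) P y(2)]) (use cs(2) c12 d in \<open>auto simp: sorted_wrt_append\<close>)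
      have b3: "blk P (Suc j) ([r] @ ds) y'" using z(4) by simp
      obtain yr where yr: "yr \<in> Cell P" "blk P (Suc j) [r] yr" "table_bd Minus j yr = table_bd Minus j y'"
        by (rule split[OF z(1) P b3]) (use cs(2) c12 d in \<open>auto simp: sorted_wrt_append\<close>)
      have "table_bd Plus j (atom b) = table_bd Minus j yr" using yr(3) z(5) IH[OF z(2,3)] by simp
      then have e: "atom b j Plus = yr j Minus" by (rule table_eq(2))
      have "supp (atom r j Minus) \<subseteq> supp (atom b j Plus)"
        using single_ge[OF yr(1) P yr(2), of Minus] e by (intro supp_le atom_pos) simp
      then show False using no_after[OF b(1) r(1,3,2)] by blast
    qed
    ultimately show ?thesis using IH[OF x(1)] bcs c12 by simp
  qed
qed

text \<open>In positive dimension two copies of \<open>b\<close> would have to follow each other,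
  making target and source of \<open>atom b\<close> equal, but these are disjoint; in dimension 0
  the augmentation excludes a second copy. A single copy is covered by
  \<open>top_unique\<close>.\<close>

lemma top_cells:
  assumes b: "strict b" "length b = Suc q" and x: "x \<in> Cell (Dv (set b))" "b \<in> supp (x q \<alpha>)"
  shows "x = atom b"
proof -
  define P where "P = Dv (set b)"
  have P: "complex P" unfolding P_def by (rule complex_Dv)
  have bn: "b \<noteq> []" using b by auto
  have bP: "b \<in> P" unfolding P_def Dv_def using b bn by auto
  have long: "v = b" if "v \<in> P" "Suc q \<le> length v" for v
  proof -
    have v: "strict v" "set v \<subseteq> set b" using that unfolding P_def Dv_def by auto
    then have "card (set v) = length v" "card (set b) = length b"
      using b(1) distinct_card unfolding strict_iff by blast+
    then have "set v = set b" using v(2) that(2) b(2) card_seteq[of "set b" "set v"] by simp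
    then show ?thesis using v(1) b(1) sorted_distinct_set_unique[of v b] unfolding strict_iff by blast
  qed
  have xP: "x \<in> Cell P" using x P_def by simp
  have "x k \<beta> = 0" if "Suc q \<le> k" for k \<beta>
  proof (rule ccontr)
    assume "x k \<beta> \<noteq> 0"
    then obtain v where v: "v \<in> supp (x k \<beta>)" by fastforce
    then have "v = b" using long[of v] CellD(2,3)[OF xP v] that by simp
    then show False using CellD(3)[OF xP v] b that by simp
  qed
  then have "blk P (Suc q) [] x" unfolding blk_def by simp
  then obtain rs where rs: "blk P q rs x" "\<forall>r\<in>set rs. length r = Suc q"
    using single_down_ex[OF xP P] by force
  have rb: "r = b" if "r \<in> set rs" for r using that rs long unfolding blk_def by auto
  have "rs \<noteq> []" using x(2) rs(1) unfolding blk_def by auto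
  then obtain rs' where rs': "rs = b # rs'" using rb by (cases rs) auto
  have "rs' = []"
  proof (rule ccontr)
    assume "rs' \<noteq> []"
    then obtain c ds where c: "rs' = c # ds" by (cases rs') blast+
    then have "c = b" using rb rs' by simp
    then have ds: "rs = [b] @ [b] @ ds" using rs' c by simp
    have dsb: "\<forall>d\<in>set ds. d = b" using rb ds by auto
    show False
    proof (cases q)
      case 0
      have "blk P 0 rs x" by (rule rs(1)[unfolded 0])
      from blk_length0[OF xP this] show False unfolding ds by simp
    next
      case (Suc j)
      have b1: "blk P (Suc j) ([b] @ ([b] @ ds)) x" using rs(1) Suc ds by simp
      obtain y z where yz: "y \<in> Cell P" "z \<in> Cell P" "blk P (Suc j) [b] z" "blk P (Suc j) ([b] @ ds) y"
         "table_bd Plus j z = table_bd Minus j y"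
        by (rule split[OF xP P b1]) (use dsb in auto)
      obtain z' where z': "z' \<in> Cell P" "blk P (Suc j) [b] z'" "table_bd Minus j z' = table_bd Minus j y"
        by (rule split[OF yz(1) P yz(4)]) (use dsb in auto)
      have "table_bd Plus j (atom b) = table_bd Minus j (atom b)"
        using top_unique[OF b(1) bn] yz z' unfolding P_def by metis
      then have e: "atom b j Plus = atom b j Minus" by (rule table_eq(2))
      have "tl b \<in> supp (atom b j Plus)" using tl_plus b Suc by simp
      then show False using atom_lt[OF b(1), of j "tl b"] b Suc e lt_asym by auto
    qed
  qed
  then show ?thesis using top_unique[OF b(1) bn] rs rs' xP P_def by auto
qed

lemma Cell_remove:
  assumes "x \<in> Cell P" "\<And>k \<alpha>. b \<notin> supp (x k \<alpha>)" shows "x \<in> Cell (P - {b})"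
  using assms unfolding Cell_def by blast

lemma atom_notin: "b \<noteq> [] \<Longrightarrow> atom b \<notin> Cell (P - {b})"
  using atom_Cell_D by blast

context scat begin

text \<open>The cell of \<open>b\<close> is attached freely to the boundary of the simplex: by
  \<open>top_cells\<close>, \<open>atom b\<close> is the only cell in which \<open>b\<close> occurs,
  so the only composites involving it are those with units.\<close>

lemma top_extend:
  assumes b: "strict b" "length b = Suc q" and F: "tfun (Dv (set b) - {b}) F" and c: "c \<in> cells q"
    and bd: "\<And>p \<alpha>. q = Suc p \<Longrightarrow> D \<alpha> p c = F (table_bd \<alpha> p (atom b))"
  shows "\<exists>F'. tfun (Dv (set b)) F' \<and> (\<forall>x\<in>Cell (Dv (set b) - {b}). F' x = F x) \<and> F' (atom b) = c"
proof -
  define P where "P = Dv (set b)"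
  interpret t: scat "Cell P" table_bd tcm by (rule scat_Cell)
  interpret t': scat "Cell (P - {b})" table_bd tcm by (rule scat_Cell)
  have bn: "b \<noteq> []" using b by auto
  have P: "complex P" unfolding P_def by (rule complex_Dv)
  have bC: "atom b \<in> Cell P" using atom_Cell[OF P] b bn unfolding P_def Dv_def by auto
  have bq: "\<forall>k>q. \<forall>\<alpha>. atom b k \<alpha> = 0" using b by (simp add: atom_zero)
  have cases: "x = atom b \<or> x \<in> Cell (P - {b})" if "x \<in> Cell P" for x
  proof (cases "\<exists>k \<alpha>. b \<in> supp (x k \<alpha>)")
    case True
    then obtain k \<alpha> where k: "b \<in> supp (x k \<alpha>)" by blast
    then have "k = q" using CellD(3)[OF that] b by fastforce
    then show ?thesis using top_cells[OF b] that k P_def by blast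
  qed (use Cell_remove[OF that] in blast)
  have sub: "Cell (P - {b}) \<subseteq> Cell P" by (rule Cell_mono) auto
  define F' where "F' x = (if x = atom b then c else F x)" for x
  have F'F: "F' x = F x" if "x \<in> Cell (P - {b})" for x unfolding F'_def using that atom_notin[OF bn] by auto
  have F'b: "F' (atom b) = c" unfolding F'_def by simp
  have Fp: "tfun (P - {b}) F" using F P_def by simp
  have low: "table_bd \<alpha> k (atom b) \<in> Cell (P - {b})" if "k < q" for k \<alpha>
  proof (rule Cell_remove[OF t.D_in[OF bC]])
    fix j \<beta> show "b \<notin> supp (table_bd \<alpha> k (atom b) j \<beta>)"
      using that atom_supp[of b b j \<beta>] atom_supp[of b b k \<alpha>] b by (auto simp: table_bd_def split: if_splits)
  qed
  have bk: "table_bd \<alpha> k (atom b) = atom b" if "q \<le> k" for \<alpha> k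
    using Cell_stable[OF bC, of k \<alpha>] bq that by simp
  have Dc: "F' (table_bd \<alpha> k (atom b)) = D \<alpha> k c" for \<alpha> k
  proof (cases "k < q")
    case True
    then obtain p where p: "q = Suc p" "k \<le> p" by (cases q) auto
    show ?thesis
    proof (cases "k = p")
      case True
      then show ?thesis using bd[OF p(1), of \<alpha>] F'F[OF low[of k \<alpha>]] p by simp
    next
      case False
      then have kp: "k < p" using p by simp
      have "D \<alpha> k c = D \<alpha> k (D Minus p c)" using D_below[OF cells_in[OF c] kp] by simp
      also have "\<dots> = F (table_bd \<alpha> k (table_bd Minus p (atom b)))"
        using bd[OF p(1), of Minus] tfunD(2)[OF Fp low[of p Minus]] p by simp
      also have "\<dots> = F (table_bd \<alpha> k (atom b))" using t.D_below[OF bC kp] by simp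
      finally show ?thesis using F'F[OF low[OF True]] by simp
    qed
  next
    case False
    then show ?thesis using bk[of k \<alpha>] F'b cells_D[OF c, of k \<alpha>] by simp
  qed
  have F'A: "F' x \<in> A" if "x \<in> Cell P" for x
    using cases[OF that] F'F F'b tfunD(1)[OF Fp] cells_in[OF c] by auto
  have F'D: "F' (table_bd \<alpha> k x) = D \<alpha> k (F' x)" if "x \<in> Cell P" for x \<alpha> k
    using cases[OF that] Dc F'b F'F t'.D_in tfunD(2)[OF Fp] by metis
  have "tfun P F'"
    unfolding tfun_def
  proof (intro conjI ballI allI impI F'A F'D)
    fix k x y assume h: "x \<in> Cell P" "y \<in> Cell P" "table_bd Plus k y = table_bd Minus k x"
    have k: "D Plus k (F' y) = D Minus k (F' x)" using h F'D by metis
    show "F' (tcm k x y) = cm k (F' x) (F' y)"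
    proof (cases "x \<in> Cell (P - {b}) \<and> y \<in> Cell (P - {b})")
      case True
      then show ?thesis using F'F t'.cm_in[of x y k] h(3) tfunD(3)[OF Fp] by metis
    next
      case False
      have dim: "\<forall>k>q. \<forall>\<alpha>. z k \<alpha> = 0" if "z \<in> Cell P" for z
      proof (intro allI impI)
        fix k \<alpha> assume k: "q < k"
        show "z k \<alpha> = 0"
        proof (rule ccontr)
          assume "z k \<alpha> \<noteq> 0"
          then obtain v where v: "v \<in> supp (z k \<alpha>)" by fastforce
          then have "strict v" "set v \<subseteq> set b" using CellD(2)[OF that v] unfolding P_def Dv_def by auto
          then have "length v \<le> length b" using b(1) distinct_card card_mono unfolding strict_iff
            by (metis List.finite_set)
          then show False using CellD(3)[OF that v] b k by simp
        qed
      qed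
      then have c1: "x \<in> t.cells q" "y \<in> t.cells q" using h Cell_cells by blast+
      show ?thesis
      proof (cases "k < q")
        case False
        then have "y = x" "tcm k x y = x" using t.cm_trivial c1 h by (auto simp: not_less)
        moreover have "F' x \<in> cells q"
          using c1 F'D[OF h(1), of Minus q] F'A[OF h(1)] unfolding t.cells_def cells_def by auto
        ultimately show ?thesis using cm_trivial[of "F' x" q "F' x" k] k False by simp
      next
        case True
        \<comment> \<open>When one factor already equals the composite \<open>atom b\<close>, the
          entries of the other factor above \<open>k\<close> are zero.\<close>
        have one: "z \<in> t.cells k" if "z = x \<and> w = atom b \<and> y = w \<or> z = y \<and> w = atom b \<and> x = w"
          "tcm k x y = atom b" for z w
        proof -
          have "z j \<alpha> = 0" if j: "j > k" for j \<alpha>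
          proof -
            have "x j \<alpha> + y j \<alpha> = atom b j \<alpha>" using tcm_simps(4)[OF h(3) j, of \<alpha>] \<open>tcm k x y = atom b\<close> by simp
            then show ?thesis using \<open>z = x \<and> _ \<or> _\<close> by auto
          qed
          then show ?thesis using Cell_cells h \<open>z = x \<and> _ \<or> _\<close> by blast
        qed
        have xy: "x = atom b \<or> y = atom b" using False cases h by blast
        have q: "tcm k x y q Minus = x q Minus + y q Minus" using tcm_simps(4)[OF h(3) True] by simp
        have bt: "atom b q Minus = frag_of b" using b by (simp add: atom_top)
        have "b \<in> supp (tcm k x y q Minus)"
          unfolding q supp_add_pos[OF CellD(1)[OF h(1)] CellD(1)[OF h(2)]] using xy bt by auto
        then have e: "tcm k x y = atom b" using top_cells[OF b] t.cm_in[OF h] P_def by blast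
        from xy show ?thesis
        proof
          assume xb: "x = atom b"
          have "y \<in> t.cells k" using one[of y x] e xb by blast
          then have "y = table_bd Minus k x" using t.cells_D[of y k k Plus] h by simp
          then show ?thesis using e xb F'b F'D[OF h(1), of Minus k] unitR[OF F'A[OF h(1)], of k] by simp
        next
          assume yb: "y = atom b"
          have "x \<in> t.cells k" using one[of x y] e yb by blast
          then have "x = table_bd Plus k y" using t.cells_D[of x k k Minus] h by simp
          then show ?thesis using e yb F'b F'D[OF h(2), of Plus k] unitL[OF F'A[OF h(2)], of k] by simp
        qed
      qed
    qed
  qed
  then show ?thesis using F'F F'b P_def by blast
qed

text \<open>Atoms of dimension below \<open>p\<close> are units in dimension \<open>p\<close>. The
  simplices of dimension \<open>p\<close> in a factor also occur in the composite, since positive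
  chains do not cancel.\<close>

lemma WI_closure:
  assumes P: "complex P" and F: "tfun P F"
    and x: "x \<in> Cell P" "\<forall>k>p. \<forall>\<alpha>. x k \<alpha> = 0" "0 < p" "\<forall>v \<in> supp (x p Minus). WI p (F (atom v))"
  shows "WI p (F x)"
  using x(1) P x(2-4)
proof (induction rule: Cell_induct)
  case (atom b)
  have b: "b \<noteq> []" using atom(1) P unfolding complex_def by blast
  have bC: "atom b \<in> Cell P" using atom_Cell[OF P atom(1)] .
  show ?case
  proof (cases "length b = Suc p")
    case True
    then show ?thesis using atom atom_top[OF True, of Minus] by simp
  next
    case False
    have "length b - 1 \<le> p"
    proof (rule ccontr)
      assume "\<not> ?thesis"
      then have "atom b (length b - 1) Minus = 0" using atom by simp
      then show False using supp_atom_top[OF b, of Minus] by simp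
    qed
    then have "length b - 1 < p" using False b by (cases b) auto
    moreover have "F (atom b) \<in> cells (length b - 1)"
      using tfun_cells[OF F bC] b by (simp add: atom_zero)
    ultimately show ?thesis using WI_unit by blast
  qed
next
  case (comp k x y)
  interpret t: scat "Cell P" table_bd tcm by (rule scat_Cell)
  show ?case
  proof (cases "k < p")
    case True
    have s: "x i \<alpha> + y i \<alpha> = tcm k x y i \<alpha>" if "p \<le> i" for i \<alpha> using tcm_simps(4)[OF comp(3)] True that by simp
    note px = CellD(1)[OF comp(1)] CellD(1)[OF comp(2)]
    have z: "\<forall>i>p. \<forall>\<alpha>. x i \<alpha> = 0 \<and> y i \<alpha> = 0"
      using s comp.prems(1) pos_add_zero[OF px] by (metis less_imp_le)
    have "supp (tcm k x y p Minus) = supp (x p Minus) \<union> supp (y p Minus)"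
      using s[of p Minus, symmetric] supp_add_pos[OF px(1)[of p Minus] px(2)[of p Minus]] by simp
    then have "WI p (F x)" "WI p (F y)" using comp.IH comp.prems z by blast+
    then have "WI p (cm k (F x) (F y))" using WI_cm[OF _ _ True] tfun_comp[OF F comp(1,2,3)] by blast
    then show ?thesis using tfunD(3)[OF F comp(1,2,3)] by simp
  next
    case False
    have "x i \<alpha> = 0 \<and> y i \<alpha> = 0" if "k < i" for i \<alpha>
    proof -
      have "x i \<alpha> + y i \<alpha> = 0" using comp.prems(1) False that tcm_simps(4)[OF comp(3), of i \<alpha>] by simp
      then show ?thesis using pos_add_zero[OF CellD(1)[OF comp(1)] CellD(1)[OF comp(2)]] by blast
    qed
    then have "x \<in> t.cells k" "y \<in> t.cells k" using comp(1,2) Cell_cells by blast+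
    then have "tcm k x y = x" using t.cm_trivial comp(3) by blast
    then show ?thesis using comp by simp
  qed
qed

end

section \<open>Faces and whiskers in the standard orientals\<close>

abbreviation topl :: "nat \<Rightarrow> nat list" where "topl n \<equiv> [0..<Suc n]"

lemma set_topl: "set (topl n) = {..n}"
  by auto

lemma topl_Dl: "topl n \<in> Dl n"
  unfolding Dv_def by (auto simp: sorted_wrt_append)

lemma strict_topl: "strict (topl n)"
  using topl_Dl unfolding Dv_def by blast

lemma Dl_topl: "Dv (set (topl n)) = Dl n"
  by (simp only: set_topl)

lemma Dl_length: "v \<in> Dl n \<Longrightarrow> length v \<le> Suc n"
proof -
  assume "v \<in> Dl n"
  then have "card (set v) = length v" "set v \<subseteq> {..n}" unfolding Dv_def strict_iff by (auto simp: distinct_card)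
  then show ?thesis by (metis card_atMost card_mono finite_atMost)
qed

lemma strict_eqI: "strict v \<Longrightarrow> strict w \<Longrightarrow> set v = set w \<Longrightarrow> v = w"
  using sorted_distinct_set_unique unfolding strict_iff by blast

lemma Dl_top_eq: "v \<in> Dl n \<Longrightarrow> length v = Suc n \<Longrightarrow> v = topl n"
proof -
  assume h: "v \<in> Dl n" "length v = Suc n"
  then have "card (set v) = Suc n" "set v \<subseteq> {..n}" unfolding Dv_def strict_iff by (auto simp: distinct_card)
  then have "set v = {..n}" by (intro card_subset_eq) auto
  moreover have "strict v" using h(1) unfolding Dv_def by blast
  ultimately show ?thesis using strict_eqI[OF _ strict_topl, of v n] set_topl by simp
qed

text \<open>An n-cell of positive dimension n whose entry of index n is zero is a unit. Otherwise
  that entry contains the only nondegenerate n-simplex, and \<open>top_cells\<close> identifies the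
  cell.\<close>

lemma top_cell_atom: "top_cell n = atom (topl n)"
  unfolding top_cell_def
proof (rule the_equality)
  have C: "atom (topl n) \<in> Cell (Dl n)" using atom_Cell[OF complex_Dv topl_Dl] .
  have z: "\<forall>k>n. \<forall>\<alpha>. atom (topl n) k \<alpha> = 0" by (simp add: atom_zero del: upt_Suc)
  have "atom (topl n) \<notin> oriental_cell n m" if "m < n" for m
  proof
    assume "atom (topl n) \<in> oriental_cell n m"
    then have "atom (topl n) n Minus = 0" using that oriental_cell_iff by blast
    then show False using atom_top[of "topl n" n Minus] by (simp del: upt_Suc)
  qed
  then show "atom (topl n) \<in> cell (oriental n) n \<and> \<not> is_unit (oriental n) n (atom (topl n))"
    using C z unfolding is_unit_def by (auto simp: oriental_cell_iff simp del: upt_Suc)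
next
  fix x assume "x \<in> cell (oriental n) n \<and> \<not> is_unit (oriental n) n x"
  then have h: "x \<in> Cell (Dl n)" "\<forall>k>n. \<forall>\<alpha>. x k \<alpha> = 0" "\<And>m. m < n \<Longrightarrow> x \<notin> oriental_cell n m"
    unfolding is_unit_def by (auto simp: oriental_cell_iff)
  have "x n Minus \<noteq> 0"
  proof
    assume z: "x n Minus = 0"
    show False
    proof (cases n)
      case 0
      then show False using CellD(5)[OF h(1), of Minus] z by simp
    next
      case (Suc m)
      have "x n Plus = x n Minus" using CellD(4)[OF h(1), of n Minus] h(2) by simp
      then have zz: "x n \<alpha> = 0" for \<alpha> using z by (cases \<alpha>) auto
      have "x k \<alpha> = 0" if "m < k" for k \<alpha>
      proof (cases "k = n")
        case False
        then have "n < k" using that Suc by simp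
        then show ?thesis using h(2) by blast
      qed (use zz in simp)
      then show False using h(3)[of m] h(1) Suc oriental_cell_iff by blast
    qed
  qed
  then obtain v where v: "v \<in> supp (x n Minus)" by fastforce
  then have "v = topl n" using CellD(2,3)[OF h(1) v] Dl_top_eq by blast
  then show "x = atom (topl n)"
    using top_cells[OF strict_topl, of n n x Minus] h(1) v unfolding set_topl by (simp del: upt_Suc)
qed

lemma set_coface: "k \<le> n \<Longrightarrow> set (coface n k) = {..n} - {k}"
  unfolding coface_def by auto

lemma strict_coface: "strict (coface n k)"
  unfolding coface_def by (auto simp: sorted_wrt_append simp del: upt_Suc)

lemma length_coface: "k \<le> n \<Longrightarrow> length (coface n k) = n"
  unfolding coface_def by auto

lemma coface_Dl: "k \<le> n \<Longrightarrow> 0 < n \<Longrightarrow> coface n k \<in> Dl n"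
proof -
  assume k: "k \<le> n" "0 < n"
  have "coface n k \<noteq> []" using length_coface[OF k(1)] k(2) by (metis list.size(3) less_irrefl)
  then show ?thesis unfolding Dv_def using set_coface[OF k(1)] strict_coface[of n k] by blast
qed

lemma coface_inj: "i \<le> n \<Longrightarrow> j \<le> n \<Longrightarrow> coface n i = coface n j \<Longrightarrow> i = j"
  using set_coface by (metis Diff_iff atMost_iff insertCI singletonD)

text \<open>The alternating sum is the difference of target and source. As these are disjoint and
  positive, the even faces form the target and the odd faces the source, each with coefficient
  1.\<close>

lemma topl_faces:
  assumes "n = Suc j"
  shows "\<exists>bs. atom (topl n) j \<alpha> = (\<Sum>b\<leftarrow>bs. frag_of b) \<and> distinct bs \<and>
    set bs = {coface n i | i. i \<le> n \<and> (even i \<longleftrightarrow> \<alpha> = Plus)}"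
proof -
  define v where "v = topl n"
  have v: "length v = Suc (Suc j)" "strict v" "v \<noteq> []" unfolding v_def using assms strict_topl by (auto simp del: upt_Suc)
  have cf: "take i v @ drop (Suc i) v = coface n i" if "i \<le> n" for i
    unfolding v_def coface_def using that by (simp add: take_upt drop_upt min_def del: upt_Suc)
  have "dl v = atom v j Plus - atom v j Minus"
    using atom_bnd[OF v(3), of j Minus] v(1) by (simp add: atom_top)
  then have d: "coef (dl v) u = coef (atom v j Plus) u - coef (atom v j Minus) u" for u by (simp add: lookup_minus)
  have c: "coef (dl v) u = (\<Sum>i\<le>n. (-1) ^ i * (if coface n i = u then 1 else 0))" for u
  proof -
    have "coef (dl v) u = (\<Sum>i<length v. coef (frag_cmul ((-1) ^ i) (frag_of (take i v @ drop (Suc i) v))) u)"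
      unfolding dl_sum lookup_sum ..
    also have "\<dots> = (\<Sum>i\<le>n. (-1) ^ i * (if coface n i = u then 1 else 0))"
      using v(1) assms cf by (intro sum.cong) auto
    finally show ?thesis .
  qed
  have c1: "coef (dl v) (coface n i) = (-1) ^ i" if "i \<le> n" for i
  proof -
    have "coef (dl v) (coface n i) = (\<Sum>j\<le>n. if j = i then (-1) ^ i else 0)"
      unfolding c using coface_inj that by (intro sum.cong) auto
    then show ?thesis using that by simp
  qed
  have c2: "coef (dl v) u = 0" if "\<And>i. i \<le> n \<Longrightarrow> u \<noteq> coface n i" for u
    unfolding c using that by (intro sum.neutral) auto
  have dis: "coef (atom v j Plus) u = 0 \<or> coef (atom v j Minus) u = 0" for u
    using atom_lt[OF v(2), of j u] v(1) lt_asym by (metis in_keys_iff lessI)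
  have p: "0 \<le> coef (atom v j \<beta>) u" for \<beta> u using posD[OF atom_pos] .
  have val: "coef (atom v j \<alpha>) u = (if \<exists>i\<le>n. u = coface n i \<and> (even i \<longleftrightarrow> \<alpha> = Plus) then 1 else 0)" for u
  proof (cases "\<exists>i\<le>n. u = coface n i")
    case True
    then obtain i where i: "i \<le> n" "u = coface n i" by blast
    then have iff: "(\<exists>i\<le>n. u = coface n i \<and> (even i \<longleftrightarrow> \<alpha> = Plus)) \<longleftrightarrow> (even i \<longleftrightarrow> \<alpha> = Plus)" using coface_inj by blast
    have e: "coef (atom v j Plus) u - coef (atom v j Minus) u = (-1) ^ i" using c1[OF i(1)] d[of u] i by simp
    show ?thesis unfolding iff using e dis[of u] p[of Plus u] p[of Minus u]
      by (cases "even i"; cases \<alpha>) auto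
  next
    case False
    then have "coef (atom v j Plus) u - coef (atom v j Minus) u = 0" using c2[of u] d[of u] by simp
    then show ?thesis using False dis[of u] by (cases \<alpha>) auto
  qed
  obtain bs where bs: "atom v j \<alpha> = (\<Sum>b\<leftarrow>bs. frag_of b)" "set bs \<subseteq> supp (atom v j \<alpha>)"
    using chain_list[OF atom_pos] by blast
  have cnt: "coef (\<Sum>b\<leftarrow>bs. frag_of b) u = int (count (mset bs) u)" for u and bs :: "nat list list"
    by (induction bs) (auto simp: lookup_add)
  have cb: "int (count (mset bs) u) = (if \<exists>i\<le>n. u = coface n i \<and> (even i \<longleftrightarrow> \<alpha> = Plus) then 1 else 0)" for u
    using val[of u] bs(1) cnt[of bs u] by simp
  have sb: "u \<in> set bs \<longleftrightarrow> (\<exists>i\<le>n. u = coface n i \<and> (even i \<longleftrightarrow> \<alpha> = Plus))" for u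
  proof -
    have "u \<in> set bs \<longleftrightarrow> count (mset bs) u \<noteq> 0" by simp
    then show ?thesis using cb[of u] by (metis of_nat_0 of_nat_eq_0_iff zero_neq_one)
  qed
  moreover have "distinct bs"
    unfolding distinct_count_atmost_1
  proof
    fix u show "count (mset bs) u = (if u \<in> set bs then 1 else 0)"
      using cb[of u] unfolding sb[of u, symmetric] by (cases "u \<in> set bs") simp_all
  qed
  ultimately show ?thesis using bs(1) v_def by blast
qed

text \<open>The codegeneracy that identifies \<open>c\<close> with c + 1.\<close>

definition clp :: "nat \<Rightarrow> nat \<Rightarrow> nat" where
  "clp c i = (if i \<le> c then i else i - 1)"

text \<open>The set {k - 1, k, k + 1} intersected with [n], written with successors to avoid
  truncated subtraction.\<close>

definition kap :: "nat \<Rightarrow> nat \<Rightarrow> nat set" where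
  "kap n k = {i. i \<le> n \<and> (i = k \<or> Suc i = k \<or> i = Suc k)}"

lemma map_clp: "k \<le> n \<Longrightarrow> c < n \<Longrightarrow> c = k \<or> Suc c = k \<Longrightarrow> map (clp c) (coface n k) = [0..<n]"
  by (rule nth_equalityI) (auto simp: coface_def clp_def nth_append simp del: upt_Suc)

text \<open>Collapsing two consecutive vertices maps the face \<open>coface n k\<close> to the top simplex, which admits
  no whiskers; hence all whiskers of the face are degenerate after the collapse.\<close>

lemma rest_collapse:
  assumes W: "W \<in> Cell (Dl n)" "blk (Dl n) (Suc m) [coface n k] W" "blk (Dl n) m (coface n k # rs) W"
    and len: "\<forall>r\<in>set rs. length r = Suc m" and k: "k \<le> n" and c: "c < n" "c = k \<or> Suc c = k" and r: "r \<in> set rs"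
  shows "c \<in> set r \<and> Suc c \<in> set r"
proof -
  define b where "b = coface n k"
  obtain n' where n': "n = Suc n'" using c by (cases n) auto
  have clp: "clp c x \<le> clp c y" if "x \<le> y" for x y using that unfolding clp_def by auto
  have cim: "clp c ` {..n} \<subseteq> {..n'}" unfolding clp_def using c n' by auto
  have pW: "pm (clp c) W \<in> Cell (Dl n')" using pm_Cell[OF _ cim W(1)] clp by blast
  have pb: "pm (clp c) (atom b) = atom (topl n')"
  proof -
    have "clp c x < clp c y" if "x \<in> set b" "y \<in> set b" "x < y" for x y
    proof -
      have "x \<noteq> k" "y \<noteq> k" using that(1,2) unfolding b_def set_coface[OF k] by blast+
      then show ?thesis using that(3) c(2) unfolding clp_def by auto
    qed
    then have "pm (clp c) (atom b) = atom (map (clp c) b)" using pm_atom strict_coface unfolding b_def by blast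
    then show ?thesis using map_clp[OF k c] unfolding b_def n' by simp
  qed
  have Wb: "W i \<alpha> = atom b i \<alpha>" if "Suc m \<le> i" for i \<alpha> using W(2) that unfolding blk_def b_def by simp
  have "pm (clp c) W i \<alpha> = bsum [topl n'] i \<alpha>" if "Suc m \<le> i" for i \<alpha>
    using Wb[OF that] fun_cong[OF fun_cong[OF pb]] unfolding pm_def by (simp del: upt_Suc)
  moreover have "Suc m < length (topl n')" using W(2) length_coface[OF k] n' unfolding blk_def by simp
  ultimately have "blk (Dl n') (Suc m) [topl n'] (pm (clp c) W)"
    unfolding blk_def using topl_Dl by simp
  then have e: "pm (clp c) W = atom (topl n')"
    using top_unique[OF strict_topl _ _, of n' "pm (clp c) W" "Suc m"] pW unfolding set_topl by (simp del: upt_Suc)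
  have "W m Minus = atom b m Minus + (\<Sum>r\<leftarrow>rs. frag_of r)"
    using W(3) bsum_generators(1)[of rs m Minus] len unfolding blk_def b_def by simp
  then have "pm (clp c) W m Minus = pm (clp c) (atom b) m Minus + pshc (clp c) (\<Sum>r\<leftarrow>rs. frag_of r)"
    unfolding pm_def by simp
  then have "pshc (clp c) (\<Sum>r\<leftarrow>rs. frag_of r) = 0" using e pb by simp
  moreover have "pshc f (\<Sum>r\<leftarrow>rs. frag_of r) = (\<Sum>r\<leftarrow>rs. push (map f r))" for f and rs :: "nat list list"
    by (induction rs) auto
  ultimately have z: "(\<Sum>r\<leftarrow>rs. push (map (clp c) r)) = 0" by simp
  \<comment> \<open>The whiskers add up to zero after the collapse. Positive chains do not cancel,
    so each whisker becomes degenerate by itself.\<close>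
  have "\<forall>r\<in>set rs. push (map (clp c) r) = 0"
    using z
  proof (induction rs)
    case (Cons a rs)
    have p: "pos (push (map (clp c) a))" "pos (\<Sum>r\<leftarrow>rs. push (map (clp c) r))"
      by (auto simp: push_def intro!: pos_sum_list)
    have "push (map (clp c) a) + (\<Sum>r\<leftarrow>rs. push (map (clp c) r)) = 0" using Cons.prems by simp
    from pos_add_zero[OF p this] show ?case using Cons.IH by simp
  qed auto
  then have "push (map (clp c) r) = 0" using r by blast
  then have ns: "\<not> strict (map (clp c) r)" unfolding push_def by (metis frag_of_nonzero)
  have "r \<in> Dl n" using W(3) r unfolding blk_def by simp
  then have "strict r" unfolding Dv_def by blast
  show ?thesis
  proof (rule ccontr)
    assume "\<not> ?thesis"
    then have "clp c x < clp c y" if "x \<in> set r" "y \<in> set r" "x < y" for x y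
    proof -
      have "\<not> (x = c \<and> y = Suc c)" using that \<open>\<not> (c \<in> set r \<and> Suc c \<in> set r)\<close> by blast
      then show ?thesis using that(3) unfolding clp_def by auto
    qed
    then show False using ns strict_map[OF \<open>strict r\<close>] by blast
  qed
qed

lemma rest_kap:
  assumes "W \<in> Cell (Dl n)" "blk (Dl n) (Suc m) [coface n k] W" "blk (Dl n) m (coface n k # rs) W"
    "\<forall>r\<in>set rs. length r = Suc m" "k \<le> n" "0 < n" "r \<in> set rs"
  shows "kap n k \<subseteq> set r"
proof
  fix i assume i: "i \<in> kap n k"
  have 1: "k \<in> set r \<and> Suc k \<in> set r" if "k < n" using rest_collapse[OF assms(1-5) that _ assms(7)] by blast
  have 2: "k' \<in> set r \<and> Suc k' \<in> set r" if "k = Suc k'" for k'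
    using rest_collapse[OF assms(1-5), of k'] assms(5,7) that by simp
  show "i \<in> set r"
  proof (cases "i = k")
    case True
    then show ?thesis using 1 2[of "k - 1"] assms(5,6) by (cases "k < n") auto
  qed (use i 1 2 in \<open>auto simp: kap_def\<close>)
qed

section \<open>Division of whiskered cells\<close>

context scat begin

text \<open>Contexts around the atom of \<open>b\<close>. The whiskers lie in \<open>L\<close>,
  where \<open>F\<close> is already defined, while the value at \<open>b\<close> may be unknown. A
  whisker attached along \<open>k\<close> has dimension at most k + 1, so division by its value
  applies; \<open>K\<close> bounds the dimensions \<open>k\<close>.\<close>

inductive Good :: "nat \<Rightarrow> nat list set \<Rightarrow> (table \<Rightarrow> 'c) \<Rightarrow> nat list \<Rightarrow> table \<Rightarrow> bool" for K L F b where
  base: "Good K L F b (atom b)"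
| step: "\<lbrakk>Good K L F b x; k < K; l \<in> Cell L; r \<in> Cell L; WI (Suc k) (F l); WI (Suc k) (F r);
    \<forall>i>Suc k. \<forall>\<alpha>. l i \<alpha> = 0 \<and> r i \<alpha> = 0; table_bd Plus k x = table_bd Minus k l;
    table_bd Plus k r = table_bd Minus k x\<rbrakk> \<Longrightarrow> Good K L F b (tcm k l (tcm k x r))"

lemma Good_Cell:
  assumes P: "complex P" "b \<in> P" "L \<subseteq> P" "length b = Suc q" "K \<le> q"
  shows "Good K L F b x \<Longrightarrow> x \<in> Cell P \<and> (\<forall>i>q. \<forall>\<alpha>. x i \<alpha> = 0)"
proof (induction rule: Good.induct)
  case base
  then show ?case using atom_Cell P atom_zero[of b] by simp
next
  case (step x k l r)
  interpret t: scat "Cell P" table_bd tcm by (rule scat_Cell)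
  have lr: "l \<in> Cell P" "r \<in> Cell P" using step Cell_mono[OF P(3)] by auto
  have c: "table_bd Plus k (tcm k x r) = table_bd Minus k l" using t.tgt_cm lr step by simp
  have "tcm k l (tcm k x r) \<in> Cell P" using t.cm_in lr step c by blast
  moreover have "tcm k l (tcm k x r) i \<alpha> = 0" if "q < i" for i \<alpha>
    using tcm_simps(4)[OF c] tcm_simps(4)[OF step(9)] step that P(5) by simp
  ultimately show ?case by blast
qed

text \<open>The equation for the value at \<open>b\<close> is solved from the outside: the outermost
  left whisker is divided off, then the right one, and the quotient is the right-hand side of the
  equation for the inner context. At the centre the quotient itself is the value
  \<open>c\<close>.\<close>

lemma solve:
  assumes P: "complex P" "b \<in> P" "L \<subseteq> P" "length b = Suc (Suc p)" and F: "tfun L F"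
    and low: "\<And>v. v \<in> P \<Longrightarrow> length v \<le> Suc p \<Longrightarrow> v \<in> L"
  shows "Good (Suc p) L F b x \<Longrightarrow> y \<in> cells (Suc p) \<Longrightarrow> (\<And>\<alpha>. D \<alpha> p y = F (table_bd \<alpha> p x)) \<Longrightarrow>
    \<exists>c \<in> cells (Suc p). (\<forall>\<alpha>. D \<alpha> p c = F (table_bd \<alpha> p (atom b))) \<and>
      (\<forall>F'. tfun P F' \<longrightarrow> (\<forall>z\<in>Cell L. F' z = F z) \<longrightarrow> F' (atom b) = c \<longrightarrow> eqv (Suc p) (F' x) y)"
proof (induction arbitrary: y rule: Good.induct)
  case base
  then show ?case using eqv_refl by (intro bexI[of _ y]) auto
next
  case (step x k l r)
  interpret t: scat "Cell P" table_bd tcm by (rule scat_Cell)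
  interpret tl: scat "Cell L" table_bd tcm by (rule scat_Cell)
  have x: "x \<in> Cell P" "\<forall>i>Suc p. \<forall>\<alpha>. x i \<alpha> = 0"
    using Good_Cell[OF P _ step(1)] by auto
  have lr: "l \<in> Cell P" "r \<in> Cell P" using step Cell_mono[OF P(3)] by auto
  have lrc: "l \<in> t.cells (Suc k)" "r \<in> t.cells (Suc k)" using lr step unfolding Cell_cells by auto
  have Flr: "F l \<in> cells (Suc k)" "F r \<in> cells (Suc k)" using step WI_cells by blast+
  have c: "table_bd Plus k (tcm k x r) = table_bd Minus k l" using t.tgt_cm lr step x by simp
  have lowC: "table_bd \<alpha> p z \<in> Cell L" if "z \<in> Cell P" for z \<alpha>
  proof -
    have "v \<in> L" if v: "v \<in> supp (table_bd \<alpha> p z j \<beta>)" for v j \<beta>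
    proof -
      have "v \<in> P" "length v = Suc j" "j \<le> p"
        using CellD(2,3)[OF t.D_in[OF \<open>z \<in> Cell P\<close>] v] v by (auto simp: table_bd_def split: if_splits)
      then show ?thesis using low by simp
    qed
    then show ?thesis using t.D_in[OF that, of \<alpha> p] unfolding Cell_def by blast
  qed
  have kp: "k \<le> p" using step by simp
  have xk: "F (table_bd \<alpha> k x) = D \<alpha> k (F (table_bd \<beta> p x))" if "k < p" for \<alpha> \<beta>
    using tfunD(2)[OF F lowC[OF x(1)], of \<alpha> k \<beta>] t.D_below[OF x(1) that] by simp
  note bl = tfunD(2)[OF F step(3)] tfunD(2)[OF F step(4)]
  \<comment> \<open>For \<open>k = p\<close> the whiskers have the dimension of the unknown cell and
    move its ends, so \<open>ExL0\<close> and \<open>ExR0\<close> apply. For \<open>k < p\<close>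
    the whiskers have lower dimension, and both ends are prescribed in \<open>exL\<close> and
    \<open>exR\<close>.\<close>
  show ?case
  proof (cases "k = p")
    case True
    have e: "table_bd Minus p (tcm k l (tcm k x r)) = table_bd Minus p r" "table_bd Plus p (tcm k l (tcm k x r)) = table_bd Plus p l"
      using True c step(8,9) lr x t.cm_in by (simp_all add: t.src_cm t.tgt_cm)
    have yD: "D Minus p y = D Minus p (F r)" "D Plus p y = D Plus p (F l)"
      using step.prems(2) e bl by simp_all
    obtain y1 where y1: "y1 \<in> cells (Suc p)" "D Plus p y1 = D Minus p (F l)" "D Minus p y1 = D Minus p y"
      "eqv (Suc p) (cm p (F l) y1) y"
      using ExL0[of p "F l" y] step yD True by auto
    obtain y2 where y2: "y2 \<in> cells (Suc p)" "D Minus p y2 = D Plus p (F r)" "D Plus p y2 = D Plus p y1"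
      "eqv (Suc p) (cm p y2 (F r)) y1"
      using ExR0[of p "F r" y1] step y1 yD True by auto
    have "D \<alpha> p y2 = F (table_bd \<alpha> p x)" for \<alpha>
      using y2(2,3) y1(2) bl(1)[of Minus p] bl(2)[of Plus p] step(8,9) True by (cases \<alpha>) metis+
    then obtain cc where cc: "cc \<in> cells (Suc p)" "\<forall>\<alpha>. D \<alpha> p cc = F (table_bd \<alpha> p (atom b))"
      "\<forall>F'. tfun P F' \<longrightarrow> (\<forall>z\<in>Cell L. F' z = F z) \<longrightarrow> F' (atom b) = cc \<longrightarrow> eqv (Suc p) (F' x) y2"
      using step.IH[OF y2(1)] by blast
    show ?thesis
    proof (intro bexI[OF _ cc(1)] conjI cc(2) allI impI)
      fix F' assume F': "tfun P F'" "\<forall>z\<in>Cell L. F' z = F z" "F' (atom b) = cc"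
      have 1: "eqv (Suc p) (F' x) y2" using cc(3) F' by blast
      have F'lr: "F' l = F l" "F' r = F r" using F' step by auto
      have k1: "D Plus p (F r) = D Minus p (F' x)" "D Plus p (F' x) = D Minus p (F l)"
        using tfun_comp[OF F'(1) x(1) lr(2) step(9)] tfun_comp[OF F'(1) lr(1) x(1) step(8)] F'lr True by simp_all
      have e2: "F' (tcm k l (tcm k x r)) = cm p (F l) (cm p (F' x) (F r))"
        using tfunD(3)[OF F'(1) lr(1) t.cm_in[OF x(1) lr(2) step(9)] c] tfunD(3)[OF F'(1) x(1) lr(2) step(9)] F'lr True by simp
      have "eqv (Suc p) (cm p (F' x) (F r)) (cm p y2 (F r))"
        using 1 Flr(2) True k1 by - (rule eqv_whiskR, auto)
      then have "eqv (Suc p) (cm p (F' x) (F r)) y1" using y2(4) eqv_trans by blast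
      then have "eqv (Suc p) (cm p (F l) (cm p (F' x) (F r))) (cm p (F l) y1)"
        using Flr True k1 tgt_cm[of "F' x" "F r" p] tfunD(1)[OF F'(1) x(1)] cells_in
        by - (rule eqv_whiskL, auto)
      then show "eqv (Suc p) (F' (tcm k l (tcm k x r))) y" unfolding e2 using y1(4) eqv_trans by blast
    qed
  next
    case False
    then have k: "k < p" using kp by simp
    have pl: "table_bd \<alpha> p l = l" "table_bd \<alpha> p r = r" for \<alpha> using t.cells_D lrc k by simp_all
    have cx: "table_bd Plus k (table_bd \<alpha> p x) = table_bd Minus k l" "table_bd Plus k r = table_bd Minus k (table_bd \<alpha> p x)" for \<alpha>
      using t.D_below[OF x(1) k] step(8,9) by simp_all
    have cxr: "table_bd Plus k (tcm k (table_bd \<alpha> p x) r) = table_bd Minus k l" for \<alpha>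
      using t.tgt_cm[OF t.D_in[OF x(1)] lr(2) cx(2)] cx(1) by simp
    have e: "table_bd \<alpha> p (tcm k l (tcm k x r)) = tcm k l (tcm k (table_bd \<alpha> p x) r)" for \<alpha>
      using t.D_cm_above[OF lr(1) t.cm_in[OF x(1) lr(2) step(9)] c k] t.D_cm_above[OF x(1) lr(2) step(9) k] pl by simp
    define a where "a \<alpha> = F (table_bd \<alpha> p x)" for \<alpha>
    have ca: "D Plus k (a \<alpha>) = D Minus k (F l)" "D Plus k (F r) = D Minus k (a \<alpha>)" for \<alpha>
      unfolding a_def using tfun_comp[OF F step(3) lowC[OF x(1)] cx(1)] tfun_comp[OF F lowC[OF x(1)] step(4) cx(2)] by auto
    have aC: "a \<alpha> \<in> cells p" for \<alpha>
      unfolding a_def using tfun_cells[OF F lowC[OF x(1)], of p \<alpha>] by (auto simp: table_bd_def)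
    have aA: "a \<alpha> \<in> A" "F l \<in> A" "F r \<in> A" for \<alpha> using aC Flr cells_in by blast+
    have apar: "D \<beta> j (a Minus) = D \<beta> j (a Plus)" if "j < p" for \<beta> j
      unfolding a_def using tfunD(2)[OF F lowC[OF x(1)], of \<beta> j] t.D_below[OF x(1) that] by metis
    have Fe: "F (table_bd \<alpha> p (tcm k l (tcm k x r))) = cm k (F l) (cm k (a \<alpha>) (F r))" for \<alpha>
      unfolding e a_def using tfunD(3)[OF F step(3) tl.cm_in[OF lowC[OF x(1)] step(4) cx(2)] cxr]
        tfunD(3)[OF F lowC[OF x(1)] step(4) cx(2)] by simp
    have Frp: "F r \<in> cells p" "F l \<in> cells p" using Flr k cells_mono by auto
    have arC: "cm k (a \<alpha>) (F r) \<in> cells p" for \<alpha> using cm_cells[OF aC Frp(1) ca(2)] .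
    obtain y1 where y1: "y1 \<in> cells (Suc p)" "D Minus p y1 = cm k (a Minus) (F r)" "D Plus p y1 = cm k (a Plus) (F r)"
      "eqv (Suc p) (cm k (F l) y1) y"
    proof (rule exL[OF step(5) k arC[of Minus] arC[of Plus], of y])
      show "D \<beta> j (cm k (a Minus) (F r)) = D \<beta> j (cm k (a Plus) (F r))" if "j < p" for \<beta> j
      proof -
        consider "j < k" | "j = k" | "k < j" by linarith
        then show ?thesis
        proof cases
          case 1 then show ?thesis using apar[OF that] aA ca by (simp add: cm_simps)
        next
          case 2 then show ?thesis using apar[OF that] aA ca by (cases \<beta>) (simp_all add: cm_simps)
        next
          case 3 then show ?thesis using apar[OF that] aA ca by (simp add: cm_simps)
        qed
      qed
    qed (use Fe step.prems ca aA in \<open>auto simp: cm_simps\<close>)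
    obtain y2 where y2: "y2 \<in> cells (Suc p)" "D Minus p y2 = a Minus" "D Plus p y2 = a Plus" "eqv (Suc p) (cm k y2 (F r)) y1"
      by (rule exR[OF step(6) k aC[of Minus] aC[of Plus] apar ca(2) y1(1-3)])
    have "D \<alpha> p y2 = F (table_bd \<alpha> p x)" for \<alpha> using y2 unfolding a_def by (cases \<alpha>) auto
    then obtain cc where cc: "cc \<in> cells (Suc p)" "\<forall>\<alpha>. D \<alpha> p cc = F (table_bd \<alpha> p (atom b))"
      "\<forall>F'. tfun P F' \<longrightarrow> (\<forall>z\<in>Cell L. F' z = F z) \<longrightarrow> F' (atom b) = cc \<longrightarrow> eqv (Suc p) (F' x) y2"
      using step.IH[OF y2(1)] by blast
    show ?thesis
    proof (intro bexI[OF _ cc(1)] conjI cc(2) allI impI)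
      fix F' assume F': "tfun P F'" "\<forall>z\<in>Cell L. F' z = F z" "F' (atom b) = cc"
      have 1: "eqv (Suc p) (F' x) y2" using cc(3) F' by blast
      have F'lr: "F' l = F l" "F' r = F r" using F' step by auto
      have k1: "D Plus k (F r) = D Minus k (F' x)" "D Plus k (F' x) = D Minus k (F l)"
        using tfun_comp[OF F'(1) x(1) lr(2) step(9)] tfun_comp[OF F'(1) lr(1) x(1) step(8)] F'lr by simp_all
      have e2: "F' (tcm k l (tcm k x r)) = cm k (F l) (cm k (F' x) (F r))"
        using tfunD(3)[OF F'(1) lr(1) t.cm_in[OF x(1) lr(2) step(9)] c] tfunD(3)[OF F'(1) x(1) lr(2) step(9)] F'lr by simp
      have "eqv (Suc p) (cm k (F' x) (F r)) (cm k y2 (F r))"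
        using 1 Frp k k1 by - (rule eqv_whiskR, auto intro: cells_mono)
      then have "eqv (Suc p) (cm k (F' x) (F r)) y1" using y2(4) eqv_trans by blast
      then have "eqv (Suc p) (cm k (F l) (cm k (F' x) (F r))) (cm k (F l) y1)"
        using Frp k k1 tgt_cm[of "F' x" "F r" k] tfunD(1)[OF F'(1) x(1)] aA
        by - (rule eqv_whiskL, auto intro: cells_mono)
      then show "eqv (Suc p) (F' (tcm k l (tcm k x r))) y" unfolding e2 using y1(4) eqv_trans by blast
    qed
  qed
qed

text \<open>The property \<open>Q\<close> stands for weak invertibility and for having a right or a
  left inverse, each of which passes from a whiskered cell to the cell.\<close>

lemma Good_reflect:
  assumes P: "complex P" "b \<in> P" "L \<subseteq> P" "length b = Suc (Suc p)" "K \<le> Suc p" and F: "tfun P F"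
    and RL: "\<And>k w z. \<lbrakk>Q (cm k w z); z \<in> cells (Suc p); WI (Suc k) w; k < K; D Plus k z = D Minus k w\<rbrakk> \<Longrightarrow> Q z"
    and RR: "\<And>k w z. \<lbrakk>Q (cm k z w); z \<in> cells (Suc p); WI (Suc k) w; k < K; D Plus k w = D Minus k z\<rbrakk> \<Longrightarrow> Q z"
  shows "Good K L F b x \<Longrightarrow> Q (F x) \<Longrightarrow> Q (F (atom b))"
proof (induction rule: Good.induct)
  case (step x k l r)
  interpret t: scat "Cell P" table_bd tcm by (rule scat_Cell)
  have x: "x \<in> Cell P" "\<forall>i>Suc p. \<forall>\<alpha>. x i \<alpha> = 0" using Good_Cell[OF P step(1)] by auto
  have lr: "l \<in> Cell P" "r \<in> Cell P" using step Cell_mono[OF P(3)] by auto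
  have xr: "tcm k x r \<in> Cell P" using t.cm_in[OF x(1) lr(2) step(9)] .
  have c: "table_bd Plus k (tcm k x r) = table_bd Minus k l" using t.tgt_cm lr step x by simp
  have xc: "F x \<in> cells (Suc p)" using tfun_cells[OF F x] .
  have rc: "F r \<in> cells (Suc p)" using WI_cells[OF step(6)] cells_mono step(2) P(5) by auto
  have k1: "D Plus k (F r) = D Minus k (F x)" "D Plus k (F (tcm k x r)) = D Minus k (F l)"
    using tfun_comp[OF F x(1) lr(2) step(9)] tfun_comp[OF F lr(1) xr c] by simp_all
  have e: "F (tcm k x r) = cm k (F x) (F r)" "F (tcm k l (tcm k x r)) = cm k (F l) (F (tcm k x r))"
    using tfunD(3)[OF F x(1) lr(2) step(9)] tfunD(3)[OF F lr(1) xr c] by simp_all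
  have "Q (F (tcm k x r))"
    using RL[of k "F l" "F (tcm k x r)"] step k1 e cm_cells[OF xc rc k1(1)] by metis
  then have "Q (F x)" using RR[of k "F x" "F r"] step k1 e xc by metis
  then show ?case by (rule step.IH)
qed

text \<open>After sorting, the blocks behind \<open>b\<close> are split off as \<open>l\<close> and
  those before it as \<open>r\<close>. Both consist of generators of dimension j + 1 with weakly
  invertible values, so \<open>WI_closure\<close> makes them admissible whiskers. In the remaining
  part \<open>b\<close> is the only block.\<close>

lemma ctx_step:
  assumes P: "complex P" "complex L" "L \<subseteq> P" and F: "tfun L F"
    and X: "X \<in> Cell P" "blk P (Suc j) (b # rs) X"
    and rs: "\<And>r. r \<in> set rs \<Longrightarrow> length r = Suc (Suc j) \<and> r \<in> L \<and> WI (Suc j) (F (atom r))"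
    and low: "\<And>v. v \<in> P \<Longrightarrow> length v \<le> Suc j \<Longrightarrow> v \<in> L"
    and IH: "\<And>W. W \<in> Cell P \<Longrightarrow> blk P (Suc j) [b] W \<Longrightarrow> Good K L F b W" and jK: "j < K"
  shows "Good K L F b X"
proof -
  obtain cs where cs: "mset cs = mset (b # rs)" "sorted_wrt le cs" using sort_ex by blast
  have "b \<in> set cs" using mset_eq_setD[OF cs(1)] by simp
  then obtain cs1 cs2 where c: "cs = cs1 @ b # cs2" by (meson split_list)
  have "mset (cs1 @ cs2) = mset rs" using cs(1) unfolding c by simp
  then have s: "set cs1 \<union> set cs2 = set rs" using mset_eq_setD[of "cs1 @ cs2" rs] by simp
  have bX: "blk P (Suc j) ((cs1 @ [b]) @ cs2) X" using blk_mset[OF X(2) cs(1)[symmetric]] c by simp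
  obtain l z where lz: "l \<in> Cell P" "z \<in> Cell P" "blk P (Suc j) (cs1 @ [b]) z" "blk P (Suc j) cs2 l"
    "table_bd Plus j z = table_bd Minus j l" "X = tcm j l z"
  proof (rule split[OF X(1) P(1) bX])
    show "le b1 b2" if "b1 \<in> set (cs1 @ [b])" "b2 \<in> set cs2" for b1 b2
      using that cs(2) unfolding c by (auto simp: sorted_wrt_append)
  qed
  obtain W r where Wr: "W \<in> Cell P" "r \<in> Cell P" "blk P (Suc j) cs1 r" "blk P (Suc j) [b] W"
    "table_bd Plus j r = table_bd Minus j W" "table_bd Plus j W = table_bd Plus j z" "z = tcm j W r"
  proof (rule split[OF lz(2) P(1) lz(3)])
    show "le b1 b2" if "b1 \<in> set cs1" "b2 \<in> set [b]" for b1 b2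
      using that cs(2) unfolding c by (auto simp: sorted_wrt_append)
  qed
  have w: "w \<in> Cell L \<and> WI (Suc j) (F w) \<and> (\<forall>i>Suc j. \<forall>\<alpha>. w i \<alpha> = 0)"
    if wc: "w \<in> Cell P" "blk P (Suc j) ds w" "set ds \<subseteq> set rs" for w ds
  proof -
    have len: "length d = Suc (Suc j)" if "d \<in> set ds" for d using that rs wc(3) by blast
    have w1: "w (Suc j) \<alpha> = (\<Sum>r\<leftarrow>ds. frag_of r)" for \<alpha>
      using wc(2) bsum_generators(1)[of ds "Suc j", OF len] unfolding blk_def by simp
    have w2: "\<forall>i>Suc j. \<forall>\<alpha>. w i \<alpha> = 0"
      using wc(2) bsum_generators(2)[of ds "Suc j", OF len] unfolding blk_def by simp
    have s1: "v \<in> set ds" if "v \<in> supp (w (Suc j) \<alpha>)" for v \<alpha>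
      using that supp_sum_list[of v frag_of ds] unfolding w1 by auto
    have "v \<in> L" if v: "v \<in> supp (w i \<alpha>)" for v i \<alpha>
    proof -
      consider "i < Suc j" | "i = Suc j" | "Suc j < i" by linarith
      then show ?thesis
      proof cases
        case 1 then show ?thesis using low CellD(2,3)[OF wc(1) v] by simp
      next
        case 2 then show ?thesis using s1 v rs wc(3) by blast
      next
        case 3 then show ?thesis using w2 v by simp
      qed
    qed
    then have wL: "w \<in> Cell L" using wc(1) unfolding Cell_def by blast
    have "WI (Suc j) (F w)"
      by (rule WI_closure[OF P(2) F wL w2]) (use s1 rs wc(3) in blast)+
    then show ?thesis using wL w2 by blast
  qed
  note wl = w[OF lz(1,4)] and wr = w[OF Wr(2,3)]
  have "Good K L F b (tcm j l (tcm j W r))"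
    using wl wr s IH[OF Wr(1,4)] jK Wr(5,6) lz(5) by (intro Good.step) auto
  then show ?thesis using lz(6) Wr(7) by simp
qed

lemma ctx:
  assumes P: "complex P" "complex L" "L \<subseteq> P" and F: "tfun L F" and b: "length b = Suc (Suc p)"
    and low: "\<And>v. v \<in> P \<Longrightarrow> length v \<le> Suc p \<Longrightarrow> v \<in> L"
    and mark: "\<And>W m rs r. \<lbrakk>W \<in> Cell P; blk P (Suc m) [b] W; blk P m (b # rs) W; \<forall>r\<in>set rs. length r = Suc m;
      r \<in> set rs; 0 < m; m \<le> p\<rbrakk> \<Longrightarrow> WI m (F (atom r))"
  shows "W \<in> Cell P \<Longrightarrow> blk P m [b] W \<Longrightarrow> m \<le> Suc p \<Longrightarrow> Good p L F b W"
proof (induction m arbitrary: W)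
  case 0
  then have "W = atom b" using blk0_atom by force
  then show ?case using Good.base by simp
next
  case (Suc m)
  obtain rs where rs: "blk P m (b # rs) W" "\<forall>r\<in>set rs. length r = Suc m"
    using single_down_ex[OF Suc.prems(1) P(1) Suc.prems(2)] by auto
  show ?case
  proof (cases m)
    case 0
    have "blk P 0 (b # rs) W" using rs(1) 0 by simp
    then have "W = atom b" using blk0_atom Suc.prems(1) by fastforce
    then show ?thesis using Good.base by simp
  next
    case (Suc j)
    show ?thesis
    proof (rule ctx_step[OF P F Suc.prems(1)])
      show "blk P (Suc j) (b # rs) W" using rs(1) Suc by simp
      show "length r = Suc (Suc j) \<and> r \<in> L \<and> WI (Suc j) (F (atom r))" if "r \<in> set rs" for r
        using rs that mark[OF Suc.prems(1,2) rs that] Suc.prems(3) Suc low unfolding blk_def by auto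
      show "Good p L F b W" if "W \<in> Cell P" "blk P (Suc j) [b] W" for W
        using Suc.IH that Suc.prems(3) Suc by simp
    qed (use Suc.prems(3) Suc low in auto)
  qed
qed

lemma Good_mono: "Good K L F b x \<Longrightarrow> K \<le> K' \<Longrightarrow> Good K' L F b x"
proof (induction rule: Good.induct)
  case (step x k l r)
  then show ?case by (intro Good.step) auto
qed (rule Good.base)

end

definition Pb :: "nat \<Rightarrow> nat list set" where "Pb n = Dl n - {topl n}"

lemma Pb_length: "v \<in> Pb n \<Longrightarrow> length v \<le> n"
  using Dl_length[of v n] Dl_top_eq[of v n] unfolding Pb_def by force

lemma sub_Dl: "v \<in> Dl n \<Longrightarrow> w \<noteq> [] \<Longrightarrow> strict w \<Longrightarrow> set w \<subseteq> set v \<Longrightarrow> w \<in> Dl n"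
  unfolding Dv_def by auto

lemma strict_sub_length: "strict v \<Longrightarrow> strict w \<Longrightarrow> set w \<subseteq> set v \<Longrightarrow> length w \<le> length v \<and> (length w = length v \<longrightarrow> w = v)"
proof -
  assume h: "strict v" "strict w" "set w \<subseteq> set v"
  have l: "card (set v) = length v" "card (set w) = length w" using h unfolding strict_iff by (simp_all add: distinct_card)
  then have "length w \<le> length v" using card_mono[OF _ h(3)] by simp
  moreover have "w = v" if "length w = length v"
    using card_seteq[OF _ h(3)] l that strict_eqI[OF h(2,1)] by simp
  ultimately show ?thesis by blast
qed

lemma complex_Pb: "complex (Pb n)"
  unfolding complex_def
proof (intro ballI conjI allI impI)
  fix v assume v: "v \<in> Pb n"
  then have vD: "v \<in> Dl n" unfolding Pb_def by blast
  then show "v \<noteq> []" "strict v" unfolding Dv_def by auto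
  fix w assume w: "w \<noteq> [] \<and> strict w \<and> set w \<subseteq> set v"
  then have "w \<in> Dl n" using sub_Dl vD by blast
  moreover have "length w \<le> length v" using strict_sub_length[of v w] w \<open>strict v\<close> by blast
  then have "length w \<noteq> Suc n" using Pb_length[OF v] by simp
  then have "w \<noteq> topl n" by auto
  ultimately show "w \<in> Pb n" unfolding Pb_def by blast
qed

lemma complex_sub: "complex P \<Longrightarrow> v \<in> P \<Longrightarrow> w \<noteq> [] \<Longrightarrow> strict w \<Longrightarrow> set w \<subseteq> set v \<Longrightarrow> w \<in> P"
  unfolding complex_def by (drule (1) bspec) blast

lemma complex_remove:
  assumes "length b = n" "strict b" shows "complex (Pb n - {b})"
  unfolding complex_def
proof (intro ballI conjI allI impI)
  fix v assume v: "v \<in> Pb n - {b}"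
  then show vs: "v \<noteq> []" "strict v" using complex_Pb unfolding complex_def by blast+
  fix w assume w: "w \<noteq> [] \<and> strict w \<and> set w \<subseteq> set v"
  then have "w \<in> Pb n" using complex_Pb v unfolding complex_def by blast
  moreover have "w \<noteq> b"
  proof
    assume "w = b"
    then have "length v = length w" using strict_sub_length[OF vs(2)] w assms Pb_length[of v n] v by force
    then show False using strict_sub_length[OF vs(2), of w] w v \<open>w = b\<close> by auto
  qed
  ultimately show "w \<in> Pb n - {b}" by blast
qed

lemma coface_Pb: "k \<le> n \<Longrightarrow> 0 < n \<Longrightarrow> coface n k \<in> Pb n"
  using coface_Dl[of k n] length_coface[of k n] unfolding Pb_def by auto

lemma topbd_Cell: "m < n \<Longrightarrow> table_bd \<alpha> m (atom (topl n)) \<in> Cell (Pb n)"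
proof -
  assume m: "m < n"
  have t: "table_bd \<alpha> m (atom (topl n)) \<in> Cell (Dl n)"
    using scat.D_in[OF scat_Cell atom_Cell[OF complex_Dv topl_Dl]] .
  have "v \<in> Pb n" if v: "v \<in> supp (table_bd \<alpha> m (atom (topl n)) i \<beta>)" for v i \<beta>
  proof -
    have "v \<in> Dl n" "length v = Suc i" using CellD(2,3)[OF t v] by auto
    moreover have "i \<le> m" using v by (auto simp: table_bd_def simp del: upt_Suc split: if_splits)
    ultimately show ?thesis using m unfolding Pb_def by auto
  qed
  then show ?thesis using t unfolding Cell_def by blast
qed

lemma face_blk:
  assumes "n = Suc (Suc p)"
  shows "\<exists>bs. blk (Pb n) (Suc p) bs (table_bd \<epsilon> (Suc p) (atom (topl n))) \<and> distinct bs \<and>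
    set bs = {coface n i | i. i \<le> n \<and> (even i \<longleftrightarrow> \<epsilon> = Plus)}"
proof -
  obtain bs where bs: "atom (topl n) (Suc p) \<epsilon> = (\<Sum>b\<leftarrow>bs. frag_of b)" "distinct bs"
    "set bs = {coface n i | i. i \<le> n \<and> (even i \<longleftrightarrow> \<epsilon> = Plus)}"
    using topl_faces[OF assms, of \<epsilon>] by blast
  have len: "length b = Suc (Suc p) \<and> b \<in> Pb n" if "b \<in> set bs" for b
    using that bs(3) length_coface coface_Pb assms by auto
  have "table_bd \<epsilon> (Suc p) (atom (topl n)) k \<alpha> = bsum bs k \<alpha>" if "Suc p \<le> k" for k \<alpha>
  proof (cases "k = Suc p")
    case True
    then show ?thesis using bs(1) bsum_generators(1)[of bs "Suc p" \<alpha>] len by (simp add: table_bd_def del: upt_Suc)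
  next
    case False
    then show ?thesis using that bsum_generators(2)[of bs "Suc p" k \<alpha>] len by (simp add: table_bd_def del: upt_Suc)
  qed
  then have "blk (Pb n) (Suc p) bs (table_bd \<epsilon> (Suc p) (atom (topl n)))" using len unfolding blk_def by simp
  then show ?thesis using bs by blast
qed

text \<open>The side of the top cell that contains the face opposite to \<open>k\<close>. The faces
  opposite to k - 1 and k + 1 lie on the other side.\<close>

definition sgn_of :: "nat \<Rightarrow> sign" where "sgn_of k = (if even k then Plus else Minus)"

lemma sgn_of: "(even i \<longleftrightarrow> sgn_of k = Plus) \<longleftrightarrow> (even i \<longleftrightarrow> even k)"
  "(even i \<longleftrightarrow> opp (sgn_of k) = Plus) \<longleftrightarrow> (even i \<longleftrightarrow> odd k)"
  unfolding sgn_of_def by auto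

lemma kap_face: "i \<le> n \<Longrightarrow> i \<noteq> k \<Longrightarrow> Suc i \<noteq> k \<Longrightarrow> i \<noteq> Suc k \<Longrightarrow> kap n k \<subseteq> set (coface n i)"
  using set_coface[of i n] unfolding kap_def by auto

section \<open>Horn filling, thinness and one-sided inverses from the faces of a simplex\<close>

context scat begin

text \<open>The whiskers of a single face have dimension at most \<open>p\<close>, so they are
  attached along dimensions below \<open>p\<close>. By \<open>rest_kap\<close> they contain
  \<open>kap n k\<close> and fall under the hypothesis on low simplices.\<close>

lemma face_ctx:
  assumes n: "n = Suc (Suc p)" and k: "k \<le> n" and F: "tfun (Pb n - {coface n k}) F"
    and low: "\<And>v. \<lbrakk>v \<in> Dl n; kap n k \<subseteq> set v; 2 \<le> length v; length v \<le> Suc p\<rbrakk> \<Longrightarrow> WI (length v - 1) (F (atom v))"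
    and W: "W \<in> Cell (Pb n)" "blk (Pb n) (Suc p) [coface n k] W"
  shows "Good p (Pb n - {coface n k}) F (coface n k) W"
proof (rule ctx[OF complex_Pb _ _ F _ _ _ W])
  show "complex (Pb n - {coface n k})" using complex_remove length_coface[OF k] strict_coface by blast
  show "length (coface n k) = Suc (Suc p)" using length_coface k n by simp
  show "v \<in> Pb n - {coface n k}" if "v \<in> Pb n" "length v \<le> Suc p" for v
    using that length_coface[OF k] n by auto
  fix W m rs r
  assume h: "W \<in> Cell (Pb n)" "blk (Pb n) (Suc m) [coface n k] W" "blk (Pb n) m (coface n k # rs) W"
     "\<forall>r\<in>set rs. length r = Suc m" "r \<in> set rs" "0 < m" "m \<le> p"
  have s: "Pb n \<subseteq> Dl n" unfolding Pb_def by blast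
  have "W \<in> Cell (Dl n)" using h(1) Cell_mono[OF s] by blast
  then have "kap n k \<subseteq> set r" using rest_kap[OF _ blk_mono[OF h(2) s] blk_mono[OF h(3) s] h(4) k _ h(5)] n by simp
  moreover have "r \<in> Dl n" using h(3,5) s unfolding blk_def by auto
  moreover have "length r = Suc m" using h(4,5) by blast
  ultimately show "WI m (F (atom r))" using low[of r] h(6,7) by simp
qed simp_all

text \<open>The remaining faces of the same parity are attached along \<open>p\<close> and have the
  dimension of the face itself; this raises the bound from \<open>p\<close> to
  \<open>Suc p\<close>.\<close>

lemma face_Good:
  assumes n: "n = Suc (Suc p)" and k: "k \<le> n" and F: "tfun (Pb n - {coface n k}) F"
    and low: "\<And>v. \<lbrakk>v \<in> Dl n; kap n k \<subseteq> set v; 2 \<le> length v; length v \<le> Suc p\<rbrakk> \<Longrightarrow> WI (length v - 1) (F (atom v))"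
    and face: "\<And>i. \<lbrakk>i \<le> n; even i \<longleftrightarrow> even k; i \<noteq> k\<rbrakk> \<Longrightarrow> WI (Suc p) (F (atom (coface n i)))"
  shows "Good (Suc p) (Pb n - {coface n k}) F (coface n k) (table_bd (sgn_of k) (Suc p) (atom (topl n)))"
proof -
  obtain bs where bs: "blk (Pb n) (Suc p) bs (table_bd (sgn_of k) (Suc p) (atom (topl n)))" "distinct bs"
    "set bs = {coface n i | i. i \<le> n \<and> (even i \<longleftrightarrow> sgn_of k = Plus)}"
    using face_blk[OF n, of "sgn_of k"] by blast
  have "coface n k \<in> set bs" using bs(3) k sgn_of(1)[of k k] by auto
  then obtain cs1 cs2 where c: "bs = cs1 @ coface n k # cs2" by (meson split_list)
  have b2: "blk (Pb n) (Suc p) (coface n k # (cs1 @ cs2)) (table_bd (sgn_of k) (Suc p) (atom (topl n)))"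
    by (rule blk_mset[OF bs(1)]) (simp add: c)
  show ?thesis
  proof (rule ctx_step[OF complex_Pb _ _ F topbd_Cell b2])
    show "complex (Pb n - {coface n k})" using complex_remove length_coface[OF k] strict_coface by blast
    fix r assume r: "r \<in> set (cs1 @ cs2)"
    then have "r \<noteq> coface n k" "r \<in> set bs" using bs(2) c by auto
    then obtain i where i: "i \<le> n" "even i \<longleftrightarrow> even k" "r = coface n i" "i \<noteq> k" using bs(3) sgn_of(1) by auto
    then show "length r = Suc (Suc p) \<and> r \<in> Pb n - {coface n k} \<and> WI (Suc p) (F (atom r))"
      using face[OF i(1,2,4)] length_coface[OF i(1)] coface_Pb[OF i(1)] coface_inj[OF i(1) k] n by auto
  next
    show "v \<in> Pb n - {coface n k}" if "v \<in> Pb n" "length v \<le> Suc p" for v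
      using that length_coface[OF k] n by auto
    show "Good (Suc p) (Pb n - {coface n k}) F (coface n k) W"
      if "W \<in> Cell (Pb n)" "blk (Pb n) (Suc p) [coface n k] W" for W
      using Good_mono[OF face_ctx[OF n k F low that]] by simp
  qed (use n in auto)
qed

lemma side_WI:
  assumes n: "n = Suc (Suc p)" and F: "tfun (Pb n) F"
    and face: "\<And>i. \<lbrakk>i \<le> n; even i \<longleftrightarrow> \<epsilon> = Plus\<rbrakk> \<Longrightarrow> WI (Suc p) (F (atom (coface n i)))"
  shows "WI (Suc p) (F (table_bd \<epsilon> (Suc p) (atom (topl n))))"
proof -
  obtain bs where bs: "blk (Pb n) (Suc p) bs (table_bd \<epsilon> (Suc p) (atom (topl n)))" "distinct bs"
    "set bs = {coface n i | i. i \<le> n \<and> (even i \<longleftrightarrow> \<epsilon> = Plus)}"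
    using face_blk[OF n, of \<epsilon>] by blast
  have len: "length b = Suc (Suc p)" if "b \<in> set bs" for b using that bs(3) length_coface n by auto
  have "table_bd \<epsilon> (Suc p) (atom (topl n)) (Suc p) Minus = (\<Sum>b\<leftarrow>bs. frag_of b)"
    using bs(1) bsum_generators(1)[of bs "Suc p", OF len] unfolding blk_def by simp
  then have "v \<in> set bs" if "v \<in> supp (table_bd \<epsilon> (Suc p) (atom (topl n)) (Suc p) Minus)" for v
    using that supp_sum_list[of v frag_of bs] by auto
  moreover have "WI (Suc p) (F (atom v))" if v: "v \<in> set bs" for v
  proof -
    obtain i where "i \<le> n" "even i \<longleftrightarrow> \<epsilon> = Plus" "v = coface n i" using v unfolding bs(3) by blast
    then show ?thesis using face by simp
  qed
  ultimately have m: "\<forall>v\<in>supp (table_bd \<epsilon> (Suc p) (atom (topl n)) (Suc p) Minus). WI (Suc p) (F (atom v))"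
    by simp
  have z: "\<forall>k>Suc p. \<forall>\<alpha>. table_bd \<epsilon> (Suc p) (atom (topl n)) k \<alpha> = 0"
    by (simp add: table_bd_def del: upt_Suc)
  have c: "table_bd \<epsilon> (Suc p) (atom (topl n)) \<in> Cell (Pb n)" by (rule topbd_Cell) (simp add: n)
  show ?thesis by (rule WI_closure[OF complex_Pb F c z zero_less_Suc m])
qed

text \<open>The missing face occurs in the side \<open>X\<close> of the top cell and not in the
  opposite side \<open>Y\<close>. Its value is found by solving for \<open>X\<close> to be
  equivalent to \<open>Y\<close>, and the weakly invertible cell witnessing this equivalence becomes
  the value of the top simplex.\<close>

lemma horn_fill:
  assumes n: "n = Suc (Suc p)" and k: "k \<le> n" and F: "tfun (Pb n - {coface n k}) F"
    and mark: "\<And>v. \<lbrakk>v \<in> Pb n - {coface n k}; kap n k \<subseteq> set v; 2 \<le> length v\<rbrakk> \<Longrightarrow> WI (length v - 1) (F (atom v))"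
  shows "\<exists>F'. tfun (Dl n) F' \<and> (\<forall>x\<in>Cell (Pb n - {coface n k}). F' x = F x) \<and> WI n (F' (atom (topl n)))"
proof -
  define b where "b = coface n k"
  define L where "L = Pb n - {b}"
  define X where "X = table_bd (sgn_of k) (Suc p) (atom (topl n))"
  define Y where "Y = table_bd (opp (sgn_of k)) (Suc p) (atom (topl n))"
  have b: "length b = Suc (Suc p)" "strict b" "b \<noteq> []" "b \<in> Pb n" "b \<in> Dl n"
    unfolding b_def using length_coface[OF k] strict_coface coface_Pb[OF k] coface_Dl[OF k] n by auto
  have L: "complex L" "L \<subseteq> Pb n" unfolding L_def using complex_remove[of b n] b(1,2) n by auto
  have FL: "tfun L F" using F unfolding L_def b_def .
  interpret t: scat "Cell (Dl n)" table_bd tcm by (rule scat_Cell)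
  have tC: "atom (topl n) \<in> Cell (Dl n)" using atom_Cell[OF complex_Dv topl_Dl] .
  have XY: "X \<in> Cell (Pb n)" "Y \<in> Cell (Pb n)" unfolding X_def Y_def by (rule topbd_Cell, simp add: n)+
  have G: "Good (Suc p) L F b X"
    unfolding L_def b_def X_def
  proof (rule face_Good[OF n k F])
    fix v assume v: "v \<in> Dl n" "kap n k \<subseteq> set v" "2 \<le> length v" "length v \<le> Suc p"
    then have "v \<in> Pb n - {coface n k}" using b(1) n unfolding Pb_def b_def by auto
    then show "WI (length v - 1) (F (atom v))" using mark v by blast
  next
    fix i assume i: "i \<le> n" "even i \<longleftrightarrow> even k" "i \<noteq> k"
    then have "kap n k \<subseteq> set (coface n i)" by (intro kap_face) auto
    moreover have "coface n i \<in> Pb n - {coface n k}" using i coface_Pb coface_inj k n by blast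
    ultimately show "WI (Suc p) (F (atom (coface n i)))"
      using mark[of "coface n i"] length_coface[OF i(1)] n by simp
  qed
  have YL: "Y \<in> Cell L"
  proof -
    obtain bs where bs: "blk (Pb n) (Suc p) bs Y" "set bs = {coface n i | i. i \<le> n \<and> (even i \<longleftrightarrow> opp (sgn_of k) = Plus)}"
      using face_blk[OF n, of "opp (sgn_of k)"] unfolding Y_def by blast
    have len: "length c = Suc (Suc p)" if "c \<in> set bs" for c using that bs(2) length_coface n by auto
    have nb: "b \<notin> set bs" unfolding bs(2) sgn_of b_def using coface_inj k by auto
    have "b \<notin> supp (Y i \<alpha>)" for i \<alpha>
    proof
      assume v: "b \<in> supp (Y i \<alpha>)"
      then have "i = Suc p" using CellD(3)[OF XY(2) v] b by simp
      then have "Y i \<alpha> = (\<Sum>c\<leftarrow>bs. frag_of c)"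
        using bs(1) bsum_generators(1)[of bs "Suc p", OF len] unfolding blk_def by simp
      then show False using v supp_sum_list[of b frag_of bs] nb by auto
    qed
    then show ?thesis using Cell_remove[OF XY(2)] unfolding L_def by blast
  qed
  have bdXY: "table_bd \<alpha> p Y = table_bd \<alpha> p X" for \<alpha>
    unfolding X_def Y_def using t.D_below[OF tC, of p "Suc p"] by simp
  have yc: "F Y \<in> cells (Suc p)" using tfun_cells[OF FL YL] unfolding Y_def by (auto simp: table_bd_def simp del: upt_Suc)
  have yb: "D \<alpha> p (F Y) = F (table_bd \<alpha> p X)" for \<alpha>
    using tfunD(2)[OF FL YL, of \<alpha> p] bdXY by simp
  have low: "v \<in> L" if "v \<in> Pb n" "length v \<le> Suc p" for v using that b(1) unfolding L_def by auto
  obtain c where c: "c \<in> cells (Suc p)" "\<And>\<alpha>. D \<alpha> p c = F (table_bd \<alpha> p (atom b))"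
     "\<And>F'. tfun (Pb n) F' \<Longrightarrow> (\<forall>z\<in>Cell L. F' z = F z) \<Longrightarrow> F' (atom b) = c \<Longrightarrow> eqv (Suc p) (F' X) (F Y)"
    using solve[OF complex_Pb b(4) L(2) b(1) FL low G yc yb] by blast
  have sub: "Dv (set b) - {b} \<subseteq> L"
  proof
    fix v assume v: "v \<in> Dv (set b) - {b}"
    then have "v \<noteq> []" "strict v" "set v \<subseteq> set b" unfolding Dv_def by simp_all
    then have "v \<in> Pb n" by (rule complex_sub[OF complex_Pb b(4)])
    then show "v \<in> L" using v unfolding L_def by blast
  qed
  obtain G1 where G1: "tfun (Dv (set b)) G1" "\<forall>x\<in>Cell (Dv (set b) - {b}). G1 x = F x" "G1 (atom b) = c"
    using top_extend[OF b(2,1) tfun_mono[OF FL sub] c(1), of] c(2) by auto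
  \<comment> \<open>The face \<open>b\<close> is added to the horn as a complex of its own:
    \<open>G1\<close> is defined on all simplices of \<open>b\<close>, and where it meets the horn
    it was constructed to agree with \<open>F\<close>.\<close>
  interpret g: gluing A D cm "{False, True}" "\<lambda>i. if i then Dv (set b) else L" "\<lambda>i. if i then G1 else F"
  proof
    fix i j :: bool and v assume h: "v \<in> (if i then Dv (set b) else L)" "v \<in> (if j then Dv (set b) else L)"
    have "G1 (atom v) = F (atom v)" if "v \<in> Dv (set b)" "v \<in> L"
    proof -
      have v: "v \<in> Dv (set b) - {b}" using that unfolding L_def by blast
      have "v \<noteq> []" using v unfolding Dv_def by blast
      have "atom v \<in> Cell (Dv (set b) - {b})"
      proof (rule Cell_remove[OF atom_Cell[OF complex_Dv that(1)]])
        fix k \<alpha> show "b \<notin> supp (atom v k \<alpha>)"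
        proof
          assume "b \<in> supp (atom v k \<alpha>)"
          then have "set b \<subseteq> set v" using atom_supp by blast
          then have "set b = set v" using v unfolding Dv_def by blast
          then show False using v strict_eqI[OF b(2), of v] unfolding Dv_def by auto
        qed
      qed
      then show ?thesis using G1 by blast
    qed
    then show "(if i then G1 else F) (atom v) = (if j then G1 else F) (atom v)" using h by (auto split: if_splits)
  qed (use L complex_Dv FL G1 in auto)
  have U: "g.U = Pb n"
  proof -
    have "g.U = Dv (set b) \<union> L" unfolding g.U_def by (auto split: if_splits)
    moreover have "b \<in> Dv (set b)" using b unfolding Dv_def by simp
    ultimately show ?thesis using sub b(4) unfolding L_def by blast
  qed
  obtain F1 where F1: "tfun (Pb n) F1" "\<forall>x\<in>Cell L. F1 x = F x" "\<forall>x\<in>Cell (Dv (set b)). F1 x = G1 x"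
    using g.glue unfolding U by auto
  have "F1 (atom b) = c" using F1(3) G1(3) atom_Cell[OF complex_Dv, of b "set b"] b unfolding Dv_def by auto
  then have eq: "eqv (Suc p) (F1 X) (F1 Y)" using c(3)[OF F1(1,2)] F1(2) YL by simp
  \<comment> \<open>The value of the top simplex must run from source to target. For even
    \<open>k\<close> the side \<open>X\<close> is the target, so the equivalence is
    reversed.\<close>
  then have "eqv (Suc p) (F1 (table_bd Minus (Suc p) (atom (topl n)))) (F1 (table_bd Plus (Suc p) (atom (topl n))))"
    using eqv_sym[OF eq] unfolding X_def Y_def sgn_of_def by (cases "even k") auto
  then obtain e where e: "WI n e" "D Minus (Suc p) e = F1 (table_bd Minus (Suc p) (atom (topl n)))"
     "D Plus (Suc p) e = F1 (table_bd Plus (Suc p) (atom (topl n)))"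
    unfolding eqv_def using n by auto
  have "\<exists>F'. tfun (Dv (set (topl n))) F' \<and> (\<forall>x\<in>Cell (Dv (set (topl n)) - {topl n}). F' x = F1 x) \<and> F' (atom (topl n)) = e"
  proof (rule top_extend[OF strict_topl, of n n])
    show "tfun (Dv (set (topl n)) - {topl n}) F1" using F1(1) unfolding Dl_topl Pb_def .
    show "D \<alpha> p' e = F1 (table_bd \<alpha> p' (atom (topl n)))" if "n = Suc p'" for p' \<alpha>
      using e(2,3) that n by (cases \<alpha>) auto
  qed (use WI_cells[OF e(1)] in auto)
  then obtain F2 where F2: "tfun (Dl n) F2" "\<forall>x\<in>Cell (Pb n). F2 x = F1 x" "F2 (atom (topl n)) = e"
    unfolding Dl_topl Pb_def by blast
  have "F2 x = F x" if "x \<in> Cell L" for x using F2(2) F1(2) Cell_mono[OF L(2)] that by auto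
  then show ?thesis using F2 e(1) unfolding L_def b_def by auto
qed

text \<open>The weakly invertible top cell makes the two sides equivalent. The side without face
  \<open>k\<close> is weakly invertible by \<open>side_WI\<close>, hence so is the other, from which
  the whiskers and remaining faces around face \<open>k\<close> are divided off.\<close>

lemma thin_gen:
  assumes n: "n = Suc (Suc p)" and k: "k \<le> n" and F: "tfun (Dl n) F" and top: "WI n (F (atom (topl n)))"
    and low: "\<And>v. \<lbrakk>v \<in> Dl n; kap n k \<subseteq> set v; 2 \<le> length v; length v \<le> Suc p\<rbrakk> \<Longrightarrow> WI (length v - 1) (F (atom v))"
    and face: "\<And>i. \<lbrakk>i \<le> n; i \<noteq> k\<rbrakk> \<Longrightarrow> WI (Suc p) (F (atom (coface n i)))"
  shows "WI (Suc p) (F (atom (coface n k)))"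
proof -
  define b where "b = coface n k"
  define X where "X = table_bd (sgn_of k) (Suc p) (atom (topl n))"
  define Y where "Y = table_bd (opp (sgn_of k)) (Suc p) (atom (topl n))"
  have b: "length b = Suc (Suc p)" "b \<in> Pb n"
    unfolding b_def using length_coface[OF k] coface_Pb[OF k] n by auto
  have s: "Pb n \<subseteq> Dl n" "Pb n - {b} \<subseteq> Dl n" unfolding Pb_def by auto
  have tC: "atom (topl n) \<in> Cell (Dl n)" using atom_Cell[OF complex_Dv topl_Dl] .
  have Y: "WI (Suc p) (F Y)"
    unfolding Y_def
  proof (rule side_WI[OF n tfun_mono[OF F s(1)]])
    fix i assume i: "i \<le> n" "even i = (opp (sgn_of k) = Plus)"
    then have "i \<noteq> k" using sgn_of(2)[of i k] by auto
    then show "WI (Suc p) (F (atom (coface n i)))" using face i by blast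
  qed
  have "eqv (Suc p) (D Minus (Suc p) (F (atom (topl n)))) (D Plus (Suc p) (F (atom (topl n))))"
    unfolding eqv_def using top n by auto
  then have e: "eqv (Suc p) (F (table_bd Minus (Suc p) (atom (topl n)))) (F (table_bd Plus (Suc p) (atom (topl n))))"
    using tfunD(2)[OF F tC] by simp
  then have "eqv (Suc p) (F X) (F Y)"
    using eqv_sym[OF e] unfolding X_def Y_def sgn_of_def by (cases "even k") auto
  then have X: "WI (Suc p) (F X)" using WI_eqv Y by blast
  have G: "Good (Suc p) (Pb n - {b}) F b X"
    unfolding X_def b_def
    using tfun_mono[OF F s(2)] unfolding b_def by (intro face_Good[OF n k] low face) auto
  show ?thesis
    unfolding b_def[symmetric]
  proof (rule Good_reflect[where Q = "WI (Suc p)", OF complex_Pb b(2) _ b(1) le_refl tfun_mono[OF F s(1)] _ _ G X])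
    show "WI (Suc p) z" if "WI (Suc p) (cm k w z)" "z \<in> cells (Suc p)" "WI (Suc k) w" "k < Suc p" "D Plus k z = D Minus k w" for k w z
      using WI_reflL[OF that(1-3)] that(4,5) by simp
    show "WI (Suc p) z" if "WI (Suc p) (cm k z w)" "z \<in> cells (Suc p)" "WI (Suc k) w" "k < Suc p" "D Plus k w = D Minus k z" for k w z
      using WI_reflR[OF that(1-3)] that(4,5) by simp
  qed blast
qed

lemma block_WI:
  assumes F: "tfun P F" "complex P" and w: "w \<in> Cell P" "blk P (Suc j) ds w"
    and ds: "\<And>d. d \<in> set ds \<Longrightarrow> length d = Suc (Suc j) \<and> WI (Suc j) (F (atom d))"
  shows "WI (Suc j) (F w)"
proof -
  have len: "length d = Suc (Suc j)" if "d \<in> set ds" for d using that ds by blast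
  have w1: "w (Suc j) \<alpha> = (\<Sum>r\<leftarrow>ds. frag_of r)" for \<alpha>
    using w(2) bsum_generators(1)[of ds "Suc j", OF len] unfolding blk_def by simp
  have w2: "\<forall>i>Suc j. \<forall>\<alpha>. w i \<alpha> = 0"
    using w(2) bsum_generators(2)[of ds "Suc j", OF len] unfolding blk_def by simp
  have "v \<in> set ds" if "v \<in> supp (w (Suc j) Minus)" for v
    using that supp_sum_list[of v frag_of ds] unfolding w1 by auto
  then show ?thesis by (intro WI_closure[OF F(2,1) w(1) w2]) (use ds in blast)+
qed

text \<open>Once the blocks are sorted along \<open>lt\<close>, everything composed after \<open>e2\<close> or before \<open>e1\<close> can be
  divided off.\<close>

lemma two_blocks:
  assumes F: "tfun P F" "complex P" and Y: "Y \<in> Cell P" "blk P (Suc p) bs Y" "WI (Suc p) (F Y)" "distinct bs"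
    and e: "e1 \<in> set bs" "e2 \<in> set bs" "lt e1 e2"
    and len: "\<And>d. d \<in> set bs \<Longrightarrow> length d = Suc (Suc p)"
    and mk: "\<And>d. d \<in> set bs \<Longrightarrow> d \<noteq> e1 \<Longrightarrow> d \<noteq> e2 \<Longrightarrow> WI (Suc p) (F (atom d))"
  shows "\<exists>W \<in> Cell P. blk P (Suc p) [e2] W \<and> RI p (F W)" "\<exists>W \<in> Cell P. blk P (Suc p) [e1] W \<and> LI p (F W)"
proof -
  obtain cs where cs: "mset cs = mset bs" "sorted_wrt le cs" using sort_ex by blast
  have set: "set cs = set bs" using mset_eq_setD cs(1) by blast
  have dist: "distinct cs" using Y(4) cs(1) mset_eq_imp_distinct_iff by blast
  obtain ds cs3 where d: "cs = ds @ e2 # cs3" using e(2) set by (metis split_list)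
  have "e1 \<notin> set (e2 # cs3)"
  proof
    assume "e1 \<in> set (e2 # cs3)"
    then have "le e2 e1" using cs(2) unfolding d by (auto simp: sorted_wrt_append)
    then show False using e(3) lt_asym lt_irrefl by blast
  qed
  then have "e1 \<in> set ds" using e(1) set d by auto
  then obtain cs1 cs2 where d1: "ds = cs1 @ e1 # cs2" by (metis split_list)
  have c: "cs = cs1 @ e1 # cs2 @ e2 # cs3" using d d1 by simp
  have bY: "blk P (Suc p) cs Y" using blk_mset[OF Y(2) cs(1)[symmetric]] .
  have srt: "sorted_wrt le (cs1 @ e1 # cs2 @ e2 # cs3)" using cs(2) c by simp
  have lc: "length d = Suc (Suc p)" if "d \<in> set cs" for d using len set that by blast
  have mk1: "length d = Suc (Suc p) \<and> WI (Suc p) (F (atom d))" if "d \<in> set cs1 \<union> set cs3" for d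
  proof -
    have "d \<noteq> e1" "d \<noteq> e2" "d \<in> set cs" using that dist unfolding c by auto
    then show ?thesis using mk lc set by blast
  qed
  interpret t: scat "Cell P" table_bd tcm by (rule scat_Cell)
  have dimc: "F w \<in> cells (Suc p)" if "w \<in> Cell P" "blk P (Suc p) es w" "set es \<subseteq> set cs" for w es
  proof (rule tfun_cells[OF F(1) that(1)])
    have "\<And>d. d \<in> set es \<Longrightarrow> length d = Suc (Suc p)" using that(3) lc by blast
    then show "\<forall>k>Suc p. \<forall>\<alpha>. w k \<alpha> = 0" using that(2) bsum_generators(2)[of es "Suc p"] unfolding blk_def by simp
  qed
  have bY1: "blk P (Suc p) ((cs1 @ e1 # cs2 @ [e2]) @ cs3) Y" using bY c by simp
  obtain l z where lz: "l \<in> Cell P" "z \<in> Cell P" "blk P (Suc p) (cs1 @ e1 # cs2 @ [e2]) z" "blk P (Suc p) cs3 l"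
    "table_bd Plus p z = table_bd Minus p l" "Y = tcm p l z"
    by (rule split[OF Y(1) F(2) bY1]) (use srt in \<open>auto simp: sorted_wrt_append\<close>)
  have bz: "blk P (Suc p) ((cs1 @ e1 # cs2) @ [e2]) z" using lz(3) by simp
  obtain W z' where W: "W \<in> Cell P" "z' \<in> Cell P" "blk P (Suc p) (cs1 @ e1 # cs2) z'" "blk P (Suc p) [e2] W"
    "table_bd Plus p z' = table_bd Minus p W" "z = tcm p W z'"
    by (rule split[OF lz(2) F(2) bz]) (use srt in \<open>auto simp: sorted_wrt_append\<close>)
  have "WI (Suc p) (F l)" by (rule block_WI[OF F lz(1,4)]) (use mk1 in auto)
  then have "WI (Suc p) (F z)"
    using WI_reflL[of p p "F l" "F z"] Y(3) lz tfunD(3)[OF F(1) lz(1,2,5)] tfun_comp[OF F(1) lz(1,2,5)]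
      dimc[OF lz(2,3)] c by auto
  then have "RI p (F W)"
    using WI_cm_RI[of p "F W" "F z'"] W tfunD(3)[OF F(1) W(1,2,5)] tfun_comp[OF F(1) W(1,2,5)]
      dimc[OF W(1,4)] dimc[OF W(2,3)] c by auto
  then show "\<exists>W \<in> Cell P. blk P (Suc p) [e2] W \<and> RI p (F W)" using W by blast
  have bY2: "blk P (Suc p) (cs1 @ (e1 # cs2 @ e2 # cs3)) Y" using bY c by simp
  obtain y r where yr: "y \<in> Cell P" "r \<in> Cell P" "blk P (Suc p) cs1 r" "blk P (Suc p) (e1 # cs2 @ e2 # cs3) y"
    "table_bd Plus p r = table_bd Minus p y" "Y = tcm p y r"
    by (rule split[OF Y(1) F(2) bY2]) (use srt in \<open>auto simp: sorted_wrt_append\<close>)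
  have by': "blk P (Suc p) ([e1] @ (cs2 @ e2 # cs3)) y" using yr(4) by simp
  obtain y' V where V: "y' \<in> Cell P" "V \<in> Cell P" "blk P (Suc p) [e1] V" "blk P (Suc p) (cs2 @ e2 # cs3) y'"
    "table_bd Plus p V = table_bd Minus p y'" "y = tcm p y' V"
    by (rule split[OF yr(1) F(2) by']) (use srt in \<open>auto simp: sorted_wrt_append\<close>)
  have "WI (Suc p) (F r)" by (rule block_WI[OF F yr(2,3)]) (use mk1 in auto)
  then have "WI (Suc p) (F y)"
    using WI_reflR[of p p "F y" "F r"] Y(3) yr tfunD(3)[OF F(1) yr(1,2,5)] tfun_comp[OF F(1) yr(1,2,5)]
      dimc[OF yr(1,4)] c by auto
  then have "LI p (F V)"
    using WI_cm_LI[of p "F y'" "F V"] V tfunD(3)[OF F(1) V(1,2,5)] tfun_comp[OF F(1) V(1,2,5)]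
      dimc[OF V(2,3)] dimc[OF V(1,4)] c by auto
  then show "\<exists>W \<in> Cell P. blk P (Suc p) [e1] W \<and> LI p (F W)" using V by blast
qed

text \<open>The faces k - 1 and k + 1 lie on the same side \<open>Y\<close>, and every face on the
  opposite side \<open>X\<close> is weakly invertible, hence so is \<open>Y\<close>. Of the two
  unknown blocks, the later one gets a right inverse and the earlier one a left inverse; division by
  the whiskers then reaches the faces.\<close>

lemma one_sided:
  assumes n: "n = Suc (Suc p)" and k: "0 < k" "k < n" and F: "tfun (Dl n) F" and top: "WI n (F (atom (topl n)))"
    and low: "\<And>v i. \<lbrakk>v \<in> Dl n; Suc i = k \<or> i = Suc k; kap n i \<subseteq> set v; 2 \<le> length v; length v \<le> Suc p\<rbrakk> \<Longrightarrow> WI (length v - 1) (F (atom v))"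
    and face: "\<And>i. \<lbrakk>i \<le> n; Suc i \<noteq> k; i \<noteq> Suc k\<rbrakk> \<Longrightarrow> WI (Suc p) (F (atom (coface n i)))"
    and i: "i1 = Suc k \<and> i2 = k - 1 \<or> i2 = Suc k \<and> i1 = k - 1" and lt: "lt (coface n i1) (coface n i2)"
  shows "RI p (F (atom (coface n i2)))" "LI p (F (atom (coface n i1)))"
proof -
  define X where "X = table_bd (sgn_of k) (Suc p) (atom (topl n))"
  define Y where "Y = table_bd (opp (sgn_of k)) (Suc p) (atom (topl n))"
  have s: "Pb n \<subseteq> Dl n" unfolding Pb_def by auto
  have FP: "tfun (Pb n) F" using tfun_mono[OF F s] .
  have tC: "atom (topl n) \<in> Cell (Dl n)" using atom_Cell[OF complex_Dv topl_Dl] .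
  have X: "WI (Suc p) (F X)"
    unfolding X_def
  proof (rule side_WI[OF n FP])
    fix i assume i: "i \<le> n" "even i = (sgn_of k = Plus)"
    then have "even i = even k" using sgn_of(1)[of i k] by simp
    then have "Suc i \<noteq> k" "i \<noteq> Suc k" by auto
    then show "WI (Suc p) (F (atom (coface n i)))" using face i by blast
  qed
  have "eqv (Suc p) (D Minus (Suc p) (F (atom (topl n)))) (D Plus (Suc p) (F (atom (topl n))))"
    unfolding eqv_def using top n by auto
  then have e: "eqv (Suc p) (F (table_bd Minus (Suc p) (atom (topl n)))) (F (table_bd Plus (Suc p) (atom (topl n))))"
    using tfunD(2)[OF F tC] by simp
  then have "eqv (Suc p) (F Y) (F X)"
    using eqv_sym[OF e] unfolding X_def Y_def sgn_of_def by (cases "even k") auto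
  then have Y: "WI (Suc p) (F Y)" using WI_eqv X by blast
  have YC: "Y \<in> Cell (Pb n)" unfolding Y_def by (rule topbd_Cell) (simp add: n)
  obtain bs where bs: "blk (Pb n) (Suc p) bs Y" "distinct bs" "set bs = {coface n i | i. i \<le> n \<and> (even i \<longleftrightarrow> odd k)}"
    using face_blk[OF n, of "opp (sgn_of k)"] unfolding Y_def sgn_of(2) by blast
  have ii: "i1 \<le> n" "i2 \<le> n" "even i1 \<longleftrightarrow> odd k" "even i2 \<longleftrightarrow> odd k" using i k by auto
  have mem: "coface n i1 \<in> set bs" "coface n i2 \<in> set bs" using ii unfolding bs(3) by auto
  have len: "length d = Suc (Suc p)" if "d \<in> set bs" for d using that bs(3) length_coface n by auto
  have mk: "WI (Suc p) (F (atom d))" if d: "d \<in> set bs" "d \<noteq> coface n i1" "d \<noteq> coface n i2" for d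
  proof -
    obtain j where j: "j \<le> n" "d = coface n j" using d(1) unfolding bs(3) by blast
    then have "j \<noteq> i1" "j \<noteq> i2" using d by auto
    then have "Suc j \<noteq> k" "j \<noteq> Suc k" using i k by auto
    then show ?thesis using face j by blast
  qed
  note two = two_blocks[OF FP complex_Pb YC bs(1) Y bs(2) mem lt len mk]
  have G: "Good p (Pb n - {coface n j}) F (coface n j) W"
    if "j = i1 \<or> j = i2" "W \<in> Cell (Pb n)" "blk (Pb n) (Suc p) [coface n j] W" for j W
  proof (rule face_ctx[OF n _ _ _ that(2,3)])
    show "j \<le> n" using that(1) ii by auto
    show "tfun (Pb n - {coface n j}) F" using tfun_mono[OF FP] by blast
    show "WI (length v - 1) (F (atom v))"
      if "v \<in> Dl n" "kap n j \<subseteq> set v" "2 \<le> length v" "length v \<le> Suc p" for v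
      using low[OF that(1) _ that(2-4)] \<open>j = i1 \<or> j = i2\<close> i k by auto
  qed
  have cP: "coface n j \<in> Pb n" "length (coface n j) = Suc (Suc p)" if "j = i1 \<or> j = i2" for j
    using that ii coface_Pb length_coface n by auto
  obtain W where W: "W \<in> Cell (Pb n)" "blk (Pb n) (Suc p) [coface n i2] W" "RI p (F W)" using two(1) by blast
  show "RI p (F (atom (coface n i2)))"
    by (rule Good_reflect[where Q = "RI p", OF complex_Pb cP(1) _ cP(2) _ FP RI_reflL RI_reflR G[OF _ W(1,2)] W(3)]) auto
  obtain V where V: "V \<in> Cell (Pb n)" "blk (Pb n) (Suc p) [coface n i1] V" "LI p (F V)" using two(2) by blast
  show "LI p (F (atom (coface n i1)))"
    by (rule Good_reflect[where Q = "LI p", OF complex_Pb cP(1) _ cP(2) _ FP LI_reflL LI_reflR G[OF _ V(1,2)] V(3)]) auto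
qed

end

section \<open>The two-out-of-six property\<close>

abbreviation sls :: "nat set \<Rightarrow> nat list" where "sls \<equiv> sorted_list_of_set"

lemma sls_set: "strict v \<Longrightarrow> sls (set v) = v"
  by (rule strict_eqI) auto

text \<open>The counterpart of \<open>kap\<close> for a simplex with vertex set \<open>T\<close>:
  for \<open>t\<close> in \<open>T\<close> it consists of \<open>t\<close> and its immediate
  neighbours.\<close>

definition kapS :: "nat set \<Rightarrow> nat \<Rightarrow> nat set" where
  "kapS T t = {x \<in> T. \<forall>y\<in>T. \<not> (x < y \<and> y < t) \<and> \<not> (t < y \<and> y < x)}"

lemma nth_sls:
  assumes "finite T" "card T = Suc n"
  shows "i < j \<Longrightarrow> j \<le> n \<Longrightarrow> sls T ! i < sls T ! j" "inj_on ((!) (sls T)) {..n}" "(!) (sls T) ` {..n} = T"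
proof -
  have l: "length (sls T) = Suc n" using assms by simp
  have s: "i < j \<Longrightarrow> j \<le> n \<Longrightarrow> sls T ! i < sls T ! j" for i j
    using sorted_wrt_nth_less[OF strict_sorted_list_of_set, of i j T] l by simp
  then show "i < j \<Longrightarrow> j \<le> n \<Longrightarrow> sls T ! i < sls T ! j" .
  show "inj_on ((!) (sls T)) {..n}"
    using l by (intro inj_on_nth) auto
  have "(!) (sls T) ` {..<Suc n} = set (sls T)" using l nth_image[of "Suc n" "sls T"] by (simp add: atLeast0LessThan)
  then show "(!) (sls T) ` {..n} = T" using assms by (simp add: lessThan_Suc_atMost)
qed

lemma nth_position:
  assumes "finite T" "card T = Suc n" "k \<le> n"
  shows "card {x \<in> T. x < sls T ! k} = k"
proof -
  have "{x \<in> T. x < sls T ! k} = (!) (sls T) ` {..<k}"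
  proof (intro set_eqI iffI)
    fix x assume x: "x \<in> {x \<in> T. x < sls T ! k}"
    then obtain i where i: "i \<le> n" "x = sls T ! i" using nth_sls(3)[OF assms(1,2)] by blast
    then have "\<not> k \<le> i" using x nth_sls(1)[OF assms(1,2), of k i] by (cases "k = i") auto
    then show "x \<in> (!) (sls T) ` {..<k}" using i by simp
  next
    fix x assume "x \<in> (!) (sls T) ` {..<k}"
    then obtain i where i: "i < k" "x = sls T ! i" by blast
    then have "x \<in> T" using nth_sls(3)[OF assms(1,2)] assms(3) by auto
    then show "x \<in> {x \<in> T. x < sls T ! k}" using i nth_sls(1)[OF assms(1,2) i(1) assms(3)] by simp
  qed
  moreover have "inj_on ((!) (sls T)) {..<k}" by (rule inj_on_subset[OF nth_sls(2)[OF assms(1,2)]]) (use assms(3) in auto)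
  ultimately show ?thesis by (simp add: card_image)
qed

lemma kapS_nth:
  assumes T: "finite T" "card T = Suc n" and k: "k \<le> n" and V: "kap n k \<subseteq> V" "V \<subseteq> {..n}"
  shows "kapS T (sls T ! k) \<subseteq> (!) (sls T) ` V"
proof
  fix x assume x: "x \<in> kapS T (sls T ! k)"
  then obtain i where i: "i \<le> n" "x = sls T ! i" using nth_sls(3)[OF T] unfolding kapS_def by blast
  have mem: "sls T ! j \<in> T" if "j \<le> n" for j using nth_sls(3)[OF T] that by blast
  have "i \<in> kap n k"
  proof (rule ccontr)
    assume "i \<notin> kap n k"
    then consider "Suc i < k" | "Suc k < i" using i unfolding kap_def by force
    then show False
    proof cases
      case 1
      then have "x < sls T ! Suc i" "sls T ! Suc i < sls T ! k" using nth_sls(1)[OF T] i k by auto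
      then show False using x mem[of "Suc i"] 1 k unfolding kapS_def by auto
    next
      case 2
      then have "sls T ! k < sls T ! Suc k" "sls T ! Suc k < x" using nth_sls(1)[OF T] i k by auto
      then show False using x mem[of "Suc k"] 2 i unfolding kapS_def by auto
    qed
  qed
  then show "x \<in> (!) (sls T) ` V" using i V by blast
qed

context scat begin

text \<open>Vertex sets stand for nondegenerate simplices, so that passing to a face is removal of a
  vertex.\<close>

definition Mk :: "(table \<Rightarrow> 'c) \<Rightarrow> nat set \<Rightarrow> bool" where
  "Mk G S \<longleftrightarrow> WI (card S - 1) (G (atom (sls S)))"

lemma face_functor:
  assumes G: "tfun (Dl N) G" and T: "T \<subseteq> {..N}" "card T = Suc n"
  shows "tfun (Dl n) (\<lambda>x. G (pm ((!) (sls T)) x))"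
    "v \<in> Dl n \<Longrightarrow> G (pm ((!) (sls T)) (atom v)) = G (atom (sls ((!) (sls T) ` set v)))"
    "v \<in> Dl n \<Longrightarrow> card ((!) (sls T) ` set v) = length v"
proof -
  have f: "finite T" using T(1) finite_subset by blast
  note N = nth_sls[OF f T(2)]
  have mono: "sls T ! a \<le> sls T ! b" if "b \<le> n" "a \<le> b" for a b
    using N(1)[of a b] that by (cases "a = b") auto
  show "tfun (Dl n) (\<lambda>x. G (pm ((!) (sls T)) x))"
    by (rule tfun_pm[OF G]) (use mono N(3) T(1) in auto)
  assume v: "v \<in> Dl n"
  have vs: "strict v" "set v \<subseteq> {..n}" using v unfolding Dv_def by auto
  have lt: "sls T ! a < sls T ! b" if "a \<in> set v" "b \<in> set v" "a < b" for a b
    using N(1)[OF that(3)] vs(2) that(2) by auto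
  have "strict (map ((!) (sls T)) v)" by (rule strict_map[OF vs(1)]) (rule lt)
  then have "sls ((!) (sls T) ` set v) = map ((!) (sls T)) v" using sls_set by (metis set_map)
  then show "G (pm ((!) (sls T)) (atom v)) = G (atom (sls ((!) (sls T) ` set v)))"
    using pm_atom[of v "(!) (sls T)", OF vs(1) lt] by simp
  show "card ((!) (sls T) ` set v) = length v"
    using card_image[OF inj_on_subset[OF N(2) vs(2)]] vs(1) unfolding strict_iff by (simp add: distinct_card)
qed

lemma face_functor_WI:
  assumes G: "tfun (Dl N) G" and T: "T \<subseteq> {..N}" "card T = Suc n" and v: "v \<in> Dl n"
  shows "WI (length v - 1) (G (pm ((!) (sls T)) (atom v))) \<longleftrightarrow> Mk G ((!) (sls T) ` set v)"
  using face_functor(2,3)[OF G T v] unfolding Mk_def by simp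

lemma image_remove:
  assumes "finite T" "card T = Suc n" "i \<le> n"
  shows "(!) (sls T) ` ({..n} - {i}) = T - {sls T ! i}"
  using inj_on_image_set_diff[OF nth_sls(2)[OF assms(1,2)], of "{..n}" "{i}"] nth_sls(3)[OF assms(1,2)] assms(3) by auto

lemma thin_set:
  assumes G: "tfun (Dl N) G" and T: "T \<subseteq> {..N}" "3 \<le> card T" "t \<in> T" and top: "Mk G T"
    and face: "\<And>u. u \<in> T \<Longrightarrow> u \<noteq> t \<Longrightarrow> Mk G (T - {u})"
    and low: "\<And>V. V \<subseteq> T \<Longrightarrow> kapS T t \<subseteq> V \<Longrightarrow> 2 \<le> card V \<Longrightarrow> card V + 2 \<le> card T \<Longrightarrow> Mk G V"
  shows "Mk G (T - {t})"
proof -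
  have f: "finite T" using T(1) finite_subset by blast
  obtain n p where n: "card T = Suc n" "n = Suc (Suc p)" using T(2) by (intro that[of "card T - 1" "card T - 3"]) auto
  note N = nth_sls[OF f n(1)]
  define r where "r = (!) (sls T)"
  define F where "F = (\<lambda>x. G (pm r x))"
  have F: "tfun (Dl n) F" unfolding F_def r_def by (rule face_functor(1)[OF G T(1) n(1)])
  have W: "WI (length v - 1) (F (atom v)) \<longleftrightarrow> Mk G (r ` set v)" if "v \<in> Dl n" for v
    unfolding F_def r_def by (rule face_functor_WI[OF G T(1) n(1) that])
  have Wc: "WI (Suc p) (F (atom (coface n i))) \<longleftrightarrow> Mk G (T - {r i})" if "i \<le> n" for i
    using W[OF coface_Dl[OF that]] length_coface[OF that] set_coface[OF that] image_remove[OF f n(1) that] n(2)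
    unfolding r_def by simp
  obtain k where k: "k \<le> n" "t = r k" using N(3) T(3) unfolding r_def by blast
  have "WI (Suc p) (F (atom (coface n k)))"
  proof (rule thin_gen[OF n(2) k(1) F])
    have "Mk G (r ` set (topl n))" using top N(3) unfolding set_topl r_def by simp
    then show "WI n (F (atom (topl n)))" using W[OF topl_Dl] by (simp del: upt_Suc)
  next
    fix v assume v: "v \<in> Dl n" "kap n k \<subseteq> set v" "2 \<le> length v" "length v \<le> Suc p"
    have vn: "set v \<subseteq> {..n}" using v(1) unfolding Dv_def by blast
    have "Mk G (r ` set v)"
    proof (rule low)
      show "r ` set v \<subseteq> T" using image_mono[OF vn, of r] N(3) unfolding r_def by simp
      show "kapS T t \<subseteq> r ` set v" using kapS_nth[OF f n(1) k(1) v(2) vn] k(2) unfolding r_def by simp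
    qed (use face_functor(3)[OF G T(1) n(1) v(1)] v(3,4) n in \<open>simp_all add: r_def\<close>)
    then show "WI (length v - 1) (F (atom v))" using W v(1) by blast
  next
    fix i assume i: "i \<le> n" "i \<noteq> k"
    have "r i \<noteq> t" using i k inj_onD[OF N(2), of i k] unfolding r_def by auto
    moreover have "r i \<in> T" using N(3) i(1) unfolding r_def by blast
    ultimately show "WI (Suc p) (F (atom (coface n i)))" using face Wc[OF i(1)] by blast
  qed
  then show ?thesis using Wc[OF k(1)] k(2) by blast
qed

text \<open>The order of the two faces is left undetermined. It depends only on \<open>n\<close> and
  the position \<open>k\<close> of the middle vertex, so two applications with the same
  \<open>n\<close> and \<open>k\<close> fall into the same case and can be compared.\<close>

lemma one_sided_set:
  assumes G: "tfun (Dl N) G" and T: "T \<subseteq> {..N}" "card T = Suc n" "n = Suc (Suc p)" and top: "Mk G T"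
    and t: "t \<in> T" "a \<in> T" "c \<in> T" "a < t" "t < c" "\<And>x. x \<in> T \<Longrightarrow> x \<le> a \<or> x = t \<or> c \<le> x"
    and k: "card {x \<in> T. x < t} = k"
    and face: "\<And>u. u \<in> T \<Longrightarrow> u \<noteq> a \<Longrightarrow> u \<noteq> c \<Longrightarrow> Mk G (T - {u})"
    and low: "\<And>V. V \<subseteq> T \<Longrightarrow> kapS T a \<subseteq> V \<or> kapS T c \<subseteq> V \<Longrightarrow> 2 \<le> card V \<Longrightarrow> card V + 2 \<le> card T \<Longrightarrow> Mk G V"
  shows "if lt (coface n (Suc k)) (coface n (k - 1))
    then RI p (G (atom (sls (T - {a})))) \<and> LI p (G (atom (sls (T - {c}))))
    else RI p (G (atom (sls (T - {c})))) \<and> LI p (G (atom (sls (T - {a}))))"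
proof -
  have f: "finite T" using T(1) finite_subset by blast
  note N = nth_sls[OF f T(2)]
  define r where "r = (!) (sls T)"
  define F where "F = (\<lambda>x. G (pm r x))"
  have F: "tfun (Dl n) F" unfolding F_def r_def by (rule face_functor(1)[OF G T(1,2)])
  have W: "WI (length v - 1) (F (atom v)) \<longleftrightarrow> Mk G (r ` set v)" if "v \<in> Dl n" for v
    unfolding F_def r_def by (rule face_functor_WI[OF G T(1,2) that])
  have Fc: "F (atom (coface n i)) = G (atom (sls (T - {r i})))" if "i \<le> n" for i
    using face_functor(2)[OF G T(1,2) coface_Dl[OF that]] set_coface[OF that] image_remove[OF f T(2) that] T(3)
    unfolding F_def r_def by simp
  have Wc: "WI (Suc p) (F (atom (coface n i))) \<longleftrightarrow> Mk G (T - {r i})" if "i \<le> n" for i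
    using W[OF coface_Dl[OF that]] length_coface[OF that] set_coface[OF that] image_remove[OF f T(2) that] T(3)
    unfolding r_def by simp
  have rT: "r i \<in> T" if "i \<le> n" for i using N(3) that unfolding r_def by blast
  have rlt: "r i < r j \<longleftrightarrow> i < j" if "i \<le> n" "j \<le> n" for i j
    using N(1)[of i j] N(1)[of j i] that unfolding r_def by (cases i j rule: linorder_cases) auto
  obtain kt where kt: "kt \<le> n" "t = r kt" using N(3) t(1) unfolding r_def by blast
  have "kt = k" using nth_position[OF f T(2) kt(1)] kt(2) k unfolding r_def by simp
  then have kn: "k \<le> n" "t = r k" using kt by auto
  obtain ia ic where ia: "ia \<le> n" "a = r ia" and ic: "ic \<le> n" "c = r ic" using N(3) t(2,3) unfolding r_def by blast
  have ik: "ia < k" "k < ic" using t(4,5) rlt ia ic kn by blast+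
  have gap: "i \<le> ia \<or> i = k \<or> ic \<le> i" if "i \<le> n" for i
  proof -
    have "\<not> r ia < r i \<or> \<not> r i < r k \<and> \<not> r k < r i \<or> \<not> r i < r ic"
      using t(6)[OF rT[OF that]] unfolding ia(2) ic(2) kn(2) by linarith
    then show ?thesis unfolding rlt[OF ia(1) that] rlt[OF that ic(1)] rlt[OF that kn(1)] rlt[OF kn(1) that] by linarith
  qed
  have e: "Suc ia = k" "ic = Suc k"
    using gap[of "Suc ia"] gap[of "Suc k"] ik ic(1) by auto
  have a: "a = r (k - 1)" "c = r (Suc k)" using e ia ic by auto
  have k0: "0 < k" "k < n" using e ic(1) by auto
  have side: "RI p (F (atom (coface n i2))) \<and> LI p (F (atom (coface n i1)))"
    if i: "i1 = Suc k \<and> i2 = k - 1 \<or> i2 = Suc k \<and> i1 = k - 1" and lt: "lt (coface n i1) (coface n i2)" for i1 i2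
  proof (rule conjI; rule one_sided[OF T(3) k0 F _ _ _ i lt])
    have "Mk G (r ` set (topl n))" using top N(3) unfolding set_topl r_def by simp
    then show "WI n (F (atom (topl n)))" "WI n (F (atom (topl n)))" using W[OF topl_Dl] by (simp_all del: upt_Suc)
    show l: "WI (length v - 1) (F (atom v))"
      if v: "v \<in> Dl n" "Suc i = k \<or> i = Suc k" "kap n i \<subseteq> set v" "2 \<le> length v" "length v \<le> Suc p" for v i
    proof -
      have i: "i \<le> n" "r i = a \<or> r i = c" using v(2) a k0 by auto
      have vn: "set v \<subseteq> {..n}" using v(1) unfolding Dv_def by blast
      have "Mk G (r ` set v)"
      proof (rule low)
        show "r ` set v \<subseteq> T" using image_mono[OF vn, of r] N(3) unfolding r_def by simp
        have "kapS T (r i) \<subseteq> r ` set v" using kapS_nth[OF f T(2) i(1) v(3) vn] unfolding r_def .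
        then show "kapS T a \<subseteq> r ` set v \<or> kapS T c \<subseteq> r ` set v" using i(2) by auto
      qed (use face_functor(3)[OF G T(1,2) v(1)] v(4,5) T in \<open>simp_all add: r_def\<close>)
      then show "WI (length v - 1) (F (atom v))" using W v(1) by blast
    qed
    show "WI (length v - 1) (F (atom v))"
      if v: "v \<in> Dl n" "Suc i = k \<or> i = Suc k" "kap n i \<subseteq> set v" "2 \<le> length v" "length v \<le> Suc p" for v i
      using l[OF v] .
    show g: "WI (Suc p) (F (atom (coface n i)))" if i: "i \<le> n" "Suc i \<noteq> k" "i \<noteq> Suc k" for i
    proof -
      have "r i \<noteq> a" "r i \<noteq> c"
        using rlt[OF i(1) ia(1)] rlt[OF ia(1) i(1)] rlt[OF i(1) ic(1)] rlt[OF ic(1) i(1)] ia(2) ic(2) e i by force+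
      then show ?thesis using face[OF rT[OF i(1)]] Wc[OF i(1)] by blast
    qed
    show "WI (Suc p) (F (atom (coface n i)))" if "i \<le> n" "Suc i \<noteq> k" "i \<noteq> Suc k" for i
      using g[OF that] .
  qed
  have ne: "coface n (Suc k) \<noteq> coface n (k - 1)" 
  proof
    assume "coface n (Suc k) = coface n (k - 1)"
    then have "Suc k = k - 1" using coface_inj[of "Suc k" n "k - 1"] k0 by linarith
    then show False by simp
  qed
  show ?thesis
  proof (cases "lt (coface n (Suc k)) (coface n (k - 1))")
    case True
    then show ?thesis using side[of "Suc k" "k - 1"] Fc[of "Suc k"] Fc[of "k - 1"] a k0 by simp
  next
    case False
    then have "lt (coface n (k - 1)) (coface n (Suc k))" using lt_total ne by blast
    then show ?thesis using False side[of "k - 1" "Suc k"] Fc[of "Suc k"] Fc[of "k - 1"] a k0 by simp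
  qed
qed

text \<open>The values at \<open>\<sigma> \<union> {q+1, q+2}\<close> acquire a right inverse from one of the simplices
  \<open>\<sigma> \<union> {q, q+1, q+2}\<close> and \<open>\<sigma> \<union> {q+1, q+2, q+3}\<close> and a left inverse from the other; the remaining
  faces follow by division.\<close>

lemma two_out_of_six:
  assumes G: "tfun (Dl N) G" and q: "q + 3 \<le> N"
    and hyp: "\<And>S. S \<subseteq> {..N} \<Longrightarrow> {q, q+2} \<subseteq> S \<or> {q+1, q+3} \<subseteq> S \<or> 3 \<le> card (S \<inter> {q..q+3}) \<Longrightarrow> Mk G S"
  shows "S \<subseteq> {..N} \<Longrightarrow> 2 \<le> card (S \<inter> {q..q+3}) \<Longrightarrow> Mk G S"
proof (induction "card (S - {q..q+3})" arbitrary: S rule: less_induct)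
  case less
  define Q where "Q = {q..q+3}"
  have Q: "Q = {q, q+1, q+2, q+3}" unfolding Q_def by auto
  define A where "A = S - Q"
  have fS: "finite S" using less.prems(1) finite_subset by blast
  have A: "A \<subseteq> {..N}" "A \<inter> Q = {}" "finite A" using less.prems(1) fS unfolding A_def by auto
  have aQ: "x < q \<or> q + 3 < x" if "x \<in> A" for x using that A(2) unfolding Q_def by force
  have IH: "Mk G V" if V: "V \<subseteq> A \<union> Q" "{x, y} \<subseteq> V \<inter> Q" "x \<noteq> y" "\<not> A \<subseteq> V" for V x y
  proof (rule less.hyps)
    have "V - Q \<subset> A" using V(1,4) A(2) by blast
    then show "card (V - {q..q+3}) < card (S - {q..q+3})" using psubset_card_mono[OF A(3)] unfolding A_def Q_def by blast
    show "V \<subseteq> {..N}" using V(1) A(1) q unfolding Q_def by auto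
    have "card {x, y} \<le> card (V \<inter> Q)" using V(2) unfolding Q_def by (intro card_mono) auto
    then show "2 \<le> card (V \<inter> {q..q+3})" using V(3) unfolding Q_def by simp
  qed
  have hyp': "Mk G V" if V: "V \<subseteq> A \<union> Q" "{q, q+2} \<subseteq> V \<or> {q+1, q+3} \<subseteq> V" for V
  proof (rule hyp)
    show "V \<subseteq> {..N}" using V(1) A(1) q unfolding Q_def by auto
  qed (use V(2) in blast)
  \<comment> \<open>Containing all of \<open>A\<close> and two vertices of \<open>Q\<close> would
    require at least \<open>card A + 2\<close> elements, more than \<open>V\<close> has. So
    \<open>V\<close> misses part of \<open>A\<close>, and the induction hypothesis applies.\<close>
  have lowM: "Mk G V" if V: "V \<subseteq> A \<union> Q" "x \<in> V" "y \<in> V" "x \<in> Q" "y \<in> Q" "x \<noteq> y" "card V + 2 \<le> card A + 3" for V x y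
  proof (rule IH[OF V(1) _ V(6)])
    show "{x, y} \<subseteq> V \<inter> Q" using V by blast
    show "\<not> A \<subseteq> V"
    proof
      assume s: "A \<subseteq> V"
      have "{x, y} \<inter> A = {}" using V(4,5) A(2) by blast
      then have "card (A \<union> {x, y}) = card A + 2" using card_Un_disjoint[OF A(3), of "{x, y}"] V(6) by auto
      moreover have "finite V" using V(1) A(3) unfolding Q by (auto intro: finite_subset)
      then have "card (A \<union> {x, y}) \<le> card V" using V(2,3) s by (intro card_mono) auto
      ultimately show False using V(7) by simp
    qed
  qed
  have cA: "card (A \<union> {x, y, z}) = card A + 3" if "{x, y, z} \<subseteq> Q" "x \<noteq> y" "x \<noteq> z" "y \<noteq> z" for x y z
  proof -
    have "A \<inter> {x, y, z} = {}" using that(1) A(2) by blast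
    then show ?thesis using card_Un_disjoint[OF A(3), of "{x, y, z}"] that(2-4) by simp
  qed
  define p n where "p = card A" and "n = card A + 2"
  have n: "n = Suc (Suc p)" unfolding n_def p_def by simp
  define B where "B = {x \<in> A. x < q}"
  have fB: "finite B" "B \<inter> Q = {}" using A unfolding B_def by auto
  define T1 T2 T3 X where "T1 = A \<union> {q, q+1, q+2}" and "T2 = A \<union> {q+1, q+2, q+3}" and "T3 = A \<union> {q, q+1, q+3}"
    and "X = A \<union> {q+1, q+2}"
  note TD = T1_def T2_def T3_def
  have Tc: "card T1 = card A + 3" "card T2 = card A + 3" "card T3 = card A + 3" unfolding TD by (rule cA; simp add: Q)+
  have TN: "T1 \<subseteq> {..N}" "T2 \<subseteq> {..N}" "T3 \<subseteq> {..N}" using A(1) q unfolding TD by auto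
  have TQ: "T1 \<subseteq> A \<union> Q" "T2 \<subseteq> A \<union> Q" "T3 \<subseteq> A \<union> Q" unfolding Q TD by auto
  have k1: "q \<notin> A" "q+1 \<notin> A" "q+2 \<notin> A" "q+3 \<notin> A" using A(2) unfolding Q by auto
  have qQ: "q \<in> Q" "q+1 \<in> Q" "q+2 \<in> Q" "q+3 \<in> Q" unfolding Q by auto
  have TM: "Mk G T1" "Mk G T2" "Mk G T3"
    using hyp'[OF TQ(1)] hyp'[OF TQ(2)] hyp'[OF TQ(3)] unfolding TD by simp_all
  have Bc: "card (insert q B) = Suc (card B)" "card (insert (q+1) B) = Suc (card B)"
    using fB unfolding Q by auto
  \<comment> \<open>The middle vertex q + 1 of \<open>T1\<close> and the middle vertex q + 2 of
    \<open>T2\<close> have the same position, so both uses of \<open>one_sided_set\<close> branch on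
    the same condition.\<close>
  have "{x \<in> T1. x < q+1} = insert q B" "{x \<in> T2. x < q+2} = insert (q+1) B"
    unfolding B_def TD using aQ by force+
  then have pos: "card {x \<in> T1. x < q+1} = Suc (card B)" "card {x \<in> T2. x < q+2} = Suc (card B)" using Bc by simp_all
  have rm: "T1 - {q} = X" "T2 - {q+3} = X" using k1 unfolding TD X_def by auto
  have gap: "x \<in> A \<Longrightarrow> x \<le> q \<or> q + 3 \<le> x" for x using aQ[of x] by linarith
  have kp: "q \<in> kapS T1 q" "q+1 \<in> kapS T1 q" "q+1 \<in> kapS T1 (q+2)" "q+2 \<in> kapS T1 (q+2)"
    "q+1 \<in> kapS T2 (q+1)" "q+2 \<in> kapS T2 (q+1)" "q+2 \<in> kapS T2 (q+3)" "q+3 \<in> kapS T2 (q+3)"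
    "q \<in> kapS T3 (q+1)" "q+1 \<in> kapS T3 (q+1)"
    unfolding kapS_def TD by auto
  have 1: "if lt (coface n (Suc (Suc (card B)))) (coface n (Suc (card B) - 1))
    then RI p (G (atom (sls (T1 - {q})))) \<and> LI p (G (atom (sls (T1 - {q+2}))))
    else RI p (G (atom (sls (T1 - {q+2})))) \<and> LI p (G (atom (sls (T1 - {q}))))"
  proof (rule one_sided_set[OF G TN(1) _ n TM(1), of "q+1"])
    show "Mk G (T1 - {u})" if u: "u \<in> T1" "u \<noteq> q" "u \<noteq> q+2" for u
    proof (rule hyp')
      show "T1 - {u} \<subseteq> A \<union> Q" using TQ by blast
    qed (use u in \<open>simp add: T1_def\<close>)
    show "Mk G V" if V: "V \<subseteq> T1" "kapS T1 q \<subseteq> V \<or> kapS T1 (q+2) \<subseteq> V" "2 \<le> card V" "card V + 2 \<le> card T1" for V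
    proof -
      have v: "V \<subseteq> A \<union> Q" "card V + 2 \<le> card A + 3" using V(1,4) TQ Tc by auto
      show ?thesis using V(2) lowM[OF v(1) _ _ qQ(1,2) _ v(2)] lowM[OF v(1) _ _ qQ(2,3) _ v(2)] kp(1-4) by auto
    qed
    show "x \<le> q \<or> x = q+1 \<or> q+2 \<le> x" for x by auto
  qed (use pos Tc in \<open>simp_all add: T1_def n_def\<close>)
  have 2: "if lt (coface n (Suc (Suc (card B)))) (coface n (Suc (card B) - 1))
    then RI p (G (atom (sls (T2 - {q+1})))) \<and> LI p (G (atom (sls (T2 - {q+3}))))
    else RI p (G (atom (sls (T2 - {q+3})))) \<and> LI p (G (atom (sls (T2 - {q+1}))))"
  proof (rule one_sided_set[OF G TN(2) _ n TM(2), of "q+2"])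
    show "Mk G (T2 - {u})" if u: "u \<in> T2" "u \<noteq> q+1" "u \<noteq> q+3" for u
    proof (rule hyp')
      show "T2 - {u} \<subseteq> A \<union> Q" using TQ by blast
    qed (use u in \<open>simp add: T2_def\<close>)
    show "Mk G V" if V: "V \<subseteq> T2" "kapS T2 (q+1) \<subseteq> V \<or> kapS T2 (q+3) \<subseteq> V" "2 \<le> card V" "card V + 2 \<le> card T2" for V
    proof -
      have v: "V \<subseteq> A \<union> Q" "card V + 2 \<le> card A + 3" using V(1,4) TQ Tc by auto
      show ?thesis using V(2) lowM[OF v(1) _ _ qQ(2,3) _ v(2)] lowM[OF v(1) _ _ qQ(3,4) _ v(2)] kp(5-8) by auto
    qed
    show "x \<le> q+1 \<or> x = q+2 \<or> q+3 \<le> x" for x by auto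
  qed (use pos Tc in \<open>simp_all add: T2_def n_def\<close>)
  \<comment> \<open>\<open>X\<close> arises from \<open>T1\<close> by removing the neighbour below
    the middle vertex and from \<open>T2\<close> by removing the one above. Whichever branch holds,
    one gives a right inverse and the other a left inverse.\<close>
  have "RI p (G (atom (sls X)))" "LI p (G (atom (sls X)))"
    using 1 2 unfolding rm by (auto split: if_splits)
  then have "WI (Suc p) (G (atom (sls X)))" by (rule RI_LI_WI)
  moreover have "card X = Suc (Suc p)"
  proof -
    have "A \<inter> {q+1, q+2} = {}" using k1 by blast
    then show ?thesis using card_Un_disjoint[OF A(3), of "{q+1, q+2}"] unfolding X_def p_def by simp
  qed
  ultimately have X: "Mk G X" unfolding Mk_def by simp
  have thin: "Mk G (T - {t})"
    if T: "T \<subseteq> {..N}" "T \<subseteq> A \<union> Q" "card T = card A + 3" "t \<in> T" "Mk G T"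
      and xy: "x \<in> kapS T t" "y \<in> kapS T t" "x \<in> Q" "y \<in> Q" "x \<noteq> y"
      and face: "\<And>u. u \<in> T \<Longrightarrow> u \<noteq> t \<Longrightarrow> Mk G (T - {u})" for T t x y
  proof (rule thin_set[OF G T(1) _ T(4,5) face])
    show "Mk G V" if V: "V \<subseteq> T" "kapS T t \<subseteq> V" "2 \<le> card V" "card V + 2 \<le> card T" for V
      by (rule lowM[OF _ _ _ xy(3,4,5)]) (use V T(2,3) xy(1,2) in auto)
  qed (use T(3) in auto)
  \<comment> \<open>With \<open>X\<close> known, each of \<open>T1\<close> and \<open>T2\<close> has
    one unknown face left, and thinness supplies it; then the same holds for \<open>T3\<close>. This
    settles the pairs {q, q+1}, {q+2, q+3} and {q, q+3} over \<open>A\<close>.\<close>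
  have F: "Mk G (T1 - {q+2})"
  proof (rule thin[OF TN(1) TQ(1) Tc(1) _ TM(1) kp(3,4) qQ(2,3)])
    show "Mk G (T1 - {u})" if u: "u \<in> T1" "u \<noteq> q+2" for u
    proof (cases "u = q")
      case False
      show ?thesis
      proof (rule hyp')
        show "T1 - {u} \<subseteq> A \<union> Q" using TQ by blast
      qed (use u False in \<open>simp add: T1_def\<close>)
    qed (use X rm in simp)
  qed (simp_all add: T1_def)
  have F2: "Mk G (T2 - {q+1})"
  proof (rule thin[OF TN(2) TQ(2) Tc(2) _ TM(2) kp(5,6) qQ(2,3)])
    show "Mk G (T2 - {u})" if u: "u \<in> T2" "u \<noteq> q+1" for u
    proof (cases "u = q+3")
      case False
      show ?thesis
      proof (rule hyp')
        show "T2 - {u} \<subseteq> A \<union> Q" using TQ by blast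
      qed (use u False in \<open>simp add: T2_def\<close>)
    qed (use X rm in simp)
  qed (simp_all add: T2_def)
  have e1: "T1 - {q+2} = A \<union> {q, q+1}" "T3 - {q+3} = A \<union> {q, q+1}" "T2 - {q+1} = A \<union> {q+2, q+3}" "T3 - {q+1} = A \<union> {q, q+3}"
    using k1 unfolding TD by auto
  have F3: "Mk G (T3 - {q+1})"
  proof (rule thin[OF TN(3) TQ(3) Tc(3) _ TM(3) kp(9,10) qQ(1,2)])
    show "Mk G (T3 - {u})" if u: "u \<in> T3" "u \<noteq> q+1" for u
    proof (cases "u = q+3")
      case False
      show ?thesis
      proof (rule hyp')
        show "T3 - {u} \<subseteq> A \<union> Q" using TQ by blast
      qed (use u False in \<open>simp add: T3_def\<close>)
    qed (use F e1 in simp)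
  qed (simp_all add: T3_def)
  show ?case
  proof (cases "3 \<le> card (S \<inter> Q)")
    case True
    then show ?thesis using hyp[OF less.prems(1)] unfolding Q_def by blast
  next
    case False
    then have "card (S \<inter> Q) = 2" using less.prems(2) unfolding Q_def by simp
    then obtain x y where xy: "S \<inter> Q = {x, y}" "x \<noteq> y" by (auto simp: card_2_iff)
    have "\<exists>x y. S \<inter> Q = {x, y} \<and> x < y \<and> x \<in> Q \<and> y \<in> Q"
    proof (cases "x < y")
      case True
      then show ?thesis using xy by (intro exI[of _ x] exI[of _ y]) auto
    next
      case False
      then show ?thesis using xy by (intro exI[of _ y] exI[of _ x]) auto
    qed
    then obtain x y where xy: "S \<inter> Q = {x, y}" "x < y" "x \<in> Q" "y \<in> Q" by blast
    have S: "S = A \<union> {x, y}" using xy(1) unfolding A_def by blast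
    have S2: "S \<subseteq> A \<union> Q" unfolding A_def by blast
    have "x = q \<and> y = q+1 \<or> x = q \<and> y = q+2 \<or> x = q \<and> y = q+3 \<or> x = q+1 \<and> y = q+2 \<or> x = q+1 \<and> y = q+3 \<or> x = q+2 \<and> y = q+3"
      using xy(2-4) unfolding Q by auto
    then show ?thesis
    proof (elim disjE)
      assume "x = q \<and> y = q+1" then show ?thesis using F e1 S by simp
    next
      assume "x = q \<and> y = q+2" then show ?thesis using hyp'[OF S2] S by simp
    next
      assume "x = q \<and> y = q+3" then show ?thesis using F3 e1 S by simp
    next
      assume "x = q+1 \<and> y = q+2" then show ?thesis using X S unfolding X_def by simp
    next
      assume "x = q+1 \<and> y = q+3" then show ?thesis using hyp'[OF S2] S by simp
    next
      assume "x = q+2 \<and> y = q+3" then show ?thesis using F2 e1 S by simp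
    qed
  qed
qed

end

section \<open>Lifting problems\<close>

text \<open>With equal underlying simplicial sets the lift must be \<open>u\<close> itself, and maps
  to the terminal object impose no condition. Only the additional markings remain to be
  checked.\<close>

lemma lifts_same:
  assumes "splx A = splx B" "act A = act B"
    and m: "\<And>u m b. strat_map A X u \<Longrightarrow> b \<in> marked B m \<Longrightarrow> u m b \<in> marked X m"
  shows "lifts_against X A B"
  unfolding lifts_against_def has_rlp_def
proof (intro allI impI, elim conjE)
  fix u v assume u: "strat_map A X u"
  then have "strat_map B X u" using m[OF u] assms(1,2) unfolding strat_map_def by auto
  then show "\<exists>h. strat_map B X h \<and> (\<forall>n. \<forall>a\<in>splx A n. h n a = u n a) \<and> (\<forall>n. \<forall>b\<in>splx B n. () = v n b)"
    by (intro exI[of _ u]) simp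
qed

lemma nth_id_map: "map ((!) s) (topl m) = s" if "length s = Suc m"
  using that map_nth[of s] by (simp del: upt_Suc)

lemma Delta_hom_iff: "s \<in> Delta_hom m N \<longleftrightarrow> s \<in> splx (Delta (int N)) m"
  unfolding splx_Delta Delta_hom_def by auto

lemma Dl_hom: "s \<in> Dl N \<Longrightarrow> length s = Suc m \<Longrightarrow> s \<in> Delta_hom m N"
  unfolding Dv_def Delta_hom_def strict_iff by simp

lemma hom_Dl: "s \<in> Delta_hom m N \<Longrightarrow> strict s \<Longrightarrow> s \<in> Dl N"
  unfolding Dv_def Delta_hom_def by auto

lemma Delta_act [simp]: "act (Delta N) n \<theta> s = map ((!) s) \<theta>"
  by (simp add: Delta_def Delta_comp_def)

lemma kap_adm: "kap n k \<subseteq> set s \<Longrightarrow> {int k - 1, int k, int k + 1} \<inter> {0..int n} \<subseteq> int ` set s"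
proof
  fix x assume k: "kap n k \<subseteq> set s" and x: "x \<in> {int k - 1, int k, int k + 1} \<inter> {0..int n}"
  then have "nat x \<in> kap n k" unfolding kap_def by auto
  moreover have "x = int (nat x)" using x by auto
  ultimately show "x \<in> int ` set s" using k by blast
qed

lemma adm_kap: "{int k - 1, int k, int k + 1} \<inter> {0..int n} \<subseteq> int ` set s \<Longrightarrow> kap n k \<subseteq> set s"
proof
  fix i assume k: "{int k - 1, int k, int k + 1} \<inter> {0..int n} \<subseteq> int ` set s" and i: "i \<in> kap n k"
  from i have "i \<le> n \<and> (i = k \<or> Suc i = k \<or> i = Suc k)" unfolding kap_def by blast
  then have "int i \<in> {int k - 1, int k, int k + 1} \<inter> {0..int n}" by (simp, linarith)
  then have "int i \<in> int ` set s" using k by blast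
  then show "i \<in> set s" by (simp add: image_iff)
qed

context strict_omega_category
begin

lemma marked_adm: "s \<in> marked (Delta_adm k n) m \<longleftrightarrow> s \<in> splx (Delta (int n)) m \<and> (\<not> strict s \<or> 0 < m \<and> kap n k \<subseteq> set s)"
proof -
  have "degenerate (Delta (int n)) m \<subseteq> splx (Delta (int n)) m"
  proof
    fix s assume "s \<in> degenerate (Delta (int n)) m"
    then obtain m' i y where h: "m = m' + 1" "i \<le> m'" "y \<in> splx (Delta (int n)) m'" "s = map ((!) y) (codegeneracy m' i)"
      unfolding degenerate_def by auto
    have "codegeneracy m' i \<in> Delta_hom m m'" using h(1,2) unfolding Delta_hom_def codegeneracy_def by (auto simp: sorted_append)
    moreover have "y \<in> Delta_hom m' n" using h(3) Delta_hom_iff by blast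
    ultimately show "s \<in> splx (Delta (int n)) m"
      using Delta_comp_hom h(4) Delta_hom_iff unfolding Delta_comp_def by blast
  qed
  then show ?thesis
    unfolding Delta_adm_def with_marking_def using degenerate_Delta[of s "int n" m] kap_adm[of n k s] adm_kap[of k n s] by auto
qed

lemma codegeneracy_hom: "i \<le> m \<Longrightarrow> codegeneracy m i \<in> Delta_hom (Suc m) m" "i \<le> m \<Longrightarrow> \<not> strict (codegeneracy m i)"
proof -
  show "i \<le> m \<Longrightarrow> codegeneracy m i \<in> Delta_hom (Suc m) m"
    unfolding Delta_hom_def codegeneracy_def by (auto simp: sorted_append)
  show "i \<le> m \<Longrightarrow> \<not> strict (codegeneracy m i)" unfolding codegeneracy_def strict_iff by auto
qed

abbreviation "NX \<equiv> with_marking NC (nerve_marking C)"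

lemma NX_sel: "splx NX = splx NC" "act NX = act NC" "marked NX = nerve_marking C"
  by (simp_all add: with_marking_def)

lemma marking_iff: "f \<in> nerve_marking C n \<longleftrightarrow> f \<in> splx NC n \<and> 0 < n \<and> hat.WI n (Fh f (atom (topl n)))"
proof -
  have t: "atom (topl n) \<in> oriental_cell n n"
    unfolding oriental_cell_iff using atom_Cell[OF complex_Dv topl_Dl] by (simp add: atom_zero del: upt_Suc)
  have "hat.WI n (Fh f (atom (topl n))) \<longleftrightarrow> weakly_invertible C n (f n (top_cell n))" if f: "f \<in> splx NC n"
    unfolding top_cell_atom Fh_at[OF f t] by (rule WI_hat[OF nerve_functor(1)[OF f t]])
  then show ?thesis unfolding nerve_marking_def by blast
qed

lemma Fh_act_atom:
  assumes f: "f \<in> splx NC N" and s: "s \<in> Delta_hom m N" "strict s"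
  shows "Fh (act NC N s f) (atom (topl m)) = Fh f (atom s)"
proof -
  have l: "length s = Suc m" using s(1) unfolding Delta_hom_def by simp
  have "pm ((!) s) (atom (topl m)) = atom (map ((!) s) (topl m))"
  proof (rule pm_atom[OF strict_topl])
    fix a b assume "a \<in> set (topl m)" "b \<in> set (topl m)" "a < b"
    then show "s ! a < s ! b" using sorted_wrt_nth_less[OF s(2)] l by auto
  qed
  then show ?thesis using nerve_act(2)[OF f s(1) atom_Cell[OF complex_Dv topl_Dl]] nth_id_map[OF l] by simp
qed

lemma act_marked:
  assumes "f \<in> splx NC N" "s \<in> Delta_hom m N" "strict s"
  shows "act NC N s f \<in> nerve_marking C m \<longleftrightarrow> 0 < m \<and> hat.WI m (Fh f (atom s))"
  unfolding marking_iff Fh_act_atom[OF assms] using nerve_act(1)[OF assms(1,2)] by blast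

text \<open>The operator sends the top simplex to a degenerate one, so the image of its cell has a
  zero entry of index \<open>m\<close>. Its value is therefore a unit, and units are weakly
  invertible.\<close>

lemma act_degenerate:
  assumes f: "f \<in> splx NC N" and s: "s \<in> Delta_hom m N" "\<not> strict s"
  shows "act NC N s f \<in> nerve_marking C m"
proof -
  have l: "length s = Suc m" using s(1) unfolding Delta_hom_def by simp
  have m: "0 < m" using s(2) l by (cases s; cases "tl s") auto
  define x where "x = pm ((!) s) (atom (topl m))"
  have tC: "atom (topl m) \<in> Cell (Dl m)" using atom_Cell[OF complex_Dv topl_Dl] .
  have xC: "x \<in> Cell (Dl N)" unfolding x_def using pm_Cell[OF Delta_hom_mono[OF s(1)] tC] by blast
  have "x k \<alpha> = 0" if "m - 1 < k" for k \<alpha>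
  proof (cases "k = m")
    case True
    have "atom (topl m) m \<alpha> = frag_of (topl m)" by (rule atom_top) (simp del: upt_Suc)
    then show ?thesis using s(2) nth_id_map[OF l] True unfolding x_def pm_def by (simp add: push_def del: upt_Suc)
  next
    case False
    then have "atom (topl m) k \<alpha> = 0" using that by (intro atom_zero) (simp del: upt_Suc)
    then show ?thesis unfolding x_def pm_def by simp
  qed
  then have "Fh f x \<in> hat.cells (m - 1)" using hat.tfun_cells[OF nerve_tfun[OF f] xC] by blast
  then have "hat.WI m (Fh f x)" using hat.WI_unit m by simp
  moreover have "Fh (act NC N s f) (atom (topl m)) = Fh f x" unfolding x_def by (rule nerve_act(2)[OF f s(1) tC])
  ultimately show ?thesis unfolding marking_iff using nerve_act(1)[OF f s(1)] m by simp
qed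

lemma nerve_comp:
  assumes "f \<in> splx NC n" "\<theta> \<in> Delta_hom m n" "\<phi> \<in> Delta_hom l m"
  shows "act NC m \<phi> (act NC n \<theta> f) = act NC n (map ((!) \<theta>) \<phi>) f"
  using simplicial_nerve assms unfolding simplicial_set_def Delta_comp_def by blast

lemma stratified_nerve: "stratified_set NX"
proof -
  have "degenerate NC n \<subseteq> nerve_marking C n" for n
  proof
    fix x assume "x \<in> degenerate NC n"
    then obtain m i y where h: "n = m + 1" "i \<le> m" "y \<in> splx NC m" "x = act NC m (codegeneracy m i) y"
      unfolding degenerate_def by blast
    then show "x \<in> nerve_marking C n" using act_degenerate[OF h(3) codegeneracy_hom(1)[OF h(2)]] codegeneracy_hom(2)[OF h(2)] h(1,4) by simp
  qed
  moreover have "simplicial_set NX" using simplicial_nerve unfolding simplicial_set_def NX_sel .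
  moreover have "degenerate NX n = degenerate NC n" for n unfolding degenerate_def NX_sel ..
  ultimately show ?thesis unfolding stratified_set_def NX_sel nerve_marking_def by auto
qed

lemma u_marked:
  assumes "strat_map A NX u" "b \<in> marked A m" shows "u m b \<in> nerve_marking C m"
  using assms unfolding strat_map_def NX_sel by blast

lemma u_splx:
  assumes "strat_map A NX u" "b \<in> splx A m" shows "u m b \<in> splx NC m"
  using assms unfolding strat_map_def NX_sel by blast

lemma u_act:
  assumes "strat_map A NX u" "b \<in> splx A m" "\<theta> \<in> Delta_hom l m" shows "u l (act A m \<theta> b) = act NC m \<theta> (u m b)"
  using assms unfolding strat_map_def NX_sel by blast

lemma thin_lift:
  assumes n: "1 \<le> n" and k: "k \<le> n"
  shows "lifts_against NX (Delta_adm' k n) (Delta_adm'' k n)"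
proof (rule lifts_same)
  show "splx (Delta_adm' k n) = splx (Delta_adm'' k n)" "act (Delta_adm' k n) = act (Delta_adm'' k n)"
    by (simp_all add: Delta_adm'_def Delta_adm''_def mark_faces_def with_marking_def)
  fix u m b assume u: "strat_map (Delta_adm' k n) NX u" and b: "b \<in> marked (Delta_adm'' k n) m"
  have sel: "splx (Delta_adm' k n) = splx (Delta (int n))" "act (Delta_adm' k n) = act (Delta (int n))"
    by (simp_all add: Delta_adm'_def mark_faces_def with_marking_def Delta_adm_def)
  have sub: "marked (Delta_adm k n) m \<subseteq> marked (Delta_adm' k n) m" for m
    by (auto simp: Delta_adm'_def mark_faces_def with_marking_def)
  \<comment> \<open>By the Yoneda lemma \<open>u\<close> is determined by its value on the top
    simplex.\<close>
  define g where "g = u n (topl n)"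
  have t: "topl n \<in> splx (Delta (int n)) n" using Dl_hom[OF topl_Dl, of n n] unfolding Delta_hom_iff by (simp del: upt_Suc)
  have g: "g \<in> splx NC n" unfolding g_def using u_splx[OF u, of "topl n" n] t unfolding sel by blast
  have ug: "u l s = act NC n s g" if s: "s \<in> Delta_hom l n" for l s
  proof -
    have "map ((!) (topl n)) s = s" using s unfolding Delta_hom_def by (intro map_idI) (auto simp del: upt_Suc)
    then show ?thesis using u_act[OF u, of "topl n" n s l] t s unfolding sel g_def by (simp del: upt_Suc)
  qed
  have mk: "hat.WI (length s - 1) (Fh g (atom s))" if s: "s \<in> Dl n" "s \<in> marked (Delta_adm' k n) (length s - 1)" for s
  proof -
    have st: "strict s" "s \<noteq> []" using s(1) unfolding Dv_def by auto
    then have h: "s \<in> Delta_hom (length s - 1) n" by (intro Dl_hom[OF s(1)]) simp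
    show ?thesis using u_marked[OF u s(2)] unfolding ug[OF h] act_marked[OF g h st(1)] by blast
  qed
  have mk2: "hat.WI (length s - 1) (Fh g (atom s))" if s: "s \<in> Dl n" "kap n k \<subseteq> set s" "2 \<le> length s" for s
  proof (rule mk[OF s(1)])
    have "s \<in> splx (Delta (int n)) (length s - 1)" using Dl_hom[OF s(1), of "length s - 1"] s(3) unfolding Delta_hom_iff by simp
    then have "s \<in> marked (Delta_adm k n) (length s - 1)" unfolding marked_adm using s(2,3) by simp
    then show "s \<in> marked (Delta_adm' k n) (length s - 1)" using sub by blast
  qed
  show "u m b \<in> marked NX m"
  proof (cases "b \<in> marked (Delta_adm k n) m")
    case True
    then show ?thesis using u_marked[OF u, of b m] sub unfolding NX_sel by blast
  next
    case False
    then obtain i where i: "b = coface n i" "i \<le> n" "0 < m" "n = Suc m"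
      using b by (auto simp: Delta_adm''_def mark_faces_def with_marking_def)
    \<comment> \<open>A newly marked face has positive dimension, so n is at least 2; for n = 1 the
      faces are vertices.\<close>
    then obtain p where p: "n = Suc (Suc p)" "m = Suc p" by (cases m) auto
    have W: "hat.WI (Suc p) (Fh g (atom (coface n i)))" if i: "i \<le> n" "i \<noteq> k" for i
    proof (cases "Suc i = k \<or> i = Suc k")
      case True
      then have "coface n i \<in> marked (Delta_adm' k n) (Suc p)"
        using i p unfolding Delta_adm'_def mark_faces_def with_marking_def by auto
      then show ?thesis using mk[OF coface_Dl[OF i(1)]] length_coface[OF i(1)] p by simp
    next
      case False
      then show ?thesis using mk2[OF coface_Dl[OF i(1)]] kap_face[OF i] length_coface[OF i(1)] p by simp
    qed
    have "hat.WI (Suc p) (Fh g (atom (coface n i)))"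
    proof (cases "i = k")
      case True
      have "hat.WI (Suc p) (Fh g (atom (coface n k)))"
      proof (rule hat.thin_gen[OF p(1) k nerve_tfun[OF g]])
        show "hat.WI n (Fh g (atom (topl n)))"
          using mk2[OF topl_Dl] p unfolding set_topl kap_def by (auto simp del: upt_Suc)
      qed (use mk2 W in auto)
      then show ?thesis using True by simp
    qed (use W i(2) in blast)
    moreover have h: "b \<in> Delta_hom m n"
      unfolding i(1) by (rule Dl_hom[OF coface_Dl[OF i(2)]]) (use length_coface[OF i(2)] i(3,4) in auto)
    ultimately show ?thesis
      unfolding NX_sel ug[OF h] using act_marked[OF g h] strict_coface i(1) p by simp
  qed
qed

text \<open>The position of a vertex: inverse to \<open>(!) s\<close> on the vertices of a strictly
  increasing \<open>s\<close>, and monotone on all numbers.\<close>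

definition ps :: "nat list \<Rightarrow> nat \<Rightarrow> nat" where "ps s a = card {x \<in> set s. x < a}"

lemma ps_nth: "strict s \<Longrightarrow> i < length s \<Longrightarrow> ps s (s ! i) = i"
proof -
  assume s: "strict s" "i < length s"
  have "card (set s) = Suc (length s - 1)" using s unfolding strict_iff by (simp add: distinct_card)
  then show ?thesis using nth_position[of "set s" "length s - 1" i] s(2) unfolding sls_set[OF s(1)] ps_def by simp
qed

lemma ps_mono: "a \<le> b \<Longrightarrow> ps s a \<le> ps s b"
  unfolding ps_def by (rule card_mono) auto

lemma nth_ps:
  assumes "strict s" "a \<in> set s" shows "ps s a < length s" "s ! ps s a = a"
proof -
  obtain i where "i < length s" "s ! i = a" using assms(2) by (auto simp: in_set_conv_nth)
  then show "ps s a < length s" "s ! ps s a = a" using ps_nth[OF assms(1)] by auto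
qed

lemma ps_strict: "strict s \<Longrightarrow> a \<in> set s \<Longrightarrow> b \<in> set s \<Longrightarrow> a < b \<Longrightarrow> ps s a < ps s b"
  using nth_ps(2)[of s a] nth_ps(2)[of s b] ps_mono[of a b s] by (metis le_neq_implies_less less_imp_le less_irrefl)

lemma horn_set:
  assumes n: "1 \<le> n" and k: "k \<le> n"
  shows "s \<in> Pb n - {coface n k} \<longleftrightarrow> s \<in> Dl n \<and> (\<exists>i\<le>n. i \<noteq> k \<and> i \<notin> set s)"
proof
  assume s: "s \<in> Pb n - {coface n k}"
  then have D: "s \<in> Dl n" "s \<noteq> topl n" unfolding Pb_def by auto
  have st: "strict s" "set s \<subseteq> {..n}" using D(1) unfolding Dv_def by auto
  have "\<exists>i\<le>n. i \<noteq> k \<and> i \<notin> set s"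
  proof (rule ccontr)
    assume "\<not> ?thesis"
    then have "{..n} - {k} \<subseteq> set s" by auto
    then have "set s = {..n} - {k} \<or> set s = {..n}" using st(2) by auto
    then have "s = coface n k \<or> s = topl n"
      using strict_eqI[OF st(1) strict_coface[of n k]] strict_eqI[OF st(1) strict_topl[of n]] set_coface[OF k] set_topl by metis
    then show False using s D by blast
  qed
  then show "s \<in> Dl n \<and> (\<exists>i\<le>n. i \<noteq> k \<and> i \<notin> set s)" using D by blast
next
  assume s: "s \<in> Dl n \<and> (\<exists>i\<le>n. i \<noteq> k \<and> i \<notin> set s)"
  then obtain i where i: "i \<le> n" "i \<noteq> k" "i \<notin> set s" by blast
  have "i \<in> set (topl n)" "i \<in> set (coface n k)" using i(1,2) unfolding set_coface[OF k] set_topl by simp_all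
  then have "s \<noteq> topl n" "s \<noteq> coface n k" using i(3) by metis+
  then show "s \<in> Pb n - {coface n k}" using s unfolding Pb_def by blast
qed

lemma const_tfun:
  assumes "c \<in> hat.cells 0" shows "hat.tfun P (\<lambda>_. c)"
  unfolding hat.tfun_def
  using assms hat.cells_in hat.cells_D[of c 0] hat.cm_trivial(2)[of c 0 c] by auto

lemma Cell_point: "x \<in> Cell {[k]} \<Longrightarrow> x = atom [k]"
proof -
  assume x: "x \<in> Cell {[k]}"
  have sub: "{[k]} \<subseteq> Dv (set [k])" unfolding Dv_def by simp
  have "supp (x 0 Minus) \<noteq> {}"
  proof
    assume "supp (x 0 Minus) = {}"
    then have "x 0 Minus = 0" by simp
    then show False using CellD(5)[OF x, of Minus] by simp
  qed
  then have "[k] \<in> supp (x 0 Minus)" using CellD(2)[OF x] by blast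
  then show ?thesis using top_cells[of "[k]" 0 x Minus] x Cell_mono[OF sub] by auto
qed

lemma horn_lift:
  assumes n: "1 \<le> n" and k: "k \<le> n"
  shows "lifts_against NX (horn_adm k n) (Delta_adm k n)"
  unfolding lifts_against_def has_rlp_def
proof (intro allI impI, elim conjE)
  fix u v assume u: "strat_map (horn_adm k n) NX u"
  define K where "K = Pb n - {coface n k}"
  have sel: "splx (horn_adm k n) m = {s. s \<in> Delta_hom m n \<and> (\<exists>i\<le>n. i \<noteq> k \<and> i \<notin> set s)}"
      "act (horn_adm k n) l \<theta> s = map ((!) s) \<theta>"
      "splx (Delta_adm k n) m = Delta_hom m n" "act (Delta_adm k n) l \<theta> s = map ((!) s) \<theta>" for m l \<theta> s
    by (auto simp: horn_adm_def horn_def with_marking_def Delta_hom_iff Delta_adm_def)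
  have mkh: "s \<in> marked (horn_adm k n) m \<longleftrightarrow> s \<in> splx (horn_adm k n) m \<and> s \<in> marked (Delta_adm k n) m" for s m
    by (simp add: horn_adm_def with_marking_def)
  have Kiff: "s \<in> K \<longleftrightarrow> s \<in> Dl n \<and> (\<exists>i\<le>n. i \<noteq> k \<and> i \<notin> set s)" for s
    unfolding K_def by (rule horn_set[OF n k])
  have cK: "complex K" unfolding K_def by (rule complex_remove[OF length_coface[OF k] strict_coface])
  have Kh: "strict s \<and> s \<in> Delta_hom (length s - 1) n \<and> s \<in> splx (horn_adm k n) (length s - 1) \<and> u (length s - 1) s \<in> splx NC (length s - 1)
     \<and> length s = Suc (length s - 1)" if s: "s \<in> K" for s
  proof -
    have sn: "strict s" "s \<noteq> []" using s cK unfolding complex_def by blast+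
    then have h: "s \<in> Delta_hom (length s - 1) n" using s Kiff by (intro Dl_hom) auto
    then have "s \<in> splx (horn_adm k n) (length s - 1)" using s Kiff unfolding sel by blast
    then show ?thesis using u_splx[OF u] sn h by auto
  qed
  have hK: "s \<in> K" if "s \<in> splx (horn_adm k n) m" "strict s" for s m
    using that hom_Dl unfolding sel Kiff by blast
  \<comment> \<open>The horn is assembled from its nondegenerate simplices: the functor of
    \<open>u\<close> at \<open>s\<close> is transported along positions to the simplices with
    vertices in \<open>set s\<close>. Compatibility of \<open>u\<close> with faces makes all these
    functors take the value \<open>c b\<close> at the atom of \<open>b\<close>.\<close>
  define G where "G s x = Fh (u (length s - 1) s) (pm (ps s) x)" for s x
  define c where "c b = Fh (u (length b - 1) b) (atom (topl (length b - 1)))" for b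
  have Gt: "hat.tfun (Dv (set s)) (G s)" if s: "s \<in> K" for s
    unfolding G_def
  proof (rule hat.tfun_pm[OF nerve_tfun])
    show "u (length s - 1) s \<in> splx NC (length s - 1)" using Kh[OF s] by blast
    show "ps s ` set s \<subseteq> {..length s - 1}" using nth_ps(1) Kh[OF s] by force
  qed (rule ps_mono)
  have Gc: "G s (atom b) = c b" if s: "s \<in> K" "b \<in> Dv (set s)" for s b
  proof -
    have st: "strict s" "length s = Suc (length s - 1)" using Kh[OF s(1)] by blast+
    have b: "b \<noteq> []" "strict b" "set b \<subseteq> set s" using s(2) unfolding Dv_def by auto
    define w where "w = map (ps s) b"
    have ls: "ps s x < ps s y" if "x \<in> set b" "y \<in> set b" "x < y" for x y
      using ps_strict[OF st(1) _ _ that(3)] that(1,2) b(3) by blast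
    have w: "strict w" unfolding w_def by (rule strict_map[OF b(2)]) (rule ls)
    have "set w \<subseteq> {..length s - 1}" unfolding w_def using nth_ps(1)[OF st(1)] b(3) st(2) by fastforce
    then have wh: "w \<in> Delta_hom (length b - 1) (length s - 1)"
      using w b(1) unfolding w_def strict_iff Delta_hom_def by simp
    have "map ((!) s) w = b" unfolding w_def using nth_ps(2)[OF st(1)] b(3) by (simp add: map_idI subset_iff)
    then have ub: "u (length b - 1) b = act NC (length s - 1) w (u (length s - 1) s)"
      using u_act[OF u _ wh, of s] Kh[OF s(1)] unfolding sel(2) by simp
    have us: "u (length s - 1) s \<in> splx NC (length s - 1)" using Kh[OF s(1)] by blast
    have "pm (ps s) (atom b) = atom w" unfolding w_def by (rule pm_atom[OF b(2)]) (rule ls)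
    then show ?thesis unfolding G_def c_def ub Fh_act_atom[OF us wh w] by simp
  qed
  interpret g: gluing "hatA C" "hatD C" "hatC C" K "\<lambda>s. Dv (set s)" G
  proof
    show "complex (Dv (set s))" for s by (rule complex_Dv)
    show "hat.tfun (Dv (set s)) (G s)" if "s \<in> K" for s using Gt that .
    show "G s (atom b) = G t (atom b)" if "s \<in> K" "t \<in> K" "b \<in> Dv (set s)" "b \<in> Dv (set t)" for s t b
      using Gc that by simp
  qed
  have U: "g.U = K"
  proof (intro equalityI subsetI)
    fix b assume "b \<in> g.U"
    then obtain s where s: "s \<in> K" "b \<in> Dv (set s)" unfolding g.U_def by blast
    then have "b \<noteq> []" "strict b" "set b \<subseteq> set s" unfolding Dv_def by auto
    then show "b \<in> K" by (rule complex_sub[OF cK s(1)])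
  next
    fix b assume b: "b \<in> K"
    then have "b \<in> Dl n" using Kiff by blast
    then have "b \<in> Dv (set b)" unfolding Dv_def by blast
    then show "b \<in> g.U" using b unfolding g.U_def by blast
  qed
  obtain F where F: "hat.tfun K F" "\<And>s x. s \<in> K \<Longrightarrow> x \<in> Cell (Dv (set s)) \<Longrightarrow> F x = G s x"
    using g.glue unfolding U by blast
  have Fc: "F (atom s) = c s" if s: "s \<in> K" for s
  proof -
    have "s \<in> Dv (set s)" using Kh[OF s] Kiff s unfolding Dv_def by blast
    then show ?thesis using F(2)[OF s atom_Cell[OF complex_Dv]] Gc[OF s] by simp
  qed
  have mark: "hat.WI (length s - 1) (F (atom s))" if s: "s \<in> K" "kap n k \<subseteq> set s" "2 \<le> length s" for s
  proof -
    have "s \<in> marked (Delta_adm k n) (length s - 1)"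
      unfolding marked_adm using Kh[OF s(1)] s(2,3) by (simp add: Delta_hom_iff)
    then have "u (length s - 1) s \<in> nerve_marking C (length s - 1)"
      using Kh[OF s(1)] by (intro u_marked[OF u]) (simp add: mkh)
    then show ?thesis unfolding Fc[OF s(1)] c_def marking_iff by blast
  qed
  have "\<exists>F'. hat.tfun (Dl n) F' \<and> (\<forall>x\<in>Cell K. F' x = F x) \<and> hat.WI n (F' (atom (topl n)))"
  \<comment> \<open>For n = 1 the horn is a vertex, and the constant functor at its value fills it
    with a unit; \<open>horn_fill\<close> covers n at least 2.\<close>
  proof (cases "n = 1")
    case True
    have K1: "K = {[k]}"
    proof (intro equalityI subsetI)
      fix s assume s: "s \<in> K"
      then obtain i where i: "s \<in> Dl n" "i \<le> n" "i \<noteq> k" "i \<notin> set s" using Kiff by blast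
      have st: "s \<noteq> []" "strict s" "set s \<subseteq> {..n}" using i(1) unfolding Dv_def by auto
      have "set s \<subseteq> {k}"
      proof
        fix x assume "x \<in> set s"
        then have "x \<le> n" "x \<noteq> i" using st(3) i(4) by auto
        then show "x \<in> {k}" using i(2,3) k True by auto
      qed
      moreover have "set s \<noteq> {}" using st(1) by simp
      ultimately have "set s = {k}" by (simp only: subset_singleton_iff) simp
      then show "s \<in> {[k]}" using strict_eqI[OF st(2), of "[k]"] by simp
    next
      fix s assume "s \<in> {[k]}"
      moreover have "\<exists>i\<le>n. i \<noteq> k \<and> i \<notin> set [k]"
        using k True by (intro exI[of _ "1 - k"]) (cases k, auto)
      ultimately show "s \<in> K" using k unfolding Kiff Dv_def by simp
    qed
    define a where "a = F (atom [k])"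
    have "atom [k] \<in> Cell K" using atom_Cell[OF cK] K1 by simp
    then have a: "a \<in> hat.cells 0" unfolding a_def by (rule hat.tfun_cells[OF F(1)]) (simp add: atom_zero)
    have "F x = a" if "x \<in> Cell K" for x using Cell_point that unfolding K1 a_def by blast
    then show ?thesis using const_tfun[OF a] hat.WI_unit[OF a, of n] n by (intro exI[of _ "\<lambda>_. a"]) auto
  next
    case False
    then have "n = Suc (Suc (n - 2))" using n by linarith
    then obtain p where p: "n = Suc (Suc p)" by blast
    show ?thesis using hat.horn_fill[OF p k F(1)[unfolded K_def]] mark unfolding K_def by blast
  qed
  then obtain F' where F': "hat.tfun (Dl n) F'" "\<And>x. x \<in> Cell K \<Longrightarrow> F' x = F x" "hat.WI n (F' (atom (topl n)))" by blast
  define f where "f = mk n F'"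
  have f: "f \<in> splx NC n" "\<And>x. x \<in> Cell (Dl n) \<Longrightarrow> Fh f x = F' x" unfolding f_def using mk_splx[OF F'(1)] Fh_mk[OF F'(1)] by auto
  have uK: "u (length s - 1) s = act NC n s f" if s: "s \<in> K" for s
  proof (rule nerve_eqI[of _ "length s - 1"])
    have st: "strict s" "s \<in> Delta_hom (length s - 1) n" "length s = Suc (length s - 1)" using Kh[OF s] by blast+
    show "u (length s - 1) s \<in> splx NC (length s - 1)" using Kh[OF s] by blast
    show "act NC n s f \<in> splx NC (length s - 1)" using nerve_act(1)[OF f(1) st(2)] .
    fix x assume x: "x \<in> Cell (Dl (length s - 1))"
    have im: "(!) s ` {..length s - 1} \<subseteq> set s" using st(3) by auto
    note mono = Delta_hom_mono(1)[OF st(2)]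
    have px: "pm ((!) s) x \<in> Cell (Dv (set s))" by (rule pm_Cell[OF _ im x]) (rule mono)
    have "Dv (set s) \<subseteq> K" using g.P_U[OF s] unfolding U .
    then have pK: "pm ((!) s) x \<in> Cell K" using px Cell_mono by blast
    have "K \<subseteq> Dl n" using Kiff by blast
    then have pn: "pm ((!) s) x \<in> Cell (Dl n)" using pK Cell_mono by blast
    have "pm (ps s) (pm ((!) s) x) = pm (ps s \<circ> (!) s) x" by (rule pm_comp[OF mono x])
    also have "\<dots> = x" by (rule pm_id[OF x]) (use ps_nth[OF st(1)] st(3) in auto)
    finally have "G s (pm ((!) s) x) = Fh (u (length s - 1) s) x" unfolding G_def by simp
    then show "Fh (u (length s - 1) s) x = Fh (act NC n s f) x"
      using nerve_act(2)[OF f(1) st(2) x] f(2)[OF pn] F'(2)[OF pK] F(2)[OF s px] by simp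
  qed
  have uh: "u m s = act NC n s f" if s: "s \<in> splx (horn_adm k n) m" for m s
  proof -
    \<comment> \<open>A simplex of the horn is an operator image of the nondegenerate simplex
      \<open>t\<close> with the same vertices, where the equality is already known.\<close>
    define t where "t = sls (set s)"
    have sh: "s \<in> Delta_hom m n" "\<exists>i\<le>n. i \<noteq> k \<and> i \<notin> set s" using s unfolding sel by auto
    have sl: "length s = Suc m" "sorted s" "set s \<subseteq> {..n}" using sh(1) unfolding Delta_hom_def by auto
    have t: "strict t" "set t = set s" unfolding t_def by auto
    have tn: "t \<noteq> []" using sl(1) t(2) by auto
    have tK: "t \<in> K" unfolding Kiff Dv_def using t tn sl(3) sh(2) by auto
    define w where "w = map (ps t) s"
    have tl: "length t = Suc (length t - 1)" "t \<in> Delta_hom (length t - 1) n" "t \<in> splx (horn_adm k n) (length t - 1)" using Kh[OF tK] by blast+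
    have "sorted w" unfolding w_def by (rule sorted_map_mono[OF sl(2)]) (rule ps_mono)
    moreover have "set w \<subseteq> {..length t - 1}" unfolding w_def using nth_ps(1)[OF t(1)] t(2) tl(1) by fastforce
    ultimately have wh: "w \<in> Delta_hom m (length t - 1)" using sl(1) unfolding Delta_hom_def w_def by simp
    have e: "map ((!) t) w = s" unfolding w_def using nth_ps(2)[OF t(1)] t(2) by (simp add: map_idI)
    have "u m s = act NC (length t - 1) w (u (length t - 1) t)" using u_act[OF u tl(3) wh] e unfolding sel by simp
    also have "\<dots> = act NC n s f" unfolding uK[OF tK] nerve_comp[OF f(1) tl(2) wh] e ..
    finally show ?thesis .
  qed
  have hm: "act NC n b f \<in> nerve_marking C m" if b: "b \<in> marked (Delta_adm k n) m" for b m
  proof (cases "strict b")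
    case False
    then show ?thesis using act_degenerate[OF f(1)] b unfolding marked_adm Delta_hom_iff by blast
  next
    case True
    then have h: "b \<in> Delta_hom m n" "kap n k \<subseteq> set b" "0 < m" using b unfolding marked_adm Delta_hom_iff by blast+
    show ?thesis
    proof (cases "b \<in> splx (horn_adm k n) m")
      case True
      then show ?thesis using u_marked[OF u] b mkh uh by metis
    next
      case False
      \<comment> \<open>A marked nondegenerate simplex contains \<open>k\<close>, so it is not the
        face opposite to \<open>k\<close>. Outside the horn only the top simplex remains.\<close>
      have "b \<in> Dl n" "b \<notin> K" using hom_Dl[OF h(1) True] False h(1) unfolding Kiff sel by blast+
      moreover have "k \<in> set b" using h(2) k unfolding kap_def by auto
      then have "b \<noteq> coface n k" using set_coface[OF k] by auto
      ultimately have bt: "b = topl n" unfolding K_def Pb_def by blast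
      moreover have "m = n" using h(1) unfolding bt Delta_hom_def by simp
      ultimately show ?thesis
        using act_marked[OF f(1) h(1) True] F'(3) f(2)[OF atom_Cell[OF complex_Dv topl_Dl]] n by simp
    qed
  qed
  have "strat_map (Delta_adm k n) NX (\<lambda>m b. act NC n b f)"
    unfolding strat_map_def NX_sel sel using nerve_act(1)[OF f(1)] nerve_comp[OF f(1)] hm by auto
  then show "\<exists>h. strat_map (Delta_adm k n) NX h \<and> (\<forall>m. \<forall>a\<in>splx (horn_adm k n) m. h m a = u m a) \<and>
      (\<forall>m. \<forall>b\<in>splx (Delta_adm k n) m. () = v m b)"
    using uh by (intro exI[of _ "\<lambda>m b. act NC n b f"]) simp
qed

text \<open>The simplex \<open>z\<close> represents a map from Delta[N] to \<open>A\<close>, and the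
  four consecutive vertices from \<open>q\<close> on form the copy of Delta[3]. The markings in
  \<open>A\<close> supply the hypotheses of \<open>two_out_of_six\<close> for the functor of
  \<open>u\<close> at \<open>z\<close>.\<close>

lemma two_of_six_marking:
  assumes u: "strat_map A NX u" and z: "z \<in> splx A N" and q: "q + 3 \<le> N"
    and mk: "\<And>S. \<lbrakk>S \<subseteq> {..N}; {q, q+2} \<subseteq> S \<or> {q+1, q+3} \<subseteq> S \<or> 3 \<le> card (S \<inter> {q..q+3})\<rbrakk> \<Longrightarrow>
      act A N (sls S) z \<in> marked A (card S - 1)"
    and s: "s \<in> Delta_hom m N" "strict s" "2 \<le> card (set s \<inter> {q..q+3})"
  shows "u m (act A N s z) \<in> nerve_marking C m"
proof -
  define g where "g = u N z"
  have g: "g \<in> splx NC N" unfolding g_def by (rule u_splx[OF u z])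
  have ug: "u l (act A N t z) = act NC N t g" if "t \<in> Delta_hom l N" for l t
    unfolding g_def by (rule u_act[OF u z that])
  have sub: "set s \<subseteq> {..N}" "length s = Suc m" using s(1) unfolding Delta_hom_def by auto
  have "hat.Mk (Fh g) (set s)"
  proof (rule hat.two_out_of_six[OF nerve_tfun[OF g] q _ sub(1) s(3)])
    fix S assume S: "S \<subseteq> {..N}" "{q, q+2} \<subseteq> S \<or> {q+1, q+3} \<subseteq> S \<or> 3 \<le> card (S \<inter> {q..q+3})"
    have f: "finite S" using S(1) finite_subset by blast
    have "S \<noteq> {}" using S(2) by auto
    then have c: "card S = Suc (card S - 1)" using f by (simp add: card_gt_0_iff)
    then have h: "sls S \<in> Delta_hom (card S - 1) N" using S(1) f unfolding Delta_hom_def by simp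
    show "hat.Mk (Fh g) S"
      using u_marked[OF u mk[OF S]] act_marked[OF g h strict_sorted_list_of_set] unfolding ug[OF h] hat.Mk_def by blast
  qed
  then have "hat.WI m (Fh g (atom s))"
    unfolding hat.Mk_def sls_set[OF s(2)] using s(2) sub(2) unfolding strict_iff by (simp add: distinct_card)
  moreover have "0 < m"
  proof -
    have "card (set s \<inter> {q..q+3}) \<le> card (set s)" by (intro card_mono) auto
    then show ?thesis using s(3) card_length[of s] sub(2) by linarith
  qed
  ultimately show ?thesis unfolding ug[OF s(1)] act_marked[OF g s(1,2)] by blast
qed

end

section \<open>Saturation: markings in joins with Delta[3]\<close>

lemma join_act_cong: "act U = act U' \<Longrightarrow> act V = act V' \<Longrightarrow> join_act U V = join_act U' V'"
proof (intro ext)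
  fix n \<theta> x
  assume "act U = act U'" "act V = act V'"
  then show "join_act U V n \<theta> x = join_act U' V' n \<theta> x" by (cases x) (simp_all add: Let_def)
qed

lemma splx_Delta_act:
  assumes "v \<in> splx (Delta N) j" "\<theta> \<in> Delta_hom l j" shows "map ((!) v) \<theta> \<in> splx (Delta N) l"
proof -
  have v: "length v = Suc j" "sorted v" "\<forall>i\<in>set v. int i \<le> N" using assms(1) unfolding Delta_def by auto
  have t: "length \<theta> = Suc l" "sorted \<theta>" "set \<theta> \<subseteq> {..j}" using assms(2) unfolding Delta_hom_def by auto
  have "sorted (map ((!) v) \<theta>)"
    by (rule sorted_map_mono[OF t(2)]) (use v(1,2) t(3) in \<open>auto intro!: sorted_nth_mono\<close>)
  moreover have "int (v ! i) \<le> N" if "i \<in> set \<theta>" for i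
    using v(3) nth_mem[of i v] v(1) t(3) that by auto
  ultimately show ?thesis using t(1) unfolding Delta_def by auto
qed

lemma map_0123: "set w \<subseteq> {..3} \<Longrightarrow> map ((!) [0, 1, 2, 3]) w = w" for w :: "nat list"
proof (intro map_idI)
  fix x assume "set w \<subseteq> {..3}" "x \<in> set w"
  then have "x = 0 \<or> x = 1 \<or> x = 2 \<or> x = 3" by auto
  then show "[0, 1, 2, 3] ! x = x" by auto
qed

lemma Delta3_sel [simp]: "splx Delta3_eq = splx (Delta 3)" "act Delta3_eq = act (Delta 3)"
  "splx Delta3_sharp = splx (Delta 3)" "act Delta3_sharp = act (Delta 3)"
  "splx (Delta_min n) = splx (Delta n)" "act (Delta_min n) = act (Delta n)"
  by (simp_all add: Delta3_eq_def Delta3_sharp_def Delta_min_def with_marking_def)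

lemma splx_Delta3: "w \<in> splx (Delta 3) i \<longleftrightarrow> length w = Suc i \<and> sorted w \<and> set w \<subseteq> {..3}"
  using splx_Delta[of w 3 i] by simp

lemma Delta3_eq_marked:
  assumes "strict w" "set w \<subseteq> {..3}" "{0, 2} \<subseteq> set w \<or> {1, 3} \<subseteq> set w \<or> 3 \<le> card (set w)" "length w = Suc i"
  shows "w \<in> marked Delta3_eq i"
proof -
  have s: "w \<in> splx (Delta 3) i" using assms(1,2,4) unfolding splx_Delta3 strict_iff by blast
  have c: "card (set w) = Suc i" using assms(1,4) unfolding strict_iff by (simp add: distinct_card)
  have "w = [0, 2] \<or> w = [1, 3] \<or> 2 \<le> i"
  proof (cases "2 \<le> i")
    case False
    then have "card (set w) \<le> 2" using c by simp
    moreover have "\<not> 3 \<le> card (set w)" using c False by simp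
    moreover have "{a, b} = set w" if "{a, b} \<subseteq> set w" "a \<noteq> b" "card (set w) \<le> 2" for a b
      by (rule card_seteq[OF _ that(1)]) (use that(2,3) in simp_all)
    ultimately have "{0, 2} = set w \<or> {1, 3} = set w" using assms(3) by (metis numeral_eq_iff one_eq_numeral_iff semiring_norm(84,88) zero_neq_numeral)
    then have "set w = {0, 2} \<or> set w = {1, 3}" by blast
    then show ?thesis using strict_eqI[OF assms(1), of "[0, 2]"] strict_eqI[OF assms(1), of "[1, 3]"] by auto
  qed simp
  then show ?thesis using s unfolding Delta3_eq_def with_marking_def by auto
qed

lemma Delta3_degenerate: "w \<in> splx (Delta 3) i \<Longrightarrow> \<not> strict w \<Longrightarrow> w \<in> marked Delta3_eq i"
  using degenerate_Delta[of w 3 i] unfolding Delta3_eq_def with_marking_def by simp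

lemma join_act_L: "set s \<subseteq> {..3} \<Longrightarrow> join_act Delta3_eq V n s (JoinL [0, 1, 2, 3]) = JoinL s"
  by (simp only: join_act.simps Delta3_sel Delta_act map_0123)

lemma join_act_R: "set s \<subseteq> {..3} \<Longrightarrow> join_act U Delta3_eq n s (JoinR [0, 1, 2, 3]) = JoinR s"
  by (simp only: join_act.simps Delta3_sel Delta_act map_0123)

lemma length_split: "length (filter (\<lambda>t. t \<le> j) s) + length (filter (\<lambda>t. j < t) s) = length s" for j :: nat
  using sum_length_filter_compl[of "\<lambda>t. t \<le> j" s] by (simp add: not_le)

context strict_omega_category
begin

lemma saturated_left: "lifts_against NX (join Delta3_eq (Delta_min n)) (join Delta3_sharp (Delta_min n))"
proof (rule lifts_same)
  let ?A = "join Delta3_eq (Delta_min n)" and ?B = "join Delta3_sharp (Delta_min n)"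
  show "splx ?A = splx ?B" by (simp add: join_def)
  have sel: "act ?A = join_act Delta3_eq (Delta_min n)" by (simp add: join_def)
  then show "act ?A = act ?B" using join_act_cong[of Delta3_eq Delta3_sharp "Delta_min n" "Delta_min n"] by (simp add: join_def)
  fix u m b assume u: "strat_map ?A NX u" and b: "b \<in> marked ?B m"
  show "u m b \<in> marked NX m"
  proof (cases "b \<in> marked ?A m")
    case True
    then show ?thesis using u_marked[OF u] unfolding NX_sel by blast
  next
    case False
    \<comment> \<open>A simplex that is newly marked must have a component of positive dimension in
      Delta[3]; markings from the other component are already present in \<open>?A\<close>.\<close>
    consider w where "b = JoinL w" "w \<in> splx (Delta 3) m" "0 < m"
      | i j w v where "b = Join i w v" "i + j + 1 = m" "w \<in> splx (Delta 3) i" "v \<in> splx (Delta n) j" "0 < i"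
      using b False by (auto simp: join_def Delta3_sharp_def with_marking_def)
    then show ?thesis
    proof cases
      case 1
      have w: "length w = Suc m" "sorted w" "set w \<subseteq> {..3}" using 1(2) unfolding splx_Delta3 by auto
      have st: "strict w" using Delta3_degenerate[OF 1(2)] False 1(1) by (auto simp: join_def)
      have z: "JoinL [0, 1, 2, 3] \<in> splx ?A 3" by (simp add: join_def splx_Delta3)
      have e: "b = act ?A 3 w (JoinL [0, 1, 2, 3])" unfolding sel join_act_L[OF w(3)] 1(1) ..
      show ?thesis
        unfolding e NX_sel
      proof (rule two_of_six_marking[OF u z, of 0])
        fix S :: "nat set" assume S: "S \<subseteq> {..3}" "{0, 0 + 2} \<subseteq> S \<or> {0 + 1, 0 + 3} \<subseteq> S \<or> 3 \<le> card (S \<inter> {0..0 + 3})"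
        have f: "finite S" "S \<noteq> {}" using S finite_subset[OF S(1)] by auto
        then have c: "card S = Suc (card S - 1)" by (simp add: card_gt_0_iff)
        have "S \<inter> {0..0 + 3} = S" using S(1) by auto
        then have S3: "{0, 2} \<subseteq> S \<or> {1, 3} \<subseteq> S \<or> 3 \<le> card S" using S(2) by (simp add: numeral_2_eq_2)
        have "sls S \<in> marked Delta3_eq (card S - 1)"
          by (rule Delta3_eq_marked) (use S(1) S3 f c in simp_all)
        moreover have "join_act Delta3_eq (Delta_min n) 3 (sls S) (JoinL [0, 1, 2, 3]) = JoinL (sls S)"
          using S(1) f by (intro join_act_L) simp
        ultimately show "act ?A 3 (sls S) (JoinL [0, 1, 2, 3]) \<in> marked ?A (card S - 1)"
          unfolding sel by (simp add: join_def)
      next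
        show "w \<in> Delta_hom m 3" using w unfolding Delta_hom_def by simp
        have "set w \<inter> {0..0 + 3} = set w" using w(3) by auto
        then show "2 \<le> card (set w \<inter> {0..0 + 3})" using st w(1) 1(3) unfolding strict_iff by (simp add: distinct_card)
      qed (use st in auto)
    next
      case 2
      have w: "length w = Suc i" "sorted w" "set w \<subseteq> {..3}" using 2(3) unfolding splx_Delta3 by auto
      have v: "length v = Suc j" using 2(4) unfolding Delta_def by simp
      have st: "strict w" using Delta3_degenerate[OF 2(3)] False 2 by (auto simp: join_def)
      \<comment> \<open>The join of all of Delta[3] with \<open>v\<close> is a simplex of dimension
        j + 4 that has \<open>b\<close> as a face. Delta[3] occupies its first four vertices, whence
        q = 0 below.\<close>
      define z :: "(nat list, nat list) join_simplex" where "z = Join 3 [0, 1, 2, 3] v"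
      have z: "z \<in> splx ?A (j + 4)" unfolding z_def using 2(4) by (auto simp: join_def splx_Delta3)
      have az: "act ?A (j + 4) s z = (let p = filter (\<lambda>t. t \<le> 3) s; r = map (\<lambda>t. t - (3 + 1)) (filter (\<lambda>t. 3 < t) s)
         in if r = [] then JoinL p else if p = [] then JoinR (map ((!) v) r) else Join (length p - 1) p (map ((!) v) r))" for s
      proof -
        have "map ((!) [0, 1, 2, 3]) (filter (\<lambda>t. t \<le> 3) s) = filter (\<lambda>t. t \<le> 3) s" by (rule map_0123) auto
        then show ?thesis unfolding sel z_def by (simp only: join_act.simps Let_def Delta3_sel Delta_act)
      qed
      define s where "s = w @ [4..<j + 5]"
      have fs: "filter (\<lambda>t. t \<le> 3) s = w" "filter (\<lambda>t. 3 < t) s = [4..<j + 5]"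
        unfolding s_def using w(3) by (auto simp: filter_id_conv filter_empty_conv)
      have r: "map (\<lambda>t. t - (3 + 1)) [4..<j + 5] = [0..<Suc j]" by (rule nth_equalityI) (simp_all del: upt_Suc)
      have e: "b = act ?A (j + 4) s z"
        unfolding az fs r Let_def nth_id_map[OF v] using w(1) 2(1) by (auto simp del: upt_Suc)
      show ?thesis
        unfolding e NX_sel
      proof (rule two_of_six_marking[OF u z, of 0])
        fix S :: "nat set" assume S: "S \<subseteq> {..j + 4}" "{0, 0 + 2} \<subseteq> S \<or> {0 + 1, 0 + 3} \<subseteq> S \<or> 3 \<le> card (S \<inter> {0..0 + 3})"
        have f: "finite S" using finite_subset[OF S(1)] by auto
        define p where "p = filter (\<lambda>t. t \<le> 3) (sls S)"
        define r where "r = map (\<lambda>t. t - (3 + 1)) (filter (\<lambda>t. 3 < t) (sls S))"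
        have sp: "set p = S \<inter> {0..0 + 3}" unfolding p_def using f by auto
        have pn: "p \<noteq> []" using S(2) sp by auto
        have l: "length p + length r = card S" using length_split[of 3 "sls S"] f unfolding p_def r_def by simp
        have ps: "strict p" unfolding p_def using sorted_wrt_filter strict_sorted_list_of_set by blast
        have p3: "set p \<subseteq> {..3}" unfolding sp by auto
        have "{0, 2} \<subseteq> set p \<or> {1, 3} \<subseteq> set p \<or> 3 \<le> card (set p)" using S(2) unfolding sp by (simp add: numeral_2_eq_2)
        moreover have "length p = Suc (length p - 1)" using pn by (cases p) auto
        ultimately have pm: "p \<in> marked Delta3_eq (length p - 1)" by (rule Delta3_eq_marked[OF ps p3])
        have psp: "p \<in> splx (Delta 3) (length p - 1)" unfolding splx_Delta3 using ps p3 pn unfolding strict_iff by simp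
        show "act ?A (j + 4) (sls S) z \<in> marked ?A (card S - 1)"
        proof (cases "r = []")
          case True
          then have "length p = card S" using l by simp
          then show ?thesis using True pm psp unfolding az p_def[symmetric] r_def[symmetric] Let_def by (simp add: join_def)
        next
          case False
          have "strict r" unfolding r_def
            by (rule strict_map) (auto simp: sorted_wrt_filter)
          then have "r \<in> Delta_hom (length r - 1) j"
            using S(1) f False unfolding strict_iff Delta_hom_def by (auto simp: r_def)
          then have "map ((!) v) r \<in> splx (Delta n) (length r - 1)" by (rule splx_Delta_act[OF 2(4)])
          moreover have "length p - 1 + (length r - 1) + 1 = card S - 1" using l pn False by (cases p; cases r) auto
          ultimately show ?thesis using False pn pm psp unfolding az p_def[symmetric] r_def[symmetric] Let_def by (auto simp: join_def)
        qed
      next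
        show "strict s" unfolding s_def using st w(3) by (auto simp: sorted_wrt_append)
        then show "s \<in> Delta_hom m (j + 4)" unfolding Delta_hom_def strict_iff s_def using w(1,3) 2(2) by auto
        have "set s \<inter> {0..0 + 3} = set w" unfolding s_def using w(3) by auto
        then show "2 \<le> card (set s \<inter> {0..0 + 3})" using st w(1) 2(5) unfolding strict_iff by (simp add: distinct_card)
      qed simp
    qed
  qed
qed

lemma saturated_right: "lifts_against NX (join (Delta_min n) Delta3_eq) (join (Delta_min n) Delta3_sharp)"
proof (rule lifts_same)
  let ?A = "join (Delta_min n) Delta3_eq" and ?B = "join (Delta_min n) Delta3_sharp"
  show "splx ?A = splx ?B" by (simp add: join_def)
  have sel: "act ?A = join_act (Delta_min n) Delta3_eq" by (simp add: join_def)
  then show "act ?A = act ?B" using join_act_cong[of "Delta_min n" "Delta_min n" Delta3_eq Delta3_sharp] by (simp add: join_def)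
  fix u m b assume u: "strat_map ?A NX u" and b: "b \<in> marked ?B m"
  show "u m b \<in> marked NX m"
  proof (cases "b \<in> marked ?A m")
    case True
    then show ?thesis using u_marked[OF u] unfolding NX_sel by blast
  next
    case False
    consider w where "b = JoinR w" "w \<in> splx (Delta 3) m" "0 < m"
      | i j w v where "b = Join j v w" "j + i + 1 = m" "w \<in> splx (Delta 3) i" "v \<in> splx (Delta n) j" "0 < i"
      using b False by (auto simp: join_def Delta3_sharp_def with_marking_def)
    then show ?thesis
    proof cases
      case 1
      have w: "length w = Suc m" "sorted w" "set w \<subseteq> {..3}" using 1(2) unfolding splx_Delta3 by auto
      have st: "strict w" using Delta3_degenerate[OF 1(2)] False 1(1) by (auto simp: join_def)
      have z: "JoinR [0, 1, 2, 3] \<in> splx ?A 3" by (simp add: join_def splx_Delta3)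
      have e: "b = act ?A 3 w (JoinR [0, 1, 2, 3])" unfolding sel join_act_R[OF w(3)] 1(1) ..
      show ?thesis
        unfolding e NX_sel
      proof (rule two_of_six_marking[OF u z, of 0])
        fix S :: "nat set" assume S: "S \<subseteq> {..3}" "{0, 0 + 2} \<subseteq> S \<or> {0 + 1, 0 + 3} \<subseteq> S \<or> 3 \<le> card (S \<inter> {0..0 + 3})"
        have f: "finite S" "S \<noteq> {}" using S finite_subset[OF S(1)] by auto
        then have c: "card S = Suc (card S - 1)" by (simp add: card_gt_0_iff)
        have "S \<inter> {0..0 + 3} = S" using S(1) by auto
        then have S3: "{0, 2} \<subseteq> S \<or> {1, 3} \<subseteq> S \<or> 3 \<le> card S" using S(2) by (simp add: numeral_2_eq_2)
        have "sls S \<in> marked Delta3_eq (card S - 1)"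
          by (rule Delta3_eq_marked) (use S(1) S3 f c in simp_all)
        moreover have "join_act (Delta_min n) Delta3_eq 3 (sls S) (JoinR [0, 1, 2, 3]) = JoinR (sls S)"
          using S(1) f by (intro join_act_R) simp
        ultimately show "act ?A 3 (sls S) (JoinR [0, 1, 2, 3]) \<in> marked ?A (card S - 1)"
          unfolding sel by (simp add: join_def)
      next
        show "w \<in> Delta_hom m 3" using w unfolding Delta_hom_def by simp
        have "set w \<inter> {0..0 + 3} = set w" using w(3) by auto
        then show "2 \<le> card (set w \<inter> {0..0 + 3})" using st w(1) 1(3) unfolding strict_iff by (simp add: distinct_card)
      qed (use st in auto)
    next
      case 2
      have w: "length w = Suc i" "sorted w" "set w \<subseteq> {..3}" using 2(3) unfolding splx_Delta3 by auto
      have v: "length v = Suc j" using 2(4) unfolding Delta_def by simp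
      have st: "strict w" using Delta3_degenerate[OF 2(3)] False 2 by (auto simp: join_def)
      \<comment> \<open>Now \<open>v\<close> occupies the first j + 1 vertices, so the copy of
        Delta[3] starts at q = j + 1.\<close>
      define z :: "(nat list, nat list) join_simplex" where "z = Join j v [0, 1, 2, 3]"
      have z: "z \<in> splx ?A (j + 4)" unfolding z_def using 2(4) by (auto simp: join_def splx_Delta3)
      have az: "act ?A (j + 4) s z = (let p = filter (\<lambda>t. t \<le> j) s; r = map (\<lambda>t. t - (j + 1)) (filter (\<lambda>t. j < t) s)
         in if r = [] then JoinL (map ((!) v) p) else if p = [] then JoinR r else Join (length p - 1) (map ((!) v) p) r)"
        if s: "set s \<subseteq> {..j + 4}" for s
      proof -
        have "map ((!) [0, 1, 2, 3]) (map (\<lambda>t. t - (j + 1)) (filter (\<lambda>t. j < t) s)) = map (\<lambda>t. t - (j + 1)) (filter (\<lambda>t. j < t) s)"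
          by (rule map_0123) (use s in auto)
        then show ?thesis unfolding sel z_def by (simp only: join_act.simps Let_def Delta3_sel Delta_act)
      qed
      define s where "s = [0..<Suc j] @ map (\<lambda>t. t + (j + 1)) w"
      have ss: "set s \<subseteq> {..j + 4}" unfolding s_def using w(3) by auto
      have fs: "filter (\<lambda>t. t \<le> j) s = [0..<Suc j]" "filter (\<lambda>t. j < t) s = map (\<lambda>t. t + (j + 1)) w"
        unfolding s_def by (auto simp: filter_id_conv filter_empty_conv simp del: upt_Suc)
      have r: "map (\<lambda>t. t - (j + 1)) (map (\<lambda>t. t + (j + 1)) w) = w" by (simp add: map_idI)
      have e: "b = act ?A (j + 4) s z"
        unfolding az[OF ss] fs r Let_def nth_id_map[OF v] using w(1) 2(1) by (auto simp del: upt_Suc)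
      show ?thesis
        unfolding e NX_sel
      proof (rule two_of_six_marking[OF u z, of "j + 1"])
        fix S :: "nat set" assume S: "S \<subseteq> {..j + 4}"
          "{j + 1, j + 1 + 2} \<subseteq> S \<or> {j + 1 + 1, j + 1 + 3} \<subseteq> S \<or> 3 \<le> card (S \<inter> {j + 1..j + 1 + 3})"
        have f: "finite S" using finite_subset[OF S(1)] by auto
        define p where "p = filter (\<lambda>t. t \<le> j) (sls S)"
        define r where "r = map (\<lambda>t. t - (j + 1)) (filter (\<lambda>t. j < t) (sls S))"
        have l: "length p + length r = card S" using length_split[of j "sls S"] f unfolding p_def r_def by simp
        have sr: "set r = (\<lambda>t. t - (j + 1)) ` (S \<inter> {j + 1..j + 1 + 3})"
          unfolding r_def using f S(1) by force
        have "inj_on (\<lambda>t. t - (j + 1)) (S \<inter> {j + 1..j + 1 + 3})" by (rule inj_onI) auto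
        then have cr: "card (set r) = card (S \<inter> {j + 1..j + 1 + 3})" unfolding sr by (rule card_image)
        have sr': "strict r" unfolding r_def
          by (rule strict_map) (auto simp: sorted_wrt_filter)
        have r3: "set r \<subseteq> {..3}" unfolding sr by auto
        have mr: "{0, 2} \<subseteq> set r \<or> {1, 3} \<subseteq> set r \<or> 3 \<le> card (set r)"
        proof -
          have m: "x - (j + 1) \<in> set r" if "x \<in> S" "j + 1 \<le> x" "x \<le> j + 1 + 3" for x
            unfolding sr by (rule imageI) (use that in simp)
          show ?thesis using S(2) m[of "j + 1"] m[of "j + 1 + 2"] m[of "j + 1 + 1"] m[of "j + 1 + 3"] unfolding cr by auto
        qed
        have rn: "r \<noteq> []" using mr by auto
        have lr: "length r = Suc (length r - 1)" using rn by (cases r) auto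
        have rm: "r \<in> marked Delta3_eq (length r - 1)" by (rule Delta3_eq_marked[OF sr' r3 mr lr])
        have rs: "r \<in> splx (Delta 3) (length r - 1)" unfolding splx_Delta3 using sr' r3 rn unfolding strict_iff by simp
        have Ss: "set (sls S) \<subseteq> {..j + 4}" using S(1) f by simp
        show "act ?A (j + 4) (sls S) z \<in> marked ?A (card S - 1)"
        proof (cases "p = []")
          case True
          then have "length r = card S" using l by simp
          then show ?thesis using True rm rs rn unfolding az[OF Ss] p_def[symmetric] r_def[symmetric] Let_def by (simp add: join_def)
        next
          case False
          have "strict p" unfolding p_def using sorted_wrt_filter strict_sorted_list_of_set by blast
          then have "p \<in> Delta_hom (length p - 1) j"
            using False unfolding strict_iff Delta_hom_def by (auto simp: p_def)
          then have "map ((!) v) p \<in> splx (Delta n) (length p - 1)" by (rule splx_Delta_act[OF 2(4)])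
          moreover have "length p - 1 + (length r - 1) + 1 = card S - 1" using l rn False by (cases p; cases r) auto
          ultimately show ?thesis using False rn rm rs unfolding az[OF Ss] p_def[symmetric] r_def[symmetric] Let_def by (auto simp: join_def)
        qed
      next
        have "strict (map (\<lambda>t. t + (j + 1)) w)" by (rule strict_map[OF st]) simp
        then show "strict s" unfolding s_def by (auto simp: sorted_wrt_append)
        then show "s \<in> Delta_hom m (j + 4)" using ss w(1) 2(2) unfolding Delta_hom_def strict_iff by (simp add: s_def)
        have "set s \<inter> {j + 1..j + 1 + 3} = (\<lambda>t. t + (j + 1)) ` set w" unfolding s_def using w(3) by auto
        then have "card (set s \<inter> {j + 1..j + 1 + 3}) = card (set w)" by (simp add: card_image inj_on_def)
        then show "2 \<le> card (set s \<inter> {j + 1..j + 1 + 3})" using st w(1) 2(5) unfolding strict_iff by (simp add: distinct_card)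
      qed simp
    qed
  qed
qed

end

theorem mainTheorem2:
  fixes C :: "'a omega_cat"
  assumes "strict_omega_category C"
  shows "saturated_complicial_set (with_marking (street_nerve C) (nerve_marking C))"
proof -
  interpret strict_omega_category C by (rule assms)
  show ?thesis
    unfolding saturated_complicial_set_def complicial_set_def
    using stratified_nerve horn_lift thin_lift saturated_left saturated_right by blast
qed

end
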